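(* Let $\mathfrak g$ be a (possibly infinite-dimensional) Lie algebra over $\mathbb{C}$ equipped with a nondegenerate symmetric invariant bilinear form $\langle\cdot,\cdot\rangle$, and let $\sigma$ be an automorphism of $\mathfrak g$ of finite order $T$ which preserves $\langle\cdot,\cdot\rangle$. Let $\ell$ be any complex number and let $W$ be any restricted $\hat{\mathfrak g}[\sigma]$-module of level $\ell$, or equivalently, a restricted $\hat{\mathfrak g}^\sigma$-module of level $\ell/T$. Then there exists a unique quasi module structure $Y_W$ on $W$ for the vertex algebra $V_{\hat{\mathfrak g}}(\ell,0)$ such that $Y_W(a,x)=a_W(x)^\sigma$ for $a\in\mathfrak g$, with $p(x)=x^T-1$ as the minimal polynomial (of the quasi module $W$).
   Context: $x,x_0,x_1,x_2$ are commuting formal variables; $\delta(z)=\sum_{n\in\mathbb{Z}}z^n$; integer powers of a binomial are expanded in nonnegative powers of the second-written term. Untwisted affine Lie algebra: $\hat{\mathfrak g}=\mathfrak g\otimes\mathbb{C}[t,t^{-1}]\oplus\mathbb{C}\mathbf k$ with $\mathbf k$ a nonzero central element and $[a\otimes t^m,b\otimes t^n]=[a,b]\otimes t^{m+n}+m\langle a,b\rangle\delta_{m+n,0}\mathbf k$. $V_{\hat{\mathfrak g}}(\ell,0)=U(\hat{\mathfrak g})\otimes_{U(\mathfrak g\otimes\mathbb{C}[t]\oplus\mathbb{C}\mathbf k)}\mathbb{C}_\ell$, where $\mathbb{C}_\ell=\mathbb{C}$ with $\mathfrak g\otimes\mathbb{C}[t]$ acting trivially and $\mathbf k$ acting as $\ell$;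 $\mathbf 1=1\otimes1$; $\mathfrak g$ is identified with a subspace via $a\mapsto (a\otimes t^{-1})\mathbf 1$. It is known that $V_{\hat{\mathfrak g}}(\ell,0)$ has a unique vertex algebra structure with vacuum $\mathbf 1$ and $Y(a,x)=\sum_{n\in\mathbb{Z}}(a\otimes t^n)x^{-n-1}$ for $a\in\mathfrak g$, and that $\mathfrak g$ generates it. Twisted affine Lie algebras: let $\omega_T=\exp(2\pi\sqrt{-1}/T)$ and $\mathfrak g_r=\{a\in\mathfrak g\mid\sigma(a)=\omega_T^ra\}$ for $r\in\mathbb{Z}$. $\hat{\mathfrak g}^\sigma=\coprod_{i=0}^{T-1}\mathfrak g_i\otimes t^i\mathbb{C}[t^T,t^{-T}]\oplus\mathbb{C}\mathbf k$, a Lie subalgebra of $\hat{\mathfrak g}$; $\hat{\mathfrak g}[\sigma]=\coprod_{i=0}^{T-1}\mathfrak g_i\otimes t^{i/T}\mathbb{C}[t,t^{-1}]\oplus\mathbb{C}\mathbf k$ with the same bracket formula for $m,n\in\frac1T\mathbb{Z}$. The map $a\otimes t^n\mapsto a\otimes t^{n/T}$, $T\mathbf k\mapsto\mathbf k$ is a Lie algebra isomorphism $\hat{\mathfrak g}^\sigma\to\hat{\mathfrak g}[\sigma]$, through which $\hat{\mathfrak g}[\sigma]$-modules of level $\ell$ are regarded as $\hat{\mathfrak g}^\sigma$-modules of level $\ell/T$. A module has level $\ell$ if $\mathbf k$ acts as the scalar $\ell$; it is restricted if for every $w$ in it and every $a$ (in the relevant $\mathfrak g_i$), $(a\otimes t^n)w=0$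 for $n$ sufficiently large. For $a\in\mathfrak g$, $a(x)^\sigma=\sum_{n\in\mathbb{Z}}\sum_{i=0}^{T-1}\omega_T^{-in}(\sigma^i(a)\otimes t^n)x^{-n-1}$, whose coefficients lie in $\hat{\mathfrak g}^\sigma\subset\hat{\mathfrak g}$, and $a_W(x)^\sigma\in\operatorname{Hom}(W,W((x)))$ is the resulting series of operators on the $\hat{\mathfrak g}^\sigma$-module $W$. Quasi module: for a vertex algebra $(V,Y,\mathbf 1)$, a quasi $V$-module is a vector space $W$ with a linear map $Y_W:V\to\operatorname{Hom}(W,W((x)))$ such that $Y_W(\mathbf 1,x)=1_W$ and for any $u,v\in V$ there is a nonzero polynomial $f(x_1,x_2)$ with $$x_0^{-1}\delta\left(\tfrac{x_1-x_2}{x_0}\right)f(x_1,x_2)Y_W(u,x_1)Y_W(v,x_2)-x_0^{-1}\delta\left(\tfrac{x_2-x_1}{-x_0}\right)f(x_1,x_2)Y_W(v,x_2)Y_W(u,x_1)=x_2^{-1}\delta\left(\tfrac{x_1-x_0}{x_2}\right)f(x_1,x_2)Y_W(Y(u,x_0)v,x_2).$$ Minimal polynomial: let $W$ be a quasi $V$-module for which there exists a nonzero polynomial $p(x)$ such that for any $u,v\in V$, $p(x_1/x_2)^r[Y_W(u,x_1),Y_W(v,x_2)]=0$ for some nonnegative integer $r$ (depending on $u,v$). The monic polynomial $p(x)$ of least degree with this property is called the minimal polynomial of $W$.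
   Formalization: That x^T-1 is the minimal polynomial is claimed only when two elements of the twisted affine algebra do not commute on W; otherwise (e.g. W=0, or l=0 with W trivial) all commutators vanish and the minimal polynomial is 1. That x^T-1 has the commutator property is proved for every W. *)

theory Defs
  imports
    Complex_Main
    "HOL-Library.Poly_Mapping"
    "HOL-Library.Product_Plus"
    "HOL-Computational_Algebra.Polynomial"
begin

section \<open>Lie algebras over the complex numbers\<close>

locale lie_algebra = vector_space scale
  for scale :: "complex \<Rightarrow> 'g::ab_group_add \<Rightarrow> 'g" +
  fixes bracket :: "'g \<Rightarrow> 'g \<Rightarrow> 'g"
  assumes bracket_linear_right: "Vector_Spaces.linear scale scale (bracket a)"
    and bracket_linear_left: "Vector_Spaces.linear scale scale (\<lambda>a. bracket a b)"
    and bracket_self: "bracket a a = 0"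
    and jacobi: "bracket a (bracket b c) + bracket b (bracket c a) + bracket c (bracket a b) = 0"

locale quadratic_lie_algebra = lie_algebra scale bracket
  for scale :: "complex \<Rightarrow> 'g::ab_group_add \<Rightarrow> 'g" and bracket +
  fixes form :: "'g \<Rightarrow> 'g \<Rightarrow> complex"
  assumes form_linear: "Vector_Spaces.linear scale (*) (form a)"
    and form_symmetric: "form a b = form b a"
    and form_invariant: "form (bracket a b) c = form a (bracket b c)"
    and form_nondegenerate: "(\<forall>b. form a b = 0) \<Longrightarrow> a = 0"

definition lie_automorphism ::
  "(complex \<Rightarrow> 'g::ab_group_add \<Rightarrow> 'g) \<Rightarrow> ('g \<Rightarrow> 'g \<Rightarrow> 'g) \<Rightarrow> ('g \<Rightarrow> 'g) \<Rightarrow> bool" where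
  "lie_automorphism scale bracket \<sigma> \<longleftrightarrow>
     Vector_Spaces.linear scale scale \<sigma> \<and> bij \<sigma> \<and>
     (\<forall>a b. \<sigma> (bracket a b) = bracket (\<sigma> a) (\<sigma> b))"

definition has_finite_order :: "('g \<Rightarrow> 'g) \<Rightarrow> nat \<Rightarrow> bool" where
  "has_finite_order \<sigma> T \<longleftrightarrow> T > 0 \<and> \<sigma> ^^ T = id \<and> (\<forall>k. 0 < k \<and> k < T \<longrightarrow> \<sigma> ^^ k \<noteq> id)"

text \<open>Module for the Lie subalgebra with carrier \<open>S\<close> of a Lie algebra given by \<open>scaleL\<close> and
  \<open>bracketL\<close>; the values of \<open>act\<close> outside \<open>S\<close> are irrelevant.\<close>

definition lie_module_on ::
  "(complex \<Rightarrow> 'l::ab_group_add \<Rightarrow> 'l) \<Rightarrow> ('l \<Rightarrow> 'l \<Rightarrow> 'l) \<Rightarrow> 'l set \<Rightarrow>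
   (complex \<Rightarrow> 'w::ab_group_add \<Rightarrow> 'w) \<Rightarrow> ('l \<Rightarrow> 'w \<Rightarrow> 'w) \<Rightarrow> bool" where
  "lie_module_on scaleL bracketL S scaleW act \<longleftrightarrow>
     vector_space scaleW \<and>
     (\<forall>X\<in>S. Vector_Spaces.linear scaleW scaleW (act X)) \<and>
     (\<forall>X\<in>S. \<forall>Y\<in>S. \<forall>w. act (X + Y) w = act X w + act Y w) \<and>
     (\<forall>c. \<forall>X\<in>S. \<forall>w. act (scaleL c X) w = scaleW c (act X w)) \<and>
     (\<forall>X\<in>S. \<forall>Y\<in>S. \<forall>w. act (bracketL X Y) w = act X (act Y w) - act Y (act X w))"


section \<open>Affine Lie algebras\<close>

text \<open>The pair \<open>(f, c)\<close> stands for \<open>(\<Sum>m. f\<^sub>m \<otimes> t\<^sup>m) + c \<k>\<close>. The exponents are integers for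
  the untwisted affine algebra and its fixed-point subalgebra, and rationals for the algebra
  with fractional powers of \<open>t\<close>; \<open>emb\<close> is the inclusion of the exponents into the complex
  numbers.\<close>

type_synonym ('e, 'g) affine = "('e \<Rightarrow>\<^sub>0 'g) \<times> complex"

definition loop :: "'e \<Rightarrow> 'g::ab_group_add \<Rightarrow> ('e, 'g) affine" where
  "loop m a = (Poly_Mapping.single m a, 0)"

definition central :: "('e, 'g::ab_group_add) affine" where
  "central = (0, 1)"

definition affine_scale ::
  "(complex \<Rightarrow> 'g::ab_group_add \<Rightarrow> 'g) \<Rightarrow> complex \<Rightarrow> ('e, 'g) affine \<Rightarrow> ('e, 'g) affine" where
  "affine_scale scale c X = (Poly_Mapping.map (scale c) (fst X), c * snd X)"

definition affine_bracket ::
  "('g::ab_group_add \<Rightarrow> 'g \<Rightarrow> 'g) \<Rightarrow> ('g \<Rightarrow> 'g \<Rightarrow> complex) \<Rightarrow> ('e::ab_group_add \<Rightarrow> complex) \<Rightarrow>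
   ('e, 'g) affine \<Rightarrow> ('e, 'g) affine \<Rightarrow> ('e, 'g) affine" where
  "affine_bracket bracket form emb X Y =
     (\<Sum>m\<in>Poly_Mapping.keys (fst X). \<Sum>n\<in>Poly_Mapping.keys (fst Y).
        let a = Poly_Mapping.lookup (fst X) m; b = Poly_Mapping.lookup (fst Y) n
        in (Poly_Mapping.single (m + n) (bracket a b),
            emb m * form a b * (if m + n = 0 then 1 else 0)))"

definition root_unity :: "nat \<Rightarrow> complex" where
  "root_unity T = exp (2 * of_real pi * \<i> / of_nat T)"

definition eigenspace ::
  "(complex \<Rightarrow> 'g::ab_group_add \<Rightarrow> 'g) \<Rightarrow> ('g \<Rightarrow> 'g) \<Rightarrow> nat \<Rightarrow> int \<Rightarrow> 'g set" where
  "eigenspace scale \<sigma> T r = {a. \<sigma> a = scale (root_unity T powi r) a}"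

text \<open>The subalgebra \<open>\<Coprod>\<^sub>i \<g>\<^sub>i \<otimes> t\<^sup>i \<complex>[t\<^sup>T, t\<^sup>-\<^sup>T] \<oplus> \<complex>\<k>\<close> of the untwisted affine algebra; note that
  the eigenspaces depend only on the index modulo \<open>T\<close>.\<close>

definition fixed_affine ::
  "(complex \<Rightarrow> 'g::ab_group_add \<Rightarrow> 'g) \<Rightarrow> ('g \<Rightarrow> 'g) \<Rightarrow> nat \<Rightarrow> (int, 'g) affine set" where
  "fixed_affine scale \<sigma> T = {X. \<forall>n. Poly_Mapping.lookup (fst X) n \<in> eigenspace scale \<sigma> T n}"

text \<open>The twisted affine algebra \<open>\<Coprod>\<^sub>i \<g>\<^sub>i \<otimes> t\<^sup>i\<^sup>/\<^sup>T \<complex>[t, t\<^sup>-\<^sup>1] \<oplus> \<complex>\<k>\<close>.\<close>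

definition twisted_affine ::
  "(complex \<Rightarrow> 'g::ab_group_add \<Rightarrow> 'g) \<Rightarrow> ('g \<Rightarrow> 'g) \<Rightarrow> nat \<Rightarrow> (rat, 'g) affine set" where
  "twisted_affine scale \<sigma> T =
     {X. \<forall>q\<in>Poly_Mapping.keys (fst X).
           \<exists>n::int. q = of_int n / of_nat T \<and>
             Poly_Mapping.lookup (fst X) q \<in> eigenspace scale \<sigma> T n}"

text \<open>The isomorphism \<open>a \<otimes> t\<^sup>n \<mapsto> a \<otimes> t\<^sup>n\<^sup>/\<^sup>T\<close>, \<open>T \<k> \<mapsto> \<k>\<close> from the former algebra onto the latter.\<close>

definition to_twisted :: "nat \<Rightarrow> (int, 'g::ab_group_add) affine \<Rightarrow> (rat, 'g) affine" where
  "to_twisted T X =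
     (\<Sum>n\<in>Poly_Mapping.keys (fst X).
        Poly_Mapping.single (of_int n / of_nat T) (Poly_Mapping.lookup (fst X) n),
      snd X / of_nat T)"

definition restricted_module_on ::
  "(complex \<Rightarrow> 'g::ab_group_add \<Rightarrow> 'g) \<Rightarrow> ('g \<Rightarrow> 'g \<Rightarrow> 'g) \<Rightarrow> ('g \<Rightarrow> 'g \<Rightarrow> complex) \<Rightarrow>
   ('e::linordered_idom \<Rightarrow> complex) \<Rightarrow> ('e, 'g) affine set \<Rightarrow> complex \<Rightarrow>
   (complex \<Rightarrow> 'w::ab_group_add \<Rightarrow> 'w) \<Rightarrow> (('e, 'g) affine \<Rightarrow> 'w \<Rightarrow> 'w) \<Rightarrow> bool" where
  "restricted_module_on scale bracket form emb S level scaleW act \<longleftrightarrow>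
     lie_module_on (affine_scale scale) (affine_bracket bracket form emb) S scaleW act \<and>
     (\<forall>w. act central w = scaleW level w) \<and>
     (\<forall>w a. \<exists>N. \<forall>n\<ge>N. loop n a \<in> S \<longrightarrow> act (loop n a) w = 0)"

text \<open>The coefficient of \<open>x\<^sup>-\<^sup>n\<^sup>-\<^sup>1\<close> in \<open>a(x)\<^sup>\<sigma>\<close>.\<close>

definition twisted_current ::
  "(complex \<Rightarrow> 'g::ab_group_add \<Rightarrow> 'g) \<Rightarrow> ('g \<Rightarrow> 'g) \<Rightarrow> nat \<Rightarrow> 'g \<Rightarrow> int \<Rightarrow> (int, 'g) affine" where
  "twisted_current scale \<sigma> T a n =
     loop n (\<Sum>i<T. scale (root_unity T powi (- (int i * n))) ((\<sigma> ^^ i) a))"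


section \<open>Enveloping algebras and induced modules\<close>

text \<open>Words under concatenation, so that \<^typ>\<open>'a \<Rightarrow>\<^sub>0 complex\<close> over words is the free
  associative algebra with the multiplication of \<^theory>\<open>HOL-Library.Poly_Mapping\<close>.\<close>

datatype 'a nc_word = NC_Word "'a list"

instantiation nc_word :: (type) monoid_add
begin

definition zero_nc_word :: "'a nc_word" where
  "zero_nc_word = NC_Word []"

fun plus_nc_word :: "'a nc_word \<Rightarrow> 'a nc_word \<Rightarrow> 'a nc_word" where
  "plus_nc_word (NC_Word u) (NC_Word v) = NC_Word (u @ v)"

instance
proof
  fix a b c :: "'a nc_word"
  show "a + b + c = a + (b + c)" by (cases a; cases b; cases c) simp
  show "0 + a = a" by (cases a) (simp add: zero_nc_word_def)
  show "a + 0 = a" by (cases a) (simp add: zero_nc_word_def)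
qed

end

type_synonym 'l free_algebra = "'l nc_word \<Rightarrow>\<^sub>0 complex"

definition fin_scale :: "complex \<Rightarrow> ('b \<Rightarrow>\<^sub>0 complex) \<Rightarrow> ('b \<Rightarrow>\<^sub>0 complex)" where
  "fin_scale c = Poly_Mapping.map ((*) c)"

lemma lookup_fin_scale: "Poly_Mapping.lookup (fin_scale c x) k = c * Poly_Mapping.lookup x k"
  by (simp add: fin_scale_def Poly_Mapping.map.rep_eq when_def)

lemma vector_space_fin_scale: "vector_space fin_scale"
  by unfold_locales
    (rule poly_mapping_eqI, simp add: lookup_fin_scale lookup_add algebra_simps)+

definition generator :: "'l \<Rightarrow> 'l free_algebra" where
  "generator X = Poly_Mapping.single (NC_Word [X]) 1"

text \<open>The two-sided ideal \<open>I\<close> of the free algebra on the set \<open>L\<close> for which the quotient by \<open>I\<close>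
  is the universal enveloping algebra \<open>U(L)\<close>.\<close>

definition enveloping_relations ::
  "(complex \<Rightarrow> 'l::ab_group_add \<Rightarrow> 'l) \<Rightarrow> ('l \<Rightarrow> 'l \<Rightarrow> 'l) \<Rightarrow> 'l free_algebra set" where
  "enveloping_relations scaleL bracketL =
     {generator (X + Y) - generator X - generator Y | X Y. True} \<union>
     {generator (scaleL c X) - fin_scale c (generator X) | c X. True} \<union>
     {generator X * generator Y - generator Y * generator X - generator (bracketL X Y) | X Y. True}"

definition enveloping_ideal ::
  "(complex \<Rightarrow> 'l::ab_group_add \<Rightarrow> 'l) \<Rightarrow> ('l \<Rightarrow> 'l \<Rightarrow> 'l) \<Rightarrow> 'l free_algebra set" where
  "enveloping_ideal scaleL bracketL =
     module.span fin_scale {u * r * v | u r v. r \<in> enveloping_relations scaleL bracketL}"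

definition pure_tensor :: "'l free_algebra \<Rightarrow> complex \<Rightarrow> ('l free_algebra \<times> complex) \<Rightarrow>\<^sub>0 complex"
  where "pure_tensor u z = Poly_Mapping.single (u, z) 1"

text \<open>Defining relations of \<open>U(L) \<otimes>\<^bsub>U(B)\<^esub> \<complex>\<^sub>\<chi>\<close> on the vector space with basis all pairs
  \<open>(u, z)\<close>, where \<open>\<complex>\<^sub>\<chi>\<close> is the one-dimensional module of the subalgebra \<open>B\<close> with character
  \<open>\<chi>\<close>: bilinearity over the complex numbers, dependence of the first factor only on its class
  in \<open>U(L)\<close>, and \<open>u b \<otimes> z = u \<otimes> b z\<close>. It suffices to impose the last one for the elements
  of \<open>B\<close>, since they generate \<open>U(B)\<close>.\<close>

definition induced_relations ::
  "(complex \<Rightarrow> 'l::ab_group_add \<Rightarrow> 'l) \<Rightarrow> ('l \<Rightarrow> 'l \<Rightarrow> 'l) \<Rightarrow> 'l set \<Rightarrow> ('l \<Rightarrow> complex) \<Rightarrow>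
   (('l free_algebra \<times> complex) \<Rightarrow>\<^sub>0 complex) set" where
  "induced_relations scaleL bracketL B \<chi> =
     {pure_tensor (u + v) z - pure_tensor u z - pure_tensor v z | u v z. True} \<union>
     {pure_tensor u (y + z) - pure_tensor u y - pure_tensor u z | u y z. True} \<union>
     {pure_tensor (fin_scale c u) z - fin_scale c (pure_tensor u z) | c u z. True} \<union>
     {pure_tensor u (c * z) - fin_scale c (pure_tensor u z) | c u z. True} \<union>
     {pure_tensor u z | u z. u \<in> enveloping_ideal scaleL bracketL} \<union>
     {pure_tensor (u * generator b) z - pure_tensor u (\<chi> b * z) | u b z. b \<in> B}"

text \<open>The vector space \<open>V\<close>, with the operators \<open>act X\<close> for \<open>X\<close> in \<open>L\<close> and the vector \<open>vac\<close>, is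
  (a copy of) the \<open>L\<close>-module \<open>U(L) \<otimes>\<^bsub>U(B)\<^esub> \<complex>\<^sub>\<chi>\<close> with the vector \<open>1 \<otimes> 1\<close>. The quotient is
  given by the linear surjection \<open>\<Phi>\<close> rather than as a set of cosets, because a type cannot
  depend on the term \<open>\<chi>\<close>.\<close>

definition is_induced_module ::
  "(complex \<Rightarrow> 'l::ab_group_add \<Rightarrow> 'l) \<Rightarrow> ('l \<Rightarrow> 'l \<Rightarrow> 'l) \<Rightarrow> 'l set \<Rightarrow> ('l \<Rightarrow> complex) \<Rightarrow>
   (complex \<Rightarrow> 'v::ab_group_add \<Rightarrow> 'v) \<Rightarrow> ('l \<Rightarrow> 'v \<Rightarrow> 'v) \<Rightarrow> 'v \<Rightarrow> bool" where
  "is_induced_module scaleL bracketL B \<chi> scaleV act vac \<longleftrightarrow>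
     (\<exists>\<Phi>. Vector_Spaces.linear fin_scale scaleV \<Phi> \<and> surj \<Phi> \<and>
        {x. \<Phi> x = 0} = module.span fin_scale (induced_relations scaleL bracketL B \<chi>) \<and>
        \<Phi> (pure_tensor 1 1) = vac \<and>
        (\<forall>X u z. \<Phi> (pure_tensor (generator X * u) z) = act X (\<Phi> (pure_tensor u z))))"

text \<open>The module of level \<open>level\<close> induced from \<open>\<g> \<otimes> \<complex>[t] \<oplus> \<complex>\<k>\<close>.\<close>

definition is_affine_vacuum_module ::
  "(complex \<Rightarrow> 'g::ab_group_add \<Rightarrow> 'g) \<Rightarrow> ('g \<Rightarrow> 'g \<Rightarrow> 'g) \<Rightarrow> ('g \<Rightarrow> 'g \<Rightarrow> complex) \<Rightarrow> complex \<Rightarrow>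
   (complex \<Rightarrow> 'v::ab_group_add \<Rightarrow> 'v) \<Rightarrow> ((int, 'g) affine \<Rightarrow> 'v \<Rightarrow> 'v) \<Rightarrow> 'v \<Rightarrow> bool" where
  "is_affine_vacuum_module scale bracket form level scaleV act vac \<longleftrightarrow>
     is_induced_module (affine_scale scale) (affine_bracket bracket form of_int)
       {X. \<forall>n\<in>Poly_Mapping.keys (fst X). 0 \<le> n} (\<lambda>X. level * snd X) scaleV act vac"


section \<open>Vertex algebras and quasi modules\<close>

text \<open>A formal series in several variables is the family of its coefficients, indexed by the
  tuple of exponents. All products below are finite sums in each coefficient, so that
  \<^const>\<open>Sum_any\<close>, which is 0 on families of infinite support, is the intended sum.\<close>

definition series_mult ::
  "(complex \<Rightarrow> 'w::ab_group_add \<Rightarrow> 'w) \<Rightarrow> ('e::ab_group_add \<Rightarrow> complex) \<Rightarrow> ('e \<Rightarrow> 'w) \<Rightarrow> 'e \<Rightarrow> 'w" where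
  "series_mult scaleW D A e = Sum_any (\<lambda>d. scaleW (D d) (A (e - d)))"

text \<open>The coefficient of \<open>y\<^sup>n\<^sup>-\<^sup>k z\<^sup>k\<close> in \<open>(y - z)\<^sup>n\<close>, expanded in nonnegative powers of \<open>z\<close>.\<close>

definition binomial_coeff :: "int \<Rightarrow> int \<Rightarrow> complex" where
  "binomial_coeff n k = (if k \<ge> 0 then (-1) ^ nat k * (of_int n gchoose nat k) else 0)"

text \<open>Exponents refer to \<open>(x\<^sub>0, x\<^sub>1, x\<^sub>2)\<close>. The three series are
  \<open>x\<^sub>0\<^sup>-\<^sup>1 \<delta>((x\<^sub>1 - x\<^sub>2) / x\<^sub>0) = \<Sum>n. x\<^sub>0\<^sup>-\<^sup>n\<^sup>-\<^sup>1 (x\<^sub>1 - x\<^sub>2)\<^sup>n\<close>,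
  \<open>x\<^sub>0\<^sup>-\<^sup>1 \<delta>((x\<^sub>2 - x\<^sub>1) / - x\<^sub>0) = \<Sum>n. (-1)\<^sup>n x\<^sub>0\<^sup>-\<^sup>n\<^sup>-\<^sup>1 (x\<^sub>2 - x\<^sub>1)\<^sup>n\<close> and
  \<open>x\<^sub>2\<^sup>-\<^sup>1 \<delta>((x\<^sub>1 - x\<^sub>0) / x\<^sub>2) = \<Sum>n. x\<^sub>2\<^sup>-\<^sup>n\<^sup>-\<^sup>1 (x\<^sub>1 - x\<^sub>0)\<^sup>n\<close>.\<close>

definition delta_12 :: "int \<times> int \<times> int \<Rightarrow> complex" where
  "delta_12 = (\<lambda>(i, j, k). let n = - i - 1 in if j = n - k then binomial_coeff n k else 0)"

definition delta_21 :: "int \<times> int \<times> int \<Rightarrow> complex" where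
  "delta_21 = (\<lambda>(i, j, k). let n = - i - 1 in
     if k = n - j then (-1) powi n * binomial_coeff n j else 0)"

definition delta_10 :: "int \<times> int \<times> int \<Rightarrow> complex" where
  "delta_10 = (\<lambda>(i, j, k). let n = - k - 1 in if j = n - i then binomial_coeff n i else 0)"

text \<open>A polynomial \<open>f(x\<^sub>1, x\<^sub>2)\<close> is an element of \<open>\<complex>[x\<^sub>2][x\<^sub>1]\<close>.\<close>

definition poly_series :: "complex poly poly \<Rightarrow> int \<times> int \<times> int \<Rightarrow> complex" where
  "poly_series f = (\<lambda>(i, j, k).
     if i = 0 \<and> j \<ge> 0 \<and> k \<ge> 0 then coeff (coeff f (nat j)) (nat k) else 0)"

text \<open>A linear map from \<open>V\<close> to \<open>Hom(W, W((x)))\<close> is given by its modes: \<open>Y u n\<close> is the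
  coefficient of \<open>x\<^sup>-\<^sup>n\<^sup>-\<^sup>1\<close> in \<open>Y(u, x)\<close>.\<close>

definition field_map ::
  "(complex \<Rightarrow> 'v::ab_group_add \<Rightarrow> 'v) \<Rightarrow> (complex \<Rightarrow> 'w::ab_group_add \<Rightarrow> 'w) \<Rightarrow>
   ('v \<Rightarrow> int \<Rightarrow> 'w \<Rightarrow> 'w) \<Rightarrow> bool" where
  "field_map scaleV scaleW Y \<longleftrightarrow>
     (\<forall>n w. Vector_Spaces.linear scaleV scaleW (\<lambda>u. Y u n w)) \<and>
     (\<forall>u n. Vector_Spaces.linear scaleW scaleW (Y u n)) \<and>
     (\<forall>u w. \<exists>N. \<forall>n\<ge>N. Y u n w = 0)"

definition jacobi_identity ::
  "('v \<Rightarrow> int \<Rightarrow> 'v \<Rightarrow> 'v) \<Rightarrow> (complex \<Rightarrow> 'w::ab_group_add \<Rightarrow> 'w) \<Rightarrow> ('v \<Rightarrow> int \<Rightarrow> 'w \<Rightarrow> 'w) \<Rightarrow>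
   complex poly poly \<Rightarrow> 'v \<Rightarrow> 'v \<Rightarrow> 'w \<Rightarrow> bool" where
  "jacobi_identity Y scaleW YW f u v w \<longleftrightarrow>
     (let uv = (\<lambda>(i, j, k). if i = 0 then YW u (- j - 1) (YW v (- k - 1) w) else 0);
          vu = (\<lambda>(i, j, k). if i = 0 then YW v (- k - 1) (YW u (- j - 1) w) else 0);
          it = (\<lambda>(i, j, k). if j = 0 then YW (Y u (- i - 1) v) (- k - 1) w else 0);
          mult = series_mult scaleW;
          F = poly_series f
      in \<forall>e. mult delta_12 (mult F uv) e - mult delta_21 (mult F vu) e = mult delta_10 (mult F it) e)"

locale vertex_algebra = vector_space scaleV
  for scaleV :: "complex \<Rightarrow> 'v::ab_group_add \<Rightarrow> 'v" +
  fixes Y :: "'v \<Rightarrow> int \<Rightarrow> 'v \<Rightarrow> 'v" and vac :: 'v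
  assumes field_map: "field_map scaleV scaleV Y"
    and vacuum: "Y vac n v = (if n = -1 then v else 0)"
    and creation: "n \<ge> 0 \<Longrightarrow> Y v n vac = 0" "Y v (-1) vac = v"
    and jacobi_identity: "jacobi_identity Y scaleV Y 1 u v w"

definition quasi_module ::
  "(complex \<Rightarrow> 'v::ab_group_add \<Rightarrow> 'v) \<Rightarrow> ('v \<Rightarrow> int \<Rightarrow> 'v \<Rightarrow> 'v) \<Rightarrow> 'v \<Rightarrow>
   (complex \<Rightarrow> 'w::ab_group_add \<Rightarrow> 'w) \<Rightarrow> ('v \<Rightarrow> int \<Rightarrow> 'w \<Rightarrow> 'w) \<Rightarrow> bool" where
  "quasi_module scaleV Y vac scaleW YW \<longleftrightarrow>
     vector_space scaleW \<and>
     field_map scaleV scaleW YW \<and>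
     (\<forall>n w. YW vac n w = (if n = -1 then w else 0)) \<and>
     (\<forall>u v. \<exists>f. f \<noteq> 0 \<and> (\<forall>w. jacobi_identity Y scaleW YW f u v w))"

text \<open>\<open>p(x\<^sub>1 / x\<^sub>2)\<close>, with exponents referring to \<open>(x\<^sub>1, x\<^sub>2)\<close>.\<close>

definition ratio_series :: "complex poly \<Rightarrow> int \<times> int \<Rightarrow> complex" where
  "ratio_series p = (\<lambda>(j, k). if j \<ge> 0 \<and> k = - j then coeff p (nat j) else 0)"

definition kills_commutators ::
  "(complex \<Rightarrow> 'w::ab_group_add \<Rightarrow> 'w) \<Rightarrow> ('v \<Rightarrow> int \<Rightarrow> 'w \<Rightarrow> 'w) \<Rightarrow> complex poly \<Rightarrow> bool" where
  "kills_commutators scaleW YW p \<longleftrightarrow>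
     p \<noteq> 0 \<and>
     (\<forall>u v. \<exists>r::nat. \<forall>w e.
        series_mult scaleW (ratio_series (p ^ r))
          (\<lambda>(j, k). YW u (- j - 1) (YW v (- k - 1) w) - YW v (- k - 1) (YW u (- j - 1) w)) e = 0)"

definition is_minimal_polynomial ::
  "(complex \<Rightarrow> 'w::ab_group_add \<Rightarrow> 'w) \<Rightarrow> ('v \<Rightarrow> int \<Rightarrow> 'w \<Rightarrow> 'w) \<Rightarrow> complex poly \<Rightarrow> bool" where
  "is_minimal_polynomial scaleW YW p \<longleftrightarrow>
     kills_commutators scaleW YW p \<and> lead_coeff p = 1 \<and>
     (\<forall>q. kills_commutators scaleW YW q \<and> lead_coeff q = 1 \<and> q \<noteq> p \<longrightarrow> degree p < degree q)"

end

theory Submission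
  imports Defs "HOL-Library.Function_Algebras"
begin

text \<open>
The currents \<open>a\<^sub>W(x)\<^sup>\<sigma>\<close> are pairwise quasi-local: their commutators are killed by powers of
\<open>x\<^sub>1\<^sup>T - x\<^sub>2\<^sup>T\<close>. For quasi-local fields the \<open>n\<close>-th product \<open>U\<^sub>n V\<close> is the residue of
\<open>(x\<^sub>1 - x\<^sub>2)\<^sup>n U(x\<^sub>1) V(x\<^sub>2)\<close> at \<open>x\<^sub>1 = x\<^sub>2\<close> alone, not at the other points \<open>x\<^sub>1 = \<zeta> x\<^sub>2\<close> with
\<open>\<zeta>\<^sup>T = 1\<close>; these products satisfy the quasi Jacobi identity. Deforming contours, the commutator of
two operators \<open>A\<^sub>m\<close> and \<open>B\<^sub>n\<close> on the space of fields sees only the singularity of \<open>[A(x\<^sub>0), B(x\<^sub>1)]\<close>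
on \<open>x\<^sub>0 = x\<^sub>1\<close>, so the products with currents represent the untwisted affine algebra at level
\<open>\<ell>\<close>. As the constant field 1 is killed by \<open>\<g> \<otimes> \<complex>[t]\<close>, the universal property of the
vacuum module gives a map \<open>Y\<^sub>W\<close> from it to fields, and Goddard's uniqueness argument shows that
\<open>Y\<^sub>W\<close> turns \<open>n\<close>-th products of vectors into \<open>n\<close>-th products of fields.

Uniqueness holds because \<open>f(x\<^sub>1, x\<^sub>2)\<close> has a finite order of vanishing along \<open>x\<^sub>1 = x\<^sub>2\<close> and can
therefore be cancelled from the quasi Jacobi identity. For the minimal polynomial, the components
of the commutator of two currents at the different \<open>T\<close>-th roots of unity are independent; a
polynomial that misses one of the roots kills that component for all currents, and since
\<open>\<sigma>\<close> permutes the components all currents commute.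
\<close>

section \<open>Laurent polynomials acting on families of coefficients\<close>

text \<open>Fields are formal series here, so a residue at x1 = x2 alone cannot be taken along a
  contour: the difference of the two expansions of (x1 - x2)^n U(x1) V(x2) carries the residues at
  all points x1 = \<zeta> x2 together. It is therefore multiplied by a polynomial in x1 / x2 that is
  1 to high order at 1 and vanishes to high order at the other T-th roots of unity, and the
  coefficient of x1^-1 is read off. The order needed grows as n decreases, so no kernel serves all
  n; hence the independence of the kernel and the lower bounds on exponents in statements on
  iterated products. An iterated product carries two kernels, in x0 / x2 and x1 / x2. On a component
  x0 = \<zeta> x1 with \<zeta> \<noteq> 1 the points x0 = x2 and x1 = x2 exclude each other, so the
  two kernels together annihilate it. Expansions of negative powers are handled by recursion:
  multiplication by x1 - x2 raises n by one, and what it annihilates is constant along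
  diagonals.\<close>

lemma poly_mapping_single_induct [case_names zero single add]:
  fixes D :: "'e \<Rightarrow>\<^sub>0 'c::comm_monoid_add"
  assumes "P 0" and "\<And>d c. P (Poly_Mapping.single d c)" and "\<And>D D'. P D \<Longrightarrow> P D' \<Longrightarrow> P (D + D')"
  shows "P D"
proof (induction D rule: update_induct)
  case const
  then show ?case by (rule assms(1))
next
  case (update f a b)
  have "Poly_Mapping.update a b f = f + Poly_Mapping.single a b"
    using update by (intro poly_mapping_eqI) (auto simp: lookup_update lookup_add lookup_single when_def in_keys_iff)
  then show ?case using update assms by simp
qed

text \<open>Repeated addition in an arbitrary monoid, so that power and binomial formulas for
  monomials are stated once for exponent pairs and triples.\<close>

primrec nmul :: "nat \<Rightarrow> 'e::monoid_add \<Rightarrow> 'e" where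
  "nmul 0 a = 0"
| "nmul (Suc j) a = a + nmul j a"

lemma nmul_int [simp]: "nmul j (x::int) = int j * x"
  by (induction j) (auto simp: algebra_simps)

lemma nmul_pair [simp]: "nmul j (x, y) = (nmul j x, nmul j y)"
  by (induction j) (auto simp: zero_prod_def)

abbreviation mon :: "'e \<Rightarrow> 'e \<Rightarrow>\<^sub>0 complex" where
  "mon d \<equiv> Poly_Mapping.single d 1"

abbreviation const :: "complex \<Rightarrow> 'e::zero \<Rightarrow>\<^sub>0 complex" where
  "const c \<equiv> Poly_Mapping.single 0 c"

lemma mon_power: "mon (d::'e::comm_monoid_add) ^ j = mon (nmul j d)"
  by (induction j) (auto simp: mult_single)

text \<open>The first two terms of the binomial expansion contain X^K, all others contain N^2. In
  the application N^2 annihilates a delta-function term, so that only a multiple of X^K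
  remains.\<close>

lemma power_add_mod_square:
  fixes X N :: "'r::comm_ring_1"
  shows "\<exists>a b. (X + N) ^ Suc K = X ^ K * a + N\<^sup>2 * b"
proof -
  have "\<exists>b. (X + N) ^ Suc K = X ^ K * (X + of_nat (Suc K) * N) + N\<^sup>2 * b"
  proof (induction K)
    case 0
    show ?case by (rule exI[of _ 0]) simp
  next
    case (Suc K)
    then obtain b where "(X + N) ^ Suc K = X ^ K * (X + of_nat (Suc K) * N) + N\<^sup>2 * b" by blast
    then have "(X + N) ^ Suc (Suc K) = (X + N) * (X ^ K * (X + of_nat (Suc K) * N) + N\<^sup>2 * b)" by simp
    also have "\<dots> = X ^ Suc K * (X + of_nat (Suc (Suc K)) * N) + N\<^sup>2 * (X ^ K * of_nat (Suc K) + (X + N) * b)"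
      by (simp add: algebra_simps power2_eq_square)
    finally show ?case by blast
  qed
  then show ?thesis by blast
qed

locale complex_space = vector_space scale
  for scale :: "complex \<Rightarrow> 'w::ab_group_add \<Rightarrow> 'w" (infixr \<open>*s\<close> 75)
begin

text \<open>\<open>\<Phi> (p, q)\<close> is the coefficient of \<open>x\<^sub>1\<^sup>-\<^sup>p\<^sup>-\<^sup>1 x\<^sub>2\<^sup>-\<^sup>q\<^sup>-\<^sup>1\<close>, so that multiplication by \<open>x\<^sub>1\<close>
  raises \<open>p\<close>.\<close>

definition laurent_act :: "('e::ab_group_add \<Rightarrow>\<^sub>0 complex) \<Rightarrow> ('e \<Rightarrow> 'w) \<Rightarrow> 'e \<Rightarrow> 'w" (infixr \<open>\<star>\<close> 70)
  where "(D \<star> \<Phi>) e = (\<Sum>d\<in>Poly_Mapping.keys D. Poly_Mapping.lookup D d *s \<Phi> (e + d))"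

lemma act_superset:
  assumes "finite S" "Poly_Mapping.keys D \<subseteq> S"
  shows "(D \<star> \<Phi>) e = (\<Sum>d\<in>S. Poly_Mapping.lookup D d *s \<Phi> (e + d))"
  unfolding laurent_act_def using assms
  by (intro sum.mono_neutral_left) (auto simp: in_keys_iff)

lemma act_add [simp]: "(D + D') \<star> \<Phi> = D \<star> \<Phi> + D' \<star> \<Phi>"
proof
  fix e
  let ?S = "Poly_Mapping.keys D \<union> Poly_Mapping.keys D'"
  have "((D + D') \<star> \<Phi>) e = (\<Sum>d\<in>?S. Poly_Mapping.lookup (D + D') d *s \<Phi> (e + d))"
    by (rule act_superset) (auto simp: keys_add)
  also have "\<dots> = (D \<star> \<Phi>) e + (D' \<star> \<Phi>) e"
    by (subst (1 2) act_superset[where S = ?S])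
      (auto simp: lookup_add scale_left_distrib sum.distrib)
  finally show "((D + D') \<star> \<Phi>) e = (D \<star> \<Phi> + D' \<star> \<Phi>) e" by simp
qed

lemma act_single [simp]: "Poly_Mapping.single d c \<star> \<Phi> = (\<lambda>e. c *s \<Phi> (e + d))"
  by (cases "c = 0") (auto simp: laurent_act_def fun_eq_iff)

lemma act_zero [simp]: "0 \<star> \<Phi> = 0"
  by (auto simp: laurent_act_def fun_eq_iff)

lemma act_one [simp]: "1 \<star> \<Phi> = \<Phi>"
  by (simp add: single_one[symmetric] del: single_one)

lemma act_add_right [simp]: "D \<star> (\<Phi> + \<Psi>) = D \<star> \<Phi> + D \<star> \<Psi>"
  by (auto simp: laurent_act_def fun_eq_iff scale_right_distrib sum.distrib)

lemma act_zero_right [simp]: "D \<star> 0 = 0"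
  by (auto simp: laurent_act_def fun_eq_iff)

lemma act_uminus [simp]: "(- D) \<star> \<Phi> = - (D \<star> \<Phi>)"
  using act_add[of "- D" D \<Phi>] by (simp del: act_add add: eq_neg_iff_add_eq_0)

lemma act_diff [simp]: "(D - D') \<star> \<Phi> = D \<star> \<Phi> - D' \<star> \<Phi>"
  using act_add[of D "- D'" \<Phi>] by simp

lemma act_uminus_right [simp]: "D \<star> (- \<Phi>) = - (D \<star> \<Phi>)"
  using act_add_right[of D "- \<Phi>" \<Phi>] by (simp del: act_add_right add: eq_neg_iff_add_eq_0)

lemma act_diff_right [simp]: "D \<star> (\<Phi> - \<Psi>) = D \<star> \<Phi> - D \<star> \<Psi>"
  using act_add_right[of D \<Phi> "- \<Psi>"] by simp

lemma act_shift: "D \<star> (\<lambda>e. \<Phi> (e + d)) = (\<lambda>e. (D \<star> \<Phi>) (e + d))"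
  by (auto simp: laurent_act_def fun_eq_iff add_ac)

lemma act_scale_right: "D \<star> (\<lambda>e. c *s \<Phi> e) = (\<lambda>e. c *s (D \<star> \<Phi>) e)"
  by (auto simp: laurent_act_def fun_eq_iff scale_sum_right mult.commute)

lemma act_sum_right: "D \<star> (\<lambda>e. \<Sum>i\<in>I. \<Phi> i e) = (\<lambda>e. \<Sum>i\<in>I. (D \<star> \<Phi> i) e)"
proof (induction I rule: infinite_finite_induct)
  case (infinite A)
  then show ?case using act_zero_right[of D] by (simp add: fun_eq_iff zero_fun_def)
next
  case empty
  then show ?case using act_zero_right[of D] by (simp add: fun_eq_iff zero_fun_def)
next
  case (insert x F)
  then show ?case using act_add_right[of D "\<Phi> x" "\<lambda>e. \<Sum>i\<in>F. \<Phi> i e"]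
    by (simp add: plus_fun_def)
qed

lemma act_mult: "(D * D') \<star> \<Phi> = D \<star> (D' \<star> \<Phi>)"
proof (induction D rule: poly_mapping_single_induct)
  case (single d c)
  show ?case
  proof (induction D' rule: poly_mapping_single_induct)
    case (single d' c')
    then show ?case by (simp add: mult_single fun_eq_iff add_ac)
  next
    case (add D D')
    then show ?case
      by (simp add: distrib_left fun_eq_iff scale_right_distrib)
  qed (simp add: fun_eq_iff)
qed (simp_all add: distrib_right fun_eq_iff)

lemma act_commute: "D \<star> (D' \<star> \<Phi>) = D' \<star> (D \<star> \<Phi>)"
  by (simp add: act_mult[symmetric] mult.commute)

lemma act_mult_eq_0: "D' \<star> \<Phi> = 0 \<Longrightarrow> (D * D') \<star> \<Phi> = 0"
  by (simp add: act_mult)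

lemma act_dvd_eq_0: "D \<star> \<Phi> = 0 \<Longrightarrow> D dvd D' \<Longrightarrow> D' \<star> \<Phi> = 0"
  by (metis act_mult_eq_0 dvdE mult.commute)

text \<open>Written out as a sum, the action can be moved through a linear operator on the module;
  this is how a vanishing statement is transported past a further field.\<close>

lemma act_binomial:
  "((mon a - mon b) ^ k \<star> \<Phi>) e =
     (\<Sum>i\<le>k. ((-1) ^ i * of_nat (k choose i)) *s \<Phi> (e + nmul (k - i) a + nmul i b))"
proof -
  have minus: "(- mon b) ^ i = Poly_Mapping.single (nmul i b) ((-1) ^ i)" for i
    by (induction i) (auto simp: mult_single simp flip: single_uminus)
  have "(mon a - mon b) ^ k = (\<Sum>i\<le>k. of_nat (k choose i) * (- mon b) ^ i * mon a ^ (k - i))"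
    using binomial_ring[of "- mon b" "mon a" k] by simp
  also have "\<dots> = (\<Sum>i\<le>k. Poly_Mapping.single (nmul (k - i) a + nmul i b) ((-1) ^ i * of_nat (k choose i)))"
    unfolding minus mon_power of_nat_single[symmetric] single_of_nat[symmetric]
    by (intro sum.cong refl) (simp add: mult_single mult_ac add_ac del: single_of_nat)
  finally have "(mon a - mon b) ^ k = (\<Sum>i\<le>k. Poly_Mapping.single (nmul (k - i) a + nmul i b) ((-1) ^ i * of_nat (k choose i)))" .
  then have "((mon a - mon b) ^ k \<star> \<Phi>) e = ((\<Sum>i\<le>k. Poly_Mapping.single (nmul (k - i) a + nmul i b) ((-1) ^ i * of_nat (k choose i))) \<star> \<Phi>) e"
    by simp
  also have "\<dots> = (\<Sum>i\<le>k. ((-1) ^ i * of_nat (k choose i)) *s \<Phi> (e + nmul (k - i) a + nmul i b))"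
  proof -
    have "((\<Sum>i\<in>I. Poly_Mapping.single (f i) (c i)) \<star> \<Phi>) e = (\<Sum>i\<in>I. c i *s \<Phi> (e + f i))"
      if "finite I" for I :: "nat set" and f c
      using that by (induction I rule: finite_induct) auto
    from this[of "{..k}"] show ?thesis by (simp add: add.assoc)
  qed
  finally show ?thesis .
qed

end

lemma linear_additive:
  assumes "Vector_Spaces.linear s1 s2 f"
  shows "f (x + y) = f x + f y" "f (x - y) = f x - f y" "f 0 = 0" "f (- x) = - f x"
    "f (s1 c x) = s2 c (f x)" "f (sum g A) = (\<Sum>a\<in>A. f (g a))"
proof -
  interpret Vector_Spaces.linear s1 s2 f by fact
  show "f (x + y) = f x + f y" "f (x - y) = f x - f y" "f 0 = 0" "f (- x) = - f x"
    "f (s1 c x) = s2 c (f x)" "f (sum g A) = (\<Sum>a\<in>A. f (g a))"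
    by (auto simp: add diff neg scale sum)
qed

lemma linearI:
  assumes "vector_space s1" "vector_space s2"
    and "\<And>x y. f (x + y) = f x + f y" "\<And>c x. f (s1 c x) = s2 c (f x)"
  shows "Vector_Spaces.linear s1 s2 f"
  using assms by (simp add: Vector_Spaces.linear_def module_hom_def module_hom_axioms_def
      module_iff_vector_space)

section \<open>Binomial sums: coefficients of expansions of (y - z)^n\<close>

definition sbinom :: "int \<Rightarrow> nat \<Rightarrow> complex" where
  "sbinom n i = (-1) ^ i * (of_int n gchoose i)"

lemma sbinom_0 [simp]: "sbinom n 0 = 1"
  by (simp add: sbinom_def)

lemma sbinom_Suc: "sbinom (n + 1) (Suc i) = sbinom n (Suc i) - sbinom n i"
proof -
  have "(of_int (n + 1) :: complex) gchoose Suc i = (of_int n gchoose i) + (of_int n gchoose Suc i)"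
    unfolding of_int_add of_int_1 by (rule gbinomial_Suc_Suc)
  then show ?thesis
    unfolding sbinom_def by (simp only: power_Suc) (simp add: algebra_simps)
qed

lemma sbinom_zero_left: "sbinom 0 i = (if i = 0 then 1 else 0)"
  by (cases i) (auto simp: sbinom_def)

text \<open>The coefficient form of d/dz (y - z)^n = -n (y - z)^(n-1).\<close>

lemma sbinom_absorb: "of_nat (Suc i) * sbinom n (Suc i) = - of_int n * sbinom (n - 1) i"
  unfolding sbinom_def power_Suc of_int_diff of_int_1
  using arg_cong[OF gbinomial_absorption[of i "of_int n :: complex"], of "\<lambda>z. (-1) ^ i * z"]
  by (simp add: mult_ac)

text \<open>\<open>Sum_any\<close> is 0 on infinite supports, so linearity of sums against a
  binomial series has to be justified by truncation, which this predicate records.\<close>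

definition fin_seq :: "(nat \<Rightarrow> 'w::zero) \<Rightarrow> bool" where
  "fin_seq \<chi> \<longleftrightarrow> (\<exists>N. \<forall>i\<ge>N. \<chi> i = 0)"

lemma fin_seqI: "(\<And>i. i \<ge> N \<Longrightarrow> \<chi> i = 0) \<Longrightarrow> fin_seq \<chi>"
  by (auto simp: fin_seq_def)

lemma fin_seq_add:
  assumes "fin_seq \<chi>" "fin_seq \<xi>"
  shows "fin_seq (\<lambda>i. \<chi> i + (\<xi> i :: 'w::monoid_add))"
proof -
  obtain M N where "\<And>i. i \<ge> M \<Longrightarrow> \<chi> i = 0" "\<And>i. i \<ge> N \<Longrightarrow> \<xi> i = 0"
    using assms by (auto simp: fin_seq_def)
  then show ?thesis by (intro fin_seqI[of "max M N"]) auto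
qed

lemma fin_seq_Suc: "fin_seq \<chi> \<Longrightarrow> fin_seq (\<lambda>i. \<chi> (Suc i))"
  unfolding fin_seq_def using le_SucI by blast

lemma fin_seq_map: "fin_seq \<chi> \<Longrightarrow> f 0 = 0 \<Longrightarrow> fin_seq (\<lambda>i. f (\<chi> i))"
  unfolding fin_seq_def by fastforce

lemma fin_seq_zero [simp]: "fin_seq (\<lambda>i. 0)"
  by (simp add: fin_seq_def)

lemma fin_seq_sum: "(\<And>a. a \<in> A \<Longrightarrow> fin_seq (\<chi> a)) \<Longrightarrow> fin_seq (\<lambda>i. \<Sum>a\<in>A. \<chi> a i :: 'w::comm_monoid_add)"
  by (induction A rule: infinite_finite_induct) (auto intro!: fin_seq_add)

context complex_space
begin

abbreviation lin :: "('w \<Rightarrow> 'w) \<Rightarrow> bool" where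
  "lin \<equiv> Vector_Spaces.linear (*s) (*s)"

lemma linI: "(\<And>x y. f (x + y) = f x + f y) \<Longrightarrow> (\<And>c x. f (c *s x) = c *s f x) \<Longrightarrow> lin f"
  by (rule linearI) (auto simp: vector_space_axioms)

text \<open>The pairing of a sequence with the coefficients of (1 - z)^n. For negative n it is the
  truncation of the sequence that keeps the sum finite.\<close>

definition binom_sum :: "int \<Rightarrow> (nat \<Rightarrow> 'w) \<Rightarrow> 'w" where
  "binom_sum n \<chi> = Sum_any (\<lambda>i. sbinom n i *s \<chi> i)"

lemma binom_sum_eq:
  assumes "\<And>i. i \<ge> N \<Longrightarrow> \<chi> i = 0"
  shows "binom_sum n \<chi> = (\<Sum>i<N. sbinom n i *s \<chi> i)"
proof -
  have "i < N" if "sbinom n i *s \<chi> i \<noteq> 0" for i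
  proof (rule ccontr)
    assume "\<not> i < N"
    then have "\<chi> i = 0" by (intro assms) simp
    then show False using that by simp
  qed
  then have "{i. sbinom n i *s \<chi> i \<noteq> 0} \<subseteq> {..<N}" by auto
  then show ?thesis unfolding binom_sum_def by (intro Sum_any.expand_superset) auto
qed

lemma binom_sum_zero [simp]: "binom_sum n (\<lambda>i. 0) = 0"
  by (simp add: binom_sum_def)

lemma common_bound:
  assumes "fin_seq \<chi>" "fin_seq \<xi>"
  obtains N where "\<And>i. i \<ge> N \<Longrightarrow> \<chi> i = 0" "\<And>i. i \<ge> N \<Longrightarrow> \<xi> i = 0"
proof -
  obtain M N where "\<And>i. i \<ge> M \<Longrightarrow> \<chi> i = 0" "\<And>i. i \<ge> N \<Longrightarrow> \<xi> i = 0"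
    using assms by (auto simp: fin_seq_def)
  then show ?thesis using that[of "max M N"] by auto
qed

lemma binom_sum_add:
  assumes "fin_seq \<chi>" "fin_seq \<xi>"
  shows "binom_sum n (\<lambda>i. \<chi> i + \<xi> i) = binom_sum n \<chi> + binom_sum n \<xi>"
proof -
  obtain N where N: "\<And>i. i \<ge> N \<Longrightarrow> \<chi> i = 0" "\<And>i. i \<ge> N \<Longrightarrow> \<xi> i = 0"
    using common_bound[OF assms] by blast
  then show ?thesis
    by (simp add: binom_sum_eq[of N] scale_right_distrib sum.distrib)
qed

lemma binom_sum_linear:
  assumes "Vector_Spaces.linear (*s) (*s) f" "fin_seq \<chi>"
  shows "f (binom_sum n \<chi>) = binom_sum n (\<lambda>i. f (\<chi> i))"
proof -
  obtain N where N: "\<And>i. i \<ge> N \<Longrightarrow> \<chi> i = 0" using assms(2) by (auto simp: fin_seq_def)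
  then show ?thesis
    by (simp add: binom_sum_eq[of N] linear_additive[OF assms(1)])
qed

lemma lin_scale: "lin (\<lambda>x. c *s x)"
  by (rule linI) (auto simp: scale_right_distrib mult.commute)

lemma binom_sum_scale: "fin_seq \<chi> \<Longrightarrow> binom_sum n (\<lambda>i. c *s \<chi> i) = c *s binom_sum n \<chi>"
  using binom_sum_linear[OF lin_scale] by simp

lemma binom_sum_uminus: "fin_seq \<chi> \<Longrightarrow> binom_sum n (\<lambda>i. - \<chi> i) = - binom_sum n \<chi>"
  using binom_sum_scale[of \<chi> n "-1"] by simp

lemma binom_sum_diff:
  assumes "fin_seq \<chi>" "fin_seq \<xi>"
  shows "binom_sum n (\<lambda>i. \<chi> i - \<xi> i) = binom_sum n \<chi> - binom_sum n \<xi>"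
  using binom_sum_add[OF assms(1) fin_seq_map[OF assms(2), of uminus]] binom_sum_uminus[OF assms(2)]
  by simp

lemma binom_sum_sum:
  assumes "\<And>a. a \<in> A \<Longrightarrow> fin_seq (\<chi> a)"
  shows "binom_sum n (\<lambda>i. \<Sum>a\<in>A. \<chi> a i) = (\<Sum>a\<in>A. binom_sum n (\<chi> a))"
  using assms
  by (induction A rule: infinite_finite_induct) (auto simp: binom_sum_add fin_seq_sum)

text \<open>Pascal's rule, that is (1 - z)^(n+1) = (1 - z) (1 - z)^n, where multiplication by z acts
  as the shift of \<chi>. The recursions in the exponent for \<open>borch\<close>,
  \<open>hat\<close> and \<open>gam\<close> all come from here.\<close>

lemma binom_sum_Suc:
  assumes "fin_seq \<chi>"
  shows "binom_sum (n + 1) \<chi> = binom_sum n \<chi> - binom_sum n (\<lambda>i. \<chi> (Suc i))"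
proof -
  obtain N where N: "\<And>i. i \<ge> N \<Longrightarrow> \<chi> i = 0" using assms by (auto simp: fin_seq_def)
  have "binom_sum m \<chi> = \<chi> 0 + (\<Sum>i<N. sbinom m (Suc i) *s \<chi> (Suc i))" for m
    using N by (subst binom_sum_eq[of "Suc N"]) (auto simp: sum.lessThan_Suc_shift simp del: sum.lessThan_Suc)
  moreover have "binom_sum n (\<lambda>i. \<chi> (Suc i)) = (\<Sum>i<N. sbinom n i *s \<chi> (Suc i))"
    using N by (intro binom_sum_eq) auto
  ultimately show ?thesis
    by (simp add: sbinom_Suc scale_left_diff_distrib sum_subtractf)
qed

lemma binom_sum_0: "binom_sum 0 \<chi> = \<chi> 0"
proof -
  have "binom_sum 0 \<chi> = (\<Sum>i\<in>{0}. sbinom 0 i *s \<chi> i)"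
    unfolding binom_sum_def by (rule Sum_any.expand_superset) (auto simp: sbinom_zero_left)
  then show ?thesis by simp
qed

lemma binom_sum_absorb:
  assumes "fin_seq \<chi>"
  shows "binom_sum n (\<lambda>i. of_nat i *s \<chi> i) = - (of_int n *s binom_sum (n - 1) (\<lambda>i. \<chi> (Suc i)))"
proof -
  obtain N where N: "\<And>i. i \<ge> N \<Longrightarrow> \<chi> i = 0" using assms by (auto simp: fin_seq_def)
  have "binom_sum n (\<lambda>i. of_nat i *s \<chi> i) = (\<Sum>i<N. (of_nat (Suc i) * sbinom n (Suc i)) *s \<chi> (Suc i))"
    using N by (subst binom_sum_eq[of "Suc N"])
      (auto simp: sum.lessThan_Suc_shift mult.commute simp del: sum.lessThan_Suc of_nat_Suc)
  moreover have "binom_sum (n - 1) (\<lambda>i. \<chi> (Suc i)) = (\<Sum>i<N. sbinom (n - 1) i *s \<chi> (Suc i))"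
    using N by (intro binom_sum_eq) auto
  ultimately show ?thesis
    by (simp only: sbinom_absorb) (simp add: scale_sum_right sum_negf)
qed

lemma binom_sum_swap:
  assumes "\<And>i j. N \<le> i \<or> N \<le> j \<Longrightarrow> \<chi> i j = 0"
  shows "binom_sum m (\<lambda>i. binom_sum n (\<lambda>j. \<chi> i j)) = binom_sum n (\<lambda>j. binom_sum m (\<lambda>i. \<chi> i j))"
proof -
  have "binom_sum m (\<lambda>i. binom_sum n (\<lambda>j. \<chi> i j)) = (\<Sum>i<N. \<Sum>j<N. (sbinom m i * sbinom n j) *s \<chi> i j)"
    using assms by (subst binom_sum_eq[of N]) (auto simp: binom_sum_eq[of N] scale_sum_right)
  moreover have "binom_sum n (\<lambda>j. binom_sum m (\<lambda>i. \<chi> i j)) = (\<Sum>j<N. \<Sum>i<N. (sbinom m i * sbinom n j) *s \<chi> i j)"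
    using assms by (subst binom_sum_eq[of N]) (auto simp: binom_sum_eq[of N] scale_sum_right mult.commute)
  ultimately show ?thesis using sum.swap[of "\<lambda>i j. (sbinom m i * sbinom n j) *s \<chi> i j" "{..<N}" "{..<N}"] by simp
qed

text \<open>Vandermonde's identity (1 - z)^m (1 - z)^n = (1 - z)^(m+n). The defect \<Delta> obeys
  Pascal's rule in m, which propagates vanishing upwards at once; downwards the truncation of \<chi>
  is needed.\<close>

lemma binom_sum_compose:
  assumes "fin_seq \<chi>"
  shows "binom_sum m (\<lambda>i. binom_sum n (\<lambda>j. \<chi> (i + j))) = binom_sum (m + n) \<chi>"
proof -
  define \<Delta> where "\<Delta> m \<chi> = binom_sum m (\<lambda>i. binom_sum n (\<lambda>j. \<chi> (i + j))) - binom_sum (m + n) \<chi>" for m \<chi>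
  have fin: "fin_seq (\<lambda>i. binom_sum n (\<lambda>j. \<chi> (i + j)))" if fin_\<chi>: "fin_seq \<chi>" for \<chi>
  proof -
    obtain N where N: "\<And>i. i \<ge> N \<Longrightarrow> \<chi> i = 0" using fin_\<chi> by (auto simp: fin_seq_def)
    then show ?thesis by (intro fin_seqI[of N]) simp
  qed
  have step: "\<Delta> (m + 1) \<chi> = \<Delta> m \<chi> - \<Delta> m (\<lambda>i. \<chi> (Suc i))" if "fin_seq \<chi>" for m \<chi>
    using binom_sum_Suc[OF fin[OF that], of m] binom_sum_Suc[OF that, of "m + n"]
    unfolding \<Delta>_def by (simp add: algebra_simps)
  have up: "(\<And>\<chi>. fin_seq \<chi> \<Longrightarrow> \<Delta> m \<chi> = 0) \<Longrightarrow> fin_seq \<chi> \<Longrightarrow> \<Delta> (m + 1) \<chi> = 0" for m \<chi>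
    by (simp add: step fin_seq_Suc[of \<chi>])
  \<comment> \<open>Vanishing at m + 1 makes \<open>\<Delta> m\<close> invariant under shifts of
    \<chi>, and enough shifts turn \<chi> into 0.\<close>
  have down: "\<Delta> m \<chi> = 0" if van: "\<And>\<chi>. fin_seq \<chi> \<Longrightarrow> \<Delta> (m + 1) \<chi> = 0" and fin_\<chi>: "fin_seq \<chi>" for m \<chi>
  proof -
    obtain N where N: "\<And>i. i \<ge> N \<Longrightarrow> \<chi> i = 0" using fin_\<chi> by (auto simp: fin_seq_def)
    have "fin_seq (\<lambda>i. \<chi> (i + j)) \<and> \<Delta> m \<chi> = \<Delta> m (\<lambda>i. \<chi> (i + j))" for j
    proof (induction j)
      case (Suc j)
      then have "\<Delta> m (\<lambda>i. \<chi> (i + j)) = \<Delta> m (\<lambda>i. \<chi> (Suc i + j))"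
        using step[of "\<lambda>i. \<chi> (i + j)" m] van[of "\<lambda>i. \<chi> (i + j)"] by simp
      then show ?case using Suc fin_seq_Suc[of "\<lambda>i. \<chi> (i + j)"] by simp
    qed (use fin_\<chi> in simp)
    then have "\<Delta> m \<chi> = \<Delta> m (\<lambda>i. \<chi> (i + N))" by blast
    also have "(\<lambda>i. \<chi> (i + N)) = (\<lambda>i. 0)" using N by auto
    also have "\<Delta> m (\<lambda>i. 0) = 0" by (simp add: \<Delta>_def)
    finally show ?thesis .
  qed
  have "\<forall>\<chi>. fin_seq \<chi> \<longrightarrow> \<Delta> m \<chi> = 0"
  proof (induction m rule: int_induct[of _ 0])
    case base
    show ?case by (simp add: \<Delta>_def binom_sum_0)
  next
    case (step1 i)
    then show ?case using up by blast
  next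
    case (step2 i)
    then show ?case using down[of "i - 1"] by simp
  qed
  then show ?thesis using assms by (simp add: \<Delta>_def)
qed

section \<open>Fields and the Borcherds products\<close>

definition is_field :: "(int \<Rightarrow> 'w \<Rightarrow> 'w) \<Rightarrow> bool" where
  "is_field U \<longleftrightarrow> (\<forall>n. lin (U n)) \<and> (\<forall>w. \<exists>N. \<forall>n\<ge>N. U n w = 0)"

lemma field_lin: "is_field U \<Longrightarrow> lin (U n)"
  by (simp add: is_field_def)

lemma field_simps_lin:
  assumes "is_field U"
  shows "U n (x + y) = U n x + U n y" "U n (x - y) = U n x - U n y" "U n 0 = 0" "U n (- x) = - U n x"
    "U n (c *s x) = c *s U n x" "U n (sum g A) = (\<Sum>a\<in>A. U n (g a))"
  using linear_additive[OF field_lin[OF assms]] by auto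

lemma field_bound:
  "is_field U \<Longrightarrow> \<exists>N. \<forall>n\<ge>N. U n w = 0"
  by (auto simp: is_field_def)

lemma field_fin: "is_field U \<Longrightarrow> fin_seq (\<lambda>i. U (q + int i) w)"
proof -
  assume "is_field U"
  then obtain N where "\<forall>n\<ge>N. U n w = 0" using field_bound by blast
  then show ?thesis by (intro fin_seqI[of "nat (N - q)"]) auto
qed

text \<open>The coefficients of \<open>(x\<^sub>1 - x\<^sub>2)\<^sup>n U(x\<^sub>1) V(x\<^sub>2) - (-x\<^sub>2 + x\<^sub>1)\<^sup>n V(x\<^sub>2) U(x\<^sub>1)\<close>.\<close>

definition borch :: "(int \<Rightarrow> 'w \<Rightarrow> 'w) \<Rightarrow> (int \<Rightarrow> 'w \<Rightarrow> 'w) \<Rightarrow> 'w \<Rightarrow> int \<Rightarrow> int \<times> int \<Rightarrow> 'w" where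
  "borch U V w n = (\<lambda>(p, q).
     binom_sum n (\<lambda>i. U (p + n - int i) (V (q + int i) w)) -
     (-1) powi n *s binom_sum n (\<lambda>i. V (q + n - int i) (U (p + int i) w)))"

lemma borch_fin:
  assumes "is_field U" "is_field V"
  shows "fin_seq (\<lambda>i. U (p - int i) (V (q + int i) w))"
proof -
  from assms(2) obtain N where "\<And>i. i \<ge> N \<Longrightarrow> V (q + int i) w = 0"
    using field_fin[of V q w] by (auto simp: fin_seq_def)
  then show ?thesis by (intro fin_seqI[of N]) (simp add: field_simps_lin(3)[OF assms(1)])
qed

lemma borch_0: "borch U V w 0 = (\<lambda>(p, q). U p (V q w) - V q (U p w))"
  by (simp add: borch_def binom_sum_0)

lemma minus_one_powi_Suc: "(-1 :: complex) powi (n + 1) = - ((-1) powi n)"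
  by (simp add: power_int_add)

text \<open>Both expansions of (x1 - x2)^n are compatible with multiplication by x1 - x2; in the
  second summand the sign (-1)^n changes along with n.\<close>

lemma borch_Suc:
  assumes "is_field U" "is_field V"
  shows "borch U V w (n + 1) = (mon (1, 0) - mon (0, 1)) \<star> borch U V w n"
proof
  fix e :: "int \<times> int"
  obtain p q where e: "e = (p, q)" by (cases e)
  have 1: "binom_sum (n + 1) (\<lambda>i. U (p + (n + 1) - int i) (V (q + int i) w)) =
      binom_sum n (\<lambda>i. U (p + 1 + n - int i) (V (q + int i) w)) -
      binom_sum n (\<lambda>i. U (p + n - int i) (V (q + 1 + int i) w))"
    using binom_sum_Suc[OF borch_fin[OF assms, of "p + (n + 1)" q w], of n] by (simp add: algebra_simps)
  have 2: "binom_sum (n + 1) (\<lambda>i. V (q + (n + 1) - int i) (U (p + int i) w)) =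
      binom_sum n (\<lambda>i. V (q + 1 + n - int i) (U (p + int i) w)) -
      binom_sum n (\<lambda>i. V (q + n - int i) (U (p + 1 + int i) w))"
    using binom_sum_Suc[OF borch_fin[OF assms(2,1), of "q + (n + 1)" p w], of n] by (simp add: algebra_simps)
  show "borch U V w (n + 1) e = ((mon (1, 0) - mon (0, 1)) \<star> borch U V w n) e"
    unfolding e borch_def prod.case 1 2 minus_one_powi_Suc
    by (simp add: scale_right_diff_distrib)
qed

lemma borch_add_nat:
  assumes "is_field U" "is_field V"
  shows "borch U V w (n + int M) = (mon (1, 0) - mon (0, 1)) ^ M \<star> borch U V w n"
proof (induction M)
  case (Suc M)
  have "borch U V w (n + int (Suc M)) = borch U V w ((n + int M) + 1)" by (simp add: algebra_simps)
  then show ?case using Suc by (simp only: borch_Suc[OF assms] power_Suc act_mult)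
qed simp

lemma borch_trunc:
  assumes "is_field U" "is_field V"
  shows "\<exists>N. \<forall>q\<ge>N. borch U V w n (p, q) = 0"
proof -
  obtain N1 where N1: "\<forall>n\<ge>N1. V n w = 0" using field_bound[OF assms(2)] by blast
  obtain N2 where N2: "\<forall>n\<ge>N2. U n w = 0" using field_bound[OF assms(1)] by blast
  \<comment> \<open>For fixed p only the indices i < K contribute to the second sum, whatever q is,
    so finitely many truncation bounds of V suffice.\<close>
  define K where "K = nat (N2 - p)"
  have "\<exists>N. \<forall>q\<ge>N. \<forall>i<K. V (q + n - int i) (U (p + int i) w) = 0" for K :: nat
  proof (induction K)
    case (Suc K)
    then obtain N where N: "\<forall>q\<ge>N. \<forall>i<K. V (q + n - int i) (U (p + int i) w) = 0" by blast
    obtain N' where N': "\<forall>m\<ge>N'. V m (U (p + int K) w) = 0" using field_bound[OF assms(2)] by blast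
    show ?case
      by (rule exI[of _ "max N (N' - n + int K)"]) (use N N' in \<open>auto simp: less_Suc_eq\<close>)
  qed simp
  then obtain N3 where N3: "\<forall>q\<ge>N3. \<forall>i<K. V (q + n - int i) (U (p + int i) w) = 0" by blast
  have "borch U V w n (p, q) = 0" if "q \<ge> max N1 N3" for q
  proof -
    have a: "V (q + n - int i) (U (p + int i) w) = 0" for i
    proof (cases "i < K")
      case False
      then have "N2 \<le> p + int i" by (simp add: K_def)
      then have "U (p + int i) w = 0" using N2 by blast
      then show ?thesis using field_simps_lin(3)[OF assms(2)] by simp
    qed (use N3 that in auto)
    show ?thesis using that N1 field_simps_lin(3)[OF assms(1)] by (simp add: borch_def a)
  qed
  then show ?thesis by blast
qed

lemma lin_binom_sum:
  assumes "\<And>i. lin (f i)" "\<And>w. fin_seq (\<lambda>i. f i w)"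
  shows "lin (\<lambda>w. binom_sum n (\<lambda>i. f i w))"
proof (rule linI)
  fix x y c
  show "binom_sum n (\<lambda>i. f i (x + y)) = binom_sum n (\<lambda>i. f i x) + binom_sum n (\<lambda>i. f i y)"
    using assms(2) by (simp add: linear_additive[OF assms(1)] binom_sum_add)
  show "binom_sum n (\<lambda>i. f i (c *s x)) = c *s binom_sum n (\<lambda>i. f i x)"
    using assms(2) by (simp add: linear_additive[OF assms(1)] binom_sum_scale)
qed

lemma lin_add: "lin f \<Longrightarrow> lin g \<Longrightarrow> lin (\<lambda>w. f w + g w)"
  by (rule linI) (simp_all add: linear_additive scale_right_distrib)

lemma lin_diff: "lin f \<Longrightarrow> lin g \<Longrightarrow> lin (\<lambda>w. f w - g w)"
  by (rule linI) (simp_all add: linear_additive scale_right_diff_distrib)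

lemma lin_scaled: "lin f \<Longrightarrow> lin (\<lambda>w. c *s f w)"
  by (rule linI) (simp_all add: linear_additive scale_right_distrib mult.commute)

lemma lin_comp: "lin f \<Longrightarrow> lin g \<Longrightarrow> lin (\<lambda>w. f (g w))"
  by (rule linI) (simp_all add: linear_additive)

lemma lin_zero: "lin (\<lambda>w. 0)"
  by (rule linI) simp_all

lemma lin_sum: "(\<And>a. a \<in> A \<Longrightarrow> lin (f a)) \<Longrightarrow> lin (\<lambda>w. \<Sum>a\<in>A. f a w)"
  by (induction A rule: infinite_finite_induct) (auto intro: lin_zero lin_add)

lemma borch_lin:
  assumes "is_field U" "is_field V"
  shows "lin (\<lambda>w. borch U V w n (p, q))"
  unfolding borch_def prod.case
  by (intro lin_diff lin_scaled lin_binom_sum lin_comp[OF field_lin field_lin] borch_fin assms)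

lemma borch_add_left:
  assumes "is_field U" "is_field U'" "is_field V"
  shows "borch (U + U') V w n = borch U V w n + borch U' V w n"
  using assms
  by (auto simp: borch_def fun_eq_iff binom_sum_add borch_fin field_simps_lin scale_right_distrib)

lemma borch_scale_left:
  assumes "is_field U" "is_field V"
  shows "borch (\<lambda>n w. c *s U n w) V w n = (\<lambda>e. c *s borch U V w n e)"
  using assms
  by (auto simp: borch_def fun_eq_iff binom_sum_scale borch_fin field_simps_lin scale_right_diff_distrib mult.commute)

lemma borch_add_right:
  assumes "is_field U" "is_field V" "is_field V'"
  shows "borch U (V + V') w n = borch U V w n + borch U V' w n"
  using assms
  by (auto simp: borch_def fun_eq_iff binom_sum_add borch_fin field_simps_lin scale_right_distrib)

lemma borch_scale_right:
  assumes "is_field U" "is_field V"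
  shows "borch U (\<lambda>n w. c *s V n w) w n = (\<lambda>e. c *s borch U V w n e)"
  using assms
  by (auto simp: borch_def fun_eq_iff binom_sum_scale borch_fin field_simps_lin scale_right_diff_distrib mult.commute)

lemma field_add:
  assumes "is_field U" "is_field V"
  shows "is_field (U + V)"
  unfolding is_field_def
proof (intro conjI allI)
  fix n
  show "lin ((U + V) n)"
    using lin_add[OF field_lin[OF assms(1)] field_lin[OF assms(2)], of n n] by (simp add: plus_fun_def)
next
  fix w
  obtain M N where "\<forall>n\<ge>M. U n w = 0" "\<forall>n\<ge>N. V n w = 0"
    using field_bound[OF assms(1)] field_bound[OF assms(2)] by blast
  then show "\<exists>N. \<forall>n\<ge>N. (U + V) n w = 0" by (intro exI[of _ "max M N"]) auto
qed

lemma field_scale: "is_field U \<Longrightarrow> is_field (\<lambda>n w. c *s U n w)"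
  unfolding is_field_def by (auto intro: lin_scaled) (metis scale_zero_right)

lemma field_zero: "is_field 0"
  unfolding is_field_def by (simp add: zero_fun_def lin_zero)

definition id_field :: "int \<Rightarrow> 'w \<Rightarrow> 'w" where
  "id_field n w = (if n = -1 then w else 0)"

lemma field_id: "is_field id_field"
  unfolding is_field_def
proof (intro conjI allI)
  show "\<exists>N. \<forall>n\<ge>N. id_field n w = 0" for w
    by (rule exI[of _ 0]) (simp add: id_field_def)
qed (rule linI; simp add: id_field_def)

end

section \<open>Evaluation of polynomials along a homomorphism of coefficient rings\<close>

locale coeff_hom =
  fixes c :: "'a::comm_ring_1 \<Rightarrow> 'r::comm_ring_1"
  assumes c_add: "c (a + b) = c a + c b" and c_mult: "c (a * b) = c a * c b" and c_one: "c 1 = 1"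
begin

lemma c_zero: "c 0 = 0"
  using c_add[of 0 0] by simp

lemma c_sum: "c (sum f A) = (\<Sum>a\<in>A. c (f a))"
  by (induction A rule: infinite_finite_induct) (auto simp: c_zero c_add)

text \<open>There are two instances: constants give \<open>pev\<close>, which substitutes a Laurent
  polynomial into a complex polynomial, and \<open>pev (mon (0, 1))\<close> gives
  \<open>bev\<close>, which evaluates elements of C[x2][x1].\<close>

definition ev :: "'r \<Rightarrow> 'a poly \<Rightarrow> 'r" where
  "ev r P = poly (map_poly c P) r"

lemma ev_pCons: "ev r (pCons a P) = c a + r * ev r P"
  by (cases "a = 0 \<and> P = 0") (auto simp: ev_def map_poly_pCons c_zero)

lemma ev_0 [simp]: "ev r 0 = 0"
  by (simp add: ev_def)

lemma ev_1 [simp]: "ev r 1 = 1"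
  by (simp add: one_pCons ev_pCons c_one)

lemma ev_add: "ev r (P + Q) = ev r P + ev r Q"
proof -
  have "map_poly c (P + Q) = map_poly c P + map_poly c Q"
    by (rule poly_eqI) (simp add: coeff_map_poly c_zero c_add)
  then show ?thesis by (simp add: ev_def)
qed

lemma ev_mult: "ev r (P * Q) = ev r P * ev r Q"
proof -
  have "map_poly c (P * Q) = map_poly c P * map_poly c Q"
    by (rule poly_eqI) (simp add: coeff_map_poly c_zero coeff_mult c_sum c_mult)
  then show ?thesis by (simp add: ev_def)
qed

lemma ev_uminus: "ev r (- P) = - ev r P"
  using ev_add[of r "- P" P] by (simp add: eq_neg_iff_add_eq_0)

lemma ev_diff: "ev r (P - Q) = ev r P - ev r Q"
  using ev_add[of r P "- Q"] by (simp add: ev_uminus)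

lemma ev_power: "ev r (P ^ n) = ev r P ^ n"
  by (induction n) (auto simp: ev_mult)

lemma ev_sum: "ev r (sum f A) = (\<Sum>a\<in>A. ev r (f a))"
  by (induction A rule: infinite_finite_induct) (auto simp: ev_add)

lemma ev_const: "ev r [:a:] = c a"
  by (simp add: ev_pCons)

lemma ev_smult: "ev r (smult a P) = c a * ev r P"
  using ev_mult[of r "[:a:]" P] by (simp add: ev_const)

lemma ev_X: "ev r [:0, 1:] = r"
  by (simp add: ev_pCons c_one c_zero)

lemma ev_monom_1: "ev r (monom 1 n) = r ^ n"
  by (induction n) (auto simp: monom_0 ev_const c_one monom_Suc ev_pCons c_zero)

lemma ev_dvd: "P dvd Q \<Longrightarrow> ev r P dvd ev r Q"
  by (auto simp: dvd_def ev_mult)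

lemma ev_altdef: "ev r P = (\<Sum>i\<le>degree P. c (coeff P i) * r ^ i)"
proof -
  have "ev r P = ev r (\<Sum>i\<le>degree P. smult (coeff P i) (monom 1 i))"
    by (simp add: smult_monom poly_as_sum_of_monoms)
  then show ?thesis by (simp add: ev_sum ev_smult ev_monom_1)
qed

end

global_interpretation const: coeff_hom "const :: complex \<Rightarrow> 'e::comm_monoid_add \<Rightarrow>\<^sub>0 complex"
  defines pev = const.ev
  by unfold_locales (auto simp: single_add mult_single)

lemmas pev_simps = const.ev_add const.ev_mult const.ev_diff const.ev_power const.ev_smult
  const.ev_X const.ev_monom_1

context complex_space
begin

lemma act_pev: "(pev (mon \<rho>) P \<star> \<Phi>) e = (\<Sum>i\<le>degree P. coeff P i *s \<Phi> (e + nmul i \<rho>))"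
proof -
  have "((\<Sum>i\<in>I. Poly_Mapping.single (f i) (c i)) \<star> \<Phi>) e = (\<Sum>i\<in>I. c i *s \<Phi> (e + f i))"
    if "finite I" for I :: "nat set" and f c
    using that by (induction I rule: finite_induct) auto
  from this[of "{..degree P}" "\<lambda>i. nmul i \<rho>" "coeff P"] show ?thesis
    by (simp add: const.ev_altdef mon_power mult_single)
qed

end

section \<open>Quasi-local fields and their n-th products\<close>

locale cyclic_space = complex_space scale
  for scale :: "complex \<Rightarrow> 'w::ab_group_add \<Rightarrow> 'w" (infixr \<open>*s\<close> 75) +
  fixes T :: nat
  assumes T_pos: "T > 0"
begin

text \<open>This is (x^T - 1) / (T (x - 1)). Its roots are the T-th roots of unity other than 1, and
  the factor 1 / T normalizes its value at 1 to 1.\<close>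

definition hpol :: "complex poly" where
  "hpol = smult (1 / of_nat T) (\<Sum>i<T. monom 1 i)"

text \<open>As a function of \<open>x\<^sub>1 / x\<^sub>2\<close> this is 1 modulo high powers of \<open>x\<^sub>1 - x\<^sub>2\<close> and vanishes to
  high order along \<open>x\<^sub>1 = \<zeta> x\<^sub>2\<close> for the \<open>T\<close>-th roots of unity \<open>\<zeta> \<noteq> 1\<close>.\<close>

definition gpol :: "nat \<Rightarrow> nat \<Rightarrow> complex poly" where
  "gpol k M = 1 - (1 - hpol ^ k) ^ M"

lemma hpol_mult: "[:-1, 1:] * hpol = smult (1 / of_nat T) (monom 1 T - 1)"
proof -
  have "[:0, 1:] ^ T - 1 = ([:0, 1:] - 1 :: complex poly) * (\<Sum>i<T. [:0, 1:] ^ i)"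
    by (rule power_diff_1_eq)
  moreover have "[:0, 1:] - 1 = ([:-1, 1:] :: complex poly)" by (simp add: one_pCons)
  moreover have "[:0, 1:] ^ i = (monom 1 i :: complex poly)" for i
    by (simp add: monom_altdef)
  ultimately show ?thesis by (simp add: hpol_def)
qed

lemma poly_hpol_1: "poly hpol 1 = 1"
  using T_pos by (simp add: hpol_def poly_sum poly_monom)

lemma one_minus_dvd: "[:-1, 1:] dvd 1 - hpol ^ k"
  by (simp add: poly_eq_0_iff_dvd[symmetric] poly_hpol_1)

text \<open>Since \<open>hpol\<close> is 1 at 1, 1 - hpol^k is divisible by x - 1, and 1 - gpol is
  its M-th power. Together with \<open>hpol_dvd_gpol\<close> this solves explicitly the Chinese
  remainder problem posed by the kernel.\<close>

lemma gpol_dvd: "[:-1, 1:] ^ M dvd 1 - gpol k M"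
  by (simp add: gpol_def dvd_power_same one_minus_dvd)

lemma hpol_dvd_gpol: "hpol ^ k dvd gpol k M"
proof -
  have "1 - (1 - hpol ^ k) dvd 1 ^ M - (1 - hpol ^ k) ^ M"
    unfolding power_diff_sumr2 by (rule dvd_triv_left)
  then show ?thesis by (simp add: gpol_def)
qed

text \<open>The condition (x1^T - x2^T)^k [U(x1), V(x2)] = 0 in expanded form, ready to be moved
  through linear operators; \<open>quasi_local_act\<close> is the same condition in operator
  notation.\<close>

definition quasi_local :: "nat \<Rightarrow> (int \<Rightarrow> 'w \<Rightarrow> 'w) \<Rightarrow> (int \<Rightarrow> 'w \<Rightarrow> 'w) \<Rightarrow> bool" where
  "quasi_local k U V \<longleftrightarrow> (\<forall>w p q. (\<Sum>i\<le>k. ((-1) ^ i * of_nat (k choose i)) *s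
     (U (p + int (k - i) * int T) (V (q + int i * int T) w) -
      V (q + int i * int T) (U (p + int (k - i) * int T) w))) = 0)"

lemma quasi_local_act:
  "quasi_local k U V \<longleftrightarrow>
   (\<forall>w. (mon (1, 0) ^ T - mon (0, 1) ^ T) ^ k \<star> (\<lambda>(p, q). U p (V q w) - V q (U p w)) = 0)"
  unfolding quasi_local_def fun_eq_iff mon_power act_binomial
  by (simp add: zero_prod_def)

lemma quasi_local_mono:
  assumes "quasi_local k U V" "k \<le> k'"
  shows "quasi_local k' U V"
  using assms act_dvd_eq_0[OF _ le_imp_power_dvd[OF assms(2)]] unfolding quasi_local_act by blast

text \<open>Exchanging the variables changes (x1^T - x2^T)^k only by the sign (-1)^k, which the
  reindexing i \<mapsto> k - i produces.\<close>

lemma quasi_local_sym: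
  assumes "quasi_local k U V"
  shows "quasi_local k V U"
  unfolding quasi_local_def
proof (intro allI)
  fix w p q
  have "(\<Sum>i\<le>k. ((-1) ^ i * of_nat (k choose i)) *s
     (V (p + int (k - i) * int T) (U (q + int i * int T) w) -
      U (q + int i * int T) (V (p + int (k - i) * int T) w))) =
    (\<Sum>i\<le>k. ((-1) ^ (k - i) * of_nat (k choose (k - i))) *s
     (V (p + int i * int T) (U (q + int (k - i) * int T) w) -
      U (q + int (k - i) * int T) (V (p + int i * int T) w)))"
    by (rule sum.reindex_bij_witness[of _ "\<lambda>i. k - i" "\<lambda>i. k - i"]) auto
  also have "\<dots> = (\<Sum>i\<le>k. (- ((-1) ^ k)) *s ((-1) ^ i * of_nat (k choose i)) *s
     (U (q + int (k - i) * int T) (V (p + int i * int T) w) -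
      V (p + int i * int T) (U (q + int (k - i) * int T) w)))"
  proof (intro sum.cong refl)
    fix i assume "i \<in> {..k}"
    then have k: "k = (k - i) + i" by simp
    have "(-1 :: complex) ^ k * (-1) ^ i = (-1) ^ (k - i) * ((-1) ^ i * (-1) ^ i)"
      by (subst k) (simp only: power_add mult.assoc)
    then have "(-1 :: complex) ^ (k - i) = (-1) ^ k * (-1) ^ i" by simp
    moreover have "k choose (k - i) = k choose i"
      using \<open>i \<in> {..k}\<close> by (simp add: binomial_symmetric[of i])
    ultimately show "((-1) ^ (k - i) * of_nat (k choose (k - i))) *s
       (V (p + int i * int T) (U (q + int (k - i) * int T) w) -
        U (q + int (k - i) * int T) (V (p + int i * int T) w)) =
      (- ((-1) ^ k)) *s ((-1) ^ i * of_nat (k choose i)) *s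
       (U (q + int (k - i) * int T) (V (p + int i * int T) w) -
        V (p + int i * int T) (U (q + int (k - i) * int T) w))"
      by (simp add: scale_right_diff_distrib mult_ac)
  qed
  also have "\<dots> = 0"
    unfolding scale_sum_right[symmetric] using assms by (simp add: quasi_local_def)
  finally show "(\<Sum>i\<le>k. ((-1) ^ i * of_nat (k choose i)) *s
     (V (p + int (k - i) * int T) (U (q + int i * int T) w) -
      U (q + int i * int T) (V (p + int (k - i) * int T) w))) = 0" .
qed

lemma quasi_local_add_right:
  assumes "quasi_local k U V" "quasi_local k' U V'" "is_field U"
  shows "quasi_local (max k k') U (V + V')"
proof -
  have "quasi_local (max k k') U V" "quasi_local (max k k') U V'"
    using assms quasi_local_mono by auto
  then have "(mon (1, 0) ^ T - mon (0, 1) ^ T) ^ max k k' \<star>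
      ((\<lambda>(p, q). U p (V q w) - V q (U p w)) + (\<lambda>(p, q). U p (V' q w) - V' q (U p w))) = 0" for w
    unfolding quasi_local_act by (simp only: act_add_right) simp
  moreover have "(\<lambda>(p, q). U p (V q w) - V q (U p w)) + (\<lambda>(p, q). U p (V' q w) - V' q (U p w))
     = (\<lambda>(p, q). U p ((V + V') q w) - (V + V') q (U p w))" for w
    by (auto simp: fun_eq_iff field_simps_lin[OF assms(3)])
  ultimately show ?thesis unfolding quasi_local_act by simp
qed

lemma quasi_local_scale_right:
  assumes "quasi_local k U V" "is_field U"
  shows "quasi_local k U (\<lambda>n w. c *s V n w)"
proof -
  have "(\<lambda>(p, q). U p (c *s V q w) - c *s V q (U p w)) = (\<lambda>e. c *s (\<lambda>(p, q). U p (V q w) - V q (U p w)) e)" for w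
    by (auto simp: fun_eq_iff field_simps_lin[OF assms(2)] scale_right_diff_distrib)
  then show ?thesis using assms(1) unfolding quasi_local_act by (simp add: act_scale_right zero_fun_def)
qed

lemma quasi_local_id: "is_field U \<Longrightarrow> quasi_local 0 U id_field"
  by (auto simp: quasi_local_def id_field_def field_simps_lin)

lemma quasi_local_zero: "is_field U \<Longrightarrow> quasi_local 0 U 0"
  by (auto simp: quasi_local_def field_simps_lin)

end

lemma pev_linear: "pev r [:-1, 1:] = r - 1"
  by (simp add: const.ev_pCons single_uminus)

context cyclic_space
begin

abbreviation xx :: "int \<times> int \<Rightarrow>\<^sub>0 complex" where "xx \<equiv> mon (1, 0)"
abbreviation yy :: "int \<times> int \<Rightarrow>\<^sub>0 complex" where "yy \<equiv> mon (0, 1)"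
abbreviation rr :: "int \<times> int \<Rightarrow>\<^sub>0 complex" where "rr \<equiv> mon (1, -1)"

text \<open>With z = x / y, the equation (z - 1) hpol(z) = (z^T - 1) / T becomes a relation between
  x - y and x^T - y^T after clearing denominators. It trades k factors \<open>hpol\<close> and k
  factors x1 - x2 for the polynomial of quasi-locality.\<close>

lemma hpol_unit:
  fixes x y y' :: "'e::comm_monoid_add \<Rightarrow>\<^sub>0 complex"
  assumes "y' * y = 1"
  shows "pev (x * y') (hpol ^ k) * (x - y) ^ k = (const (1 / of_nat T) * y * y' ^ T) ^ k * (x ^ T - y ^ T) ^ k"
proof -
  have "pev (x * y') hpol * (x - y) = y * pev (x * y') ([:-1, 1:] * hpol)"
  proof -
    have "y * (x * y') = x" using assms by (metis mult.assoc mult.commute mult_1)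
    then have "y * (x * y' - 1) = x - y" by (simp add: right_diff_distrib)
    show ?thesis by (simp only: const.ev_mult pev_linear flip: \<open>y * (x * y' - 1) = x - y\<close>) (simp only: mult_ac)
  qed
  also have "\<dots> = y * (const (1 / of_nat T) * ((x * y') ^ T - 1))"
    by (simp only: hpol_mult pev_simps const.ev_1)
  also have "(x * y') ^ T - 1 = y' ^ T * (x ^ T - y ^ T)"
  proof -
    have "y' ^ T * y ^ T = 1" using assms by (simp add: power_mult_distrib[symmetric])
    then show ?thesis by (simp add: power_mult_distrib algebra_simps)
  qed
  finally have "pev (x * y') hpol * (x - y) = (const (1 / of_nat T) * y * y' ^ T) * (x ^ T - y ^ T)"
    by (simp add: mult_ac)
  then show ?thesis by (simp only: pev_simps power_mult_distrib[symmetric])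
qed

lemma borch_local:
  assumes "is_field U" "is_field V" "quasi_local k U V" "n \<ge> 0"
  shows "(xx ^ T - yy ^ T) ^ k \<star> borch U V w n = 0"
proof -
  have "borch U V w n = (xx - yy) ^ nat n \<star> borch U V w 0"
    using borch_add_nat[OF assms(1,2), of w 0 "nat n"] assms(4) by simp
  moreover have "(xx ^ T - yy ^ T) ^ k \<star> borch U V w 0 = 0"
    using assms(3) unfolding quasi_local_act borch_0 by blast
  ultimately show ?thesis by (simp add: act_commute[of _ "(xx - yy) ^ nat n"])
qed

text \<open>The factor (x1 / x2 - 1)^M raises the exponent from n to n + M \<ge> k. Of the factors
  x1 - x2 now available, k combine with hpol^k into (x1^T - x2^T)^k; the remaining exponent is
  nonnegative, where quasi-locality applies.\<close>

lemma borch_kill: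
  assumes "is_field U" "is_field V" "quasi_local k U V" "n + int M \<ge> int k"
    and "hpol ^ k * [:-1, 1:] ^ M dvd P"
  shows "pev rr P \<star> borch U V w n = 0"
proof -
  have yy: "mon (0, -1) * yy = 1" by (simp add: mult_single zero_prod_def[symmetric])
  have rr: "rr = xx * mon (0, -1)" by (simp add: mult_single)
  define n' where "n' = n + int M - int k"
  have n': "n + int M = n' + int k" "n' \<ge> 0" using assms(4) by (auto simp: n'_def)
  have "rr - 1 = mon (0, -1) * (xx - yy)" using yy by (simp add: rr algebra_simps)
  then have "pev rr (hpol ^ k * [:-1, 1:] ^ M) = mon (0, -1) ^ M * pev rr (hpol ^ k) * (xx - yy) ^ M"
    by (simp only: pev_simps pev_linear power_mult_distrib) (simp add: mult_ac)
  then have "pev rr (hpol ^ k * [:-1, 1:] ^ M) \<star> borch U V w n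
    = (mon (0, -1) ^ M * pev rr (hpol ^ k)) \<star> borch U V w (n' + int k)"
    using n'(1) by (simp only: act_mult borch_add_nat[OF assms(1,2), of w n M, symmetric])
  also have "\<dots> = (mon (0, -1) ^ M * (pev rr (hpol ^ k) * (xx - yy) ^ k)) \<star> borch U V w n'"
    by (simp only: act_mult borch_add_nat[OF assms(1,2), of w n' k])
  also have "\<dots> = 0"
    unfolding rr hpol_unit[OF yy] mult.assoc[symmetric]
    by (intro act_mult_eq_0 borch_local assms n')
  finally show ?thesis
    using act_dvd_eq_0 const.ev_dvd[OF assms(5)] by blast
qed

text \<open>G - G' = G (1 - G') - G' (1 - G), and in each product one factor supplies hpol^k and the
  other a sufficient power of x - 1.\<close>

lemma kernel_unique_aux:
  assumes "is_field U" "is_field V" "quasi_local k U V" "k \<le> k'"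
    and "n + int M \<ge> int k" "hpol ^ k dvd G" "[:-1, 1:] ^ M dvd 1 - G"
    and "n + int M' \<ge> int k'" "hpol ^ k' dvd G'" "[:-1, 1:] ^ M' dvd 1 - G'"
  shows "pev rr G \<star> borch U V w n = pev rr G' \<star> borch U V w n"
proof -
  have "hpol ^ k dvd G'" using assms(4,9) le_imp_power_dvd dvd_trans by blast
  then have "hpol ^ k * [:-1, 1:] ^ M dvd G' * (1 - G)" using assms(7) by (rule mult_dvd_mono)
  then have 1: "pev rr (G' * (1 - G)) \<star> borch U V w n = 0"
    by (rule borch_kill[OF assms(1-3,5)])
  have "hpol ^ k * [:-1, 1:] ^ M' dvd G * (1 - G')" using assms(6,10) by (rule mult_dvd_mono)
  then have 2: "pev rr (G * (1 - G')) \<star> borch U V w n = 0"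
    using assms(4,8) by (intro borch_kill[OF assms(1-3)]) auto
  have "G - G' = G * (1 - G') - G' * (1 - G)" by (simp add: algebra_simps)
  then have "pev rr (G - G') \<star> borch U V w n = 0" using 1 2 by (simp add: const.ev_diff)
  then show ?thesis by (simp add: const.ev_diff)
qed

lemma kernel_unique:
  assumes "is_field U" "is_field V" "quasi_local k U V" "quasi_local k' U V"
    and "n + int M \<ge> int k" "hpol ^ k dvd G" "[:-1, 1:] ^ M dvd 1 - G"
    and "n + int M' \<ge> int k'" "hpol ^ k' dvd G'" "[:-1, 1:] ^ M' dvd 1 - G'"
  shows "pev rr G \<star> borch U V w n = pev rr G' \<star> borch U V w n"
proof (cases "k \<le> k'")
  case True
  then show ?thesis using kernel_unique_aux[OF assms(1-3) True assms(5-)] by simp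
next
  case False
  then show ?thesis using kernel_unique_aux[OF assms(1,2,4) _ assms(8-10) assms(5-7)] by simp
qed

text \<open>The \<open>n\<close>-th product of two quasi-local fields, as the residue of \<open>(x\<^sub>1 - x\<^sub>2)\<^sup>n U(x\<^sub>1) V(x\<^sub>2)\<close>
  at \<open>x\<^sub>1 = x\<^sub>2\<close>: the kernel \<^const>\<open>gpol\<close> removes the residues at the other roots of unity.\<close>

definition nprod :: "(int \<Rightarrow> 'w \<Rightarrow> 'w) \<Rightarrow> (int \<Rightarrow> 'w \<Rightarrow> 'w) \<Rightarrow> int \<Rightarrow> int \<Rightarrow> 'w \<Rightarrow> 'w" where
  "nprod U V n q w = (let k = LEAST k. quasi_local k U V in
     (pev rr (gpol k (nat (int k - n))) \<star> borch U V w n) (0, q))"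

text \<open>Any polynomial with the right behaviour at the roots of unity computes the product. The
  \<open>LEAST\<close> in the definition thereby disappears, and products of different pairs of
  fields can be computed with one common kernel.\<close>

lemma nprod_kernel:
  assumes "is_field U" "is_field V" "quasi_local k U V"
    and "n + int M \<ge> int k" "hpol ^ k dvd G" "[:-1, 1:] ^ M dvd 1 - G"
  shows "nprod U V n q w = (pev rr G \<star> borch U V w n) (0, q)"
proof -
  define k' where "k' = (LEAST k. quasi_local k U V)"
  have "quasi_local k' U V" unfolding k'_def using assms(3) by (rule LeastI)
  then have "pev rr (gpol k' (nat (int k' - n))) \<star> borch U V w n = pev rr G \<star> borch U V w n"
    using assms by (intro kernel_unique[of U V k' k n "nat (int k' - n)" _ M])
      (auto simp: hpol_dvd_gpol gpol_dvd)
  then show ?thesis by (simp add: nprod_def k'_def[symmetric])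
qed

lemma nprod_eq:
  assumes "is_field U" "is_field V" "quasi_local k U V" "n + int M \<ge> int k"
  shows "nprod U V n q w = (pev rr (gpol k M) \<star> borch U V w n) (0, q)"
  by (rule nprod_kernel[OF assms]) (auto simp: hpol_dvd_gpol gpol_dvd)

lemma nprod_large:
  assumes "is_field U" "is_field V" "quasi_local k U V" "n \<ge> int k"
  shows "nprod U V n q w = 0"
proof -
  \<comment> \<open>For n \<ge> k the value M = 0 is admissible, so 1 - G need not vanish at 1 and G
    = 0 is a legitimate kernel.\<close>
  have "nprod U V n q w = (pev rr 0 \<star> borch U V w n) (0, q)"
    using assms(4) by (intro nprod_kernel[OF assms(1-3), of n 0]) auto
  then show ?thesis by simp
qed

lemma field_nprod:
  assumes "is_field U" "is_field V" "quasi_local k U V"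
  shows "is_field (nprod U V n)"
proof -
  define G where "G = gpol k (nat (int k - n))"
  have eq: "nprod U V n q w = (\<Sum>i\<le>degree G. coeff G i *s borch U V w n (int i, q - int i))" for q w
    unfolding G_def by (subst nprod_eq[OF assms, of n "nat (int k - n)"]) (auto simp: act_pev)
  show ?thesis
    unfolding is_field_def
  proof (intro conjI allI)
    fix q
    show "lin (nprod U V n q)"
      unfolding eq[abs_def] by (intro lin_sum lin_scaled borch_lin assms)
  next
    fix w
    have "\<exists>N. \<forall>q\<ge>N. \<forall>i\<le>d. borch U V w n (int i, q - int i) = 0" for d
    proof (induction d)
      case 0
      then show ?case using borch_trunc[OF assms(1,2), of w n 0] by simp
    next
      case (Suc d)
      then obtain N where N: "\<forall>q\<ge>N. \<forall>i\<le>d. borch U V w n (int i, q - int i) = 0" by blast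
      obtain N' where N': "\<forall>q\<ge>N'. borch U V w n (int (Suc d), q) = 0"
        using borch_trunc[OF assms(1,2), of w n "int (Suc d)"] by blast
      have "\<forall>q\<ge>max N (N' + int (Suc d)). \<forall>i\<le>Suc d. borch U V w n (int i, q - int i) = 0"
        using N N' by (auto simp: le_Suc_eq)
      then show ?case by blast
    qed
    then obtain N where "\<forall>q\<ge>N. \<forall>i\<le>degree G. borch U V w n (int i, q - int i) = 0" by blast
    then show "\<exists>N. \<forall>q\<ge>N. nprod U V n q w = 0"
      by (intro exI[of _ N]) (simp add: eq)
  qed
qed

lemma nprod_add_right:
  assumes "is_field U" "is_field V" "is_field V'" "quasi_local k U V" "quasi_local k' U V'"
  shows "nprod U (V + V') n = nprod U V n + nprod U V' n"
proof (intro ext)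
  fix q w
  define m where "m = max k k'"
  have loc: "quasi_local m U V" "quasi_local m U V'" "quasi_local m U (V + V')"
    using assms quasi_local_mono quasi_local_add_right unfolding m_def by auto
  show "nprod U (V + V') n q w = (nprod U V n + nprod U V' n) q w"
    using assms loc
    by (simp add: nprod_eq[where k = m and M = "nat (int m - n)"] field_add borch_add_right)
qed

lemma nprod_scale_right:
  assumes "is_field U" "is_field V" "quasi_local k U V"
  shows "nprod U (\<lambda>n w. c *s V n w) n = (\<lambda>q w. c *s nprod U V n q w)"
proof (intro ext)
  fix q w
  show "nprod U (\<lambda>n w. c *s V n w) n q w = c *s nprod U V n q w"
    using assms
    by (simp add: nprod_eq[where k = k and M = "nat (int k - n)"] field_scale quasi_local_scale_right
        borch_scale_right act_scale_right)
qed

lemma nprod_add_left: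
  assumes "is_field U" "is_field U'" "is_field V" "quasi_local k U V" "quasi_local k' U' V"
  shows "nprod (U + U') V n = nprod U V n + nprod U' V n"
proof (intro ext)
  fix q w
  define m where "m = max k k'"
  have loc: "quasi_local m U V" "quasi_local m U' V" "quasi_local m (U + U') V"
    using quasi_local_mono[OF assms(4), of m] quasi_local_mono[OF assms(5), of m]
      quasi_local_sym[OF quasi_local_add_right[OF quasi_local_sym[OF assms(4)] quasi_local_sym[OF assms(5)] assms(3)]]
    unfolding m_def by auto
  show "nprod (U + U') V n q w = (nprod U V n + nprod U' V n) q w"
    using assms loc
    by (simp add: nprod_eq[where k = m and M = "nat (int m - n)"] field_add borch_add_left)
qed

lemma nprod_scale_left:
  assumes "is_field U" "is_field V" "quasi_local k U V"
  shows "nprod (\<lambda>n w. c *s U n w) V n = (\<lambda>q w. c *s nprod U V n q w)"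
proof (intro ext)
  fix q w
  have "quasi_local k (\<lambda>n w. c *s U n w) V"
    by (intro quasi_local_sym[OF quasi_local_scale_right] quasi_local_sym[OF assms(3)] assms)
  then show "nprod (\<lambda>n w. c *s U n w) V n q w = c *s nprod U V n q w"
    using assms
    by (simp add: nprod_eq[where k = k and M = "nat (int k - n)"] field_scale
        borch_scale_left act_scale_right)
qed

section \<open>The quasi Jacobi identity\<close>

text \<open>If \<open>Q n\<close> is the \<open>n\<close>-th product of two fields, these are the coefficients of the right-hand
  side of the Jacobi identity at \<open>x\<^sub>0\<^sup>-\<^sup>n\<^sup>-\<^sup>1\<close>.\<close>

definition hat :: "(int \<Rightarrow> int \<Rightarrow> 'w) \<Rightarrow> int \<Rightarrow> int \<times> int \<Rightarrow> 'w" where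
  "hat Q n = (\<lambda>(p, q). binom_sum p (\<lambda>j. (-1) ^ j *s Q (n + int j) (p + q - int j)))"

lemma hat_0: "hat Q n (0, q) = Q n q"
  by (simp add: hat_def binom_sum_0)

lemma hat_fin:
  assumes "\<And>n q. n \<ge> N \<Longrightarrow> Q n q = 0"
  shows "fin_seq (\<lambda>j. (-1) ^ j *s Q (n + int j) (m - int j))"
  by (rule fin_seqI[of "nat (N - n)"]) (simp add: assms)

text \<open>On the side of the iterate, multiplication by x1 - x2 is multiplication by x0, which
  again raises n by one.\<close>

lemma hat_Suc:
  assumes "\<And>n q. n \<ge> N \<Longrightarrow> Q n q = 0"
  shows "hat Q (n + 1) = (xx - yy) \<star> hat Q n"
proof
  fix e :: "int \<times> int"
  obtain p q where e: "e = (p, q)" by (cases e)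
  have fin: "fin_seq (\<lambda>j. (-1) ^ j *s Q (n + 1 + int j) (p + q - int j))"
    using assms by (rule hat_fin)
  have "hat Q n (p + 1, q) = hat Q n (p, q + 1) + hat Q (n + 1) (p, q)"
    using binom_sum_Suc[OF hat_fin[of N Q n "p + 1 + q", OF assms], of p] binom_sum_uminus[OF fin, of p]
    by (simp add: hat_def algebra_simps)
  then show "hat Q (n + 1) e = ((xx - yy) \<star> hat Q n) e"
    by (simp add: e)
qed

lemma hat_zero:
  assumes "\<And>n q. n \<ge> N \<Longrightarrow> Q n q = 0" "n \<ge> N"
  shows "hat Q n = 0"
  using assms by (auto simp: hat_def fun_eq_iff)

text \<open>The hypothesis says that x1 - x2 annihilates \<Theta>; following a diagonal leads to the
  entry with p = 0.\<close>

lemma constant_diagonal: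
  assumes "\<And>p q. \<Theta> (p + 1, q) = \<Theta> (p, q + 1)"
  shows "\<Theta> (p, q) = \<Theta> (0 :: int, p + q :: int)"
proof -
  have "\<forall>q. \<Theta> (p, q) = \<Theta> (0, p + q)"
  proof (induction p rule: int_induct[of _ 0])
    case (step2 i)
    have "\<Theta> (i - 1, q) = \<Theta> (i, q - 1)" for q using assms[of "i - 1" "q - 1"] by simp
    then show ?case using step2 by (simp add: algebra_simps)
  next
    case (step1 i)
    then show ?case by (simp only: assms) (simp add: algebra_simps)
  qed simp
  then show ?thesis by blast
qed

text \<open>Descending induction on n, starting from n \<ge> k, where both sides vanish. Both sides
  obey the same recursion in n, so their difference is annihilated by x1 - x2 and determined by its
  entries at p = 0, and these are 0 by the formula for \<open>nprod\<close>. The bound n0 lets one M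
  serve all n involved.\<close>

lemma nprod_hat:
  assumes "is_field U" "is_field V" "quasi_local k U V" "n0 + int M \<ge> int k" "n \<ge> n0"
  shows "pev rr (gpol k M) \<star> borch U V w n = hat (\<lambda>n q. nprod U V n q w) n"
  using assms(5)
proof (induction "nat (int k - n)" arbitrary: n)
  case 0
  then have n: "n \<ge> int k" by simp
  then have "pev rr (gpol k M) \<star> borch U V w n = 0"
    by (intro borch_kill[OF assms(1-3), of n 0]) (auto simp: hpol_dvd_gpol)
  moreover have "hat (\<lambda>n q. nprod U V n q w) n = 0"
    using nprod_large[OF assms(1-3)] n by (intro hat_zero[of "int k"]) auto
  ultimately show ?case by simp
next
  case (Suc m)
  let ?Q = "\<lambda>n q. nprod U V n q w"
  define \<Theta> where "\<Theta> = pev rr (gpol k M) \<star> borch U V w n - hat ?Q n"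
  have IH: "pev rr (gpol k M) \<star> borch U V w (n + 1) = hat ?Q (n + 1)"
    using Suc by (intro Suc(1)) auto
  have "(xx - yy) \<star> \<Theta> = pev rr (gpol k M) \<star> ((xx - yy) \<star> borch U V w n) - (xx - yy) \<star> hat ?Q n"
    unfolding \<Theta>_def by (simp only: act_diff_right act_commute[of "xx - yy"])
  also have "\<dots> = 0"
    using IH nprod_large[OF assms(1-3)]
    by (simp only: borch_Suc[OF assms(1,2), symmetric] hat_Suc[of "int k" ?Q n, symmetric]) simp
  finally have z: "(xx - yy) \<star> \<Theta> = 0" .
  have "\<Theta> (p, q) = 0" for p q
  proof -
    have "\<Theta> (p + 1, q) = \<Theta> (p, q + 1)" for p q
      using fun_cong[OF z, of "(p, q)"] by simp
    then have "\<Theta> (p, q) = \<Theta> (0, p + q)" by (rule constant_diagonal)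
    also have "\<dots> = 0"
      using Suc(3) assms(4) by (simp add: \<Theta>_def hat_0 nprod_eq[OF assms(1-3), of n M])
    finally show ?thesis .
  qed
  then show ?case by (auto simp: \<Theta>_def fun_eq_iff)
qed

text \<open>After multiplication by (x1^T - x2^T)^k the kernel acts as 1: the product of this power
  with 1 - gpol annihilates \<open>borch U V w n\<close>, and \<open>nprod_hat\<close> computes what
  the kernel itself gives.\<close>

lemma quasi_jacobi:
  assumes "is_field U" "is_field V" "quasi_local k U V"
  shows "(xx ^ T - yy ^ T) ^ k \<star> borch U V w n = (xx ^ T - yy ^ T) ^ k \<star> hat (\<lambda>n q. nprod U V n q w) n"
proof -
  define M where "M = max k (nat (int k - n))"
  have yy: "mon (0, -1) * yy = 1" "mon (-1, 0) * xx = 1" by (auto simp: mult_single zero_prod_def[symmetric])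
  have rr: "rr = xx * mon (0, -1)" by (simp add: mult_single)
  have "hpol ^ k * [:-1, 1:] ^ M dvd hpol ^ k * (1 - gpol k M)"
    using gpol_dvd by (rule mult_dvd_mono[OF dvd_refl])
  then have "pev rr (hpol ^ k * (1 - gpol k M)) \<star> borch U V w n = 0"
    by (rule borch_kill[OF assms, rotated]) (simp add: M_def)
  then have "((xx - yy) ^ k * pev rr (hpol ^ k * (1 - gpol k M))) \<star> borch U V w n = 0"
    by (rule act_mult_eq_0)
  moreover have "(xx - yy) ^ k * pev rr (hpol ^ k * (1 - gpol k M)) =
      (const (1 / of_nat T) * yy * mon (0, -1) ^ T) ^ k * ((xx ^ T - yy ^ T) ^ k * pev rr (1 - gpol k M))"
  proof -
    have "(xx - yy) ^ k * pev rr (hpol ^ k * (1 - gpol k M)) = (pev rr (hpol ^ k) * (xx - yy) ^ k) * pev rr (1 - gpol k M)"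
      by (simp only: const.ev_mult mult_ac)
    also have "pev rr (hpol ^ k) * (xx - yy) ^ k = (const (1 / of_nat T) * yy * mon (0, -1) ^ T) ^ k * (xx ^ T - yy ^ T) ^ k"
      using hpol_unit[OF yy(1), of xx k] by (simp only: rr[symmetric])
    finally show ?thesis by (simp only: mult.assoc)
  qed
  ultimately have kill: "((const (1 / of_nat T) * yy * mon (0, -1) ^ T) ^ k * ((xx ^ T - yy ^ T) ^ k * pev rr (1 - gpol k M))) \<star> borch U V w n = 0"
    by (simp only:)
  \<comment> \<open>The factor between the two forms of the annihilator consists of a constant and
    monomials, hence is invertible and can be cancelled.\<close>
  have "const (of_nat T) * const (1 / of_nat T) = (1 :: int \<times> int \<Rightarrow>\<^sub>0 complex)"
    using T_pos by (simp add: mult_single del: single_of_nat)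
  moreover have "(mon (0, -1) * yy) * (mon (0, -1) * yy) ^ T = 1" by (simp only: yy(1) mult_1 power_one)
  moreover have "(const (of_nat T) * mon (0, -1) * yy ^ T) * (const (1 / of_nat T) * yy * mon (0, -1) ^ T) =
      (const (of_nat T) * const (1 / of_nat T)) * ((mon (0, -1) * yy) * (mon (0, -1) * yy) ^ T)"
    by (simp only: power_mult_distrib mult_ac)
  ultimately have "(const (of_nat T) * mon (0, -1) * yy ^ T) * (const (1 / of_nat T) * yy * mon (0, -1) ^ T) = 1"
    by (simp only: mult_1)
  then have unit: "(const (of_nat T) * mon (0, -1) * yy ^ T) ^ k * (const (1 / of_nat T) * yy * mon (0, -1) ^ T) ^ k = 1"
    by (simp only: power_mult_distrib[symmetric] power_one)
  have "((xx ^ T - yy ^ T) ^ k * pev rr (1 - gpol k M)) \<star> borch U V w n = 0"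
    using act_mult_eq_0[OF kill, of "(const (of_nat T) * mon (0, -1) * yy ^ T) ^ k"]
    by (simp only: mult.assoc[symmetric] unit mult_1)
  then have "(xx ^ T - yy ^ T) ^ k \<star> borch U V w n = (xx ^ T - yy ^ T) ^ k \<star> (pev rr (gpol k M) \<star> borch U V w n)"
    by (simp add: const.ev_diff act_mult)
  also have "pev rr (gpol k M) \<star> borch U V w n = hat (\<lambda>n q. nprod U V n q w) n"
    by (rule nprod_hat[OF assms, of n]) (auto simp: M_def)
  finally show ?thesis .
qed

section \<open>Products with the identity and derivatives\<close>

lemma sbinom_minus_1: "sbinom (-1) i = 1"
  using sbinom_Suc[of "-1"] by (induction i) (auto simp: sbinom_zero_left)

lemma nprod_id_right:
  assumes "is_field U"
  shows "nprod U id_field n q w = borch U id_field w n (0, q)"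
  using nprod_kernel[OF assms field_id quasi_local_id[OF assms], of n "nat (- n)" 1 q w] by simp

lemma nprod_id_nonneg:
  assumes "is_field U" "n \<ge> 0"
  shows "nprod U id_field n = 0"
  using nprod_large[OF assms(1) field_id quasi_local_id[OF assms(1)], of n] assms(2) by (auto simp: fun_eq_iff)

lemma binom_sum_single:
  assumes "\<And>i. i \<noteq> a \<Longrightarrow> \<chi> i = 0"
  shows "binom_sum n \<chi> = sbinom n a *s \<chi> a"
proof -
  have "binom_sum n \<chi> = (\<Sum>i\<in>{a}. sbinom n i *s \<chi> i)"
    unfolding binom_sum_def by (rule Sum_any.expand_superset) (use assms in force)+
  then show ?thesis by simp
qed

lemma nprod_id_minus_1:
  assumes "is_field U"
  shows "nprod U id_field (-1) = U"
proof (intro ext)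
  fix q w
  have "nprod U id_field (-1) q w = borch U id_field w (-1) (0, q)" by (rule nprod_id_right[OF assms])
  also have "\<dots> = binom_sum (-1) (\<lambda>i. U (-1 - int i) (id_field (q + int i) w)) +
      binom_sum (-1) (\<lambda>i. id_field (q - 1 - int i) (U (int i) w))"
    by (simp add: borch_def)
  \<comment> \<open>The first sum yields the modes with q < 0, the second those with q \<ge> 0: the
    two halves of U(x) are put together again.\<close>
  also have "\<dots> = U q w"
  proof (cases "q \<ge> 0")
    case True
    have "binom_sum (-1) (\<lambda>i. id_field (q - 1 - int i) (U (int i) w)) = sbinom (-1) (nat q) *s U q w"
      using True by (subst binom_sum_single[of "nat q"]) (auto simp: id_field_def)
    moreover have "(\<lambda>i. U (-1 - int i) (id_field (q + int i) w)) = (\<lambda>i. 0)"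
      using True by (auto simp: id_field_def field_simps_lin[OF assms])
    ultimately show ?thesis by (simp add: sbinom_minus_1)
  next
    case False
    have "binom_sum (-1) (\<lambda>i. U (-1 - int i) (id_field (q + int i) w)) = sbinom (-1) (nat (-1 - q)) *s U q w"
      using False by (subst binom_sum_single[of "nat (-1 - q)"]) (auto simp: id_field_def field_simps_lin[OF assms])
    moreover have "(\<lambda>i. id_field (q - 1 - int i) (U (int i) w)) = (\<lambda>i. 0)"
      using False by (auto simp: id_field_def)
    ultimately show ?thesis by (simp add: sbinom_minus_1)
  qed
  finally show "nprod U id_field (-1) q w = U q w" .
qed

text \<open>The derivative dU/dx: its coefficient at x^(-q-1) comes from the one of U(x) at x^(-q),
  which is mode q - 1.\<close>

definition dfield :: "(int \<Rightarrow> 'w \<Rightarrow> 'w) \<Rightarrow> int \<Rightarrow> 'w \<Rightarrow> 'w" where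
  "dfield U q w = (- of_int q) *s U (q - 1) w"

lemma field_dfield:
  assumes "is_field U"
  shows "is_field (dfield U)"
  unfolding is_field_def
proof (intro conjI allI)
  show "lin (dfield U n)" for n
    unfolding dfield_def[abs_def] by (intro lin_scaled field_lin assms)
next
  fix w
  obtain N where "\<forall>n\<ge>N. U n w = 0" using field_bound[OF assms] by blast
  then show "\<exists>N. \<forall>n\<ge>N. dfield U n w = 0" by (intro exI[of _ "N + 1"]) (auto simp: dfield_def)
qed

lemma fin_seq_weighted: "fin_seq \<chi> \<Longrightarrow> fin_seq (\<lambda>i. of_nat i *s \<chi> i)"
  unfolding fin_seq_def by force

text \<open>Integration by parts in coefficients: the weight splits into a constant and a multiple
  of i, and the latter is absorbed into the binomial coefficient, which lowers n by one.\<close>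

lemma weighted_binom_sum:
  assumes "fin_seq \<chi>"
  shows "binom_sum n (\<lambda>i. (- of_int (m + n - int i)) *s \<chi> i) =
    - (of_int m *s binom_sum n \<chi>) - of_int n *s binom_sum (n - 1) \<chi>"
proof -
  have "binom_sum n (\<lambda>i. (- of_int (m + n - int i)) *s \<chi> i) =
      binom_sum n (\<lambda>i. (- of_int (m + n)) *s \<chi> i + of_nat i *s \<chi> i)"
    by (simp add: scale_left_distrib scale_left_diff_distrib algebra_simps)
  also have "\<dots> = (- of_int (m + n)) *s binom_sum n \<chi> - of_int n *s binom_sum (n - 1) (\<lambda>i. \<chi> (Suc i))"
    by (subst binom_sum_add[OF fin_seq_map[OF assms] fin_seq_weighted[OF assms]])
      (simp_all only: binom_sum_scale[OF assms] binom_sum_absorb[OF assms] scale_zero_right, simp)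
  also have "binom_sum (n - 1) (\<lambda>i. \<chi> (Suc i)) = binom_sum (n - 1) \<chi> - binom_sum n \<chi>"
    using binom_sum_Suc[OF assms, of "n - 1"] by (simp add: algebra_simps)
  finally show ?thesis
    by (simp add: scale_left_distrib scale_right_diff_distrib scale_left_diff_distrib)
qed

lemma weighted_binom_sum':
  assumes "fin_seq \<chi>"
  shows "binom_sum n (\<lambda>i. (- of_int (m + int i)) *s \<chi> i) =
    - (of_int m *s binom_sum n \<chi>) + of_int n *s binom_sum (n - 1) (\<lambda>i. \<chi> (Suc i))"
proof -
  have "binom_sum n (\<lambda>i. (- of_int (m + int i)) *s \<chi> i) =
      binom_sum n (\<lambda>i. (- of_int m) *s \<chi> i - of_nat i *s \<chi> i)"
    by (simp add: scale_left_distrib scale_left_diff_distrib algebra_simps)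
  also have "\<dots> = (- of_int m) *s binom_sum n \<chi> + of_int n *s binom_sum (n - 1) (\<lambda>i. \<chi> (Suc i))"
    by (subst binom_sum_diff[OF fin_seq_map[OF assms] fin_seq_weighted[OF assms]])
      (simp_all only: binom_sum_scale[OF assms] binom_sum_absorb[OF assms] scale_zero_right, simp)
  finally show ?thesis by simp
qed

lemma minus_one_powi_diff: "(-1 :: complex) powi (n - 1) = - ((-1) powi n)"
  by (simp add: power_int_diff)

text \<open>The Leibniz rule for d/dx1 on (x1 - x2)^n U(x1) V(x2); differentiating the binomial
  produces the term with n - 1.\<close>

lemma borch_dfield_left:
  assumes "is_field U" "is_field V"
  shows "borch (dfield U) V w n (p, q) =
    - (of_int p *s borch U V w n (p - 1, q)) - of_int n *s borch U V w (n - 1) (p, q)"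
proof -
  have 1: "binom_sum n (\<lambda>i. dfield U (p + n - int i) (V (q + int i) w)) =
      - (of_int p *s binom_sum n (\<lambda>i. U (p - 1 + n - int i) (V (q + int i) w))) -
      of_int n *s binom_sum (n - 1) (\<lambda>i. U (p + (n - 1) - int i) (V (q + int i) w))"
    using weighted_binom_sum[OF borch_fin[OF assms, of "p + n - 1" q w], of n p]
    by (simp add: dfield_def algebra_simps)
  have 2: "binom_sum n (\<lambda>i. V (q + n - int i) (dfield U (p + int i) w)) =
      - (of_int p *s binom_sum n (\<lambda>i. V (q + n - int i) (U (p - 1 + int i) w))) +
      of_int n *s binom_sum (n - 1) (\<lambda>i. V (q + (n - 1) - int i) (U (p + int i) w))"
    using weighted_binom_sum'[OF borch_fin[OF assms(2,1), of "q + n" "p - 1" w], of n p]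
    by (simp add: dfield_def field_simps_lin[OF assms(2)] algebra_simps)
  show ?thesis
    unfolding borch_def prod.case 1 2 minus_one_powi_diff
    by (simp add: scale_right_distrib scale_right_diff_distrib mult.commute)
qed

text \<open>Exchanging x1 and x2 interchanges the two expansions and multiplies (x1 - x2)^n by
  (-1)^n.\<close>

lemma borch_skew: "borch U V w n (p, q) = - ((-1) powi n *s borch V U w n (q, p))"
proof -
  have "(-1 :: complex) powi n * (-1) powi n = 1"
    by (simp flip: power_int_mult_distrib)
  then show ?thesis
    by (simp add: borch_def scale_right_diff_distrib)
qed

lemma borch_dfield_right:
  assumes "is_field U" "is_field V"
  shows "borch U (dfield V) w n (p, q) =
    - (of_int q *s borch U V w n (p, q - 1)) + of_int n *s borch U V w (n - 1) (p, q)"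
proof -
  have "borch U (dfield V) w n (p, q) =
     - ((-1) powi n *s (- (of_int q *s borch V U w n (q - 1, p)) - of_int n *s borch V U w (n - 1) (q, p)))"
    by (subst borch_skew) (simp add: borch_dfield_left[OF assms(2,1)])
  also have "\<dots> = - (of_int q *s borch U V w n (p, q - 1)) + of_int n *s borch U V w (n - 1) (p, q)"
    unfolding borch_skew[of U V w n p "q - 1"] borch_skew[of U V w "n - 1" p q] minus_one_powi_diff
    by (simp add: scale_right_distrib scale_right_diff_distrib mult.commute)
  finally show ?thesis .
qed

lemma nprod_id_deriv:
  assumes "is_field U"
  shows "nprod (dfield U) id_field n = (\<lambda>q w. (- of_int n) *s nprod U id_field (n - 1) q w)"
  by (intro ext) (simp add: nprod_id_right assms field_dfield borch_dfield_left field_id)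

text \<open>\<open>D'\<close> is the image of \<open>D\<close> under the derivation \<open>x\<^sub>2 d/dx\<^sub>2\<close>.\<close>

definition der :: "(int \<times> int \<Rightarrow>\<^sub>0 complex) \<Rightarrow> (int \<times> int \<Rightarrow>\<^sub>0 complex) \<Rightarrow> bool" where
  "der D D' \<longleftrightarrow> (\<forall>\<Phi>. D \<star> (\<lambda>(p, q). of_int q *s \<Phi> (p, q)) = (\<lambda>(p, q). of_int q *s (D \<star> \<Phi>) (p, q)) + D' \<star> \<Phi>)"

lemma derD: "der D D' \<Longrightarrow> D \<star> (\<lambda>(p, q). of_int q *s \<Phi> (p, q)) =
    (\<lambda>(p, q). of_int q *s (D \<star> \<Phi>) (p, q)) + D' \<star> \<Phi>"
  by (simp add: der_def)

lemma der_single: "der (Poly_Mapping.single (a, b) c) (Poly_Mapping.single (a, b) (of_int b * c))"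
  by (auto simp: der_def fun_eq_iff scale_left_distrib algebra_simps)

lemma der_add:
  assumes "der D D'" "der E E'"
  shows "der (D + E) (D' + E')"
  using assms unfolding der_def by (auto simp: fun_eq_iff scale_right_distrib algebra_simps)

lemma der_diff:
  assumes "der D D'" "der E E'"
  shows "der (D - E) (D' - E')"
  using assms unfolding der_def by (auto simp: fun_eq_iff scale_right_diff_distrib algebra_simps)

lemma der_mult:
  assumes "der D D'" "der E E'"
  shows "der (D * E) (D' * E + D * E')"
  unfolding der_def
proof
  fix \<Phi>
  have "(D * E) \<star> (\<lambda>(p, q). of_int q *s \<Phi> (p, q)) =
      D \<star> ((\<lambda>(p, q). of_int q *s (E \<star> \<Phi>) (p, q)) + E' \<star> \<Phi>)"
    by (simp only: act_mult derD[OF assms(2)])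
  also have "\<dots> = (\<lambda>(p, q). of_int q *s (D \<star> E \<star> \<Phi>) (p, q)) + D' \<star> E \<star> \<Phi> + D \<star> E' \<star> \<Phi>"
    by (simp only: act_add_right derD[OF assms(1)])
  finally show "(D * E) \<star> (\<lambda>(p, q). of_int q *s \<Phi> (p, q)) =
      (\<lambda>(p, q). of_int q *s ((D * E) \<star> \<Phi>) (p, q)) + (D' * E + D * E') \<star> \<Phi>"
    by (simp only: act_mult act_add add.assoc)
qed

lemma der_one: "der 1 0"
  using der_single[of 0 0 1] by (simp add: zero_prod_def[symmetric])

lemma der_power:
  assumes "der D D'"
  shows "der (D ^ Suc n) (of_nat (Suc n) * D ^ n * D')"
proof (induction n)
  case (Suc n)
  have "of_nat (Suc (Suc n)) * D ^ Suc n * D' = D' * D ^ Suc n + D * (of_nat (Suc n) * D ^ n * D')"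
    by (simp add: algebra_simps)
  then show ?case using der_mult[OF assms Suc] by simp
qed (use assms in simp)

lemma der_ex: "\<exists>D'. der D D'"
proof (induction D rule: poly_mapping_single_induct)
  case zero
  show ?case by (rule exI[of _ 0]) (auto simp: der_def fun_eq_iff)
next
  case (single d c)
  then show ?case using der_single by (cases d) blast
qed (blast intro: der_add)

text \<open>Differentiating (x1^T - x2^T)^(k+1) leaves k of its factors intact, which is why the
  order goes up by one.\<close>

lemma quasi_local_dfield:
  assumes "is_field U" "is_field V" "quasi_local k U V"
  shows "quasi_local (Suc k) U (dfield V)"
  unfolding quasi_local_act
proof
  fix w
  let ?D = "xx ^ T - yy ^ T"
  define \<Phi> where "\<Phi> = (\<lambda>(p, q). U p (V (q - 1) w) - V (q - 1) (U p w))"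
  obtain D' where D': "der ?D D'" using der_ex by blast
  have eq: "(\<lambda>(p, q). U p (dfield V q w) - dfield V q (U p w)) = - (\<lambda>(p, q). of_int q *s \<Phi> (p, q))"
    by (auto simp: fun_eq_iff dfield_def \<Phi>_def field_simps_lin[OF assms(1)] scale_right_diff_distrib)
  have "?D ^ k \<star> \<Phi> = 0"
  proof -
    have "\<Phi> = (\<lambda>e. (\<lambda>(p, q). U p (V q w) - V q (U p w)) (e + (0, -1)))" by (auto simp: fun_eq_iff \<Phi>_def)
    then show ?thesis using assms(3) unfolding quasi_local_act by (simp only: act_shift) (simp add: fun_eq_iff)
  qed
  then have "?D ^ Suc k \<star> \<Phi> = 0" "(of_nat (Suc k) * ?D ^ k * D') \<star> \<Phi> = 0"
    using act_dvd_eq_0[of "?D ^ k" \<Phi>] by (auto simp del: of_nat_Suc)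
  then have "?D ^ Suc k \<star> (\<lambda>(p, q). of_int q *s \<Phi> (p, q)) = 0"
    unfolding derD[OF der_power[OF D']] by (simp add: fun_eq_iff del: power_Suc of_nat_Suc)
  then show "?D ^ Suc k \<star> (\<lambda>(p, q). U p (dfield V q w) - dfield V q (U p w)) = 0"
    unfolding eq by (simp del: power_Suc)
qed

text \<open>Besides the Leibniz rule for the series there is a derivative of the kernel, which
  depends on x2. It contributes nothing: it is divisible by hpol^k (1 - hpol^(k+1))^M, so
  \<open>borch_kill\<close> applies.\<close>

lemma nprod_dfield_right:
  assumes "is_field U" "is_field V" "quasi_local k U V"
  shows "nprod U (dfield V) n = dfield (nprod U V n) + (\<lambda>q w. of_int n *s nprod U V (n - 1) q w)"
proof (intro ext)
  fix q w
  define M where "M = nat (int k - n + 1)"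
  \<comment> \<open>Both parameters are raised by one so that k respectively M factors survive the
    differentiation.\<close>
  define G where "G = gpol (Suc k) (Suc M)"
  let ?H = "pev rr hpol"
  obtain H' where H': "der ?H H'" using der_ex by blast
  define G' where "G' = 0 - (of_nat (Suc M) * (1 - ?H ^ Suc k) ^ M * (0 - of_nat (Suc k) * ?H ^ k * H'))"
  have "der (pev rr G) G'"
    unfolding G_def G'_def gpol_def const.ev_diff const.ev_power const.ev_1
    by (intro der_diff der_one der_power H')
  have "hpol ^ k * [:-1, 1:] ^ M dvd hpol ^ k * (1 - hpol ^ Suc k) ^ M"
    by (intro mult_dvd_mono dvd_refl dvd_power_same one_minus_dvd)
  then have "pev rr (hpol ^ k * (1 - hpol ^ Suc k) ^ M) \<star> borch U V w n = 0"
    by (rule borch_kill[OF assms, rotated]) (simp add: M_def)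
  then have "(?H ^ k * (1 - ?H ^ Suc k) ^ M) \<star> borch U V w n = 0"
    by (simp only: const.ev_mult const.ev_diff const.ev_power const.ev_1)
  moreover have "?H ^ k * (1 - ?H ^ Suc k) ^ M dvd G'"
  proof -
    have "G' = (?H ^ k * (1 - ?H ^ Suc k) ^ M) * (of_nat (Suc M) * of_nat (Suc k) * H')"
      unfolding G'_def by (simp only: diff_0 mult_minus_right minus_minus mult_ac)
    then show ?thesis by (metis dvd_triv_left)
  qed
  ultimately have G'0: "G' \<star> borch U V w n = 0" using act_dvd_eq_0 by blast
  define \<Phi> where "\<Phi> = (\<lambda>e. borch U V w n (e + (0, -1)))"
  have eq: "borch U (dfield V) w n = - (\<lambda>(p, q). of_int q *s \<Phi> (p, q)) + (\<lambda>e. of_int n *s borch U V w (n - 1) e)"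
    by (auto simp: fun_eq_iff \<Phi>_def borch_dfield_right[OF assms(1,2)])
  have k: "quasi_local (Suc k) U V" using assms(3) by (rule quasi_local_mono) simp
  have d: "pev rr G \<star> (\<lambda>(p, q). of_int q *s \<Phi> (p, q)) = (\<lambda>(p, q). of_int q *s (pev rr G \<star> \<Phi>) (p, q)) + G' \<star> \<Phi>"
    by (rule derD) fact
  have "nprod U (dfield V) n q w = (pev rr G \<star> borch U (dfield V) w n) (0, q)"
    unfolding G_def
    by (rule nprod_eq[OF assms(1) field_dfield[OF assms(2)] quasi_local_dfield[OF assms]])
      (simp add: M_def)
  also have "\<dots> = - (of_int q *s (pev rr G \<star> borch U V w n) (0, q - 1)) +
      of_int n *s (pev rr G \<star> borch U V w (n - 1)) (0, q)"
    unfolding eq act_add_right act_uminus_right d unfolding \<Phi>_def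
    by (simp only: act_scale_right act_shift[of _ "borch U V w n"]) (simp add: G'0)
  also have "\<dots> = - (of_int q *s nprod U V n (q - 1) w) + of_int n *s nprod U V (n - 1) q w"
  proof -
    have "nprod U V n (q - 1) w = (pev rr G \<star> borch U V w n) (0, q - 1)"
      unfolding G_def by (rule nprod_eq[OF assms(1,2) k]) (simp add: M_def)
    moreover have "nprod U V (n - 1) q w = (pev rr G \<star> borch U V w (n - 1)) (0, q)"
      unfolding G_def by (rule nprod_eq[OF assms(1,2) k]) (simp add: M_def)
    ultimately show ?thesis by simp
  qed
  finally show "nprod U (dfield V) n q w = (dfield (nprod U V n) + (\<lambda>q w. of_int n *s nprod U V (n - 1) q w)) q w"
    by (simp add: dfield_def)
qed

end

text \<open>Each term of the binomial expansion contains a at least m times or b at least n times.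
  This splits the exponent in Dong's lemma.\<close>

lemma add_power_split:
  fixes a b :: "'r::comm_ring_1"
  shows "\<exists>u v. (a + b) ^ (m + n) = a ^ m * u + b ^ n * v"
proof (induction m arbitrary: n)
  case 0
  show ?case by (rule exI[of _ "(a + b) ^ n"], rule exI[of _ 0]) simp
next
  case (Suc m)
  show ?case
  proof (induction n)
    case 0
    show ?case by (rule exI[of _ 0], rule exI[of _ "(a + b) ^ Suc m"]) simp
  next
    case (Suc n)
    then obtain u v where 1: "(a + b) ^ (Suc m + n) = a ^ Suc m * u + b ^ n * v" by blast
    obtain u' v' where 2: "(a + b) ^ (m + Suc n) = a ^ m * u' + b ^ Suc n * v'"
      using Suc.prems \<open>\<And>n. \<exists>u v. (a + b) ^ (m + n) = a ^ m * u + b ^ n * v\<close> by blast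
    have "(a + b) ^ (Suc m + Suc n) = a * (a + b) ^ (m + Suc n) + b * (a + b) ^ (Suc m + n)"
      by (simp add: algebra_simps)
    also have "\<dots> = a ^ Suc m * (u' + b * u) + b ^ Suc n * (a * v' + v)"
      unfolding 1 2 by (simp add: algebra_simps)
    finally show ?case by blast
  qed
qed

section \<open>Double binomial sums and series in three variables\<close>

definition dfin :: "(nat \<Rightarrow> nat \<Rightarrow> 'w::zero) \<Rightarrow> bool" where
  "dfin \<chi> \<longleftrightarrow> (\<exists>N. \<forall>i j. N \<le> i \<or> N \<le> j \<longrightarrow> \<chi> i j = 0)"

text \<open>A bound on j valid for all i, and bounds on i for each of the finitely many remaining j,
  combine into a common one. Iterated actions of two fields on a vector are truncated in this
  pattern.\<close>

lemma dfinI: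
  assumes "\<And>i j. N \<le> j \<Longrightarrow> \<chi> i j = 0" "\<And>j. fin_seq (\<lambda>i. \<chi> i j)"
  shows "dfin \<chi>"
proof -
  have "\<exists>N'. \<forall>j<K. \<forall>i\<ge>N'. \<chi> i j = 0" for K
  proof (induction K)
    case (Suc K)
    then obtain N1 where "\<forall>j<K. \<forall>i\<ge>N1. \<chi> i j = 0" by blast
    moreover obtain N2 where "\<forall>i\<ge>N2. \<chi> i K = 0" using assms(2)[of K] by (auto simp: fin_seq_def)
    ultimately show ?case by (intro exI[of _ "max N1 N2"]) (auto simp: less_Suc_eq)
  qed simp
  then obtain N' where N': "\<forall>j<N. \<forall>i\<ge>N'. \<chi> i j = 0" by blast
  have "\<chi> i j = 0" if "max N N' \<le> i \<or> max N N' \<le> j" for i j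
    using that N' assms(1)[of j i] by (cases "j < N") auto
  then show ?thesis unfolding dfin_def by blast
qed

lemma dfin_swap: "dfin \<chi> \<Longrightarrow> dfin (\<lambda>i j. \<chi> j i)"
  unfolding dfin_def by blast

lemma dfin_row: "dfin \<chi> \<Longrightarrow> fin_seq (\<chi> i)"
  unfolding dfin_def fin_seq_def by blast

lemma dfin_diff:
  fixes \<chi> \<xi> :: "nat \<Rightarrow> nat \<Rightarrow> 'w::ab_group_add"
  assumes "dfin \<chi>" "dfin \<xi>"
  shows "dfin (\<lambda>i j. \<chi> i j - \<xi> i j)"
proof -
  obtain M N where "\<forall>i j. M \<le> i \<or> M \<le> j \<longrightarrow> \<chi> i j = 0" "\<forall>i j. N \<le> i \<or> N \<le> j \<longrightarrow> \<xi> i j = 0"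
    using assms by (auto simp: dfin_def)
  then have "\<forall>i j. max M N \<le> i \<or> max M N \<le> j \<longrightarrow> \<chi> i j - \<xi> i j = 0" by auto
  then show ?thesis unfolding dfin_def by blast
qed

lemma dfin_map: "dfin \<chi> \<Longrightarrow> (\<And>i j. f i j 0 = 0) \<Longrightarrow> dfin (\<lambda>i j. f i j (\<chi> i j))"
  unfolding dfin_def by metis

lemma dfin_sum_index:
  assumes "fin_seq \<chi>" "\<And>i j. f i j 0 = 0"
  shows "dfin (\<lambda>i j. f i j (\<chi> (i + j)))"
proof -
  obtain N where "\<forall>i\<ge>N. \<chi> i = 0" using assms(1) by (auto simp: fin_seq_def)
  then have "\<forall>i j. N \<le> i \<or> N \<le> j \<longrightarrow> f i j (\<chi> (i + j)) = 0" using assms(2) by auto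
  then show ?thesis unfolding dfin_def by blast
qed

context complex_space
begin

lemma dfin_binom_sum: "dfin \<chi> \<Longrightarrow> fin_seq (\<lambda>i. binom_sum n (\<chi> i))"
proof -
  assume "dfin \<chi>"
  then obtain N where "\<forall>i j. N \<le> i \<or> N \<le> j \<longrightarrow> \<chi> i j = 0" by (auto simp: dfin_def)
  then have "binom_sum n (\<chi> i) = 0" if "i \<ge> N" for i using that by (subst binom_sum_eq[of 0]) auto
  then show ?thesis by (rule fin_seqI)
qed

lemma dfin_binom_sum_swap:
  assumes "dfin \<chi>"
  shows "binom_sum m (\<lambda>i. binom_sum n (\<lambda>j. \<chi> i j)) = binom_sum n (\<lambda>j. binom_sum m (\<lambda>i. \<chi> i j))"
proof -
  obtain N where "\<forall>i j. N \<le> i \<or> N \<le> j \<longrightarrow> \<chi> i j = 0" using assms by (auto simp: dfin_def)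
  then show ?thesis by (intro binom_sum_swap[of N]) blast
qed

lemma dfin_binom_sum_diff:
  assumes "dfin \<chi>" "dfin \<xi>"
  shows "binom_sum m (\<lambda>i. binom_sum n (\<lambda>j. \<chi> i j - \<xi> i j)) =
    binom_sum m (\<lambda>i. binom_sum n (\<lambda>j. \<chi> i j)) - binom_sum m (\<lambda>i. binom_sum n (\<lambda>j. \<xi> i j))"
  using assms by (simp add: binom_sum_diff dfin_row dfin_binom_sum)

lemma act_binom_sum:
  assumes "\<And>e. fin_seq (\<phi> e)"
  shows "(D \<star> (\<lambda>e. binom_sum n (\<phi> e))) e = binom_sum n (\<lambda>i. (D \<star> (\<lambda>e. \<phi> e i)) e)"
  unfolding laurent_act_def using assms
  by (subst binom_sum_sum) (auto simp: binom_sum_scale intro: fin_seq_map)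

lemma act_dfin_binom_sum:
  assumes "\<And>e. dfin (\<phi> e)"
  shows "(D \<star> (\<lambda>e. binom_sum m (\<lambda>i. binom_sum n (\<phi> e i)))) e =
    binom_sum m (\<lambda>i. binom_sum n (\<lambda>j. (D \<star> (\<lambda>e. \<phi> e i j)) e))"
  using assms by (simp add: act_binom_sum dfin_binom_sum dfin_row)

text \<open>The operators \<open>F p\<^sub>0 p\<close> are the coefficients of a commutator \<open>[A(x\<^sub>0), U(x\<^sub>1)]\<close>; the result
  is its double residue with \<open>V(x\<^sub>2)\<close> against \<open>(x\<^sub>0 - x\<^sub>2)\<^sup>m (x\<^sub>1 - x\<^sub>2)\<^sup>n\<close>.\<close>

definition gam :: "(int \<Rightarrow> int \<Rightarrow> 'w \<Rightarrow> 'w) \<Rightarrow> (int \<Rightarrow> 'w \<Rightarrow> 'w) \<Rightarrow> 'w \<Rightarrow> int \<Rightarrow> int \<Rightarrow> int \<times> int \<times> int \<Rightarrow> 'w" where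
  "gam F V w m n = (\<lambda>(p\<^sub>0, p, q).
     binom_sum m (\<lambda>i. binom_sum n (\<lambda>j. F (p\<^sub>0 + m - int i) (p + n - int j) (V (q + int i + int j) w))) -
     (-1) powi (m + n) *s
     binom_sum m (\<lambda>i. binom_sum n (\<lambda>j. V (q + m + n - int i - int j) (F (p\<^sub>0 + int i) (p + int j) w))))"

text \<open>Joint truncation in both modes keeps the second double sum of \<open>gam\<close> finite;
  in the first one the truncation comes from V, and F only has to send 0 to 0.\<close>

definition regular :: "(int \<Rightarrow> int \<Rightarrow> 'w \<Rightarrow> 'w) \<Rightarrow> bool" where
  "regular F \<longleftrightarrow> (\<forall>p\<^sub>0 p. F p\<^sub>0 p 0 = 0) \<and> (\<forall>w p\<^sub>0 p. dfin (\<lambda>i j. F (p\<^sub>0 + int i) (p + int j) w))"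

lemma gam_dfin1:
  assumes "regular F" "is_field V"
  shows "dfin (\<lambda>i j. F (a - int i) (b - int j) (V (q + int i + int j) w))"
  using dfin_sum_index[of "\<lambda>i. V (q + int i) w" "\<lambda>i j. F (a - int i) (b - int j)"] field_fin[OF assms(2), of q w] assms(1)
  by (simp add: regular_def algebra_simps)

lemma gam_dfin2:
  assumes "regular F" "is_field V"
  shows "dfin (\<lambda>i j. V (a - int i - int j) (F (p\<^sub>0 + int i) (p + int j) w))"
  using assms(1) field_simps_lin(3)[OF assms(2)] unfolding regular_def
  by (intro dfin_map[of _ "\<lambda>i j. V (a - int i - int j)"]) auto

lemma gam_Suc_left:
  assumes "regular F" "is_field V"
  shows "gam F V w (m + 1) n = (mon (1, 0, 0) - mon (0, 0, 1)) \<star> gam F V w m n"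
proof
  fix e :: "int \<times> int \<times> int"
  obtain p0 p q where e: "e = (p0, p, q)" by (cases e)
  have 1: "binom_sum (m + 1) (\<lambda>i. binom_sum n (\<lambda>j. F (p0 + (m + 1) - int i) (p + n - int j) (V (q + int i + int j) w)))
    = binom_sum m (\<lambda>i. binom_sum n (\<lambda>j. F (p0 + 1 + m - int i) (p + n - int j) (V (q + int i + int j) w)))
    - binom_sum m (\<lambda>i. binom_sum n (\<lambda>j. F (p0 + m - int i) (p + n - int j) (V (q + 1 + int i + int j) w)))"
    using binom_sum_Suc[OF dfin_binom_sum[OF gam_dfin1[OF assms, of "p0 + m + 1" "p + n" q w]], of m n]
    by (simp add: algebra_simps)
  have 2: "binom_sum (m + 1) (\<lambda>i. binom_sum n (\<lambda>j. V (q + (m + 1) + n - int i - int j) (F (p0 + int i) (p + int j) w)))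
    = binom_sum m (\<lambda>i. binom_sum n (\<lambda>j. V (q + 1 + m + n - int i - int j) (F (p0 + int i) (p + int j) w)))
    - binom_sum m (\<lambda>i. binom_sum n (\<lambda>j. V (q + m + n - int i - int j) (F (p0 + 1 + int i) (p + int j) w)))"
    using binom_sum_Suc[OF dfin_binom_sum[OF gam_dfin2[OF assms, of "q + m + 1 + n" p0 p w]], of m n]
    by (simp add: algebra_simps)
  have 3: "(-1 :: complex) powi (m + 1 + n) = - ((-1) powi (m + n))"
    using minus_one_powi_Suc[of "m + n"] by (simp add: algebra_simps)
  show "gam F V w (m + 1) n e = ((mon (1, 0, 0) - mon (0, 0, 1)) \<star> gam F V w m n) e"
    unfolding e gam_def prod.case 1 2 3
    by (simp add: scale_right_diff_distrib)
qed

lemma gam_swap: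
  assumes "regular F" "is_field V"
  shows "gam F V w m n (p\<^sub>0, p, q) = gam (\<lambda>p p\<^sub>0. F p\<^sub>0 p) V w n m (p, p\<^sub>0, q)"
  unfolding gam_def prod.case
    dfin_binom_sum_swap[OF gam_dfin1[OF assms], of m n]
    dfin_binom_sum_swap[OF gam_dfin2[OF assms], of m n]
  by (simp add: algebra_simps)

lemma regular_swap: "regular F \<Longrightarrow> regular (\<lambda>p p\<^sub>0. F p\<^sub>0 p)"
  unfolding regular_def using dfin_swap by blast

lemma gam_Suc_right:
  assumes "regular F" "is_field V"
  shows "gam F V w m (n + 1) = (mon (0, 1, 0) - mon (0, 0, 1)) \<star> gam F V w m n"
proof
  fix e :: "int \<times> int \<times> int"
  obtain p0 p q where e: "e = (p0, p, q)" by (cases e)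
  show "gam F V w m (n + 1) e = ((mon (0, 1, 0) - mon (0, 0, 1)) \<star> gam F V w m n) e"
    using fun_cong[OF gam_Suc_left[OF regular_swap[OF assms(1)] assms(2), of w n m], of "(p, p0, q)"]
    unfolding e gam_swap[OF assms]
    by (simp add: gam_swap[OF assms] algebra_simps)
qed

text \<open>\<open>gam\<close> is a binomial combination of shifts of two shapes: F applied to a
  family of vectors in x2, and a family of operators in x2 applied to F. The Laurent action commutes
  with shifts and with these sums, so annihilating the two shapes is enough.\<close>

lemma gam_kill:
  assumes "regular F" "is_field V"
    and "\<And>g. D \<star> (\<lambda>(p\<^sub>0, p, q). F p\<^sub>0 p (g q)) = 0"
    and "\<And>g w. (\<And>q. lin (g q)) \<Longrightarrow> D \<star> (\<lambda>(p\<^sub>0, p, q). g q (F p\<^sub>0 p w)) = 0"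
  shows "D \<star> gam F V w m n = 0"
proof -
  let ?\<phi> = "\<lambda>e::int \<times> int \<times> int. \<lambda>i j. F (fst e + m - int i) (fst (snd e) + n - int j) (V (snd (snd e) + int i + int j) w)"
  let ?\<psi> = "\<lambda>e::int \<times> int \<times> int. \<lambda>i j. V (snd (snd e) + m + n - int i - int j) (F (fst e + int i) (fst (snd e) + int j) w)"
  have "(\<lambda>e. ?\<phi> e i j) = (\<lambda>e. (\<lambda>(p\<^sub>0, p, q). F p\<^sub>0 p (V (q + int i + int j) w)) (e + (m - int i, n - int j, 0)))" for i j
    by (auto simp: fun_eq_iff algebra_simps)
  then have 1: "D \<star> (\<lambda>e. ?\<phi> e i j) = 0" for i j
    using assms(3)[of "\<lambda>q. V (q + int i + int j) w"] by (simp only: act_shift) (simp add: fun_eq_iff)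
  have "(\<lambda>e. ?\<psi> e i j) = (\<lambda>e. (\<lambda>(p\<^sub>0, p, q). V (q + m + n - int i - int j) (F p\<^sub>0 p w)) (e + (int i, int j, 0)))" for i j
    by (auto simp: fun_eq_iff algebra_simps)
  then have 2: "D \<star> (\<lambda>e. ?\<psi> e i j) = 0" for i j
    using assms(4)[of "\<lambda>q. V (q + m + n - int i - int j)" w] field_lin[OF assms(2)]
    by (simp only: act_shift) (simp add: fun_eq_iff)
  have gam: "gam F V w m n = (\<lambda>e. binom_sum m (\<lambda>i. binom_sum n (?\<phi> e i))) -
      (\<lambda>e. (-1) powi (m + n) *s binom_sum m (\<lambda>i. binom_sum n (?\<psi> e i)))"
    by (auto simp: gam_def fun_eq_iff)
  show ?thesis
  proof
    fix e
    show "(D \<star> gam F V w m n) e = 0 e"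
      using gam_dfin1[OF assms(1,2)] gam_dfin2[OF assms(1,2)]
      unfolding gam act_diff_right act_scale_right minus_apply
      by (subst act_dfin_binom_sum, simp, subst act_dfin_binom_sum, simp) (simp add: 1 2)
  qed
qed

lemma regular_commutator:
  assumes "is_field A" "is_field U"
  shows "regular (\<lambda>p\<^sub>0 p w. A p\<^sub>0 (U p w) - U p (A p\<^sub>0 w))"
  unfolding regular_def
proof (intro conjI allI)
  fix w p0 p
  have "dfin (\<lambda>i j. A (p0 + int i) (U (p + int j) w))"
  proof -
    obtain N where "\<forall>j\<ge>N. U (p + int j) w = 0" using field_fin[OF assms(2), of p w] by (auto simp: fin_seq_def)
    then show ?thesis
      by (intro dfinI[of N] field_fin assms) (simp add: field_simps_lin(3)[OF assms(1)])
  qed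
  moreover have "dfin (\<lambda>j i. U (p + int j) (A (p0 + int i) w))"
  proof -
    obtain N where "\<forall>i\<ge>N. A (p0 + int i) w = 0" using field_fin[OF assms(1), of p0 w] by (auto simp: fin_seq_def)
    then show ?thesis
      by (intro dfinI[of N] field_fin assms) (simp add: field_simps_lin(3)[OF assms(2)])
  qed
  ultimately show "dfin (\<lambda>i j. A (p0 + int i) (U (p + int j) w) - U (p + int j) (A (p0 + int i) w))"
    by (intro dfin_diff dfin_swap[of "\<lambda>j i. U (p + int j) (A (p0 + int i) w)"])
qed (simp add: field_simps_lin[OF assms(1)] field_simps_lin[OF assms(2)])

text \<open>The exponent p of x1 is frozen, so that the remaining coefficients of the series of U
  and V form a field in x2, with which A is paired.\<close>

definition borch2 :: "(int \<Rightarrow> 'w \<Rightarrow> 'w) \<Rightarrow> (int \<Rightarrow> 'w \<Rightarrow> 'w) \<Rightarrow> (int \<Rightarrow> 'w \<Rightarrow> 'w) \<Rightarrow> 'w \<Rightarrow> int \<Rightarrow> int \<Rightarrow> int \<times> int \<times> int \<Rightarrow> 'w" where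
  "borch2 A U V w m n = (\<lambda>(p\<^sub>0, p, q). borch A (\<lambda>q w. borch U V w n (p, q)) w m (p\<^sub>0, q))"

lemma borch2_expand:
  assumes "is_field A" "is_field U" "is_field V"
  shows "borch2 A U V w m n (p\<^sub>0, p, q) =
    binom_sum m (\<lambda>i. binom_sum n (\<lambda>j. A (p\<^sub>0 + m - int i) (U (p + n - int j) (V (q + int i + int j) w)))) -
    (-1) powi n *s binom_sum m (\<lambda>i. binom_sum n (\<lambda>j. A (p\<^sub>0 + m - int i) (V (q + int i + n - int j) (U (p + int j) w)))) -
    (-1) powi m *s binom_sum m (\<lambda>i. binom_sum n (\<lambda>j. U (p + n - int j) (V (q + m - int i + int j) (A (p\<^sub>0 + int i) w)))) +
    (-1) powi (m + n) *s binom_sum m (\<lambda>i. binom_sum n (\<lambda>j. V (q + m + n - int i - int j) (U (p + int j) (A (p\<^sub>0 + int i) w))))"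
    and "dfin (\<lambda>i j. A (p\<^sub>0 + m - int i) (U (p + n - int j) (V (q + int i + int j) w)))"
    and "dfin (\<lambda>i j. A (p\<^sub>0 + m - int i) (V (q + int i + n - int j) (U (p + int j) w)))"
    and "dfin (\<lambda>i j. U (p + n - int j) (V (q + m - int i + int j) (A (p\<^sub>0 + int i) w)))"
    and "dfin (\<lambda>i j. V (q + m + n - int i - int j) (U (p + int j) (A (p\<^sub>0 + int i) w)))"
proof -
  note zA = field_simps_lin(3)[OF assms(1)] and zU = field_simps_lin(3)[OF assms(2)] and zV = field_simps_lin(3)[OF assms(3)]
  show d1: "dfin (\<lambda>i j. A (p\<^sub>0 + m - int i) (U (p + n - int j) (V (q + int i + int j) w)))"
    using dfin_sum_index[OF field_fin[OF assms(3), of q w], of "\<lambda>i j x. A (p\<^sub>0 + m - int i) (U (p + n - int j) x)"]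
    by (simp add: zA zU algebra_simps)
  obtain NU where NU: "\<forall>j\<ge>NU. U (p + int j) w = 0" using field_fin[OF assms(2), of p w] by (auto simp: fin_seq_def)
  obtain NA where NA: "\<forall>i\<ge>NA. A (p\<^sub>0 + int i) w = 0" using field_fin[OF assms(1), of p\<^sub>0 w] by (auto simp: fin_seq_def)
  show d2: "dfin (\<lambda>i j. A (p\<^sub>0 + m - int i) (V (q + int i + n - int j) (U (p + int j) w)))"
  proof (rule dfinI[of NU])
    fix j
    have "fin_seq (\<lambda>i. V (q + n - int j + int i) (U (p + int j) w))" by (rule field_fin[OF assms(3)])
    then obtain N where "\<And>i. i \<ge> N \<Longrightarrow> V (q + n - int j + int i) (U (p + int j) w) = 0" by (auto simp: fin_seq_def)
    then show "fin_seq (\<lambda>i. A (p\<^sub>0 + m - int i) (V (q + int i + n - int j) (U (p + int j) w)))"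
      by (intro fin_seqI[of N]) (simp add: zA algebra_simps)
  qed (simp add: NU zA zV)
  show d3: "dfin (\<lambda>i j. U (p + n - int j) (V (q + m - int i + int j) (A (p\<^sub>0 + int i) w)))"
  proof (rule dfin_swap, rule dfinI[of NA])
    fix i
    have "fin_seq (\<lambda>j. V (q + m - int i + int j) (A (p\<^sub>0 + int i) w))" by (rule field_fin[OF assms(3)])
    then obtain N where "\<And>j. j \<ge> N \<Longrightarrow> V (q + m - int i + int j) (A (p\<^sub>0 + int i) w) = 0" by (auto simp: fin_seq_def)
    then show "fin_seq (\<lambda>j. U (p + n - int j) (V (q + m - int i + int j) (A (p\<^sub>0 + int i) w)))"
      by (intro fin_seqI[of N]) (simp add: zU)
  qed (simp add: NA zU zV)
  show d4: "dfin (\<lambda>i j. V (q + m + n - int i - int j) (U (p + int j) (A (p\<^sub>0 + int i) w)))"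
  proof (rule dfin_swap, rule dfinI[of NA])
    fix i
    have "fin_seq (\<lambda>j. U (p + int j) (A (p\<^sub>0 + int i) w))" by (rule field_fin[OF assms(2)])
    then obtain N where "\<And>j. j \<ge> N \<Longrightarrow> U (p + int j) (A (p\<^sub>0 + int i) w) = 0" by (auto simp: fin_seq_def)
    then show "fin_seq (\<lambda>j. V (q + m + n - int i - int j) (U (p + int j) (A (p\<^sub>0 + int i) w)))"
      by (intro fin_seqI[of N]) (simp add: zV)
  qed (simp add: NA zU zV)
  have 1: "A a (borch U V w n (p, b)) = binom_sum n (\<lambda>j. A a (U (p + n - int j) (V (b + int j) w))) -
      (-1) powi n *s binom_sum n (\<lambda>j. A a (V (b + n - int j) (U (p + int j) w)))" for a b
    unfolding borch_def prod.case field_simps_lin[OF assms(1)]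
    by (simp add: binom_sum_linear[OF field_lin[OF assms(1)]] borch_fin assms)
  have 2: "borch U V (A a w) n (p, b) = binom_sum n (\<lambda>j. U (p + n - int j) (V (b + int j) (A a w))) -
      (-1) powi n *s binom_sum n (\<lambda>j. V (b + n - int j) (U (p + int j) (A a w)))" for a b
    unfolding borch_def prod.case ..
  have n1: "binom_sum m (\<lambda>i. binom_sum n (f i) - (-1) powi n *s binom_sum n (g i)) =
      binom_sum m (\<lambda>i. binom_sum n (f i)) - (-1) powi n *s binom_sum m (\<lambda>i. binom_sum n (g i))"
    if "dfin f" "dfin g" for f g
    using binom_sum_diff[OF dfin_binom_sum[OF that(1)] fin_seq_map[OF dfin_binom_sum[OF that(2)], of "\<lambda>x. (-1) powi n *s x"]]
      binom_sum_scale[OF dfin_binom_sum[OF that(2)]] by simp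
  have d4': "dfin (\<lambda>i j. V (q + m - int i + n - int j) (U (p + int j) (A (p\<^sub>0 + int i) w)))"
    using d4 by (simp add: algebra_simps)
  have "borch2 A U V w m n (p\<^sub>0, p, q) =
    (binom_sum m (\<lambda>i. binom_sum n (\<lambda>j. A (p\<^sub>0 + m - int i) (U (p + n - int j) (V (q + int i + int j) w)))) -
    (-1) powi n *s binom_sum m (\<lambda>i. binom_sum n (\<lambda>j. A (p\<^sub>0 + m - int i) (V (q + int i + n - int j) (U (p + int j) w))))) -
    (-1) powi m *s (binom_sum m (\<lambda>i. binom_sum n (\<lambda>j. U (p + n - int j) (V (q + m - int i + int j) (A (p\<^sub>0 + int i) w)))) -
    (-1) powi n *s binom_sum m (\<lambda>i. binom_sum n (\<lambda>j. V (q + m - int i + n - int j) (U (p + int j) (A (p\<^sub>0 + int i) w)))))"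
    unfolding borch2_def prod.case borch_def[of A] 1 2
    unfolding n1[OF d1 d2] n1[OF d3 d4'] ..
  then show "borch2 A U V w m n (p\<^sub>0, p, q) =
    binom_sum m (\<lambda>i. binom_sum n (\<lambda>j. A (p\<^sub>0 + m - int i) (U (p + n - int j) (V (q + int i + int j) w)))) -
    (-1) powi n *s binom_sum m (\<lambda>i. binom_sum n (\<lambda>j. A (p\<^sub>0 + m - int i) (V (q + int i + n - int j) (U (p + int j) w)))) -
    (-1) powi m *s binom_sum m (\<lambda>i. binom_sum n (\<lambda>j. U (p + n - int j) (V (q + m - int i + int j) (A (p\<^sub>0 + int i) w)))) +
    (-1) powi (m + n) *s binom_sum m (\<lambda>i. binom_sum n (\<lambda>j. V (q + m + n - int i - int j) (U (p + int j) (A (p\<^sub>0 + int i) w))))"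
    by (simp add: scale_right_diff_distrib power_int_add algebra_simps)
qed

text \<open>Of the four orderings in each iterated series, those with V in the middle occur on both
  sides and cancel; the others combine into [A, U] V and V [A, U].\<close>

lemma borch2_commutator:
  assumes "is_field A" "is_field U" "is_field V"
  shows "borch2 A U V w m n (p\<^sub>0, p, q) - borch2 U A V w n m (p, p\<^sub>0, q) =
    gam (\<lambda>p\<^sub>0 p w. A p\<^sub>0 (U p w) - U p (A p\<^sub>0 w)) V w m n (p\<^sub>0, p, q)"
proof -
  note e1 = borch2_expand[OF assms, where w = w and m = m and n = n and p\<^sub>0 = p\<^sub>0 and p = p and q = q]
  note e2 = borch2_expand[OF assms(2,1,3), where w = w and m = n and n = m and p\<^sub>0 = p and p = p\<^sub>0 and q = q]
  have d1: "dfin (\<lambda>i j. U (p + n - int j) (A (p\<^sub>0 + m - int i) (V (q + int i + int j) w)))"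
    using dfin_swap[OF e2(2)] by (simp add: algebra_simps)
  have d4: "dfin (\<lambda>i j. V (q + m + n - int i - int j) (A (p\<^sub>0 + int i) (U (p + int j) w)))"
    using dfin_swap[OF e2(5)] by (simp add: algebra_simps)
  have g1: "binom_sum m (\<lambda>i. binom_sum n (\<lambda>j. A (p\<^sub>0 + m - int i) (U (p + n - int j) (V (q + int i + int j) w)) -
        U (p + n - int j) (A (p\<^sub>0 + m - int i) (V (q + int i + int j) w)))) =
      binom_sum m (\<lambda>i. binom_sum n (\<lambda>j. A (p\<^sub>0 + m - int i) (U (p + n - int j) (V (q + int i + int j) w)))) -
      binom_sum n (\<lambda>j. binom_sum m (\<lambda>i. U (p + n - int j) (A (p\<^sub>0 + m - int i) (V (q + int j + int i) w))))"
    unfolding dfin_binom_sum_diff[OF e1(2) d1] dfin_binom_sum_swap[OF d1] by (simp add: algebra_simps)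
  have g4: "binom_sum m (\<lambda>i. binom_sum n (\<lambda>j. V (q + m + n - int i - int j) (A (p\<^sub>0 + int i) (U (p + int j) w) - U (p + int j) (A (p\<^sub>0 + int i) w)))) =
      binom_sum n (\<lambda>j. binom_sum m (\<lambda>i. V (q + n + m - int j - int i) (A (p\<^sub>0 + int i) (U (p + int j) w)))) -
      binom_sum m (\<lambda>i. binom_sum n (\<lambda>j. V (q + m + n - int i - int j) (U (p + int j) (A (p\<^sub>0 + int i) w))))"
    unfolding field_simps_lin[OF assms(3)] dfin_binom_sum_diff[OF d4 e1(5)] dfin_binom_sum_swap[OF d4]
    by (simp add: algebra_simps)
  have g2: "binom_sum m (\<lambda>i. binom_sum n (\<lambda>j. A (p\<^sub>0 + m - int i) (V (q + int i + n - int j) (U (p + int j) w)))) =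
      binom_sum n (\<lambda>j. binom_sum m (\<lambda>i. A (p\<^sub>0 + m - int i) (V (q + n - int j + int i) (U (p + int j) w))))"
    unfolding dfin_binom_sum_swap[OF e1(3)] by (simp add: algebra_simps)
  have g3: "binom_sum m (\<lambda>i. binom_sum n (\<lambda>j. U (p + n - int j) (V (q + m - int i + int j) (A (p\<^sub>0 + int i) w)))) =
      binom_sum n (\<lambda>j. binom_sum m (\<lambda>i. U (p + n - int j) (V (q + int j + m - int i) (A (p\<^sub>0 + int i) w))))"
    unfolding dfin_binom_sum_swap[OF e1(4)] by (simp add: algebra_simps)
  show ?thesis
    unfolding e1(1) e2(1) gam_def prod.case g1 g4 g2 g3
    by (simp add: scale_right_diff_distrib add.commute[of n m] algebra_simps)
qed

end

lemma power_diff_dvd: "(a - b :: 'r::comm_ring_1) dvd a ^ n - b ^ n"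
  unfolding power_diff_sumr2 by (rule dvd_triv_left)

lemma fin_seq_diff: "fin_seq \<chi> \<Longrightarrow> fin_seq \<xi> \<Longrightarrow> fin_seq (\<lambda>i. \<chi> i - (\<xi> i :: 'w::ab_group_add))"
  using fin_seq_add[of \<chi> "\<lambda>i. - \<xi> i"] fin_seq_map[of \<xi> uminus] by simp

context cyclic_space
begin

abbreviation x0 :: "int \<times> int \<times> int \<Rightarrow>\<^sub>0 complex" where "x0 \<equiv> mon (1, 0, 0)"
abbreviation x1 :: "int \<times> int \<times> int \<Rightarrow>\<^sub>0 complex" where "x1 \<equiv> mon (0, 1, 0)"
abbreviation x2 :: "int \<times> int \<times> int \<Rightarrow>\<^sub>0 complex" where "x2 \<equiv> mon (0, 0, 1)"

section \<open>Dong's lemma\<close>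

text \<open>The exponent is k + (k + (k + L)). With c = a + b, the power c^(2k+L) is a combination
  of a^k and b^(k+L). The first together with another c^k moves Z past A and past \<alpha>. In the
  second, b^L contains (x1 - x2)^L, which raises n to a nonnegative exponent, and there b^k
  annihilates the series of A and \<alpha>.\<close>

lemma dong:
  assumes "is_field Z" "is_field A" "is_field \<alpha>"
    and "quasi_local k Z A" "quasi_local k Z \<alpha>" "quasi_local k A \<alpha>" "- int L \<le> n"
  shows "quasi_local (3 * k + L) Z (nprod A \<alpha> n)"
proof -
  define a b c where "a = x0 ^ T - x1 ^ T" and "b = x1 ^ T - x2 ^ T" and "c = x0 ^ T - x2 ^ T"
  \<comment> \<open>The commutator of Z with the series from which the kernel produces
    \<open>nprod A \<alpha> n\<close>.\<close>
  define \<Omega> where "\<Omega> w n = (\<lambda>(y, p, q). Z y (borch A \<alpha> w n (p, q)) - borch A \<alpha> (Z y w) n (p, q))" for w n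
  have \<Omega>_add: "\<Omega> w (n + int M) = (x1 - x2) ^ M \<star> \<Omega> w n" for w n M
  proof (induction M)
    case (Suc M)
    have "\<Omega> w ((n + int M) + 1) = (x1 - x2) \<star> \<Omega> w (n + int M)"
      unfolding \<Omega>_def borch_Suc[OF assms(2,3)]
      by (auto simp: fun_eq_iff field_simps_lin[OF assms(1)] algebra_simps)
    then show ?case using Suc by (simp add: act_mult add_ac)
  qed simp
  have b_kill: "b ^ k \<star> \<Omega> w n = 0" if "n \<ge> 0" for w n
  proof
    fix e :: "int \<times> int \<times> int"
    obtain y p q where e: "e = (y, p, q)" by (cases e)
    have loc: "((xx ^ T - yy ^ T) ^ k \<star> borch A \<alpha> w n) (p, q) = 0" for w
      using borch_local[OF assms(2,3,6) that, of w] by simp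
    have "(b ^ k \<star> \<Omega> w n) e = Z y (((xx ^ T - yy ^ T) ^ k \<star> borch A \<alpha> w n) (p, q)) -
        ((xx ^ T - yy ^ T) ^ k \<star> borch A \<alpha> (Z y w) n) (p, q)"
      unfolding b_def \<Omega>_def e mon_power act_binomial
      by (simp add: field_simps_lin[OF assms(1)] zero_prod_def scale_right_diff_distrib sum_subtractf)
    then show "(b ^ k \<star> \<Omega> w n) e = 0 e" by (simp add: loc field_simps_lin[OF assms(1)])
  qed
  have ac_kill: "(a ^ k * c ^ k) \<star> \<Omega> w n = 0" for w n
  proof -
    define \<phi> where "\<phi> = (\<lambda>(y, p, q). Z y (A p (\<alpha> q w)) - A p (\<alpha> q (Z y w)))"
    define \<psi> where "\<psi> = (\<lambda>(y, p, q). Z y (\<alpha> q (A p w)) - \<alpha> q (A p (Z y w)))"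
    have ka: "a ^ k \<star> (\<lambda>(y, p, q). Z y (A p (g q)) - A p (Z y (g q))) = 0" for g
      using assms(4) unfolding a_def mon_power fun_eq_iff act_binomial quasi_local_def
      by (simp add: zero_prod_def)
    have ka': "a ^ k \<star> (\<lambda>(y, p, q). \<alpha> q (Z y (A p w)) - \<alpha> q (A p (Z y w))) = 0"
    proof
      fix e :: "int \<times> int \<times> int"
      obtain y p q where e: "e = (y, p, q)" by (cases e)
      have eq: "(a ^ k \<star> (\<lambda>(y, p, q). \<alpha> q (Z y (A p w)) - \<alpha> q (A p (Z y w)))) e =
        \<alpha> q (\<Sum>i\<le>k. ((-1) ^ i * of_nat (k choose i)) *s (Z (y + int (k - i) * int T) (A (p + int i * int T) w) -
           A (p + int i * int T) (Z (y + int (k - i) * int T) w)))"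
        unfolding a_def mon_power act_binomial field_simps_lin[OF assms(3)] e
        by (simp add: zero_prod_def)
      then show "(a ^ k \<star> (\<lambda>(y, p, q). \<alpha> q (Z y (A p w)) - \<alpha> q (A p (Z y w)))) e = 0 e"
        unfolding eq assms(4)[unfolded quasi_local_def, rule_format] by (simp add: field_simps_lin[OF assms(3)])
    qed
    have kc: "c ^ k \<star> (\<lambda>(y, p, q). Z y (\<alpha> q (g p)) - \<alpha> q (Z y (g p))) = 0" for g
      using assms(5) unfolding c_def mon_power fun_eq_iff act_binomial quasi_local_def
      by (simp add: zero_prod_def)
    have kc': "c ^ k \<star> (\<lambda>(y, p, q). A p (Z y (\<alpha> q w)) - A p (\<alpha> q (Z y w))) = 0"
    proof
      fix e :: "int \<times> int \<times> int"
      obtain y p q where e: "e = (y, p, q)" by (cases e)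
      have eq: "(c ^ k \<star> (\<lambda>(y, p, q). A p (Z y (\<alpha> q w)) - A p (\<alpha> q (Z y w)))) e =
        A p (\<Sum>i\<le>k. ((-1) ^ i * of_nat (k choose i)) *s (Z (y + int (k - i) * int T) (\<alpha> (q + int i * int T) w) -
           \<alpha> (q + int i * int T) (Z (y + int (k - i) * int T) w)))"
        unfolding c_def mon_power act_binomial field_simps_lin[OF assms(2)] e
        by (simp add: zero_prod_def)
      then show "(c ^ k \<star> (\<lambda>(y, p, q). A p (Z y (\<alpha> q w)) - A p (\<alpha> q (Z y w)))) e = 0 e"
        unfolding eq assms(5)[unfolded quasi_local_def, rule_format] by (simp add: field_simps_lin[OF assms(2)])
    qed
    have "\<phi> = (\<lambda>(y, p, q). Z y (A p (\<alpha> q w)) - A p (Z y (\<alpha> q w))) + (\<lambda>(y, p, q). A p (Z y (\<alpha> q w)) - A p (\<alpha> q (Z y w)))"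
      by (auto simp: \<phi>_def fun_eq_iff)
    then have \<phi>0: "(a ^ k * c ^ k) \<star> \<phi> = 0"
      using act_mult_eq_0[OF ka, of "c ^ k" "\<lambda>q. \<alpha> q w"] act_mult_eq_0[OF kc', of "a ^ k"]
      by (simp add: mult.commute)
    have "\<psi> = (\<lambda>(y, p, q). Z y (\<alpha> q (A p w)) - \<alpha> q (Z y (A p w))) + (\<lambda>(y, p, q). \<alpha> q (Z y (A p w)) - \<alpha> q (A p (Z y w)))"
      by (auto simp: \<psi>_def fun_eq_iff)
    then have \<psi>0: "(a ^ k * c ^ k) \<star> \<psi> = 0"
      using act_mult_eq_0[OF ka', of "c ^ k"] act_mult_eq_0[OF kc, of "a ^ k" "\<lambda>p. A p w"]
      by (simp add: mult.commute)
    have fin1: "fin_seq (\<lambda>i. \<phi> (e + (0, n - int i, int i)))" for e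
    proof -
      obtain y p q where e: "e = (y, p, q)" by (cases e)
      have "fin_seq (\<lambda>i. Z y (A (p + n - int i) (\<alpha> (q + int i) w)) - A (p + n - int i) (\<alpha> (q + int i) (Z y w)))"
        by (intro fin_seq_diff fin_seq_map[of _ "Z y"] borch_fin assms field_simps_lin(3))
      then show ?thesis by (simp add: e \<phi>_def algebra_simps)
    qed
    have fin2: "fin_seq (\<lambda>i. \<psi> (e + (0, int i, n - int i)))" for e
    proof -
      obtain y p q where e: "e = (y, p, q)" by (cases e)
      have "fin_seq (\<lambda>i. Z y (\<alpha> (q + n - int i) (A (p + int i) w)) - \<alpha> (q + n - int i) (A (p + int i) (Z y w)))"
        by (intro fin_seq_diff fin_seq_map[of _ "Z y"] borch_fin assms field_simps_lin(3))
      then show ?thesis by (simp add: e \<psi>_def algebra_simps)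
    qed
    have "\<Omega> w n = (\<lambda>e. binom_sum n (\<lambda>i. \<phi> (e + (0, n - int i, int i)))) -
        (\<lambda>e. (-1) powi n *s binom_sum n (\<lambda>i. \<psi> (e + (0, int i, n - int i))))"
    proof
      fix e :: "int \<times> int \<times> int"
      obtain y p q where e: "e = (y, p, q)" by (cases e)
      note z = field_simps_lin(3)[OF assms(1)]
      have 1: "binom_sum n (\<lambda>i. \<phi> (e + (0, n - int i, int i))) =
          Z y (binom_sum n (\<lambda>i. A (p + n - int i) (\<alpha> (q + int i) w))) - binom_sum n (\<lambda>i. A (p + n - int i) (\<alpha> (q + int i) (Z y w)))"
        using borch_fin[OF assms(2,3)]
        by (simp add: e \<phi>_def binom_sum_linear[OF field_lin[OF assms(1)]] add_diff_eq
            binom_sum_diff fin_seq_map[of _ "Z y", OF _ z])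
      have 2: "binom_sum n (\<lambda>i. \<psi> (e + (0, int i, n - int i))) =
          Z y (binom_sum n (\<lambda>i. \<alpha> (q + n - int i) (A (p + int i) w))) - binom_sum n (\<lambda>i. \<alpha> (q + n - int i) (A (p + int i) (Z y w)))"
        using borch_fin[OF assms(3,2)]
        by (simp add: e \<psi>_def binom_sum_linear[OF field_lin[OF assms(1)]] add_diff_eq
            binom_sum_diff fin_seq_map[of _ "Z y", OF _ z])
      show "\<Omega> w n e = ((\<lambda>e. binom_sum n (\<lambda>i. \<phi> (e + (0, n - int i, int i)))) -
        (\<lambda>e. (-1) powi n *s binom_sum n (\<lambda>i. \<psi> (e + (0, int i, n - int i))))) e"
        unfolding minus_apply 1 2
        by (simp add: e \<Omega>_def borch_def field_simps_lin[OF assms(1)] algebra_simps scale_right_diff_distrib)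
    qed
    moreover have "(a ^ k * c ^ k) \<star> (\<lambda>e. binom_sum n (\<lambda>i. \<phi> (e + (0, n - int i, int i)))) = 0"
    proof
      fix e
      show "((a ^ k * c ^ k) \<star> (\<lambda>e. binom_sum n (\<lambda>i. \<phi> (e + (0, n - int i, int i))))) e = 0 e"
        by (subst act_binom_sum[OF fin1]) (simp only: act_shift \<phi>0, simp)
    qed
    moreover have "(a ^ k * c ^ k) \<star> (\<lambda>e. binom_sum n (\<lambda>i. \<psi> (e + (0, int i, n - int i)))) = 0"
    proof
      fix e
      show "((a ^ k * c ^ k) \<star> (\<lambda>e. binom_sum n (\<lambda>i. \<psi> (e + (0, int i, n - int i))))) e = 0 e"
        by (subst act_binom_sum[OF fin2]) (simp only: act_shift \<psi>0, simp)
    qed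
    ultimately show ?thesis by (simp only: act_diff_right act_scale_right) (simp add: fun_eq_iff)
  qed
  have "c = a + b" by (simp add: a_def b_def c_def)
  then obtain u v where uv: "c ^ (k + (k + L)) = a ^ k * u + b ^ (k + L) * v"
    using add_power_split by blast
  obtain N where N: "b = (x1 - x2) * N" using power_diff_dvd[of x1 x2 T] by (auto simp: b_def dvd_def)
  have kill: "c ^ (3 * k + L) \<star> \<Omega> w n = 0" for w
  proof -
    have "c ^ (3 * k + L) = u * (a ^ k * c ^ k) + c ^ k * v * N ^ L * (b ^ k * (x1 - x2) ^ L)"
    proof -
      have "3 * k + L = k + (k + (k + L))" by simp
      then have "c ^ (3 * k + L) = c ^ k * c ^ (k + (k + L))" by (simp only: power_add)
      also have "\<dots> = u * (a ^ k * c ^ k) + c ^ k * v * (b ^ k * b ^ L)"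
        unfolding uv power_add[of b k L] by (simp add: algebra_simps)
      also have "b ^ L = (x1 - x2) ^ L * N ^ L" by (simp add: N power_mult_distrib)
      finally show ?thesis by (simp add: mult_ac)
    qed
    moreover have "(b ^ k * (x1 - x2) ^ L) \<star> \<Omega> w n = 0"
      using b_kill[of "n + int L" w] assms(7) by (simp add: act_mult \<Omega>_add)
    ultimately show ?thesis using ac_kill by (simp add: act_mult_eq_0)
  qed
  define M where "M = nat (int k - n)"
  have np: "nprod A \<alpha> n q w = (pev rr (gpol k M) \<star> borch A \<alpha> w n) (0, q)" for q w
    by (rule nprod_eq[OF assms(2,3,6)]) (simp add: M_def)
  \<comment> \<open>The kernel commutes with c, and c does not move the middle exponent, so the
    vanishing of c^(3k+L) on \<Omega> passes to the entries with middle exponent 0.\<close>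
  have comm: "Z y (nprod A \<alpha> n q w) - nprod A \<alpha> n q (Z y w) = (pev (mon (0, 1, -1)) (gpol k M) \<star> \<Omega> w n) (y, 0, q)" for y q w
    unfolding np act_pev \<Omega>_def
    by (simp add: field_simps_lin[OF assms(1)] scale_right_diff_distrib sum_subtractf)
  show ?thesis
    unfolding quasi_local_def
  proof (intro allI)
    fix w p q
    have "(c ^ (3 * k + L) \<star> (pev (mon (0, 1, -1)) (gpol k M) \<star> \<Omega> w n)) (p, 0, q) = 0"
      by (simp add: act_commute[of "c ^ (3 * k + L)"] kill)
    then show "(\<Sum>i\<le>3 * k + L. ((- 1) ^ i * of_nat (3 * k + L choose i)) *s
       (Z (p + int (3 * k + L - i) * int T) (nprod A \<alpha> n (q + int i * int T) w) -
        nprod A \<alpha> n (q + int i * int T) (Z (p + int (3 * k + L - i) * int T) w))) = 0"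
      unfolding comm c_def mon_power act_binomial by (simp add: zero_prod_def)
  qed
qed

section \<open>The commutator of two products\<close>

lemma borch_zero_right: "is_field A \<Longrightarrow> borch A 0 w n = 0"
  by (auto simp: borch_def fun_eq_iff field_simps_lin)

lemma borch_sum_right:
  assumes "is_field A" "\<And>i. i \<in> I \<Longrightarrow> is_field (V i)"
  shows "is_field (\<lambda>q w. \<Sum>i\<in>I. c i *s V i (q - d i) w)"
    and "borch A (\<lambda>q w. \<Sum>i\<in>I. c i *s V i (q - d i) w) w m (p, q) = (\<Sum>i\<in>I. c i *s borch A (V i) w m (p, q - d i))"
proof -
  have "is_field (\<lambda>q w. \<Sum>i\<in>I. c i *s V i (q - d i) w) \<and>
    borch A (\<lambda>q w. \<Sum>i\<in>I. c i *s V i (q - d i) w) w m (p, q) = (\<Sum>i\<in>I. c i *s borch A (V i) w m (p, q - d i))"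
    using assms(2)
  proof (induction I rule: infinite_finite_induct)
    case (insert i I)
    define X where "X = (\<lambda>q w. c i *s V i (q - d i) w)"
    have shift: "is_field (\<lambda>q w. V i (q - d i) w)"
      unfolding is_field_def
    proof (intro conjI allI)
      fix w
      obtain N where "\<forall>n\<ge>N. V i n w = 0" using field_bound insert.prems by blast
      then show "\<exists>N. \<forall>n\<ge>N. V i (n - d i) w = 0" by (intro exI[of _ "N + d i"]) simp
    qed (use insert.prems field_lin in simp)
    have "borch A (\<lambda>q w. V i (q - d i) w) w m (p, q) = borch A (V i) w m (p, q - d i)"
      by (simp add: borch_def algebra_simps)
    then have X: "is_field X" "borch A X w m (p, q) = c i *s borch A (V i) w m (p, q - d i)"
      unfolding X_def using borch_scale_right[OF assms(1) shift] field_scale[OF shift] by auto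
    have "(\<lambda>q w. \<Sum>i\<in>insert i I. c i *s V i (q - d i) w) = X + (\<lambda>q w. \<Sum>i\<in>I. c i *s V i (q - d i) w)"
      using insert by (auto simp: X_def fun_eq_iff)
    then show ?case
      using insert X by (simp add: field_add borch_add_right assms(1))
  qed (use borch_zero_right[OF assms(1)] field_zero in \<open>simp_all add: zero_fun_def\<close>)
  then show "is_field (\<lambda>q w. \<Sum>i\<in>I. c i *s V i (q - d i) w)"
    and "borch A (\<lambda>q w. \<Sum>i\<in>I. c i *s V i (q - d i) w) w m (p, q) = (\<Sum>i\<in>I. c i *s borch A (V i) w m (p, q - d i))"
    by blast+
qed

lemma field_borch:
  assumes "is_field U" "is_field V"
  shows "is_field (\<lambda>q w. borch U V w n (p, q))"
  unfolding is_field_def using borch_lin[OF assms] borch_trunc[OF assms] by blast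

text \<open>Inner and outer product use the same kernel; the coefficients are then symmetric in i
  and j, which allows the comparison with the product in the opposite order.\<close>

lemma nprod_nprod:
  assumes "is_field A" "is_field U" "is_field V"
    and "quasi_local k U V" "n + int M \<ge> int k"
    and "quasi_local k A (nprod U V n)" "m + int M \<ge> int k"
  shows "nprod A (nprod U V n) m q w = (\<Sum>i\<le>degree (gpol k M). \<Sum>j\<le>degree (gpol k M).
    (coeff (gpol k M) i * coeff (gpol k M) j) *s borch2 A U V w m n (int i, int j, q - int i - int j))"
proof -
  let ?G = "gpol k M"
  have eq: "nprod U V n = (\<lambda>q w. \<Sum>j\<le>degree ?G. coeff ?G j *s borch U V w n (int j, q - int j))"
    unfolding fun_eq_iff nprod_eq[OF assms(2-5)] act_pev by simp
  have "nprod A (nprod U V n) m q w = (pev rr ?G \<star> borch A (nprod U V n) w m) (0, q)"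
    by (rule nprod_eq[OF assms(1) field_nprod[OF assms(2-4)] assms(6,7)])
  also have "\<dots> = (\<Sum>i\<le>degree ?G. coeff ?G i *s (\<Sum>j\<le>degree ?G. coeff ?G j *s
      borch A (\<lambda>q w. borch U V w n (int j, q)) w m (int i, q - int i - int j)))"
    unfolding act_pev eq
    using borch_sum_right(2)[OF assms(1) field_borch[OF assms(2,3)], where d = int and c = "coeff ?G"]
    by simp
  finally show ?thesis by (simp add: borch2_def scale_sum_right)
qed

text \<open>The order supplied by Dong's lemma grows as the exponents decrease, so k0 depends on the
  lower bounds m0 and n0. It serves all larger m and n at once because coefficients with
  neighbouring exponents are later combined under a common kernel.\<close>

lemma nprod_commutator:
  assumes "is_field A" "is_field U" "is_field V"
    and "quasi_local ka U V" "quasi_local kb A V" "quasi_local kc A U"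
  obtains k0 where "\<And>k M m n q w. k \<ge> k0 \<Longrightarrow> m0 + int M \<ge> int k \<Longrightarrow> n0 + int M \<ge> int k \<Longrightarrow> m \<ge> m0 \<Longrightarrow> n \<ge> n0 \<Longrightarrow>
    nprod A (nprod U V n) m q w - nprod U (nprod A V m) n q w =
      (pev (mon (1, 0, -1)) (gpol k M) \<star> pev (mon (0, 1, -1)) (gpol k M) \<star>
        gam (\<lambda>p\<^sub>0 p w. A p\<^sub>0 (U p w) - U p (A p\<^sub>0 w)) V w m n) (0, 0, q)"
proof -
  define kk where "kk = max ka (max kb kc)"
  define L where "L = max (nat (- m0)) (nat (- n0))"
  have loc: "quasi_local kk U V" "quasi_local kk A V" "quasi_local kk A U" "quasi_local kk U A"
    using assms(4-6) quasi_local_mono quasi_local_sym[OF assms(6)] unfolding kk_def by auto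
  have loc': "quasi_local (3 * kk + L) A (nprod U V n)" if "n \<ge> n0" for n
    by (rule dong[OF assms(1-3) loc(3,2,1)]) (use that in \<open>auto simp: L_def\<close>)
  have loc'': "quasi_local (3 * kk + L) U (nprod A V m)" if "m \<ge> m0" for m
    by (rule dong[OF assms(2,1,3) loc(4,1,2)]) (use that in \<open>auto simp: L_def\<close>)
  show ?thesis
  proof (rule that[of "3 * kk + L"])
    fix k M m n q w
    assume k: "3 * kk + L \<le> k" and M: "m0 + int M \<ge> int k" "n0 + int M \<ge> int k" and mn: "m \<ge> m0" "n \<ge> n0"
    let ?G = "gpol k M"
    let ?F = "\<lambda>p\<^sub>0 p w. A p\<^sub>0 (U p w) - U p (A p\<^sub>0 w)"
    have l: "quasi_local k U V" "quasi_local k A V" "quasi_local k A (nprod U V n)" "quasi_local k U (nprod A V m)"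
      using loc loc'[OF mn(2)] loc''[OF mn(1)] quasi_local_mono k by auto
    have "nprod A (nprod U V n) m q w = (\<Sum>i\<le>degree ?G. \<Sum>j\<le>degree ?G.
        (coeff ?G i * coeff ?G j) *s borch2 A U V w m n (int i, int j, q - int i - int j))"
      using l M mn by (intro nprod_nprod assms) auto
    moreover have "nprod U (nprod A V m) n q w = (\<Sum>j\<le>degree ?G. \<Sum>i\<le>degree ?G.
        (coeff ?G j * coeff ?G i) *s borch2 U A V w n m (int j, int i, q - int j - int i))"
      using l M mn by (intro nprod_nprod assms) auto
    then have "nprod U (nprod A V m) n q w = (\<Sum>i\<le>degree ?G. \<Sum>j\<le>degree ?G.
        (coeff ?G i * coeff ?G j) *s borch2 U A V w n m (int j, int i, q - int i - int j))"
      by (subst sum.swap) (simp add: mult.commute algebra_simps)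
    ultimately have "nprod A (nprod U V n) m q w - nprod U (nprod A V m) n q w = (\<Sum>i\<le>degree ?G. \<Sum>j\<le>degree ?G.
        (coeff ?G i * coeff ?G j) *s gam ?F V w m n (int i, int j, q - int i - int j))"
      unfolding borch2_commutator[OF assms(1-3), symmetric]
      by (simp add: scale_right_diff_distrib sum_subtractf)
    also have "\<dots> = (pev (mon (1, 0, -1)) ?G \<star> pev (mon (0, 1, -1)) ?G \<star> gam ?F V w m n) (0, 0, q)"
      unfolding act_pev by (simp add: scale_sum_right)
    finally show "nprod A (nprod U V n) m q w - nprod U (nprod A V m) n q w =
      (pev (mon (1, 0, -1)) ?G \<star> pev (mon (0, 1, -1)) ?G \<star> gam ?F V w m n) (0, 0, q)" .
  qed
qed

lemma gam_kill_local:
  assumes "is_field A" "is_field U" "is_field V" "quasi_local k A U"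
  shows "(x0 ^ T - x1 ^ T) ^ k \<star> gam (\<lambda>p\<^sub>0 p w. A p\<^sub>0 (U p w) - U p (A p\<^sub>0 w)) V w m n = 0"
proof (rule gam_kill[OF regular_commutator[OF assms(1,2)] assms(3)])
  fix g
  show "(x0 ^ T - x1 ^ T) ^ k \<star> (\<lambda>(p\<^sub>0, p, q). A p\<^sub>0 (U p (g q)) - U p (A p\<^sub>0 (g q))) = 0"
    using assms(4) unfolding mon_power fun_eq_iff act_binomial quasi_local_def
    by (simp add: zero_prod_def)
next
  fix g :: "int \<Rightarrow> 'w \<Rightarrow> 'w" and w
  assume g: "\<And>q. lin (g q)"
  show "(x0 ^ T - x1 ^ T) ^ k \<star> (\<lambda>(p\<^sub>0, p, q). g q (A p\<^sub>0 (U p w) - U p (A p\<^sub>0 w))) = 0"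
  proof
    fix e :: "int \<times> int \<times> int"
    obtain p0 p q where e: "e = (p0, p, q)" by (cases e)
    have eq: "((x0 ^ T - x1 ^ T) ^ k \<star> (\<lambda>(p\<^sub>0, p, q). g q (A p\<^sub>0 (U p w) - U p (A p\<^sub>0 w)))) e =
      g q (\<Sum>i\<le>k. ((-1) ^ i * of_nat (k choose i)) *s (A (p0 + int (k - i) * int T) (U (p + int i * int T) w) -
           U (p + int i * int T) (A (p0 + int (k - i) * int T) w)))"
      unfolding mon_power act_binomial linear_additive[OF g] e by (simp add: zero_prod_def linear_additive[OF g])
    then show "((x0 ^ T - x1 ^ T) ^ k \<star> (\<lambda>(p\<^sub>0, p, q). g q (A p\<^sub>0 (U p w) - U p (A p\<^sub>0 w)))) e = 0 e"
      unfolding eq assms(4)[unfolded quasi_local_def, rule_format] by (simp add: linear_additive[OF g])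
  qed
qed

text \<open>Below, \<open>(m, n, q)\<close> index the coefficients of \<open>z\<^sub>0\<^sup>-\<^sup>m\<^sup>-\<^sup>1 z\<^sub>1\<^sup>-\<^sup>n\<^sup>-\<^sup>1 x\<^sub>2\<^sup>-\<^sup>q\<^sup>-\<^sup>1\<close>, so that
  \<open>x\<^sub>0 = z\<^sub>0 + x\<^sub>2\<close> and \<open>x\<^sub>1 = z\<^sub>1 + x\<^sub>2\<close> become \<open>x0 + x2\<close> and \<open>x1 + x2\<close>.\<close>

lemma nprod_commutator_local:
  assumes "is_field A" "is_field U" "is_field V"
    and "quasi_local ka U V" "quasi_local kb A V" "quasi_local k A U"
  shows "((x0 + x2) ^ T - (x1 + x2) ^ T) ^ k \<star>
    (\<lambda>(m, n, q). nprod A (nprod U V n) m q w - nprod U (nprod A V m) n q w) = 0"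
proof
  fix e :: "int \<times> int \<times> int"
  obtain m0 n0 q0 where e: "e = (m0, n0, q0)" by (cases e)
  let ?F = "\<lambda>p\<^sub>0 p w. A p\<^sub>0 (U p w) - U p (A p\<^sub>0 w)"
  obtain k0 where k0: "\<And>k M m n q w. k \<ge> k0 \<Longrightarrow> m0 + int M \<ge> int k \<Longrightarrow> n0 + int M \<ge> int k \<Longrightarrow> m \<ge> m0 \<Longrightarrow> n \<ge> n0 \<Longrightarrow>
    nprod A (nprod U V n) m q w - nprod U (nprod A V m) n q w =
      (pev (mon (1, 0, -1)) (gpol k M) \<star> pev (mon (0, 1, -1)) (gpol k M) \<star> gam ?F V w m n) (0, 0, q)"
    using nprod_commutator[OF assms, of m0 n0] by blast
  define M where "M = max (nat (int k0 - m0)) (nat (int k0 - n0))"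
  define \<Lambda> where "\<Lambda> m n = pev (mon (1, 0, -1)) (gpol k0 M) \<star> pev (mon (0, 1, -1)) (gpol k0 M) \<star> gam ?F V w m n" for m n
  define \<Theta> where "\<Theta> = (\<lambda>(m, n, q). nprod A (nprod U V n) m q w - nprod U (nprod A V m) n q w)"
  \<comment> \<open>\<Theta> is read off from \<Lambda> at (0, 0, q), and \<Lambda> obeys the
    recursions of \<open>gam\<close>. Since x0 - x2 raises m by one, multiplying \<Lambda> by x0
    amounts to multiplying \<Theta> by z0 + x2; likewise for x1 and n.\<close>
  define corr where "corr \<Theta> \<Lambda> \<longleftrightarrow> (\<forall>m\<ge>m0. \<forall>n\<ge>n0. \<forall>q. \<Theta> (m, n, q) = \<Lambda> m n (0, 0, q)) \<and>
      (\<forall>m n. \<Lambda> (m + 1) n = (x0 - x2) \<star> \<Lambda> m n) \<and> (\<forall>m n. \<Lambda> m (n + 1) = (x1 - x2) \<star> \<Lambda> m n)"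
    for \<Theta> and \<Lambda> :: "int \<Rightarrow> int \<Rightarrow> int \<times> int \<times> int \<Rightarrow> 'w"
  have start: "corr \<Theta> \<Lambda>"
    unfolding corr_def
  proof (intro conjI allI impI)
    show "m0 \<le> m \<Longrightarrow> n0 \<le> n \<Longrightarrow> \<Theta> (m, n, q) = \<Lambda> m n (0, 0, q)" for m n q
      unfolding \<Theta>_def \<Lambda>_def prod.case by (rule k0) (auto simp: M_def)
    show "\<Lambda> (m + 1) n = (x0 - x2) \<star> \<Lambda> m n" for m n
      unfolding \<Lambda>_def gam_Suc_left[OF regular_commutator[OF assms(1,2)] assms(3)]
      by (simp only: act_commute[of _ "x0 - x2"])
    show "\<Lambda> m (n + 1) = (x1 - x2) \<star> \<Lambda> m n" for m n
      unfolding \<Lambda>_def gam_Suc_right[OF regular_commutator[OF assms(1,2)] assms(3)]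
      by (simp only: act_commute[of _ "x1 - x2"])
  qed
  have s0: "corr ((x0 + x2) \<star> \<Theta>) (\<lambda>m n. x0 \<star> \<Lambda> m n)" if c: "corr \<Theta> \<Lambda>" for \<Theta> \<Lambda>
  proof -
    have \<Theta>: "\<Theta> (m, n, q) = \<Lambda> m n (0, 0, q)" if "m0 \<le> m" "n0 \<le> n" for m n q
      using c that unfolding corr_def by blast
    have r: "\<Lambda> (m + 1) n = (x0 - x2) \<star> \<Lambda> m n" "\<Lambda> m (n + 1) = (x1 - x2) \<star> \<Lambda> m n" for m n
      using c unfolding corr_def by blast+
    have main: "((x0 + x2) \<star> \<Theta>) (m, n, q) = (x0 \<star> \<Lambda> m n) (0, 0, q)" if "m0 \<le> m" "n0 \<le> n" for m n q
      using fun_cong[OF r(1)[of m n], of "(0, 0, q)"] that by (simp add: \<Theta>)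
    then show ?thesis
      unfolding corr_def r using main act_commute[of x0] by blast
  qed
  have s0T: "corr ((x0 + x2) ^ j \<star> \<Theta>) (\<lambda>m n. x0 ^ j \<star> \<Lambda> m n)" if "corr \<Theta> \<Lambda>" for \<Theta> \<Lambda> j
  proof (induction j)
    case (Suc j)
    then show ?case unfolding power_Suc act_mult by (rule s0)
  qed (use that in simp)
  have s1: "corr ((x1 + x2) \<star> \<Theta>) (\<lambda>m n. x1 \<star> \<Lambda> m n)" if c: "corr \<Theta> \<Lambda>" for \<Theta> \<Lambda>
  proof -
    have \<Theta>: "\<Theta> (m, n, q) = \<Lambda> m n (0, 0, q)" if "m0 \<le> m" "n0 \<le> n" for m n q
      using c that unfolding corr_def by blast
    have r: "\<Lambda> (m + 1) n = (x0 - x2) \<star> \<Lambda> m n" "\<Lambda> m (n + 1) = (x1 - x2) \<star> \<Lambda> m n" for m n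
      using c unfolding corr_def by blast+
    have main: "((x1 + x2) \<star> \<Theta>) (m, n, q) = (x1 \<star> \<Lambda> m n) (0, 0, q)" if "m0 \<le> m" "n0 \<le> n" for m n q
      using fun_cong[OF r(2)[of m n], of "(0, 0, q)"] that by (simp add: \<Theta>)
    then show ?thesis
      unfolding corr_def r using main act_commute[of x1] by blast
  qed
  have s1T: "corr ((x1 + x2) ^ j \<star> \<Theta>) (\<lambda>m n. x1 ^ j \<star> \<Lambda> m n)" if "corr \<Theta> \<Lambda>" for \<Theta> \<Lambda> j
  proof (induction j)
    case (Suc j)
    then show ?case unfolding power_Suc act_mult by (rule s1)
  qed (use that in simp)
  have sd: "corr (\<Theta> - \<Theta>') (\<lambda>m n. \<Lambda> m n - \<Lambda>' m n)" if "corr \<Theta> \<Lambda>" "corr \<Theta>' \<Lambda>'" for \<Theta> \<Lambda> \<Theta>' \<Lambda>'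
    using that unfolding corr_def by simp
  have "corr (((x0 + x2) ^ T - (x1 + x2) ^ T) ^ j \<star> \<Theta>) (\<lambda>m n. (x0 ^ T - x1 ^ T) ^ j \<star> \<Lambda> m n)" for j
  proof (induction j)
    case (Suc j)
    then show ?case
      unfolding power_Suc act_mult act_diff by (intro sd s0T s1T)
  qed (use start in simp)
  from this[of k] have "(((x0 + x2) ^ T - (x1 + x2) ^ T) ^ k \<star> \<Theta>) e = ((x0 ^ T - x1 ^ T) ^ k \<star> \<Lambda> m0 n0) (0, 0, q0)"
    unfolding corr_def e by auto
  also have "(x0 ^ T - x1 ^ T) ^ k \<star> \<Lambda> m0 n0 = 0"
    unfolding \<Lambda>_def by (simp only: act_commute[of "(x0 ^ T - x1 ^ T) ^ k"] gam_kill_local[OF assms(1-3,6)] act_zero_right)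
  finally show "(((x0 + x2) ^ T - (x1 + x2) ^ T) ^ k \<star>
    (\<lambda>(m, n, q). nprod A (nprod U V n) m q w - nprod U (nprod A V m) n q w)) e = 0 e"
    by (simp add: \<Theta>_def)
qed

text \<open>The lowest part of (z0 + x2)^T - (z1 + x2)^T is T (z0 - z1) x2^(T-1). At the largest m
  with a nonzero entry, and the largest n for this m, raising m gives 0; so each application lowers
  the top n by one and multiplies the top entries by -T, up to a shift in q. No power can therefore
  annihilate a nonzero \<Theta>.\<close>

lemma local_zero:
  fixes \<Theta> :: "int \<times> int \<times> int \<Rightarrow> 'w"
  assumes "((x0 + x2) ^ T - (x1 + x2) ^ T) ^ k \<star> \<Theta> = 0"
    and M: "\<And>m n q. m \<ge> M \<Longrightarrow> \<Theta> (m, n, q) = 0"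
    and N: "\<And>m. \<exists>N. \<forall>n\<ge>N. \<forall>q. \<Theta> (m, n, q) = 0"
  shows "\<Theta> = 0"
proof (rule ccontr)
  assume "\<Theta> \<noteq> 0"
  then obtain e where "\<Theta> e \<noteq> 0" by (auto simp: fun_eq_iff)
  then obtain m0 n0 q0 where ne: "\<Theta> (m0, n0, q0) \<noteq> 0" by (cases e) auto
  define S where "S = {m. m \<ge> m0 \<and> (\<exists>n q. \<Theta> (m, n, q) \<noteq> 0)}"
  have "S \<subseteq> {m0..<M}"
  proof
    fix m' assume "m' \<in> S"
    then have "m0 \<le> m'" "\<not> M \<le> m'" using M unfolding S_def by blast+
    then show "m' \<in> {m0..<M}" by simp
  qed
  then have fS: "finite S" by (rule finite_subset) simp
  have "m0 \<in> S" using ne by (auto simp: S_def)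
  define m where "m = Max S"
  have "m \<in> S" unfolding m_def using fS \<open>m0 \<in> S\<close> by (intro Max_in) auto
  have m: "\<Theta> (m', n, q) = 0" if "m' > m" for m' n q
  proof (rule ccontr)
    assume "\<Theta> (m', n, q) \<noteq> 0"
    then have "m' \<in> S" using that \<open>m \<in> S\<close> by (auto simp: S_def)
    then have "m' \<le> m" unfolding m_def by (rule Max_ge[OF fS])
    then show False using that by simp
  qed
  obtain n1 q1 where n1: "\<Theta> (m, n1, q1) \<noteq> 0" using \<open>m \<in> S\<close> by (auto simp: S_def)
  obtain N0 where N0: "\<forall>n\<ge>N0. \<forall>q. \<Theta> (m, n, q) = 0" using N by blast
  define R where "R = {n. n \<ge> n1 \<and> (\<exists>q. \<Theta> (m, n, q) \<noteq> 0)}"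
  have "R \<subseteq> {n1..<N0}"
  proof
    fix n' assume "n' \<in> R"
    then have "n1 \<le> n'" "\<not> N0 \<le> n'" using N0 unfolding R_def by blast+
    then show "n' \<in> {n1..<N0}" by simp
  qed
  then have fR: "finite R" by (rule finite_subset) simp
  have "n1 \<in> R" using n1 by (auto simp: R_def)
  define n where "n = Max R"
  have "n \<in> R" unfolding n_def using fR \<open>n1 \<in> R\<close> by (intro Max_in) auto
  have n: "\<Theta> (m, n', q) = 0" if "n' > n" for n' q
  proof (rule ccontr)
    assume "\<Theta> (m, n', q) \<noteq> 0"
    then have "n' \<in> R" using that \<open>n \<in> R\<close> by (auto simp: R_def)
    then have "n' \<le> n" unfolding n_def by (rule Max_ge[OF fR])
    then show False using that by simp
  qed
  obtain q where q: "\<Theta> (m, n, q) \<noteq> 0" using \<open>n \<in> R\<close> by (auto simp: R_def)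
  define lead where "lead \<Theta> n c \<longleftrightarrow> (\<forall>m' n q. m' > m \<longrightarrow> \<Theta> (m', n, q) = 0) \<and>
      (\<forall>n' q. n' > n \<longrightarrow> \<Theta> (m, n', q) = 0) \<and> (\<forall>q. \<Theta> (m, n, q) = c q)"
    for \<Theta> :: "int \<times> int \<times> int \<Rightarrow> 'w" and n c
  have start: "lead \<Theta> n (\<lambda>q. \<Theta> (m, n, q))" using m n by (auto simp: lead_def)
  have step: "lead (((x0 + x2) ^ T - (x1 + x2) ^ T) \<star> \<Theta>) (n - 1) (\<lambda>q. (- of_nat T) *s c (q + int T - 1))"
    if l: "lead \<Theta> n c" for \<Theta> n c
  proof -
    have a: "((x0 + x2) ^ j \<star> \<Theta>) (m', n', q) = (if m' > m then 0 else \<Theta> (m, n', q + int j))" if "m' \<ge> m" for m' n' q j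
      using that
    proof (induction j arbitrary: m' n' q)
      case 0
      then show ?case using l by (auto simp: lead_def)
    next
      case (Suc j)
      show ?case
        using Suc.IH[of "m' + 1" n' q] Suc.IH[of m' n' "q + 1"] Suc.prems
        by (simp add: act_mult add_ac)
    qed
    have b: "((x1 + x2) ^ j \<star> \<Theta>) (m', n', q) = 0" if "m' > m \<or> (m' = m \<and> n' > n)" for m' n' q j
      using that
    proof (induction j arbitrary: m' n' q)
      case 0
      then show ?case using l by (auto simp: lead_def)
    next
      case (Suc j)
      then show ?case
        using Suc.IH[of m' "n' + 1" q] Suc.IH[of m' n' "q + 1"] by (auto simp: act_mult)
    qed
    have c: "((x1 + x2) ^ j \<star> \<Theta>) (m, n, q) = c (q + int j)" for q j
    proof (induction j arbitrary: q)
      case 0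
      then show ?case using l by (simp add: lead_def)
    next
      case (Suc j)
      then show ?case using b[of m "n + 1" j q] Suc.IH[of "q + 1"] by (simp add: act_mult add_ac)
    qed
    \<comment> \<open>Of (x1 + x2)^j only x2^j and j x1 x2^(j-1) contribute to row n - 1. For j = T
      the first cancels against the contribution of (x0 + x2)^T.\<close>
    have d: "((x1 + x2) ^ j \<star> \<Theta>) (m, n - 1, q) = \<Theta> (m, n - 1, q + int j) + of_nat j *s c (q + int j - 1)" for q j
    proof (induction j arbitrary: q)
      case (Suc j)
      then show ?case using c[of j q] Suc.IH[of "q + 1"] by (simp add: act_mult scale_left_distrib add_ac)
    qed simp
    show ?thesis
      unfolding lead_def
    proof (intro conjI allI impI)
      fix m' n' q assume "m < m'"
      then show "(((x0 + x2) ^ T - (x1 + x2) ^ T) \<star> \<Theta>) (m', n', q) = 0"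
        using a[of m' T n' q] b[of m' n' T q] by simp
    next
      fix n' q assume "n - 1 < n'"
      then consider "n' = n" | "n' > n" by linarith
      then show "(((x0 + x2) ^ T - (x1 + x2) ^ T) \<star> \<Theta>) (m, n', q) = 0"
      proof cases
        case 1
        then show ?thesis using a[of m T n q] c[of T q] l by (simp add: lead_def)
      next
        case 2
        then show ?thesis using a[of m T n' q] b[of m n' T q] l by (simp add: lead_def)
      qed
    next
      fix q
      show "(((x0 + x2) ^ T - (x1 + x2) ^ T) \<star> \<Theta>) (m, n - 1, q) = (- of_nat T) *s c (q + int T - 1)"
        using a[of m T "n - 1" q] d[of T q] by simp
    qed
  qed
  have "\<exists>a c'. a \<noteq> 0 \<and> lead (((x0 + x2) ^ T - (x1 + x2) ^ T) ^ j \<star> \<Theta>) (n - int j) (\<lambda>q. a *s \<Theta> (m, n, q + c'))" for j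
  proof (induction j)
    case 0
    show ?case by (rule exI[of _ 1], rule exI[of _ 0]) (use start in simp)
  next
    case (Suc j)
    then obtain a c' where "a \<noteq> 0" and
      l: "lead (((x0 + x2) ^ T - (x1 + x2) ^ T) ^ j \<star> \<Theta>) (n - int j) (\<lambda>q. a *s \<Theta> (m, n, q + c'))" by blast
    have "lead (((x0 + x2) ^ T - (x1 + x2) ^ T) ^ Suc j \<star> \<Theta>) (n - int (Suc j))
        (\<lambda>q. (- of_nat T * a) *s \<Theta> (m, n, q + (int T - 1 + c')))"
      using step[OF l] unfolding power_Suc act_mult by (simp add: algebra_simps)
    moreover have "- of_nat T * a \<noteq> 0" using \<open>a \<noteq> 0\<close> T_pos by simp
    ultimately show ?case by blast
  qed
  then obtain a c' where "a \<noteq> 0" "lead (0 :: int \<times> int \<times> int \<Rightarrow> 'w) (n - int k) (\<lambda>q. a *s \<Theta> (m, n, q + c'))"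
    unfolding assms(1)[symmetric] by blast
  then have "a *s \<Theta> (m, n, (q - c') + c') = 0" unfolding lead_def zero_fun_apply by (metis (no_types))
  then show False using q \<open>a \<noteq> 0\<close> by simp
qed

end

section \<open>Contributions of the separate roots of unity to a commutator\<close>

lemma pev_diff_dvd: "r - s dvd pev r P - pev s P"
proof -
  have "r - s dvd (\<Sum>i\<le>degree P. const (coeff P i) * (r ^ i - s ^ i))"
    by (intro dvd_sum dvd_mult power_diff_dvd)
  then show ?thesis
    by (simp add: const.ev_altdef sum_subtractf right_diff_distrib)
qed

lemma pev_pcompose: "pev r (pcompose P [:0, \<zeta>:]) = pev (const \<zeta> * r) P"
proof (induction P)
  case (pCons a P)
  have "pev r [:0, \<zeta>:] = const \<zeta> * r" by (simp add: const.ev_pCons mult.commute)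
  then show ?case
    using pCons by (simp add: pcompose_pCons const.ev_add const.ev_mult const.ev_smult const.ev_pCons mult_ac)
qed simp

context cyclic_space
begin

lemma gam_Suc_left_power:
  assumes "regular F" "is_field V"
  shows "(x0 - x2) ^ L \<star> gam F V w m n = gam F V w (m + int L) n"
proof (induction L)
  case (Suc L)
  then show ?case
    using gam_Suc_left[OF assms, of w "m + int L" n] by (simp only: power_Suc act_mult) (simp add: add_ac)
qed simp

lemma gam_Suc_right_power:
  assumes "regular F" "is_field V"
  shows "(x1 - x2) ^ K \<star> gam F V w m n = gam F V w m (n + int K)"
proof (induction K)
  case (Suc K)
  then show ?case
    using gam_Suc_right[OF assms, of w m "n + int K"] by (simp only: power_Suc act_mult) (simp add: add_ac)
qed simp

abbreviation y2 :: "int \<times> int \<times> int \<Rightarrow>\<^sub>0 complex" where "y2 \<equiv> mon (0, 0, -1)"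
abbreviation r0 :: "int \<times> int \<times> int \<Rightarrow>\<^sub>0 complex" where "r0 \<equiv> mon (1, 0, -1)"
abbreviation r1 :: "int \<times> int \<times> int \<Rightarrow>\<^sub>0 complex" where "r1 \<equiv> mon (0, 1, -1)"

lemma ratio_simps: "y2 * x2 = 1" "r0 = x0 * y2" "r1 = x1 * y2"
    "r0 - 1 = y2 * (x0 - x2)" "r1 - 1 = y2 * (x1 - x2)"
proof -
  show y: "y2 * x2 = 1" "r0 = x0 * y2" "r1 = x1 * y2" by (auto simp: mult_single zero_prod_def[symmetric])
  show "r0 - 1 = y2 * (x0 - x2)" "r1 - 1 = y2 * (x1 - x2)"
    by (simp_all add: right_diff_distrib y(1)) (simp_all add: y(2,3) mult.commute)
qed

text \<open>Setting r = 1 and s = \<zeta> r gives s = \<zeta>, a root of \<open>hpol\<close>; hence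
  hpol(s) lies in the ideal generated by r - 1 and s - \<zeta> r.\<close>

lemma hpol_twist:
  assumes "\<zeta> \<noteq> 1" "\<zeta> ^ T = 1"
  obtains e z where "pev s hpol = (r - 1) * e + (s - const \<zeta> * r) * z"
proof -
  have "(\<zeta> - 1) * (\<Sum>i<T. \<zeta> ^ i) = 0" using assms(2) by (simp add: power_diff_1_eq[symmetric])
  then have "poly (pcompose hpol [:0, \<zeta>:]) 1 = 0"
    using assms(1) by (simp add: poly_pcompose hpol_def poly_sum poly_monom)
  then have "[:-1, 1:] dvd pcompose hpol [:0, \<zeta>:]" by (simp add: poly_eq_0_iff_dvd)
  then have "r - 1 dvd pev (const \<zeta> * r) hpol"
    using const.ev_dvd[of "[:-1, 1:]" "pcompose hpol [:0, \<zeta>:]" r] by (simp add: pev_pcompose pev_linear)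
  then obtain e where e: "pev (const \<zeta> * r) hpol = (r - 1) * e" by (auto simp: dvd_def)
  obtain z where "pev s hpol - pev (const \<zeta> * r) hpol = (s - const \<zeta> * r) * z"
    using pev_diff_dvd[of s "const \<zeta> * r" hpol] unfolding dvd_def by blast
  then have "pev s hpol = (r - 1) * e + (s - const \<zeta> * r) * z" by (simp only: e diff_eq_eq add.commute)
  then show ?thesis by (rule that)
qed

text \<open>The coefficients of a term of a commutator supported on \<open>x\<^sub>0 = \<zeta>\<^sup>-\<^sup>1 x\<^sub>1\<close> with central
  charge \<open>c\<close>.\<close>

definition delta_term :: "complex \<Rightarrow> complex \<Rightarrow> (int \<Rightarrow> 'w \<Rightarrow> 'w) \<Rightarrow> int \<Rightarrow> int \<Rightarrow> 'w \<Rightarrow> 'w" where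
  "delta_term \<zeta> c C p\<^sub>0 p w = \<zeta> powi p\<^sub>0 *s (C (p\<^sub>0 + p) w + (if p\<^sub>0 + p = 0 then (of_int p\<^sub>0 * c) *s w else 0))"

lemma delta_term_lin: "is_field C \<Longrightarrow> lin (delta_term \<zeta> c C p\<^sub>0 p)"
  unfolding delta_term_def[abs_def]
  by (cases "p\<^sub>0 + p = 0") (auto intro!: lin_scaled lin_add field_lin[of C] lin_zero lin_scale)

lemma regular_delta_term:
  assumes "is_field C"
  shows "regular (delta_term \<zeta> c C)"
  unfolding regular_def
proof (intro conjI allI)
  fix w p0 p
  obtain N where N: "\<forall>n\<ge>N. C n w = 0" using field_bound[OF assms] by blast
  define N' where "N' = nat (max N 1 - p0 - p)"
  have "delta_term \<zeta> c C (p0 + int i) (p + int j) w = 0" if "N' \<le> i \<or> N' \<le> j" for i j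
  proof -
    have "p0 + int i + (p + int j) \<ge> max N 1" using that unfolding N'_def by linarith
    then show ?thesis using N by (auto simp: delta_term_def)
  qed
  then show "dfin (\<lambda>i j. delta_term \<zeta> c C (p0 + int i) (p + int j) w)" unfolding dfin_def by blast
qed (use linear_additive(3)[OF delta_term_lin[OF assms]] in simp)

text \<open>The family consists of a delta function at x0 = \<zeta> x1 and its first derivative: one
  factor x0 - \<zeta> x1 removes f and replaces the linear weight by a constant, the second removes
  the rest.\<close>

lemma delta_term_kill:
  assumes "\<zeta> \<noteq> 0"
  shows "((x0 - const \<zeta> * x1)\<^sup>2 \<star> (\<lambda>(p\<^sub>0, p, q). \<zeta> powi p\<^sub>0 *s (f (p\<^sub>0 + p) q + of_int p\<^sub>0 *s g (p\<^sub>0 + p) q))) = 0"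
    (is "_ \<star> ?\<phi> = 0")
proof -
  have z: "\<zeta> powi (n + 1) = \<zeta> * \<zeta> powi n" for n
    using assms by (simp add: power_int_add mult.commute)
  have "(x0 - const \<zeta> * x1) \<star> ?\<phi> = (\<lambda>(p\<^sub>0, p, q). \<zeta> powi (p\<^sub>0 + 1) *s g (p\<^sub>0 + p + 1) q)" (is "_ = ?\<psi>")
    unfolding act_diff act_mult
    by (auto simp: fun_eq_iff z scale_right_distrib scale_left_distrib algebra_simps)
  moreover have "(x0 - const \<zeta> * x1) \<star> ?\<psi> = 0"
    unfolding act_diff act_mult
    by (auto simp: fun_eq_iff z algebra_simps)
  ultimately show ?thesis by (simp only: power2_eq_square act_mult)
qed

lemma gam_delta_term_kill:
  assumes "is_field C" "is_field V" "\<zeta> \<noteq> 0"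
  shows "(x0 - const \<zeta> * x1)\<^sup>2 \<star> gam (delta_term \<zeta> c C) V w m n = 0"
proof (rule gam_kill[OF regular_delta_term[OF assms(1)] assms(2)])
  fix g :: "int \<Rightarrow> 'w"
  show "(x0 - const \<zeta> * x1)\<^sup>2 \<star> (\<lambda>(p\<^sub>0, p, q). delta_term \<zeta> c C p\<^sub>0 p (g q)) = 0"
    using delta_term_kill[OF assms(3), of "\<lambda>n q. C n (g q)" "\<lambda>n q. if n = 0 then c *s g q else 0"]
    by (simp add: delta_term_def if_distrib[of "\<lambda>x. of_int _ *s x"] cong: if_cong)
next
  fix g :: "int \<Rightarrow> 'w \<Rightarrow> 'w" and w
  assume g: "\<And>q. lin (g q)"
  have "(\<lambda>(p\<^sub>0, p, q). g q (delta_term \<zeta> c C p\<^sub>0 p w)) = (\<lambda>(p\<^sub>0, p, q). \<zeta> powi p\<^sub>0 *s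
      (g q (C (p\<^sub>0 + p) w) + of_int p\<^sub>0 *s (if p\<^sub>0 + p = 0 then c *s g q w else 0)))"
    by (auto simp: fun_eq_iff delta_term_def linear_additive[OF g])
  then show "(x0 - const \<zeta> * x1)\<^sup>2 \<star> (\<lambda>(p\<^sub>0, p, q). g q (delta_term \<zeta> c C p\<^sub>0 p w)) = 0"
    using delta_term_kill[OF assms(3), of "\<lambda>n q. g q (C n w)" "\<lambda>n q. if n = 0 then c *s g q w else 0"] by simp
qed

text \<open>At m = n = 0 the central part cancels and a delta function times [C, V] is left, in
  which the first two modes enter C only through their sum; so quasi-locality of C and V applies in
  x1 and x2. Larger exponents merely multiply by powers of x0 - x2 and x1 - x2.\<close>

lemma gam_delta_term_local:
  assumes "is_field C" "is_field V" "quasi_local k C V" "m \<ge> 0" "n \<ge> 0"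
  shows "(x1 ^ T - x2 ^ T) ^ k \<star> gam (delta_term \<zeta> c C) V w m n = 0"
proof -
  have "gam (delta_term \<zeta> c C) V w 0 0 = (\<lambda>(p\<^sub>0, p, q). \<zeta> powi p\<^sub>0 *s (C (p\<^sub>0 + p) (V q w) - V q (C (p\<^sub>0 + p) w)))"
    by (auto simp: gam_def fun_eq_iff binom_sum_0 delta_term_def field_simps_lin[OF assms(2)]
        scale_right_distrib scale_right_diff_distrib)
  moreover have "(x1 ^ T - x2 ^ T) ^ k \<star> (\<lambda>(p\<^sub>0, p, q). \<zeta> powi p\<^sub>0 *s (C (p\<^sub>0 + p) (V q w) - V q (C (p\<^sub>0 + p) w))) = 0"
  proof
    fix e :: "int \<times> int \<times> int"
    obtain p0 p q where e: "e = (p0, p, q)" by (cases e)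
    have eq: "((x1 ^ T - x2 ^ T) ^ k \<star> (\<lambda>(p\<^sub>0, p, q). \<zeta> powi p\<^sub>0 *s (C (p\<^sub>0 + p) (V q w) - V q (C (p\<^sub>0 + p) w)))) e =
      \<zeta> powi p0 *s (\<Sum>i\<le>k. ((-1) ^ i * of_nat (k choose i)) *s
        (C ((p0 + p) + int (k - i) * int T) (V (q + int i * int T) w) -
         V (q + int i * int T) (C ((p0 + p) + int (k - i) * int T) w)))"
      unfolding mon_power act_binomial e by (simp add: zero_prod_def scale_sum_right mult.commute add.assoc)
    show "((x1 ^ T - x2 ^ T) ^ k \<star> (\<lambda>(p\<^sub>0, p, q). \<zeta> powi p\<^sub>0 *s (C (p\<^sub>0 + p) (V q w) - V q (C (p\<^sub>0 + p) w)))) e = 0 e"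
      unfolding eq assms(3)[unfolded quasi_local_def, rule_format] by simp
  qed
  ultimately have 0: "(x1 ^ T - x2 ^ T) ^ k \<star> gam (delta_term \<zeta> c C) V w 0 0 = 0" by simp
  have "gam (delta_term \<zeta> c C) V w m n = (x0 - x2) ^ nat m \<star> (x1 - x2) ^ nat n \<star> gam (delta_term \<zeta> c C) V w 0 0"
    unfolding gam_Suc_right_power[OF regular_delta_term[OF assms(1)] assms(2)]
      gam_Suc_left_power[OF regular_delta_term[OF assms(1)] assms(2)]
    using assms(4,5) by simp
  then show ?thesis by (simp only: act_commute[of "(x1 ^ T - x2 ^ T) ^ k"] 0 act_zero_right)
qed

text \<open>Modulo s = r0 - \<zeta> r1 the polynomial hpol(r0) is divisible by r1 - 1 and hpol(r1)
  by r0 - 1, while s^2 annihilates the term. So the kernel in r0 supplies factors that raise n, the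
  one in r1 factors that raise m and k' factors hpol(r1) for the quasi-locality of C and V.\<close>

lemma gam_delta_term_zero:
  assumes "is_field C" "is_field V" "quasi_local k' C V" "\<zeta> \<noteq> 1" "\<zeta> ^ T = 1"
    and "k \<ge> 2 * k' + nat (- m) + nat (- n) + 2" "hpol ^ k dvd G"
  shows "pev r0 G \<star> pev r1 G \<star> gam (delta_term \<zeta> c C) V w m n = 0"
proof -
  let ?\<Gamma> = "gam (delta_term \<zeta> c C) V w"
  note reg = regular_delta_term[OF assms(1), of \<zeta> c]
  \<comment> \<open>K raises n to a nonnegative value and leaves k' factors x1 - x2 over; L raises
    m. The kernels then have to contain hpol(r0)^(K+1) and hpol(r1)^(L+1+k'), which the bound on k
    allows.\<close>
  define K L where "K = nat (- n) + k'" and "L = nat (- m)"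
  have \<zeta>0: "\<zeta> \<noteq> 0" using assms(5) T_pos by (metis zero_neq_one zero_power)
  define s where "s = r0 - const \<zeta> * r1"
  have s_kill: "s\<^sup>2 \<star> ?\<Gamma> m n = 0"
  proof -
    have "s = y2 * (x0 - const \<zeta> * x1)" unfolding s_def ratio_simps(2,3) by (simp add: algebra_simps)
    then have "s\<^sup>2 = y2\<^sup>2 * (x0 - const \<zeta> * x1)\<^sup>2" by (simp add: power_mult_distrib)
    then show ?thesis by (simp only: act_mult gam_delta_term_kill[OF assms(1,2) \<zeta>0] act_zero_right)
  qed
  obtain e1 z1 where "pev r0 hpol = (r1 - 1) * e1 + s * z1"
    using hpol_twist[OF assms(4,5), of r0 r1] unfolding s_def by blast
  then obtain a1 b1 where h0: "pev r0 hpol ^ Suc K = ((r1 - 1) * e1) ^ K * a1 + (s * z1)\<^sup>2 * b1"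
    using power_add_mod_square by metis
  have "1 / \<zeta> \<noteq> 1" "(1 / \<zeta>) ^ T = 1" using assms(4,5) by (auto simp: power_one_over)
  then obtain e0 z0 where "pev r1 hpol = (r0 - 1) * e0 + (r1 - const (1 / \<zeta>) * r0) * z0"
    using hpol_twist by blast
  moreover have "r1 - const (1 / \<zeta>) * r0 = s * const (- 1 / \<zeta>)"
  proof -
    have "const \<zeta> * const (- 1 / \<zeta>) = (- 1 :: int \<times> int \<times> int \<Rightarrow>\<^sub>0 complex)"
    proof -
      have "const \<zeta> * const (- 1 / \<zeta>) = (const (- 1) :: int \<times> int \<times> int \<Rightarrow>\<^sub>0 complex)"
        using \<zeta>0 by (simp only: mult_single) simp
      then show ?thesis by (simp only: single_uminus single_one)
    qed
    moreover have "(const \<zeta> * r1) * const (- 1 / \<zeta>) = (const \<zeta> * const (- 1 / \<zeta>)) * r1" by (simp only: mult_ac)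
    ultimately have "(const \<zeta> * r1) * const (- 1 / \<zeta>) = - r1" by (simp only: mult_minus_left mult_1)
    moreover have "const (- 1 / \<zeta>) = - (const (1 / \<zeta>) :: int \<times> int \<times> int \<Rightarrow>\<^sub>0 complex)"
      by (simp add: single_uminus)
    ultimately show ?thesis unfolding s_def by (simp add: left_diff_distrib right_diff_distrib mult.commute)
  qed
  ultimately have "pev r1 hpol = (r0 - 1) * e0 + s * (const (- 1 / \<zeta>) * z0)" by (simp add: mult.assoc)
  then obtain a0 b0 where h1: "pev r1 hpol ^ Suc L = ((r0 - 1) * e0) ^ L * a0 + (s * (const (- 1 / \<zeta>) * z0))\<^sup>2 * b0"
    using power_add_mod_square by metis
  have main: "((r1 - 1) ^ K * (r0 - 1) ^ L * pev r1 hpol ^ k') \<star> ?\<Gamma> m n = 0"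
  proof -
    have "((r1 - 1) ^ K * (r0 - 1) ^ L * pev r1 hpol ^ k') \<star> ?\<Gamma> m n =
        (y2 ^ K * y2 ^ L * pev r1 hpol ^ k') \<star> ((x0 - x2) ^ L \<star> (x1 - x2) ^ K \<star> ?\<Gamma> m n)"
      unfolding ratio_simps(4,5) act_mult[symmetric] by (simp only: power_mult_distrib mult_ac)
    also have "(x0 - x2) ^ L \<star> (x1 - x2) ^ K \<star> ?\<Gamma> m n = ?\<Gamma> (m + int L) ((n + int (nat (- n))) + int k')"
      unfolding gam_Suc_right_power[OF reg assms(2)] gam_Suc_left_power[OF reg assms(2)]
      by (simp add: K_def add.assoc)
    also have "\<dots> = (x1 - x2) ^ k' \<star> ?\<Gamma> (m + int L) (n + int (nat (- n)))"
      by (rule gam_Suc_right_power[OF reg assms(2), symmetric])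
    also have "(y2 ^ K * y2 ^ L * pev r1 hpol ^ k') \<star> \<dots> = (y2 ^ K * y2 ^ L) \<star> ((pev r1 hpol ^ k' * (x1 - x2) ^ k') \<star> ?\<Gamma> (m + int L) (n + int (nat (- n))))"
      by (simp only: act_mult)
    also have "pev r1 hpol ^ k' * (x1 - x2) ^ k' = (const (1 / of_nat T) * x2 * y2 ^ T) ^ k' * (x1 ^ T - x2 ^ T) ^ k'"
      using hpol_unit[OF ratio_simps(1), of x1 k'] unfolding ratio_simps(3)[symmetric] const.ev_power .
    also have "\<dots> \<star> ?\<Gamma> (m + int L) (n + int (nat (- n))) = 0"
      by (rule act_mult_eq_0, rule gam_delta_term_local[OF assms(1-3)]) (auto simp: L_def)
    finally show ?thesis by (simp only: act_zero_right)
  qed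
  have "(pev r0 hpol ^ Suc K * (pev r1 hpol ^ Suc L * pev r1 hpol ^ k')) \<star> ?\<Gamma> m n = 0"
  proof -
    define B d where "B = ((r0 - 1) * e0) ^ L * a0" and "d = (const (- 1 / \<zeta>) * z0)\<^sup>2 * b0"
    have h1': "pev r1 hpol ^ Suc L = B + s\<^sup>2 * d" unfolding h1 B_def d_def by (simp add: power_mult_distrib mult_ac)
    have h0': "pev r0 hpol ^ Suc K = ((r1 - 1) * e1) ^ K * a1 + s\<^sup>2 * (z1\<^sup>2 * b1)"
      unfolding h0 by (simp add: power_mult_distrib mult_ac)
    have "(A + S * b) * ((B + S * d) * h) = A * B * h + (b * (B + S * d) * h + A * d * h) * S"
      for A S b h :: "int \<times> int \<times> int \<Rightarrow>\<^sub>0 complex"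
      by (simp add: algebra_simps)
    then have "pev r0 hpol ^ Suc K * (pev r1 hpol ^ Suc L * pev r1 hpol ^ k') = ((r1 - 1) * e1) ^ K * a1 * B * pev r1 hpol ^ k' +
        (z1\<^sup>2 * b1 * (B + s\<^sup>2 * d) * pev r1 hpol ^ k' + ((r1 - 1) * e1) ^ K * a1 * d * pev r1 hpol ^ k') * s\<^sup>2"
      unfolding h0' h1' by blast
    moreover have "((r1 - 1) * e1) ^ K * a1 * B * pev r1 hpol ^ k' =
        (e1 ^ K * a1 * e0 ^ L * a0) * ((r1 - 1) ^ K * (r0 - 1) ^ L * pev r1 hpol ^ k')"
      unfolding B_def by (simp only: power_mult_distrib mult_ac)
    moreover have "((e1 ^ K * a1 * e0 ^ L * a0) * ((r1 - 1) ^ K * (r0 - 1) ^ L * pev r1 hpol ^ k')) \<star> ?\<Gamma> m n = 0"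
      by (rule act_mult_eq_0[OF main])
    moreover have "((z1\<^sup>2 * b1 * (B + s\<^sup>2 * d) * pev r1 hpol ^ k' + ((r1 - 1) * e1) ^ K * a1 * d * pev r1 hpol ^ k') * s\<^sup>2) \<star> ?\<Gamma> m n = 0"
      by (rule act_mult_eq_0[OF s_kill])
    ultimately show ?thesis by (simp only: act_add add_0)
  qed
  moreover have "pev r0 hpol ^ Suc K * (pev r1 hpol ^ Suc L * pev r1 hpol ^ k') dvd pev r0 G * pev r1 G"
  proof (rule mult_dvd_mono)
    have "pev r hpol ^ j dvd pev r G" if "j \<le> k" for r :: "int \<times> int \<times> int \<Rightarrow>\<^sub>0 complex" and j
      using const.ev_dvd[OF dvd_trans[OF le_imp_power_dvd[OF that] assms(7)], of r] by (simp add: const.ev_power)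
    then show "pev r0 hpol ^ Suc K dvd pev r0 G" "pev r1 hpol ^ Suc L * pev r1 hpol ^ k' dvd pev r1 G"
      unfolding power_add[symmetric] using assms(6) by (simp_all add: K_def L_def del: power_Suc)
  qed
  ultimately have "(pev r0 G * pev r1 G) \<star> ?\<Gamma> m n = 0" using act_dvd_eq_0 by blast
  then show ?thesis by (simp add: act_mult)
qed

text \<open>Absorbing the weight i into the first binomial lowers m by one and shifts \<chi>;
  Vandermonde's identity then merges the two sums.\<close>

lemma binom_sum_compose_weighted:
  assumes "fin_seq \<chi>"
  shows "binom_sum m (\<lambda>i. binom_sum n (\<lambda>j. of_nat i *s \<chi> (i + j))) = - (of_int m *s binom_sum (m + n - 1) (\<lambda>l. \<chi> (Suc l)))"
proof -
  have shift: "fin_seq (\<lambda>j. \<chi> (i + j))" for i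
    using assms unfolding fin_seq_def by (meson trans_le_add2)
  have fin: "fin_seq (\<lambda>i. binom_sum n (\<lambda>j. \<chi> (i + j)))"
    by (rule dfin_binom_sum[OF dfin_sum_index[OF assms, of "\<lambda>_ _ x. x"]]) simp
  have "binom_sum m (\<lambda>i. binom_sum n (\<lambda>j. of_nat i *s \<chi> (i + j))) = binom_sum m (\<lambda>i. of_nat i *s binom_sum n (\<lambda>j. \<chi> (i + j)))"
    by (simp add: binom_sum_scale[OF shift])
  also have "\<dots> = - (of_int m *s binom_sum (m - 1) (\<lambda>i. binom_sum n (\<lambda>j. \<chi> (Suc i + j))))"
    by (rule binom_sum_absorb[OF fin])
  also have "binom_sum (m - 1) (\<lambda>i. binom_sum n (\<lambda>j. \<chi> (Suc i + j))) = binom_sum (m + n - 1) (\<lambda>l. \<chi> (Suc l))"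
    using binom_sum_compose[OF fin_seq_Suc[OF assms], of "m - 1" n] by (simp add: algebra_simps)
  finally show ?thesis .
qed

text \<open>For \<zeta> = 1 the summands depend on i and j only through i + j, apart from the linear
  weight in the central term, so Vandermonde's identity merges the two binomials into one with
  exponent m + n. The central term becomes a series with the constant field, and its weight leads to
  the coefficients p0 and m.\<close>

lemma gam_delta_term_one:
  assumes "is_field C" "is_field V"
  shows "gam (delta_term 1 c C) V w m n (p\<^sub>0, p, q) = borch C V w (m + n) (p\<^sub>0 + p, q) +
    c *s (of_int p\<^sub>0 *s borch id_field V w (m + n) (p\<^sub>0 + p - 1, q) + of_int m *s borch id_field V w (m + n - 1) (p\<^sub>0 + p, q))"
proof -
  define P N where "P = p\<^sub>0 + p" and "N = m + n"
  define \<chi> where "\<chi> l = C (P + N - int l) (V (q + int l) w)" for l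
  define \<xi> where "\<xi> l = id_field (P - 1 + N - int l) (V (q + int l) w)" for l
  define \<chi>' where "\<chi>' l = V (q + N - int l) (C (P + int l) w)" for l
  define \<xi>' where "\<xi>' l = V (q + N - int l) (id_field (P - 1 + int l) w)" for l
  have fin: "fin_seq \<chi>" "fin_seq \<xi>" "fin_seq \<chi>'" "fin_seq \<xi>'"
    unfolding \<chi>_def \<xi>_def \<chi>'_def \<xi>'_def by (intro borch_fin assms field_id)+
  have d: "dfin (\<lambda>i j. a i *s f (i + j))" if "fin_seq f" for f :: "nat \<Rightarrow> 'w" and a :: "nat \<Rightarrow> complex"
    using dfin_sum_index[OF that, of "\<lambda>i j x. a i *s x"] by simp
  have d0: "dfin (\<lambda>i j. f (i + j))" if "fin_seq f" for f :: "nat \<Rightarrow> 'w"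
    using dfin_sum_index[OF that, of "\<lambda>i j x. x"] by simp
  have lin3: "binom_sum m (\<lambda>i. binom_sum n (\<lambda>j. f (i + j) + (a *s g (i + j) + b *s (of_nat i *s g (i + j))))) =
      binom_sum (m + n) f + (a *s binom_sum (m + n) g - (b * of_int m) *s binom_sum (m + n - 1) (\<lambda>l. g (Suc l)))"
    if f: "fin_seq f" and g: "fin_seq g" for f g a b
  proof -
    have add: "binom_sum m (\<lambda>i. binom_sum n (\<lambda>j. f i j + g i j)) =
        binom_sum m (\<lambda>i. binom_sum n (f i)) + binom_sum m (\<lambda>i. binom_sum n (g i))" if "dfin f" "dfin g" for f g
      using that by (simp add: binom_sum_add dfin_row dfin_binom_sum)
    have sc: "binom_sum m (\<lambda>i. binom_sum n (\<lambda>j. a *s f i j)) = a *s binom_sum m (\<lambda>i. binom_sum n (f i))" if "dfin f" for f a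
      using that by (simp add: binom_sum_scale dfin_row dfin_binom_sum)
    have d1: "dfin (\<lambda>i j. a *s g (i + j) + b *s (of_nat i *s g (i + j)))"
      using d[OF g, of "\<lambda>i. a + b * of_nat i"] by (simp add: scale_left_distrib)
    have d2: "dfin (\<lambda>i j. b *s (of_nat i *s g (i + j)))" using d[OF g, of "\<lambda>i. b * of_nat i"] by simp
    show ?thesis
      unfolding add[OF d0[OF f] d1] add[OF d[OF g] d2] sc[OF d0[OF g]] sc[OF d[OF g]]
        binom_sum_compose[OF f] binom_sum_compose[OF g] binom_sum_compose_weighted[OF g]
      by simp
  qed
  have 1: "binom_sum m (\<lambda>i. binom_sum n (\<lambda>j. delta_term 1 c C (p\<^sub>0 + m - int i) (p + n - int j) (V (q + int i + int j) w))) =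
      binom_sum N \<chi> + c *s (of_int (p\<^sub>0 + m) *s binom_sum N \<xi> + of_int m *s binom_sum (N - 1) (\<lambda>l. \<xi> (Suc l)))"
  proof -
    have "delta_term 1 c C (p\<^sub>0 + m - int i) (p + n - int j) (V (q + int i + int j) w) =
       \<chi> (i + j) + ((c * of_int (p\<^sub>0 + m)) *s \<xi> (i + j) + (- c) *s (of_nat i *s \<xi> (i + j)))" for i j
      by (simp add: delta_term_def \<chi>_def \<xi>_def P_def N_def id_field_def algebra_simps scale_left_diff_distrib)
    then show ?thesis
      by (simp only: lin3[OF fin(1,2)]) (simp add: N_def scale_right_distrib)
  qed
  have 2: "binom_sum m (\<lambda>i. binom_sum n (\<lambda>j. V (q + m + n - int i - int j) (delta_term 1 c C (p\<^sub>0 + int i) (p + int j) w))) =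
      binom_sum N \<chi>' + c *s (of_int p\<^sub>0 *s binom_sum N \<xi>' - of_int m *s binom_sum (N - 1) (\<lambda>l. \<xi>' (Suc l)))"
  proof -
    have "V (q + m + n - int i - int j) (delta_term 1 c C (p\<^sub>0 + int i) (p + int j) w) =
       \<chi>' (i + j) + ((c * of_int p\<^sub>0) *s \<xi>' (i + j) + c *s (of_nat i *s \<xi>' (i + j)))" for i j
      by (simp add: delta_term_def \<chi>'_def \<xi>'_def P_def N_def id_field_def algebra_simps scale_left_distrib
          field_simps_lin[OF assms(2)])
    then show ?thesis
      by (simp only: lin3[OF fin(3,4)]) (simp add: N_def scale_right_distrib scale_right_diff_distrib)
  qed
  have 3: "binom_sum N \<xi> = binom_sum (N - 1) \<xi> - binom_sum (N - 1) (\<lambda>l. \<xi> (Suc l))"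
    using binom_sum_Suc[OF fin(2), of "N - 1"] by simp
  have b: "borch C V w N (P, q) = binom_sum N \<chi> - (-1) powi N *s binom_sum N \<chi>'"
    by (simp add: borch_def \<chi>_def[abs_def] \<chi>'_def[abs_def])
  have b1: "borch id_field V w N (P - 1, q) = binom_sum N \<xi> - (-1) powi N *s binom_sum N \<xi>'"
    by (simp add: borch_def \<xi>_def[abs_def] \<xi>'_def[abs_def])
  have b2: "borch id_field V w (N - 1) (P, q) = binom_sum (N - 1) \<xi> + (-1) powi N *s binom_sum (N - 1) (\<lambda>l. \<xi>' (Suc l))"
    unfolding borch_def minus_one_powi_diff
    by (simp add: \<xi>_def[abs_def] \<xi>'_def[abs_def] algebra_simps)
  have "gam (delta_term 1 c C) V w m n (p\<^sub>0, p, q) =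
     binom_sum N \<chi> + c *s (of_int (p\<^sub>0 + m) *s binom_sum N \<xi> + of_int m *s binom_sum (N - 1) (\<lambda>l. \<xi> (Suc l))) -
     (-1) powi N *s (binom_sum N \<chi>' + c *s (of_int p\<^sub>0 *s binom_sum N \<xi>' - of_int m *s binom_sum (N - 1) (\<lambda>l. \<xi>' (Suc l))))"
    unfolding gam_def prod.case 1 2 by (simp add: N_def)
  also have "\<dots> = borch C V w N (P, q) + c *s (of_int p\<^sub>0 *s borch id_field V w N (P - 1, q) + of_int m *s borch id_field V w (N - 1) (P, q))"
  proof -
    have h: "of_int (p\<^sub>0 + m) *s binom_sum N \<xi> + of_int m *s binom_sum (N - 1) (\<lambda>l. \<xi> (Suc l)) =
        of_int p\<^sub>0 *s binom_sum N \<xi> + of_int m *s binom_sum (N - 1) \<xi>"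
      using 3 by (simp add: scale_left_distrib scale_right_diff_distrib)
    then show ?thesis
      unfolding h b b1 b2
      by (simp add: scale_right_distrib scale_right_diff_distrib algebra_simps)
  qed
  finally show ?thesis by (simp add: P_def N_def)
qed

lemma quasi_local_id_left: "is_field V \<Longrightarrow> quasi_local 0 id_field V"
  using quasi_local_id quasi_local_sym by blast

lemma nprod_id_left:
  assumes "is_field V"
  shows "nprod id_field V n q w = (if n = -1 then V q w else 0)"
proof (cases "n \<ge> 0")
  case True
  then show ?thesis using nprod_large[OF field_id assms quasi_local_id_left[OF assms]] by simp
next
  case False
  have "nprod id_field V n q w = borch id_field V w n (0, q)"
    using nprod_kernel[OF field_id assms quasi_local_id_left[OF assms], of n "nat (- n)" 1 q w] by simp
  also have "\<dots> = binom_sum n (\<lambda>i. id_field (n - int i) (V (q + int i) w))"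
    using field_simps_lin(3)[OF assms] by (simp add: borch_def id_field_def)
  also have "\<dots> = sbinom n 0 *s id_field n (V q w)"
    using False by (subst binom_sum_single[of 0]) (auto simp: id_field_def)
  finally show ?thesis by (simp add: id_field_def)
qed

text \<open>The kernel in x0 / x2 can be replaced by 1: its difference from 1 supplies (x0 - x2)^M,
  and with m raised by M the kernel in x1 / x2 annihilates the series. At p0 = 0 there remain the
  product of C and V and m c times a product of the constant field with V, nonzero only for m + n =
  0.\<close>

lemma nprod_delta_term_one:
  assumes "is_field C" "is_field V" "quasi_local k C V"
    and M: "m + n + int M \<ge> int k + 1"
  shows "(pev r0 (gpol k M) \<star> pev r1 (gpol k M) \<star> gam (delta_term 1 c C) V w m n) (0, 0, q) =
    nprod C V (m + n) q w + (if m + n = 0 then (of_int m * c) *s V q w else 0)"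
proof -
  let ?\<Gamma> = "gam (delta_term 1 c C) V w"
  let ?G = "gpol k M"
  note reg = regular_delta_term[OF assms(1), of 1 c]
  define \<Gamma>1 where "\<Gamma>1 m n = (\<lambda>(p\<^sub>0, p, q). borch C V w (m + n) (p\<^sub>0 + p, q))" for m n :: int
  have b0: "borch id_field V w N e = 0" if "N \<ge> 0" for N e
    using borch_local[OF field_id assms(2) quasi_local_id_left[OF assms(2)] that, of w] by simp
  have \<Gamma>1_Suc: "\<Gamma>1 m (n + 1) = (x1 - x2) \<star> \<Gamma>1 m n" for m n
    using borch_Suc[OF assms(1,2), of w "m + n"] unfolding \<Gamma>1_def
    by (auto simp: fun_eq_iff algebra_simps)
  have \<Gamma>1_power: "\<Gamma>1 m (n + int j) = (x1 - x2) ^ j \<star> \<Gamma>1 m n" for m n j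
  proof (induction j)
    case (Suc j)
    then show ?case using \<Gamma>1_Suc[of m "n + int j"] by (simp only: power_Suc act_mult) (simp add: add_ac)
  qed simp
  have \<Gamma>1_local: "(x1 ^ T - x2 ^ T) ^ k \<star> \<Gamma>1 m n = 0" if "m + n \<ge> 0" for m n
  proof
    fix e :: "int \<times> int \<times> int"
    obtain p0 p q where e: "e = (p0, p, q)" by (cases e)
    have "((x1 ^ T - x2 ^ T) ^ k \<star> \<Gamma>1 m n) e = ((xx ^ T - yy ^ T) ^ k \<star> borch C V w (m + n)) (p0 + p, q)"
      unfolding mon_power act_binomial e \<Gamma>1_def by (simp add: zero_prod_def add.assoc)
    then show "((x1 ^ T - x2 ^ T) ^ k \<star> \<Gamma>1 m n) e = 0 e"
      by (simp add: borch_local[OF assms(1-3) that])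
  qed
  \<comment> \<open>The constant field commutes with V, so its series with V vanishes at nonnegative
    exponents; the lower one of those occurring is m + n - 1.\<close>
  have \<Gamma>_large: "?\<Gamma> m n = \<Gamma>1 m n" if "m + n \<ge> 1" for m n
    using that by (auto simp: fun_eq_iff \<Gamma>1_def gam_delta_term_one[OF assms(1,2)] b0)
  have "pev r1 (hpol ^ k) \<star> ?\<Gamma> (m + int M) n = 0"
  proof -
    have "?\<Gamma> (m + int M) n = \<Gamma>1 (m + int M) ((n - int k) + int k)" using M by (simp add: \<Gamma>_large)
    also have "\<dots> = (x1 - x2) ^ k \<star> \<Gamma>1 (m + int M) (n - int k)" by (rule \<Gamma>1_power)
    finally have "pev r1 (hpol ^ k) \<star> ?\<Gamma> (m + int M) n = (pev r1 (hpol ^ k) * (x1 - x2) ^ k) \<star> \<Gamma>1 (m + int M) (n - int k)"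
      by (simp only: act_mult)
    also have "pev r1 (hpol ^ k) * (x1 - x2) ^ k = (const (1 / of_nat T) * x2 * y2 ^ T) ^ k * (x1 ^ T - x2 ^ T) ^ k"
      using hpol_unit[OF ratio_simps(1), of x1 k] unfolding ratio_simps(3)[symmetric] .
    also have "\<dots> \<star> \<Gamma>1 (m + int M) (n - int k) = 0"
      using M by (intro act_mult_eq_0 \<Gamma>1_local) simp
    finally show ?thesis .
  qed
  then have "(y2 ^ M * pev r1 (hpol ^ k)) \<star> ((x0 - x2) ^ M \<star> ?\<Gamma> m n) = 0"
    unfolding gam_Suc_left_power[OF reg assms(2)] by (rule act_mult_eq_0)
  then have "(pev r0 ([:-1, 1:] ^ M) * pev r1 (hpol ^ k)) \<star> ?\<Gamma> m n = 0"
    unfolding act_mult[symmetric] const.ev_power[of _ "[:-1, 1:]"] pev_linear ratio_simps(4)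
    by (simp only: power_mult_distrib mult_ac)
  moreover have "pev r0 ([:-1, 1:] ^ M) * pev r1 (hpol ^ k) dvd pev r0 (1 - ?G) * pev r1 ?G"
    by (intro mult_dvd_mono const.ev_dvd gpol_dvd hpol_dvd_gpol)
  ultimately have "(pev r0 (1 - ?G) * pev r1 ?G) \<star> ?\<Gamma> m n = 0" using act_dvd_eq_0 by blast
  then have "pev r0 ?G \<star> pev r1 ?G \<star> ?\<Gamma> m n = pev r1 ?G \<star> ?\<Gamma> m n"
    by (simp only: act_mult const.ev_diff const.ev_1 act_diff act_one) simp
  then have "(pev r0 ?G \<star> pev r1 ?G \<star> ?\<Gamma> m n) (0, 0, q) = (\<Sum>i\<le>degree ?G. coeff ?G i *s ?\<Gamma> m n (0, int i, q - int i))"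
    by (simp add: act_pev)
  also have "\<dots> = (\<Sum>i\<le>degree ?G. coeff ?G i *s borch C V w (m + n) (int i, q - int i)) +
      (c * of_int m) *s (\<Sum>i\<le>degree ?G. coeff ?G i *s borch id_field V w (m + n - 1) (int i, q - int i))"
    unfolding gam_delta_term_one[OF assms(1,2)]
    by (simp add: scale_right_distrib sum.distrib scale_sum_right mult_ac)
  also have "(\<Sum>i\<le>degree ?G. coeff ?G i *s borch C V w (m + n) (int i, q - int i)) = nprod C V (m + n) q w"
    using M by (subst nprod_eq[OF assms(1-3), of "m + n" M]) (auto simp: act_pev)
  also have "(\<Sum>i\<le>degree ?G. coeff ?G i *s borch id_field V w (m + n - 1) (int i, q - int i)) = nprod id_field V (m + n - 1) q w"
    using M quasi_local_mono[OF quasi_local_id_left[OF assms(2)], of k]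
    by (subst nprod_eq[OF field_id assms(2), of k "m + n - 1" M]) (auto simp: act_pev)
  finally show ?thesis by (simp add: nprod_id_left[OF assms(2)] mult.commute)
qed

end

lemma cyclic_shift_sum:
  fixes f :: "nat \<Rightarrow> 'a::ab_group_add"
  assumes "\<And>i. f (i + T) = f i"
  shows "(\<Sum>i<T. f (i + j)) = (\<Sum>i<T. f i)"
proof (induction j)
  case (Suc j)
  have "(\<Sum>i<T. f (Suc i + j)) + f j = (\<Sum>i<T. f (i + j)) + f (T + j)"
    using sum.lessThan_Suc_shift[of "\<lambda>i. f (i + j)" T] sum.lessThan_Suc[of "\<lambda>i. f (i + j)" T]
    by (simp add: add.commute)
  moreover have "f (T + j) = f j" using assms[of j] by (simp add: add.commute)
  ultimately show ?case using Suc by simp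
qed simp

context complex_space
begin

lemma gam_zero: "gam (\<lambda>p\<^sub>0 p w. 0) V w m n = 0" if "is_field V"
  using field_simps_lin(3)[OF that] by (auto simp: gam_def fun_eq_iff)

lemma gam_add:
  assumes "regular F" "regular F'" "is_field V"
  shows "gam (\<lambda>p\<^sub>0 p w. F p\<^sub>0 p w + F' p\<^sub>0 p w) V w m n = gam F V w m n + gam F' V w m n"
proof -
  have add: "binom_sum m (\<lambda>i. binom_sum n (\<lambda>j. f i j + g i j)) =
      binom_sum m (\<lambda>i. binom_sum n (f i)) + binom_sum m (\<lambda>i. binom_sum n (g i))" if "dfin f" "dfin g" for f g
    using that by (simp add: binom_sum_add dfin_row dfin_binom_sum)
  show ?thesis
    by (auto simp: fun_eq_iff gam_def field_simps_lin[OF assms(3)] scale_right_distrib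
        add[OF gam_dfin1[OF assms(1,3)] gam_dfin1[OF assms(2,3)]]
        add[OF gam_dfin2[OF assms(1,3)] gam_dfin2[OF assms(2,3)]])
qed

lemma regular_add:
  assumes "regular F" "regular F'"
  shows "regular (\<lambda>p\<^sub>0 p w. F p\<^sub>0 p w + F' p\<^sub>0 p w)"
  unfolding regular_def
proof (intro conjI allI)
  fix w p0 p
  obtain M where "\<forall>i j. M \<le> i \<or> M \<le> j \<longrightarrow> F (p0 + int i) (p + int j) w = 0"
    using assms(1) unfolding regular_def dfin_def by blast
  moreover obtain N where "\<forall>i j. N \<le> i \<or> N \<le> j \<longrightarrow> F' (p0 + int i) (p + int j) w = 0"
    using assms(2) unfolding regular_def dfin_def by blast
  ultimately have "\<forall>i j. max M N \<le> i \<or> max M N \<le> j \<longrightarrow> F (p0 + int i) (p + int j) w + F' (p0 + int i) (p + int j) w = 0"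
    by simp
  then show "dfin (\<lambda>i j. F (p0 + int i) (p + int j) w + F' (p0 + int i) (p + int j) w)"
    unfolding dfin_def by blast
qed (use assms in \<open>simp add: regular_def\<close>)

lemma gam_sum:
  assumes "finite I" "\<And>i. i \<in> I \<Longrightarrow> regular (F i)" "is_field V"
  shows "regular (\<lambda>p\<^sub>0 p w. \<Sum>i\<in>I. F i p\<^sub>0 p w)"
    and "gam (\<lambda>p\<^sub>0 p w. \<Sum>i\<in>I. F i p\<^sub>0 p w) V w m n = (\<lambda>e. \<Sum>i\<in>I. gam (F i) V w m n e)"
proof -
  have "regular (\<lambda>p\<^sub>0 p w. \<Sum>i\<in>I. F i p\<^sub>0 p w) \<and>
    gam (\<lambda>p\<^sub>0 p w. \<Sum>i\<in>I. F i p\<^sub>0 p w) V w m n = (\<lambda>e. \<Sum>i\<in>I. gam (F i) V w m n e)"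
    using assms(1,2)
  proof (induction I rule: finite_induct)
    case empty
    show ?case using gam_zero[OF assms(3)] by (simp add: regular_def dfin_def zero_fun_def)
  next
    case (insert i I)
    then show ?case
      using regular_add[of "F i" "\<lambda>p\<^sub>0 p w. \<Sum>i\<in>I. F i p\<^sub>0 p w"]
        gam_add[of "F i" "\<lambda>p\<^sub>0 p w. \<Sum>i\<in>I. F i p\<^sub>0 p w", OF _ _ assms(3)]
      by (simp add: plus_fun_def)
  qed
  then show "regular (\<lambda>p\<^sub>0 p w. \<Sum>i\<in>I. F i p\<^sub>0 p w)"
    and "gam (\<lambda>p\<^sub>0 p w. \<Sum>i\<in>I. F i p\<^sub>0 p w) V w m n = (\<lambda>e. \<Sum>i\<in>I. gam (F i) V w m n e)"
    by blast+
qed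

end

lemma root_unity_powi: "root_unity T powi n = exp (2 * of_real pi * \<i> * of_int n / of_nat T)"
  unfolding root_unity_def exp_power_int by (simp add: mult_ac)

lemma root_unity_powi_eq_1_iff:
  assumes "T > 0"
  shows "root_unity T powi n = 1 \<longleftrightarrow> int T dvd n"
proof -
  have "root_unity T powi n = exp (\<i> * of_real (2 * pi * (of_int n / of_nat T)))"
    by (simp add: root_unity_powi mult_ac)
  also have "\<dots> = 1 \<longleftrightarrow> (\<exists>k::int. (of_int n :: real) = of_int (k * int T))"
  proof -
    have "exp (\<i> * of_real x) = 1 \<longleftrightarrow> (\<exists>k::int. x = of_int (2 * k) * pi)" for x
    proof -
      have "exp (\<i> * of_real x) = 1 \<longleftrightarrow> cos x = 1"
      proof
        show "exp (\<i> * of_real x) = 1 \<Longrightarrow> cos x = 1" unfolding cis_conv_exp[symmetric] by (simp add: complex_eq_iff)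
        assume "cos x = 1"
        moreover from this have "sin x = 0" using sin_cos_squared_add[of x] by simp
        ultimately show "exp (\<i> * of_real x) = 1" unfolding cis_conv_exp[symmetric] by (simp add: complex_eq_iff)
      qed
      moreover have "real_of_int k * 2 * pi = of_int (2 * k) * pi" for k by simp
      ultimately show ?thesis unfolding cos_one_2pi_int by (simp only:)
    qed
    then have "exp (\<i> * of_real (2 * pi * (of_int n / of_nat T))) = 1 \<longleftrightarrow>
        (\<exists>k::int. 2 * pi * (of_int n / of_nat T) = of_int (2 * k) * pi)" .
    also have "\<dots> \<longleftrightarrow> (\<exists>k::int. (of_int n :: real) = of_int (k * int T))"
      using assms by (simp add: field_simps)
    finally show ?thesis .
  qed
  also have "\<dots> \<longleftrightarrow> int T dvd n"
    unfolding of_int_eq_iff dvd_def by (simp only: mult.commute)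
  finally show ?thesis .
qed

lemma root_unity_nonzero: "root_unity T \<noteq> 0"
  by (simp add: root_unity_def)

section \<open>Twisted currents\<close>

locale twisted_module =
  g: quadratic_lie_algebra sg bracket form + cyclic_space scale T
  for sg :: "complex \<Rightarrow> 'g::ab_group_add \<Rightarrow> 'g" and bracket form
    and scale :: "complex \<Rightarrow> 'w::ab_group_add \<Rightarrow> 'w" (infixr \<open>*s\<close> 75) and T +
  fixes \<sigma> :: "'g \<Rightarrow> 'g" and level :: complex and actW :: "(int, 'g) affine \<Rightarrow> 'w \<Rightarrow> 'w"
  assumes automorphism: "lie_automorphism sg bracket \<sigma>"
    and form_\<sigma>: "form (\<sigma> a) (\<sigma> b) = form a b"
    and finite_order: "has_finite_order \<sigma> T"
    and restricted: "restricted_module_on sg bracket form of_int (fixed_affine sg \<sigma> T) (level / of_nat T) scale actW"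
begin

abbreviation "om \<equiv> root_unity T"
abbreviation "FA \<equiv> fixed_affine sg \<sigma> T"
abbreviation "eig \<equiv> eigenspace sg \<sigma> T"

lemma om_T: "om powi (n * int T) = 1"
  using root_unity_powi_eq_1_iff[OF T_pos] by simp

lemma om_add: "om powi (m + n) = om powi m * om powi n"
  by (simp add: power_int_add root_unity_nonzero)

lemma \<sigma>_linear: "Vector_Spaces.linear sg sg \<sigma>"
  using automorphism by (simp add: lie_automorphism_def)

lemma \<sigma>_bracket: "\<sigma> (bracket a b) = bracket (\<sigma> a) (\<sigma> b)"
  using automorphism by (simp add: lie_automorphism_def)

lemma \<sigma>_pow_linear: "Vector_Spaces.linear sg sg (\<sigma> ^^ i)"
proof (induction i)
  case 0
  show ?case by (rule linearI) (auto simp: g.vector_space_axioms)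
next
  case (Suc i)
  show ?case
    by (rule linearI) (auto simp: g.vector_space_axioms linear_additive[OF Suc] linear_additive[OF \<sigma>_linear])
qed

lemma \<sigma>_pow_bracket: "(\<sigma> ^^ i) (bracket a b) = bracket ((\<sigma> ^^ i) a) ((\<sigma> ^^ i) b)"
  by (induction i) (auto simp: \<sigma>_bracket)

lemma \<sigma>_pow_form: "form ((\<sigma> ^^ i) a) ((\<sigma> ^^ i) b) = form a b"
  by (induction i) (auto simp: form_\<sigma>)

lemma \<sigma>_pow_T: "(\<sigma> ^^ (i + T)) = \<sigma> ^^ i"
  using finite_order by (simp add: has_finite_order_def funpow_add)

lemmas bracket_left = linear_additive[OF g.bracket_linear_left]
lemmas bracket_right = linear_additive[OF g.bracket_linear_right]
lemmas form_right = linear_additive[OF g.form_linear]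

lemma form_left_linear: "Vector_Spaces.linear sg (*) (\<lambda>a. form a b)"
  unfolding g.form_symmetric[of _ b] by (rule g.form_linear)

lemmas form_left = linear_additive[OF form_left_linear]

text \<open>\<open>T\<close> times the projection onto the eigenspace of index \<open>n\<close>.\<close>

definition tproj :: "'g \<Rightarrow> int \<Rightarrow> 'g" where
  "tproj a n = (\<Sum>i<T. sg (om powi (- (int i * n))) ((\<sigma> ^^ i) a))"

lemma twisted_current_eq: "twisted_current sg \<sigma> T a n = loop n (tproj a n)"
  by (simp add: twisted_current_def tproj_def)

lemma tproj_periodic: "sg (om powi (- (int (i + T) * n))) ((\<sigma> ^^ (i + T)) a) = sg (om powi (- (int i * n))) ((\<sigma> ^^ i) a)"
proof -
  have "- (int (i + T) * n) = - (int i * n) + (- n) * int T" by (simp add: algebra_simps)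
  then show ?thesis unfolding \<sigma>_pow_T by (simp only: om_add om_T mult_1_right)
qed

lemma tproj_shift: "(\<Sum>i<T. sg (om powi (- (int (i + j) * n))) ((\<sigma> ^^ (i + j)) a)) = tproj a n"
  unfolding tproj_def
  by (rule cyclic_shift_sum[of "\<lambda>i. sg (om powi (- (int i * n))) ((\<sigma> ^^ i) a)"]) (rule tproj_periodic)

lemma tproj_eig: "tproj a n \<in> eig n"
proof -
  have "\<sigma> (tproj a n) = (\<Sum>i<T. sg (om powi (- (int i * n))) ((\<sigma> ^^ Suc i) a))"
    by (simp add: tproj_def linear_additive[OF \<sigma>_linear])
  also have "\<dots> = (\<Sum>i<T. sg (om powi n) (sg (om powi (- (int (i + 1) * n))) ((\<sigma> ^^ (i + 1)) a)))"
    by (intro sum.cong refl) (simp add: om_add[symmetric] algebra_simps)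
  also have "\<dots> = sg (om powi n) (\<Sum>i<T. sg (om powi (- (int (i + 1) * n))) ((\<sigma> ^^ (i + 1)) a))"
    by (rule g.scale_sum_right[symmetric])
  also have "\<dots> = sg (om powi n) (tproj a n)" unfolding tproj_shift ..
  finally show ?thesis by (simp add: eigenspace_def)
qed

lemma tproj_period: "tproj a (n + int T) = tproj a n"
  unfolding tproj_def
proof (intro sum.cong refl)
  fix i
  have "- (int i * (n + int T)) = - (int i * n) + (- int i) * int T" by (simp add: algebra_simps)
  then show "sg (om powi (- (int i * (n + int T)))) ((\<sigma> ^^ i) a) = sg (om powi (- (int i * n))) ((\<sigma> ^^ i) a)"
    by (simp only: om_add om_T mult_1_right)
qed

lemma tproj_add: "tproj (a + b) n = tproj a n + tproj b n"
  by (simp add: tproj_def linear_additive[OF \<sigma>_pow_linear] g.scale_right_distrib sum.distrib)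

lemma tproj_scale: "tproj (sg c a) n = sg c (tproj a n)"
  by (simp add: tproj_def linear_additive[OF \<sigma>_pow_linear] g.scale_sum_right mult.commute)

lemma eig_zero: "0 \<in> eig n" and eig_add: "x \<in> eig n \<Longrightarrow> y \<in> eig n \<Longrightarrow> x + y \<in> eig n"
  and eig_scale: "x \<in> eig n \<Longrightarrow> sg c x \<in> eig n"
  by (auto simp: eigenspace_def linear_additive[OF \<sigma>_linear] g.scale_right_distrib mult.commute)

lemma eig_bracket: "x \<in> eig m \<Longrightarrow> y \<in> eig n \<Longrightarrow> bracket x y \<in> eig (m + n)"
  by (auto simp: eigenspace_def \<sigma>_bracket bracket_left bracket_right om_add mult.commute)

lemma loop_FA: "x \<in> eig n \<Longrightarrow> loop n x \<in> FA"
  by (auto simp: fixed_affine_def loop_def lookup_single when_def eig_zero)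

lemma central_FA: "(0, z) \<in> FA"
  by (auto simp: fixed_affine_def eig_zero)

lemma FA_add: "X \<in> FA \<Longrightarrow> Y \<in> FA \<Longrightarrow> X + Y \<in> FA"
  by (auto simp: fixed_affine_def lookup_add eig_add)

lemma affine_scale_loop: "affine_scale sg c (loop n x) = loop n (sg c x)"
  by (simp add: affine_scale_def loop_def)

lemma module_on: "lie_module_on (affine_scale sg) (affine_bracket bracket form of_int) FA scale actW"
  using restricted by (simp add: restricted_module_on_def)

lemma actW_linear: "X \<in> FA \<Longrightarrow> lin (actW X)"
  using module_on by (simp add: lie_module_on_def)

lemma actW_add: "X \<in> FA \<Longrightarrow> Y \<in> FA \<Longrightarrow> actW (X + Y) w = actW X w + actW Y w"
  using module_on by (simp add: lie_module_on_def)

lemma actW_scale: "X \<in> FA \<Longrightarrow> actW (affine_scale sg c X) w = c *s actW X w"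
  using module_on by (simp add: lie_module_on_def)

lemma actW_bracket: "X \<in> FA \<Longrightarrow> Y \<in> FA \<Longrightarrow>
    actW (affine_bracket bracket form of_int X Y) w = actW X (actW Y w) - actW Y (actW X w)"
  using module_on by (simp add: lie_module_on_def)

lemma actW_central: "actW (0, z) w = (z * level / of_nat T) *s w"
proof -
  have "(0, z) = affine_scale sg z (central :: (int, 'g) affine)"
    by (auto simp: affine_scale_def central_def intro: poly_mapping_eqI simp: Poly_Mapping.map.rep_eq)
  moreover have "actW central w = (level / of_nat T) *s w"
    using restricted by (simp add: restricted_module_on_def)
  ultimately show ?thesis using actW_scale[of central z w] central_FA[of 1] by (simp add: central_def)
qed

lemma actW_loop_add: "x \<in> eig n \<Longrightarrow> y \<in> eig n \<Longrightarrow> actW (loop n (x + y)) w = actW (loop n x) w + actW (loop n y) w"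
  using actW_add[OF loop_FA loop_FA, of x n y n w] by (simp add: loop_def single_add)

lemma actW_loop_scale: "x \<in> eig n \<Longrightarrow> actW (loop n (sg c x)) w = c *s actW (loop n x) w"
  using actW_scale[OF loop_FA, of x n c w] by (simp add: affine_scale_loop)

lemma actW_loop_zero: "actW (loop n 0) w = 0"
  using actW_loop_scale[OF eig_zero, of n 0 w] by simp

lemma actW_loop_sum: "(\<And>i. i \<in> I \<Longrightarrow> f i \<in> eig n) \<Longrightarrow>
    sum f I \<in> eig n \<and> actW (loop n (sum f I)) w = (\<Sum>i\<in>I. actW (loop n (f i)) w)"
  by (induction I rule: infinite_finite_induct) (auto simp: actW_loop_zero actW_loop_add eig_zero eig_add)

lemma affine_bracket_loop:
  "affine_bracket bracket form emb (loop m x) (loop n y) =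
    loop (m + n) (bracket x y) + (0, emb m * form x y * (if m + n = 0 then 1 else 0))"
proof (cases "x = 0 \<or> y = 0")
  case True
  then show ?thesis
    using bracket_left(3)[of y] bracket_right(3)[of x] form_left(3)[of y] form_right(3)[of x]
    by (auto simp: affine_bracket_def loop_def zero_prod_def)
next
  case False
  then show ?thesis by (simp add: affine_bracket_def loop_def)
qed

lemma actW_loop_commutator:
  assumes "x \<in> eig m" "y \<in> eig n"
  shows "actW (loop m x) (actW (loop n y) w) - actW (loop n y) (actW (loop m x) w) =
    actW (loop (m + n) (bracket x y)) w + (if m + n = 0 then (of_int m * form x y * level / of_nat T) *s w else 0)"
  unfolding actW_bracket[OF loop_FA[OF assms(1)] loop_FA[OF assms(2)], symmetric] affine_bracket_loop
  using actW_add[OF loop_FA[OF eig_bracket[OF assms]] central_FA] by (simp add: actW_central)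

definition cur :: "'g \<Rightarrow> int \<Rightarrow> 'w \<Rightarrow> 'w" where
  "cur a n w = actW (twisted_current sg \<sigma> T a n) w"

lemma cur_eq: "cur a n w = actW (loop n (tproj a n)) w"
  by (simp add: cur_def twisted_current_eq)

lemma cur_add: "cur (a + b) = cur a + cur b"
  by (auto simp: fun_eq_iff cur_eq tproj_add actW_loop_add tproj_eig)

lemma cur_scale: "cur (sg c a) = (\<lambda>n w. c *s cur a n w)"
  by (auto simp: fun_eq_iff cur_eq tproj_scale actW_loop_scale tproj_eig)

lemma field_cur: "is_field (cur a)"
  unfolding is_field_def
proof (intro conjI allI)
  show "lin (cur a n)" for n
    using actW_linear[OF loop_FA[OF tproj_eig[of a n]]] by (simp add: cur_eq[abs_def])
next
  fix w
  \<comment> \<open>Restrictedness gives a bound for each element of the Lie algebra separately. As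
    \<open>tproj a n\<close> depends only on n modulo T, the maximum of T such bounds serves all
    n.\<close>
  have "\<forall>r. \<exists>N. \<forall>n\<ge>N. loop n (tproj a (int r)) \<in> FA \<longrightarrow> actW (loop n (tproj a (int r))) w = 0"
    using restricted by (simp add: restricted_module_on_def)
  then obtain N where N: "\<And>r n. n \<ge> N r \<Longrightarrow> loop n (tproj a (int r)) \<in> FA \<Longrightarrow> actW (loop n (tproj a (int r))) w = 0"
    by metis
  have mod: "tproj a n = tproj a (n mod int T)" for n
  proof -
    have "tproj a (n + int j * int T) = tproj a n" for n j
    proof (induction j)
      case (Suc j)
      then show ?case using tproj_period[of a "n + int j * int T"] by (simp add: algebra_simps)
    qed simp
    from this[of "n mod int T" "nat (n div int T)"] this[of n "nat (- (n div int T))"]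
    show ?thesis
      by (cases "n div int T \<ge> 0") (simp_all add: minus_mult_div_eq_mod[symmetric] algebra_simps)
  qed
  have "cur a n w = 0" if "n \<ge> Max (N ` {..<T})" for n
  proof -
    define r where "r = nat (n mod int T)"
    have r: "r < T" "int r = n mod int T" using T_pos by (auto simp: r_def nat_less_iff)
    have "n \<ge> N r" using that r(1) by (meson Max_ge dual_order.trans finite_imageI finite_lessThan imageI lessThan_iff)
    moreover have "tproj a n = tproj a (int r)" using mod[of n] r(2) by simp
    ultimately show ?thesis using N[of r n] loop_FA[OF tproj_eig[of a n]] by (simp add: cur_eq)
  qed
  then show "\<exists>N. \<forall>n\<ge>N. cur a n w = 0" by blast
qed

text \<open>The double sum is grouped by the difference of the two powers of \<sigma>, using
  \<sigma>^j [\<sigma>^i a, b] = [\<sigma>^(i+j) a, \<sigma>^j b].\<close>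

lemma bracket_tproj:
  "bracket (tproj a m) (tproj b n) = (\<Sum>i<T. sg (om powi (- (int i * m))) (tproj (bracket ((\<sigma> ^^ i) a) b) (m + n)))"
proof -
  have "(\<Sum>i<T. sg (om powi (- (int i * m))) (tproj (bracket ((\<sigma> ^^ i) a) b) (m + n))) =
      (\<Sum>i<T. \<Sum>j<T. sg (om powi (- (int (i + j) * m))) (sg (om powi (- (int j * n))) (bracket ((\<sigma> ^^ (i + j)) a) ((\<sigma> ^^ j) b))))"
    unfolding tproj_def g.scale_sum_right \<sigma>_pow_bracket
  proof (intro sum.cong refl)
    fix i j
    have "- (int i * m) + - (int j * (m + n)) = - (int (i + j) * m) + - (int j * n)" by (simp add: algebra_simps)
    then have "om powi (- (int i * m)) * om powi (- (int j * (m + n))) = om powi (- (int (i + j) * m)) * om powi (- (int j * n))"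
      by (simp only: om_add[symmetric])
    moreover have "(\<sigma> ^^ j) ((\<sigma> ^^ i) a) = (\<sigma> ^^ (i + j)) a" by (simp add: funpow_add add.commute[of i j])
    ultimately show "sg (om powi (- (int i * m))) (sg (om powi (- (int j * (m + n)))) (bracket ((\<sigma> ^^ j) ((\<sigma> ^^ i) a)) ((\<sigma> ^^ j) b))) =
      sg (om powi (- (int (i + j) * m))) (sg (om powi (- (int j * n))) (bracket ((\<sigma> ^^ (i + j)) a) ((\<sigma> ^^ j) b)))"
      by simp
  qed
  also have "\<dots> = (\<Sum>j<T. bracket (\<Sum>i<T. sg (om powi (- (int (i + j) * m))) ((\<sigma> ^^ (i + j)) a)) (sg (om powi (- (int j * n))) ((\<sigma> ^^ j) b)))"
    by (subst sum.swap) (simp add: bracket_left bracket_right g.scale_sum_right mult.commute)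
  also have "\<dots> = bracket (tproj a m) (tproj b n)"
    unfolding tproj_shift by (simp add: tproj_def[of b] bracket_right)
  finally show ?thesis ..
qed

text \<open>Invariance of the form makes the outer summands equal, whence the factor T. It cancels
  the denominator of the level level / T of the module, so the untwisted level \<open>level\<close>
  appears in the commutators.\<close>

lemma form_tproj:
  assumes "m + n = 0"
  shows "form (tproj a m) (tproj b n) = of_nat T * (\<Sum>i<T. om powi (- (int i * m)) * form ((\<sigma> ^^ i) a) b)"
proof -
  have n: "n = - m" using assms by simp
  have "form (tproj a m) (tproj b n) = (\<Sum>j<T. om powi (- (int j * n)) * form (tproj a m) ((\<sigma> ^^ j) b))"
    by (simp add: tproj_def[of b] form_right)
  also have "\<dots> = (\<Sum>j<T. \<Sum>i<T. om powi (- (int i * m)) * form ((\<sigma> ^^ i) a) b)"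
  proof (intro sum.cong refl)
    fix j
    have "om powi (- (int j * n)) * form (tproj a m) ((\<sigma> ^^ j) b) =
        om powi (- (int j * n)) * form (\<Sum>i<T. sg (om powi (- (int (i + j) * m))) ((\<sigma> ^^ (i + j)) a)) ((\<sigma> ^^ j) b)"
      unfolding tproj_shift ..
    also have "\<dots> = (\<Sum>i<T. om powi (- (int j * n)) * (om powi (- (int (i + j) * m)) * form ((\<sigma> ^^ (i + j)) a) ((\<sigma> ^^ j) b)))"
      by (simp add: form_left sum_distrib_left)
    also have "\<dots> = (\<Sum>i<T. om powi (- (int i * m)) * form ((\<sigma> ^^ i) a) b)"
    proof (intro sum.cong refl)
      fix i
      have "- (int j * n) + - (int (i + j) * m) = - (int i * m)" by (simp add: n algebra_simps)
      then have "om powi (- (int j * n)) * om powi (- (int (i + j) * m)) = om powi (- (int i * m))"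
        by (simp only: om_add[symmetric])
      moreover have "form ((\<sigma> ^^ (i + j)) a) ((\<sigma> ^^ j) b) = form ((\<sigma> ^^ i) a) b"
        using \<sigma>_pow_form[of j "(\<sigma> ^^ i) a" b] by (simp add: funpow_add add.commute[of i j])
      ultimately show "om powi (- (int j * n)) * (om powi (- (int (i + j) * m)) * form ((\<sigma> ^^ (i + j)) a) ((\<sigma> ^^ j) b)) =
          om powi (- (int i * m)) * form ((\<sigma> ^^ i) a) b" by (simp add: mult.assoc[symmetric])
    qed
    finally show "om powi (- (int j * n)) * form (tproj a m) ((\<sigma> ^^ j) b) = (\<Sum>i<T. om powi (- (int i * m)) * form ((\<sigma> ^^ i) a) b)" .
  qed
  finally show ?thesis by simp
qed

text \<open>The part of [a(x1), b(x2)] supported on x1 = om^(-i) x2.\<close>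

definition cterm :: "'g \<Rightarrow> 'g \<Rightarrow> nat \<Rightarrow> int \<Rightarrow> int \<Rightarrow> 'w \<Rightarrow> 'w" where
  "cterm a b i = delta_term (om powi (- int i)) (level * form ((\<sigma> ^^ i) a) b) (cur (bracket ((\<sigma> ^^ i) a) b))"

lemma om_powi_powi: "(om powi (- int i)) powi m = om powi (- (int i * m))"
  by (simp add: power_int_mult[symmetric])

lemma cur_commutator:
  "cur a m (cur b n w) - cur b n (cur a m w) = (\<Sum>i<T. cterm a b i m n w)"
proof -
  have 1: "actW (loop (m + n) (bracket (tproj a m) (tproj b n))) w =
      (\<Sum>i<T. om powi (- (int i * m)) *s cur (bracket ((\<sigma> ^^ i) a) b) (m + n) w)"
    unfolding bracket_tproj
    using actW_loop_sum[of "{..<T}" "\<lambda>i. sg (om powi (- (int i * m))) (tproj (bracket ((\<sigma> ^^ i) a) b) (m + n))" "m + n" w]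
    by (simp add: eig_scale tproj_eig actW_loop_scale cur_eq)
  have 2: "(if m + n = 0 then (of_int m * form (tproj a m) (tproj b n) * level / of_nat T) *s w else 0) =
      (\<Sum>i<T. om powi (- (int i * m)) *s (if m + n = 0 then (of_int m * (level * form ((\<sigma> ^^ i) a) b)) *s w else 0))"
  proof (cases "m + n = 0")
    case True
    then show ?thesis
      using T_pos by (simp add: form_tproj sum_distrib_left sum_distrib_right sum_divide_distrib scale_sum_left mult_ac)
  qed simp
  show ?thesis
    unfolding cur_eq[of a] cur_eq[of b] actW_loop_commutator[OF tproj_eig tproj_eig] 1 2
    by (simp add: cterm_def delta_term_def om_powi_powi scale_right_distrib sum.distrib)
qed

lemma om_root: "(om powi (- int i)) ^ T = 1"
proof -
  have "(om powi (- int i)) ^ T = (om powi (- int i)) powi int T" by simp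
  also have "\<dots> = om powi ((- int i) * int T)" by (simp only: power_int_mult)
  finally show ?thesis by (simp only: om_T)
qed

text \<open>As \<zeta>^T = 1, the factor \<zeta>^p does not change under shifts of p by T; one
  factor x1^T - x2^T cancels C, a second one the central term.\<close>

lemma delta_term_local:
  assumes "\<zeta> ^ T = 1"
  shows "(xx ^ T - yy ^ T)\<^sup>2 \<star> (\<lambda>(p, q). delta_term \<zeta> c C p q w) = 0"
proof -
  have \<zeta>0: "\<zeta> \<noteq> 0" using assms T_pos by (metis zero_neq_one zero_power)
  have z: "\<zeta> powi (n + int T) = \<zeta> powi n" for n
    using assms \<zeta>0 by (simp add: power_int_add)
  have D: "(xx ^ T - yy ^ T) \<star> \<Phi> = (\<lambda>(p, q). \<Phi> (p + int T, q) - \<Phi> (p, q + int T))" for \<Phi>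
    by (auto simp: fun_eq_iff mon_power zero_prod_def)
  have "(xx ^ T - yy ^ T) \<star> (\<lambda>(p, q). delta_term \<zeta> c C p q w) =
      (\<lambda>(p, q). \<zeta> powi p *s (if p + q + int T = 0 then (of_nat T * c) *s w else 0))"
    unfolding D by (auto simp: fun_eq_iff delta_term_def z algebra_simps scale_left_distrib)
  moreover have "(xx ^ T - yy ^ T) \<star> (\<lambda>(p, q). \<zeta> powi p *s (if p + q + int T = 0 then (of_nat T * c) *s w else 0)) = 0"
    unfolding D by (auto simp: fun_eq_iff z algebra_simps)
  ultimately show ?thesis by (simp only: power2_eq_square act_mult)
qed

lemma cur_local: "quasi_local 2 (cur a) (cur b)"
  unfolding quasi_local_act cur_commutator
proof
  fix w
  have "(\<lambda>(p, q). \<Sum>i<T. cterm a b i p q w) = (\<lambda>e. \<Sum>i<T. (\<lambda>(p, q). cterm a b i p q w) e)" by auto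
  moreover have "(xx ^ T - yy ^ T)\<^sup>2 \<star> (\<lambda>(p, q). cterm a b i p q w) = 0" for i
    unfolding cterm_def by (rule delta_term_local[OF om_root])
  ultimately show "(xx ^ T - yy ^ T)\<^sup>2 \<star> (\<lambda>(p, q). \<Sum>i<T. cterm a b i p q w) = 0"
    by (simp only: act_sum_right) (simp add: zero_fun_def)
qed

section \<open>The action of the affine algebra on quasi-local fields\<close>

text \<open>Quasi-locality is required with the currents alone, with an order depending on the
  current. This is what products with currents need, and by Dong's lemma they preserve it.\<close>

definition good :: "(int \<Rightarrow> 'w \<Rightarrow> 'w) \<Rightarrow> bool" where
  "good \<alpha> \<longleftrightarrow> is_field \<alpha> \<and> (\<forall>a. \<exists>k. quasi_local k (cur a) \<alpha>)"

lemma goodD: "good \<alpha> \<Longrightarrow> is_field \<alpha>" and good_local: "good \<alpha> \<Longrightarrow> \<exists>k. quasi_local k (cur a) \<alpha>"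
  by (auto simp: good_def)

lemma good_id: "good id_field"
  unfolding good_def using field_id quasi_local_id[OF field_cur] by blast

lemma good_zero: "good 0"
  unfolding good_def using field_zero quasi_local_zero[OF field_cur] by blast

lemma good_add: "good \<alpha> \<Longrightarrow> good \<beta> \<Longrightarrow> good (\<alpha> + \<beta>)"
  unfolding good_def using field_add quasi_local_add_right[OF _ _ field_cur] by blast

lemma good_scale: "good \<alpha> \<Longrightarrow> good (\<lambda>n w. c *s \<alpha> n w)"
  unfolding good_def using field_scale quasi_local_scale_right[OF _ field_cur] by blast

lemma good_sum: "(\<And>i. i \<in> I \<Longrightarrow> good (f i)) \<Longrightarrow> good (sum f I)"
  by (induction I rule: infinite_finite_induct) (auto intro: good_zero good_add)

lemma good_nprod:
  assumes "good \<alpha>"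
  shows "good (nprod (cur a) \<alpha> n)"
  unfolding good_def
proof (intro conjI allI)
  obtain k where k: "quasi_local k (cur a) \<alpha>" using good_local[OF assms] by blast
  show "is_field (nprod (cur a) \<alpha> n)" by (rule field_nprod[OF field_cur goodD[OF assms] k])
  fix b
  obtain k' where k': "quasi_local k' (cur b) \<alpha>" using good_local[OF assms] by blast
  define K where "K = max 2 (max k k')"
  have "quasi_local (3 * K + nat (- n)) (cur b) (nprod (cur a) \<alpha> n)"
    by (rule dong[OF field_cur field_cur goodD[OF assms]])
      (use quasi_local_mono[OF cur_local, of K] quasi_local_mono[OF k, of K] quasi_local_mono[OF k', of K] in \<open>auto simp: K_def\<close>)
  then show "\<exists>k. quasi_local k (cur b) (nprod (cur a) \<alpha> n)" by blast
qed

lemma cur_nprod_commutator: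
  assumes "good \<alpha>"
  shows "nprod (cur a) (nprod (cur b) \<alpha> n) m q w - nprod (cur b) (nprod (cur a) \<alpha> m) n q w =
    nprod (cur (bracket a b)) \<alpha> (m + n) q w + (if m + n = 0 then (of_int m * (level * form a b)) *s \<alpha> q w else 0)"
proof -
  note f\<alpha> = goodD[OF assms]
  obtain ka kb where kab: "quasi_local ka (cur b) \<alpha>" "quasi_local kb (cur a) \<alpha>" using good_local[OF assms] by blast
  obtain k0 where k0: "\<And>k M m' n' q w. k \<ge> k0 \<Longrightarrow> m + int M \<ge> int k \<Longrightarrow> n + int M \<ge> int k \<Longrightarrow> m' \<ge> m \<Longrightarrow> n' \<ge> n \<Longrightarrow>
    nprod (cur a) (nprod (cur b) \<alpha> n') m' q w - nprod (cur b) (nprod (cur a) \<alpha> m') n' q w =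
      (pev (mon (1, 0, -1)) (gpol k M) \<star> pev (mon (0, 1, -1)) (gpol k M) \<star>
        gam (\<lambda>p\<^sub>0 p w. cur a p\<^sub>0 (cur b p w) - cur b p (cur a p\<^sub>0 w)) \<alpha> w m' n') (0, 0, q)"
    using nprod_commutator[OF field_cur field_cur f\<alpha> kab cur_local, of m n] by blast
  have "\<forall>i. \<exists>k. quasi_local k (cur (bracket ((\<sigma> ^^ i) a) b)) \<alpha>" using good_local[OF assms] by blast
  then obtain kk where kk: "\<And>i. quasi_local (kk i) (cur (bracket ((\<sigma> ^^ i) a) b)) \<alpha>" by metis
  define K where "K = Max (kk ` {..<T})"
  have K: "quasi_local K (cur (bracket ((\<sigma> ^^ i) a) b)) \<alpha>" if "i < T" for i
    by (rule quasi_local_mono[OF kk]) (use that in \<open>simp add: K_def\<close>)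
  \<comment> \<open>k exceeds the threshold of the commutator formula, the one that removes the
    components with i \<noteq> 0, and the order of the surviving current with \<alpha>; M is then
    large enough for the exponents m, n and m + n.\<close>
  define k where "k = k0 + 2 * K + nat (- m) + nat (- n) + 2"
  have Kk: "quasi_local k (cur (bracket a b)) \<alpha>"
    using quasi_local_mono[OF K[OF T_pos], of k] by (simp add: k_def)
  define M where "M = nat (int k - m) + nat (int k - n) + nat (int k + 1 - m - n)"
  have reg: "regular (cterm a b i)" for i
    unfolding cterm_def by (rule regular_delta_term[OF field_cur])
  have "nprod (cur a) (nprod (cur b) \<alpha> n) m q w - nprod (cur b) (nprod (cur a) \<alpha> m) n q w =
      (pev r0 (gpol k M) \<star> pev r1 (gpol k M) \<star> gam (\<lambda>p\<^sub>0 p w. \<Sum>i<T. cterm a b i p\<^sub>0 p w) \<alpha> w m n) (0, 0, q)"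
    unfolding cur_commutator[symmetric] by (rule k0) (auto simp: k_def M_def)
  also have "\<dots> = (\<Sum>i<T. (pev r0 (gpol k M) \<star> pev r1 (gpol k M) \<star> gam (cterm a b i) \<alpha> w m n) (0, 0, q))"
    by (subst gam_sum[OF _ reg f\<alpha>]) (auto simp: act_sum_right)
  also have "\<dots> = (\<Sum>i<T. if i = 0 then (pev r0 (gpol k M) \<star> pev r1 (gpol k M) \<star> gam (cterm a b 0) \<alpha> w m n) (0, 0, q) else 0)"
  proof (intro sum.cong refl)
    fix i assume i: "i \<in> {..<T}"
    have "pev r0 (gpol k M) \<star> pev r1 (gpol k M) \<star> gam (cterm a b i) \<alpha> w m n = 0" if "i \<noteq> 0"
      unfolding cterm_def
    proof (rule gam_delta_term_zero[OF field_cur f\<alpha> K])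
      show "om powi (- int i) \<noteq> 1"
        using root_unity_powi_eq_1_iff[OF T_pos, of "- int i"] that i by (auto dest: zdvd_imp_le)
      show "(om powi (- int i)) ^ T = 1" by (rule om_root)
      show "2 * K + nat (- m) + nat (- n) + 2 \<le> k" by (simp add: k_def)
      show "hpol ^ k dvd gpol k M" by (rule hpol_dvd_gpol)
    qed (use i in simp)
    then show "(pev r0 (gpol k M) \<star> pev r1 (gpol k M) \<star> gam (cterm a b i) \<alpha> w m n) (0, 0, q) =
        (if i = 0 then (pev r0 (gpol k M) \<star> pev r1 (gpol k M) \<star> gam (cterm a b 0) \<alpha> w m n) (0, 0, q) else 0)"
      by simp
  qed
  also have "\<dots> = (pev r0 (gpol k M) \<star> pev r1 (gpol k M) \<star> gam (cterm a b 0) \<alpha> w m n) (0, 0, q)"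
    using T_pos by simp
  also have "cterm a b 0 = delta_term 1 (level * form a b) (cur (bracket a b))" by (simp add: cterm_def)
  also have "(pev r0 (gpol k M) \<star> pev r1 (gpol k M) \<star> gam (delta_term 1 (level * form a b) (cur (bracket a b))) \<alpha> w m n) (0, 0, q) =
      nprod (cur (bracket a b)) \<alpha> (m + n) q w + (if m + n = 0 then (of_int m * (level * form a b)) *s \<alpha> q w else 0)"
    by (rule nprod_delta_term_one[OF field_cur f\<alpha> Kk]) (auto simp: M_def)
  finally show ?thesis .
qed

end

lemma regroup_diff: "(d1 + b + a + z) - (d2 + a + b + z) = d1 - (d2 :: 'x::ab_group_add)"
  by (simp add: algebra_simps)

section \<open>Linear maps out of free vector spaces and free algebras\<close>

lemma keys_fin_scale: "Poly_Mapping.keys (fin_scale c x) \<subseteq> Poly_Mapping.keys x"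
  by (auto simp: in_keys_iff lookup_fin_scale)

lemma fin_scale_single: "fin_scale c (Poly_Mapping.single k d) = Poly_Mapping.single k (c * d)"
  by (rule poly_mapping_eqI) (simp add: lookup_fin_scale lookup_single when_def)

lemma fin_scale_mult_left: "fin_scale c (x * y) = fin_scale c x * (y :: ('b::monoid_add) \<Rightarrow>\<^sub>0 complex)"
  by (simp add: fin_scale_def mult_map_scale_conv_mult mult.assoc)

lemma fin_scale_mult_right: "x * fin_scale c y = fin_scale c (x * (y :: ('b::monoid_add) \<Rightarrow>\<^sub>0 complex))"
proof -
  have "x * const c = const c * x"
    by (induction x rule: poly_mapping_single_induct) (auto simp: mult_single distrib_left distrib_right mult.commute)
  then show ?thesis by (simp add: fin_scale_def mult_map_scale_conv_mult mult.assoc[symmetric])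
qed

interpretation FS: vector_space "fin_scale :: complex \<Rightarrow> ('b \<Rightarrow>\<^sub>0 complex) \<Rightarrow> _"
  by (rule vector_space_fin_scale)

context complex_space
begin

definition lin_ext :: "('b \<Rightarrow> 'w) \<Rightarrow> ('b \<Rightarrow>\<^sub>0 complex) \<Rightarrow> 'w" where
  "lin_ext f x = (\<Sum>k\<in>Poly_Mapping.keys x. Poly_Mapping.lookup x k *s f k)"

lemma lin_ext_superset:
  assumes "finite S" "Poly_Mapping.keys x \<subseteq> S"
  shows "lin_ext f x = (\<Sum>k\<in>S. Poly_Mapping.lookup x k *s f k)"
  unfolding lin_ext_def using assms by (intro sum.mono_neutral_left) (auto simp: in_keys_iff)

lemma lin_ext_add: "lin_ext f (x + y) = lin_ext f x + lin_ext f y"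
proof -
  let ?S = "Poly_Mapping.keys x \<union> Poly_Mapping.keys y"
  show ?thesis
    by (subst (1 2 3) lin_ext_superset[where S = ?S])
      (use keys_add[of x y] in \<open>auto simp: lookup_add scale_left_distrib sum.distrib\<close>)
qed

lemma lin_ext_scale: "lin_ext f (fin_scale c x) = c *s lin_ext f x"
  by (subst lin_ext_superset[OF _ keys_fin_scale]) (simp_all add: lin_ext_def lookup_fin_scale scale_sum_right)

lemma lin_ext_single [simp]: "lin_ext f (Poly_Mapping.single k c) = c *s f k"
  by (cases "c = 0") (simp_all add: lin_ext_def)

lemma lin_ext_linear: "Vector_Spaces.linear fin_scale (*s) (lin_ext f)"
  by (rule linearI) (auto simp: vector_space_axioms vector_space_fin_scale lin_ext_add lin_ext_scale)

lemma linear_zero_on_span: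
  assumes "Vector_Spaces.linear fin_scale (*s) f" "\<And>x. x \<in> S \<Longrightarrow> f x = 0" "x \<in> module.span fin_scale S"
  shows "f x = 0"
proof -
  have "FS.subspace {x. f x = 0}"
    unfolding FS.subspace_def by (auto simp: linear_additive[OF assms(1)])
  then have "module.span fin_scale S \<subseteq> {x. f x = 0}"
    using assms(2) by (intro FS.span_minimal) auto
  then show ?thesis using assms(3) by blast
qed

end

context twisted_module
begin

definition fscale :: "complex \<Rightarrow> (int \<Rightarrow> 'w \<Rightarrow> 'w) \<Rightarrow> int \<Rightarrow> 'w \<Rightarrow> 'w" where
  "fscale c \<alpha> = (\<lambda>n w. c *s \<alpha> n w)"

text \<open>All families of operators form a vector space, so linear extension applies to maps into
  it; that the values are good fields is tracked separately.\<close>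

sublocale E: complex_space fscale
  by unfold_locales (auto simp: fscale_def fun_eq_iff scale_right_distrib scale_left_distrib)

lemma nprod_cur_add:
  assumes "good \<alpha>"
  shows "nprod (cur (a + b)) \<alpha> n = nprod (cur a) \<alpha> n + nprod (cur b) \<alpha> n"
proof -
  obtain k k' where "quasi_local k (cur a) \<alpha>" "quasi_local k' (cur b) \<alpha>" using good_local[OF assms] by blast
  then show ?thesis unfolding cur_add by (rule nprod_add_left[OF field_cur field_cur goodD[OF assms]])
qed

lemma nprod_cur_scale: "good \<alpha> \<Longrightarrow> nprod (cur (sg c a)) \<alpha> n = fscale c (nprod (cur a) \<alpha> n)"
  unfolding cur_scale fscale_def using nprod_scale_left[OF field_cur goodD] good_local by blast

lemma nprod_cur_zero: "good \<alpha> \<Longrightarrow> nprod (cur 0) \<alpha> n = 0"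
  using nprod_cur_scale[of \<alpha> 0 0 n] by simp

lemma nprod_good_add:
  assumes "good \<alpha>" "good \<beta>"
  shows "nprod (cur a) (\<alpha> + \<beta>) n = nprod (cur a) \<alpha> n + nprod (cur a) \<beta> n"
proof -
  obtain k k' where "quasi_local k (cur a) \<alpha>" "quasi_local k' (cur a) \<beta>" using good_local assms by blast
  then show ?thesis by (rule nprod_add_right[OF field_cur goodD[OF assms(1)] goodD[OF assms(2)]])
qed

lemma good_fscale: "good \<alpha> \<Longrightarrow> good (fscale c \<alpha>)"
  unfolding fscale_def by (rule good_scale)

lemma nprod_good_scale: "good \<alpha> \<Longrightarrow> nprod (cur a) (fscale c \<alpha>) n = fscale c (nprod (cur a) \<alpha> n)"
  unfolding fscale_def using nprod_scale_right[OF field_cur goodD] good_local by blast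

lemma nprod_good_zero: "nprod (cur a) 0 n = 0"
  using nprod_good_scale[OF good_zero, of a 0 n] by simp

lemma nprod_good_sum:
  "(\<And>i. i \<in> I \<Longrightarrow> good (f i)) \<Longrightarrow> nprod (cur a) (sum f I) n = (\<Sum>i\<in>I. nprod (cur a) (f i) n)"
  by (induction I rule: infinite_finite_induct) (auto simp: nprod_good_zero nprod_good_add good_sum)

text \<open>The untwisted affine algebra acts on fields: a \<otimes> t^n by the n-th product with
  the current of a, the central element by \<open>level\<close>.\<close>

definition aff :: "(int, 'g) affine \<Rightarrow> (int \<Rightarrow> 'w \<Rightarrow> 'w) \<Rightarrow> int \<Rightarrow> 'w \<Rightarrow> 'w" where
  "aff X \<alpha> = (\<Sum>n\<in>Poly_Mapping.keys (fst X). nprod (cur (Poly_Mapping.lookup (fst X) n)) \<alpha> n) + fscale (level * snd X) \<alpha>"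

lemma aff_superset:
  assumes "good \<alpha>" "finite S" "Poly_Mapping.keys (fst X) \<subseteq> S"
  shows "aff X \<alpha> = (\<Sum>n\<in>S. nprod (cur (Poly_Mapping.lookup (fst X) n)) \<alpha> n) + fscale (level * snd X) \<alpha>"
  unfolding aff_def using assms
  by (intro arg_cong2[of _ _ _ _ "(+)"] sum.mono_neutral_left refl) (auto simp: in_keys_iff nprod_cur_zero)

lemma aff_add:
  assumes "good \<alpha>"
  shows "aff (X + Y) \<alpha> = aff X \<alpha> + aff Y \<alpha>"
proof -
  let ?S = "Poly_Mapping.keys (fst X) \<union> Poly_Mapping.keys (fst Y)"
  show ?thesis
    by (subst (1 2 3) aff_superset[OF assms, where S = ?S])
      (use keys_add[of "fst X" "fst Y"] in
        \<open>auto simp: lookup_add nprod_cur_add[OF assms] sum.distrib distrib_left E.scale_left_distrib algebra_simps\<close>)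
qed

lemma aff_zero: "aff 0 \<alpha> = 0"
  by (simp add: aff_def)

lemma aff_sum: "good \<alpha> \<Longrightarrow> aff (sum X I) \<alpha> = (\<Sum>i\<in>I. aff (X i) \<alpha>)"
  by (induction I rule: infinite_finite_induct) (auto simp: aff_zero aff_add)

lemma aff_scale:
  assumes "good \<alpha>"
  shows "aff (affine_scale sg c X) \<alpha> = fscale c (aff X \<alpha>)"
proof -
  have l: "Poly_Mapping.lookup (Poly_Mapping.map (sg c) (fst X)) n = sg c (Poly_Mapping.lookup (fst X) n)" for n
    by (simp add: Poly_Mapping.map.rep_eq when_def)
  have "Poly_Mapping.keys (Poly_Mapping.map (sg c) (fst X)) \<subseteq> Poly_Mapping.keys (fst X)"
    by (auto simp: in_keys_iff l)
  then show ?thesis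
    by (subst aff_superset[OF assms, where S = "Poly_Mapping.keys (fst X)"])
      (auto simp: affine_scale_def aff_def l nprod_cur_scale[OF assms] E.scale_right_distrib E.scale_sum_right mult_ac)
qed

lemma aff_loop: "good \<alpha> \<Longrightarrow> aff (loop n a) \<alpha> = nprod (cur a) \<alpha> n"
  by (cases "a = 0") (auto simp: aff_def loop_def nprod_cur_zero)

lemma good_aff: "good \<alpha> \<Longrightarrow> good (aff X \<alpha>)"
  unfolding aff_def by (intro good_add good_sum good_nprod good_fscale)

lemma aff_add_right: "good \<alpha> \<Longrightarrow> good \<beta> \<Longrightarrow> aff X (\<alpha> + \<beta>) = aff X \<alpha> + aff X \<beta>"
  by (simp add: aff_def nprod_good_add sum.distrib E.scale_right_distrib algebra_simps)

lemma aff_scale_right: "good \<alpha> \<Longrightarrow> aff X (fscale c \<alpha>) = fscale c (aff X \<alpha>)"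
  by (simp add: aff_def nprod_good_scale E.scale_right_distrib E.scale_sum_right mult_ac)

lemma aff_zero_right: "aff X 0 = 0"
  by (simp add: aff_def nprod_good_zero)

text \<open>Bilinear expansion reduces this to \<open>cur_nprod_commutator\<close>; the scalar parts
  of X and Y commute with the rest and cancel.\<close>

lemma aff_commutator:
  assumes "good \<alpha>"
  shows "aff (affine_bracket bracket form of_int X Y) \<alpha> = aff X (aff Y \<alpha>) - aff Y (aff X \<alpha>)"
proof -
  let ?a = "Poly_Mapping.lookup (fst X)" and ?b = "Poly_Mapping.lookup (fst Y)"
  let ?K = "Poly_Mapping.keys (fst X)" and ?L = "Poly_Mapping.keys (fst Y)"
  define S where "S = (\<Sum>m\<in>?K. nprod (cur (?a m)) \<alpha> m)"
  define R where "R = (\<Sum>n\<in>?L. nprod (cur (?b n)) \<alpha> n)"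
  have gS: "good S" "good R" unfolding S_def R_def by (intro good_sum good_nprod assms)+
  have X: "aff X \<alpha> = S + fscale (level * snd X) \<alpha>" and Y: "aff Y \<alpha> = R + fscale (level * snd Y) \<alpha>"
    by (simp_all add: aff_def S_def R_def)
  have XY: "aff X (aff Y \<alpha>) = (\<Sum>m\<in>?K. \<Sum>n\<in>?L. nprod (cur (?a m)) (nprod (cur (?b n)) \<alpha> n) m) +
      fscale (level * snd Y) S + fscale (level * snd X) R + fscale (level * snd Y) (fscale (level * snd X) \<alpha>)"
  proof -
    have "aff X (aff Y \<alpha>) = aff X R + fscale (level * snd Y) (aff X \<alpha>)"
      unfolding Y by (simp add: aff_add_right aff_scale_right gS assms good_fscale)
    also have "aff X R = (\<Sum>m\<in>?K. \<Sum>n\<in>?L. nprod (cur (?a m)) (nprod (cur (?b n)) \<alpha> n) m) + fscale (level * snd X) R"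
      unfolding aff_def R_def by (simp add: nprod_good_sum good_nprod assms)
    finally show ?thesis unfolding X by (simp only: E.scale_right_distrib ac_simps)
  qed
  have YX: "aff Y (aff X \<alpha>) = (\<Sum>m\<in>?K. \<Sum>n\<in>?L. nprod (cur (?b n)) (nprod (cur (?a m)) \<alpha> m) n) +
      fscale (level * snd X) R + fscale (level * snd Y) S + fscale (level * snd Y) (fscale (level * snd X) \<alpha>)"
  proof -
    have "aff Y (aff X \<alpha>) = aff Y S + fscale (level * snd X) (aff Y \<alpha>)"
      unfolding X by (simp add: aff_add_right aff_scale_right gS assms good_fscale)
    also have "aff Y S = (\<Sum>n\<in>?L. \<Sum>m\<in>?K. nprod (cur (?b n)) (nprod (cur (?a m)) \<alpha> m) n) + fscale (level * snd Y) S"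
      unfolding aff_def S_def by (simp add: nprod_good_sum good_nprod assms)
    also have "(\<Sum>n\<in>?L. \<Sum>m\<in>?K. nprod (cur (?b n)) (nprod (cur (?a m)) \<alpha> m) n) =
        (\<Sum>m\<in>?K. \<Sum>n\<in>?L. nprod (cur (?b n)) (nprod (cur (?a m)) \<alpha> m) n)" by (rule sum.swap)
    finally show ?thesis
      unfolding Y by (simp only: E.scale_right_distrib E.scale_left_commute[of "level * snd X" "level * snd Y"] ac_simps)
  qed
  have trm: "aff (Poly_Mapping.single (m + n) (bracket (?a m) (?b n)), of_int m * form (?a m) (?b n) * (if m + n = 0 then 1 else 0)) \<alpha> =
      nprod (cur (?a m)) (nprod (cur (?b n)) \<alpha> n) m - nprod (cur (?b n)) (nprod (cur (?a m)) \<alpha> m) n" for m n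
  proof -
    have "(Poly_Mapping.single (m + n) (bracket (?a m) (?b n)), of_int m * form (?a m) (?b n) * (if m + n = 0 then 1 else 0)) =
        loop (m + n) (bracket (?a m) (?b n)) + (0, of_int m * form (?a m) (?b n) * (if m + n = 0 then 1 else 0))"
      by (simp add: loop_def)
    then have "aff (Poly_Mapping.single (m + n) (bracket (?a m) (?b n)), of_int m * form (?a m) (?b n) * (if m + n = 0 then 1 else 0)) \<alpha> =
        nprod (cur (bracket (?a m) (?b n))) \<alpha> (m + n) + fscale (level * (of_int m * form (?a m) (?b n) * (if m + n = 0 then 1 else 0))) \<alpha>"
      by (simp only: aff_add[OF assms] aff_loop[OF assms]) (simp add: aff_def)
    also have "\<dots> = nprod (cur (?a m)) (nprod (cur (?b n)) \<alpha> n) m - nprod (cur (?b n)) (nprod (cur (?a m)) \<alpha> m) n"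
      using cur_nprod_commutator[OF assms] by (auto simp: fun_eq_iff fscale_def mult_ac)
    finally show ?thesis .
  qed
  have "aff (affine_bracket bracket form of_int X Y) \<alpha> =
      (\<Sum>m\<in>?K. \<Sum>n\<in>?L. nprod (cur (?a m)) (nprod (cur (?b n)) \<alpha> n) m - nprod (cur (?b n)) (nprod (cur (?a m)) \<alpha> m) n)"
    unfolding affine_bracket_def Let_def aff_sum[OF assms] trm ..
  also have "\<dots> = aff X (aff Y \<alpha>) - aff Y (aff X \<alpha>)"
    unfolding XY YX sum_subtractf by (rule regroup_diff[symmetric])
  finally show ?thesis .
qed

section \<open>Evaluation of the enveloping algebra\<close>

primrec words :: "(int, 'g) affine list \<Rightarrow> (int \<Rightarrow> 'w \<Rightarrow> 'w) \<Rightarrow> int \<Rightarrow> 'w \<Rightarrow> 'w" where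
  "words [] \<alpha> = \<alpha>"
| "words (X # u) \<alpha> = aff X (words u \<alpha>)"

definition eval_free :: "(int, 'g) affine free_algebra \<Rightarrow> (int \<Rightarrow> 'w \<Rightarrow> 'w) \<Rightarrow> int \<Rightarrow> 'w \<Rightarrow> 'w" where
  "eval_free u \<alpha> = E.lin_ext (\<lambda>k. case k of NC_Word l \<Rightarrow> words l \<alpha>) u"

lemma words_append: "words (u @ v) \<alpha> = words u (words v \<alpha>)"
  by (induction u) auto

lemma good_words: "good \<alpha> \<Longrightarrow> good (words u \<alpha>)"
  by (induction u) (auto simp: good_aff)

lemma words_add: "good \<alpha> \<Longrightarrow> good \<beta> \<Longrightarrow> words u (\<alpha> + \<beta>) = words u \<alpha> + words u \<beta>"
  by (induction u) (auto simp: aff_add_right good_words)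

lemma words_scale: "good \<alpha> \<Longrightarrow> words u (fscale c \<alpha>) = fscale c (words u \<alpha>)"
  by (induction u) (auto simp: aff_scale_right good_words)

lemma good_eval: "good \<alpha> \<Longrightarrow> good (eval_free u \<alpha>)"
  unfolding eval_free_def E.lin_ext_def
  by (intro good_sum good_fscale) (auto simp: good_words split: nc_word.split)

lemma eval_add: "eval_free (u + v) \<alpha> = eval_free u \<alpha> + eval_free v \<alpha>"
  by (simp add: eval_free_def E.lin_ext_add)

lemma eval_fin_scale: "eval_free (fin_scale c u) \<alpha> = fscale c (eval_free u \<alpha>)"
  by (simp add: eval_free_def E.lin_ext_scale)

lemma eval_diff: "eval_free (u - v) \<alpha> = eval_free u \<alpha> - eval_free v \<alpha>"
  using eval_add[of "u - v" v \<alpha>] by simp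

lemma eval_zero: "eval_free 0 \<alpha> = 0"
  by (simp add: eval_free_def E.lin_ext_def)

lemma eval_single: "eval_free (Poly_Mapping.single (NC_Word l) c) \<alpha> = fscale c (words l \<alpha>)"
  by (simp add: eval_free_def)

lemma eval_one: "eval_free 1 \<alpha> = \<alpha>"
  using eval_single[of "[]" 1 \<alpha>] by (simp add: zero_nc_word_def[symmetric])

lemma eval_generator: "eval_free (generator X) \<alpha> = aff X \<alpha>"
  by (simp add: generator_def eval_single)

lemma eval_add_right: "good \<alpha> \<Longrightarrow> good \<beta> \<Longrightarrow> eval_free u (\<alpha> + \<beta>) = eval_free u \<alpha> + eval_free u \<beta>"
  unfolding eval_free_def E.lin_ext_def
  by (auto simp: words_add E.scale_right_distrib sum.distrib[symmetric] intro!: sum.cong split: nc_word.split)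

lemma eval_scale_right: "good \<alpha> \<Longrightarrow> eval_free u (fscale c \<alpha>) = fscale c (eval_free u \<alpha>)"
  unfolding eval_free_def E.lin_ext_def
  by (auto simp: words_scale E.scale_sum_right mult.commute intro!: sum.cong split: nc_word.split)

lemma eval_zero_right: "eval_free u 0 = 0"
  using eval_scale_right[OF good_zero, of u 0] by simp

lemma eval_mult:
  assumes "good \<alpha>"
  shows "eval_free (u * v) \<alpha> = eval_free u (eval_free v \<alpha>)"
proof (induction u rule: poly_mapping_single_induct)
  case (single k c)
  obtain l where k: "k = NC_Word l" by (cases k)
  show ?case
  proof (induction v rule: poly_mapping_single_induct)
    case (single k' c')
    obtain l' where k': "k' = NC_Word l'" by (cases k')
    show ?case
      by (simp add: k k' mult_single eval_single words_append words_scale good_words assms)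
  next
    case (add D D')
    then show ?case by (simp only: distrib_left eval_add eval_add_right good_eval assms)
  qed (simp only: mult_zero_right eval_zero eval_zero_right)
qed (simp_all only: distrib_right eval_add eval_zero mult_zero_left)

text \<open>By linearity only products u r v with a defining relation r matter, and r acts by 0 on
  every good field, in particular on the one produced by v.\<close>

lemma eval_ideal:
  assumes "u \<in> enveloping_ideal (affine_scale sg) (affine_bracket bracket form of_int)" "good \<alpha>"
  shows "eval_free u \<alpha> = 0"
proof (rule E.linear_zero_on_span[of "\<lambda>u. eval_free u \<alpha>"])
  show "Vector_Spaces.linear fin_scale fscale (\<lambda>u. eval_free u \<alpha>)"
    unfolding eval_free_def by (rule E.lin_ext_linear)
  show "u \<in> module.span fin_scale {u * r * v | u r v. r \<in> enveloping_relations (affine_scale sg) (affine_bracket bracket form of_int)}"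
    using assms(1) by (simp add: enveloping_ideal_def)
  fix x
  assume "x \<in> {u * r * v | u r v. r \<in> enveloping_relations (affine_scale sg) (affine_bracket bracket form of_int)}"
  then obtain u r v where x: "x = u * r * v"
    and r: "r \<in> enveloping_relations (affine_scale sg) (affine_bracket bracket form of_int)" by blast
  have "eval_free r \<beta> = 0" if \<beta>: "good \<beta>" for \<beta>
  proof -
    consider (add) X Y where "r = generator (X + Y) - generator X - generator Y"
      | (scale) c X where "r = generator (affine_scale sg c X) - fin_scale c (generator X)"
      | (bracket) X Y where "r = generator X * generator Y - generator Y * generator X -
          generator (affine_bracket bracket form of_int X Y)"
      using r unfolding enveloping_relations_def by blast
    then show ?thesis
      by cases (simp_all only: eval_diff eval_generator eval_mult[OF \<beta>] aff_add[OF \<beta>] aff_scale[OF \<beta>]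
          eval_fin_scale aff_commutator[OF \<beta>] add_diff_cancel_left' diff_self)
  qed
  then show "eval_free x \<alpha> = 0"
    by (simp add: x eval_mult assms(2) good_eval eval_zero_right)
qed

definition eval_tensor :: "((int, 'g) affine free_algebra \<times> complex \<Rightarrow>\<^sub>0 complex) \<Rightarrow> int \<Rightarrow> 'w \<Rightarrow> 'w" where
  "eval_tensor = E.lin_ext (\<lambda>(u, z). fscale z (eval_free u id_field))"

lemma eval_tensor_linear: "Vector_Spaces.linear fin_scale fscale eval_tensor"
  unfolding eval_tensor_def by (rule E.lin_ext_linear)

lemma eval_pure_tensor: "eval_tensor (pure_tensor u z) = fscale z (eval_free u id_field)"
  by (simp add: eval_tensor_def pure_tensor_def)

lemma good_eval_tensor: "good (eval_tensor x)"
  unfolding eval_tensor_def E.lin_ext_def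
  by (intro good_sum good_fscale) (auto intro!: good_fscale good_eval good_id)

lemma aff_positive_id:
  assumes "\<forall>n\<in>Poly_Mapping.keys (fst X). 0 \<le> n"
  shows "aff X id_field = fscale (level * snd X) id_field"
  using assms by (simp add: aff_def nprod_id_nonneg[OF field_cur])

text \<open>Evaluation on the constant field respects the inducing character, because nonnegative
  modes kill that field and the central element acts by \<open>level\<close>. Hence evaluation
  descends to the induced module.\<close>

lemma eval_tensor_relations:
  assumes "x \<in> module.span fin_scale (induced_relations (affine_scale sg) (affine_bracket bracket form of_int)
      {X. \<forall>n\<in>Poly_Mapping.keys (fst X). 0 \<le> n} (\<lambda>X. level * snd X))"
  shows "eval_tensor x = 0"
proof (rule E.linear_zero_on_span[OF eval_tensor_linear _ assms])
  fix x
  assume "x \<in> induced_relations (affine_scale sg) (affine_bracket bracket form of_int)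
      {X. \<forall>n\<in>Poly_Mapping.keys (fst X). 0 \<le> n} (\<lambda>X. level * snd X)"
  then show "eval_tensor x = 0"
    unfolding induced_relations_def
    by (auto simp: linear_additive[OF eval_tensor_linear] eval_pure_tensor eval_add eval_fin_scale
        E.scale_right_distrib E.scale_left_distrib eval_ideal good_id eval_mult eval_generator
        aff_positive_id eval_scale_right mult_ac)
qed

end

section \<open>The Jacobi identity in components\<close>

global_interpretation bipoly: coeff_hom "pev (mon (0, 1) :: int \<times> int \<Rightarrow>\<^sub>0 complex)"
  defines bev = bipoly.ev
  by unfold_locales (auto simp: const.ev_add const.ev_mult)

abbreviation pl :: "complex poly poly \<Rightarrow> int \<times> int \<Rightarrow>\<^sub>0 complex" where
  "pl \<equiv> bev (mon (1, 0))"

lemma sbinom_eq: "binomial_coeff n (int l) = sbinom n l"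
  by (simp add: binomial_coeff_def sbinom_def)

text \<open>The delta series of the iterate has upper index j + l, while \<open>hat\<close> uses the
  mode p = - j - 1 of x1; the reflection of binomial coefficients passes between them.\<close>

lemma sbinom_reflect: "sbinom (j + int l) l = (-1) ^ l * sbinom (- j - 1) l"
proof -
  have "(of_int (- j - 1) :: complex) gchoose l = (-1) ^ l * (of_int (j + int l) gchoose l)"
  proof -
    have e: "(of_int (- j - 1) :: complex) = - (of_int j + 1)" by simp
    show ?thesis unfolding e gbinomial_minus by simp
  qed
  then show ?thesis by (simp add: sbinom_def mult.assoc[symmetric])
qed

context cyclic_space
begin

lemma act_pl: "(pl f \<star> \<Phi>) (p, q) = (\<Sum>a\<le>degree f. \<Sum>b\<le>degree (coeff f a). coeff (coeff f a) b *s \<Phi> (p + int a, q + int b))"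
proof -
  have act_sum: "((\<Sum>i\<in>I. D i) \<star> \<Phi>) e = (\<Sum>i\<in>I. (D i \<star> \<Phi>) e)" for I :: "nat set" and D :: "nat \<Rightarrow> int \<times> int \<Rightarrow>\<^sub>0 complex" and e
    by (induction I rule: infinite_finite_induct) auto
  have "(pl f \<star> \<Phi>) (p, q) = (\<Sum>a\<le>degree f. ((pev (mon (0, 1)) (coeff f a) * mon (1, 0) ^ a) \<star> \<Phi>) (p, q))"
    by (simp only: bipoly.ev_altdef act_sum)
  also have "\<dots> = (\<Sum>a\<le>degree f. \<Sum>b\<le>degree (coeff f a). coeff (coeff f a) b *s \<Phi> (p + int a, q + int b))"
    by (simp add: act_mult act_pev mon_power)
  finally show ?thesis .
qed

lemma Sum_any_image:
  assumes "finite I" "inj_on g I" "\<And>d. d \<notin> g ` I \<Longrightarrow> h d = (0 :: 'w)"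
  shows "Sum_any h = (\<Sum>i\<in>I. h (g i))"
proof -
  have "Sum_any h = sum h (g ` I)"
    by (rule Sum_any.expand_superset) (use assms in auto)
  then show ?thesis by (simp add: sum.reindex[OF assms(2)])
qed

lemma mult_poly_series:
  "series_mult (*s) (poly_series f) A (i, j, k) =
    (\<Sum>a\<le>degree f. \<Sum>b\<le>degree (coeff f a). coeff (coeff f a) b *s A (i, j - int a, k - int b))"
proof -
  have zero: "poly_series f d = 0"
    if d: "d \<notin> (\<lambda>(a, b). (0, int a, int b)) ` Sigma {..degree f} (\<lambda>a. {..degree (coeff f a)})" for d
  proof (rule ccontr)
    assume nz: "poly_series f d \<noteq> 0"
    obtain x y z where xyz: "d = (x, y, z)" by (cases d)
    have h: "x = 0" "y \<ge> 0" "z \<ge> 0" "coeff (coeff f (nat y)) (nat z) \<noteq> 0"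
      using nz by (auto simp: poly_series_def xyz split: if_splits)
    then have "nat z \<le> degree (coeff f (nat y))" by (intro le_degree)
    moreover have "nat y \<le> degree f" using h(4) by (intro le_degree) auto
    ultimately have "d \<in> (\<lambda>(a, b). (0, int a, int b)) ` Sigma {..degree f} (\<lambda>a. {..degree (coeff f a)})"
      using h by (intro image_eqI[of _ _ "(nat y, nat z)"]) (auto simp: xyz)
    then show False using d by blast
  qed
  have "series_mult (*s) (poly_series f) A (i, j, k) =
      (\<Sum>x\<in>Sigma {..degree f} (\<lambda>a. {..degree (coeff f a)}).
        poly_series f ((\<lambda>(a, b). (0, int a, int b)) x) *s A ((i, j, k) - (\<lambda>(a, b). (0, int a, int b)) x))"
    unfolding series_mult_def
    by (rule Sum_any_image) (use zero in \<open>auto simp: inj_on_def\<close>)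
  also have "\<dots> = (\<Sum>a\<le>degree f. \<Sum>b\<le>degree (coeff f a). coeff (coeff f a) b *s A (i, j - int a, k - int b))"
    by (subst sum.Sigma) (auto simp: poly_series_def intro!: sum.cong)
  finally show ?thesis .
qed

lemma mult_delta_12:
  assumes G: "\<And>i j k. i \<noteq> 0 \<Longrightarrow> G (i, j, k) = 0"
    and fin: "fin_seq (\<lambda>l. G (0, j - (- i - 1) + int l, k - int l))"
  shows "series_mult (*s) delta_12 G (i, j, k) = binom_sum (- i - 1) (\<lambda>l. G (0, j - (- i - 1) + int l, k - int l))"
proof -
  define n where "n = - i - 1"
  obtain N where N: "\<And>l. l \<ge> N \<Longrightarrow> G (0, j - n + int l, k - int l) = 0"
    using fin by (auto simp: fin_seq_def n_def)
  have zero: "delta_12 d *s G ((i, j, k) - d) = 0" if d: "d \<notin> (\<lambda>l. (i, n - int l, int l)) ` {..<N}" for d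
  proof (rule ccontr)
    assume nz: "delta_12 d *s G ((i, j, k) - d) \<noteq> 0"
    obtain x y z where xyz: "d = (x, y, z)" by (cases d)
    have "i - x = 0" using G[of "i - x"] nz by (auto simp: xyz)
    moreover have "y = n - z" "z \<ge> 0"
      using nz \<open>i - x = 0\<close> by (auto simp: delta_12_def Let_def xyz binomial_coeff_def n_def split: if_splits)
    moreover have "nat z < N"
    proof (rule ccontr)
      assume "\<not> nat z < N"
      then have "G (0, j - n + int (nat z), k - int (nat z)) = 0" by (intro N) simp
      then show False using nz calculation by (simp add: xyz algebra_simps)
    qed
    ultimately have "d \<in> (\<lambda>l. (i, n - int l, int l)) ` {..<N}"
      by (intro image_eqI[of _ _ "nat z"]) (auto simp: xyz)
    then show False using d by blast
  qed
  have "series_mult (*s) delta_12 G (i, j, k) = (\<Sum>l<N. delta_12 (i, n - int l, int l) *s G ((i, j, k) - (i, n - int l, int l)))"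
    unfolding series_mult_def by (rule Sum_any_image) (use zero in \<open>auto simp: inj_on_def\<close>)
  also have "\<dots> = (\<Sum>l<N. sbinom n l *s G (0, j - n + int l, k - int l))"
    by (intro sum.cong refl) (simp add: delta_12_def Let_def n_def sbinom_eq algebra_simps)
  also have "\<dots> = binom_sum n (\<lambda>l. G (0, j - n + int l, k - int l))"
    by (rule binom_sum_eq[symmetric]) (rule N)
  finally show ?thesis by (simp add: n_def)
qed

lemma mult_delta_21:
  assumes G: "\<And>i j k. i \<noteq> 0 \<Longrightarrow> G (i, j, k) = 0"
    and fin: "fin_seq (\<lambda>l. G (0, j - int l, k - (- i - 1) + int l))"
  shows "series_mult (*s) delta_21 G (i, j, k) =
    (-1) powi (- i - 1) *s binom_sum (- i - 1) (\<lambda>l. G (0, j - int l, k - (- i - 1) + int l))"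
proof -
  define n where "n = - i - 1"
  obtain N where N: "\<And>l. l \<ge> N \<Longrightarrow> G (0, j - int l, k - n + int l) = 0"
    using fin by (auto simp: fin_seq_def n_def)
  have zero: "delta_21 d *s G ((i, j, k) - d) = 0" if d: "d \<notin> (\<lambda>l. (i, int l, n - int l)) ` {..<N}" for d
  proof (rule ccontr)
    assume nz: "delta_21 d *s G ((i, j, k) - d) \<noteq> 0"
    obtain x y z where xyz: "d = (x, y, z)" by (cases d)
    have "i - x = 0" using G[of "i - x"] nz by (auto simp: xyz)
    moreover have "z = n - y" "y \<ge> 0"
      using nz \<open>i - x = 0\<close> by (auto simp: delta_21_def Let_def xyz binomial_coeff_def n_def split: if_splits)
    moreover have "nat y < N"
    proof (rule ccontr)
      assume "\<not> nat y < N"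
      then have "G (0, j - int (nat y), k - n + int (nat y)) = 0" by (intro N) simp
      then show False using nz calculation by (simp add: xyz algebra_simps)
    qed
    ultimately have "d \<in> (\<lambda>l. (i, int l, n - int l)) ` {..<N}"
      by (intro image_eqI[of _ _ "nat y"]) (auto simp: xyz)
    then show False using d by blast
  qed
  have "series_mult (*s) delta_21 G (i, j, k) = (\<Sum>l<N. delta_21 (i, int l, n - int l) *s G ((i, j, k) - (i, int l, n - int l)))"
    unfolding series_mult_def by (rule Sum_any_image) (use zero in \<open>auto simp: inj_on_def\<close>)
  also have "\<dots> = (\<Sum>l<N. (-1) powi n *s (sbinom n l *s G (0, j - int l, k - n + int l)))"
    by (intro sum.cong refl) (simp add: delta_21_def Let_def n_def sbinom_eq algebra_simps)
  also have "\<dots> = (-1) powi n *s binom_sum n (\<lambda>l. G (0, j - int l, k - n + int l))"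
    by (subst binom_sum_eq[of N]) (auto simp: N scale_sum_right)
  finally show ?thesis by (simp add: n_def)
qed

text \<open>Multiplication by f comes first and spreads the iterate, which is free of x1, over the
  exponents 0 to degree f. Regrouped by monomials of f, each contribution is \<open>hat\<close>
  shifted by the monomial.\<close>

lemma mult_delta_10:
  assumes N: "\<And>l. l \<ge> N \<Longrightarrow> Q (- i - 1 + int l) = (\<lambda>q. 0)"
  shows "series_mult (*s) delta_10 (series_mult (*s) (poly_series f) (\<lambda>(i, j, k). if j = 0 then Q (- i - 1) (- k - 1) else 0)) (i, j, k) =
    (\<Sum>a\<le>degree f. \<Sum>b\<le>degree (coeff f a). coeff (coeff f a) b *s hat Q (- i - 1) (- j - 1 + int a, - k - 1 + int b))"
proof -
  define it where "it = (\<lambda>(i :: int, j :: int, k). if j = 0 then Q (- i - 1) (- k - 1) else 0)"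
  define G where "G = series_mult (*s) (poly_series f) it"
  have G: "G (i, j, k) = (if j \<ge> 0 \<and> nat j \<le> degree f then
      \<Sum>b\<le>degree (coeff f (nat j)). coeff (coeff f (nat j)) b *s Q (- i - 1) (- (k - int b) - 1) else 0)" for i j k
  proof -
    have "G (i, j, k) = (\<Sum>a\<le>degree f. if j = int a then \<Sum>b\<le>degree (coeff f a). coeff (coeff f a) b *s Q (- i - 1) (- (k - int b) - 1) else 0)"
      unfolding G_def mult_poly_series by (intro sum.cong refl) (auto simp: it_def)
    also have "\<dots> = (if j \<ge> 0 \<and> nat j \<le> degree f then
      \<Sum>b\<le>degree (coeff f (nat j)). coeff (coeff f (nat j)) b *s Q (- i - 1) (- (k - int b) - 1) else 0)"
    proof (cases "j \<ge> 0")
      case True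
      then have "j = int a \<longleftrightarrow> a = nat j" for a by auto
      then show ?thesis using True by simp
    qed (auto intro!: sum.neutral)
    finally show ?thesis .
  qed
  let ?g = "\<lambda>(l, a). (int l, j - int a, - (j - int a + int l) - 1)"
  have zero: "delta_10 d *s G ((i, j, k) - d) = 0" if d: "d \<notin> ?g ` ({..<N} \<times> {..degree f})" for d
  proof (rule ccontr)
    assume nz: "delta_10 d *s G ((i, j, k) - d) \<noteq> 0"
    obtain x y z where xyz: "d = (x, y, z)" by (cases d)
    have y: "y = - z - 1 - x" "x \<ge> 0"
      using nz by (auto simp: delta_10_def Let_def xyz binomial_coeff_def split: if_splits)
    have nzG: "G (i - x, j - y, k - z) \<noteq> 0" using nz by (auto simp: xyz)
    then have a: "j - y \<ge> 0" "nat (j - y) \<le> degree f" by (auto simp: G split: if_splits)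
    have "nat x < N"
    proof (rule ccontr)
      assume "\<not> nat x < N"
      then have "Q (- i - 1 + int (nat x)) = (\<lambda>q. 0)" by (intro N) simp
      then have "Q (- (i - x) - 1) = (\<lambda>q. 0)" using y(2) by (simp add: algebra_simps)
      then have "G (i - x, j - y, k - z) = 0" by (simp add: G)
      then show False using nzG by simp
    qed
    then have "d \<in> ?g ` ({..<N} \<times> {..degree f})"
      using y a by (intro image_eqI[of _ _ "(nat x, nat (j - y))"]) (auto simp: xyz)
    then show False using d by blast
  qed
  have "series_mult (*s) delta_10 G (i, j, k) = (\<Sum>x\<in>{..<N} \<times> {..degree f}. delta_10 (?g x) *s G ((i, j, k) - ?g x))"
    unfolding series_mult_def by (rule Sum_any_image) (use zero in \<open>auto simp: inj_on_def\<close>)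
  also have "\<dots> = (\<Sum>a\<le>degree f. \<Sum>l<N. delta_10 (?g (l, a)) *s G ((i, j, k) - ?g (l, a)))"
    by (subst sum.swap) (auto simp: sum.cartesian_product intro!: sum.cong)
  also have "\<dots> = (\<Sum>a\<le>degree f. \<Sum>l<N. \<Sum>b\<le>degree (coeff f a).
      coeff (coeff f a) b *s (sbinom (- j - 1 + int a) l *s ((-1) ^ l *s Q (- i - 1 + int l) ((- j - 1 + int a) + (- k - 1 + int b) - int l))))"
  proof (intro sum.cong refl)
    fix a l assume a: "a \<in> {..degree f}"
    have d: "delta_10 (?g (l, a)) = (-1) ^ l * sbinom (- j - 1 + int a) l"
      using sbinom_reflect[of "j - int a" l] by (simp add: delta_10_def Let_def sbinom_eq algebra_simps)
    have "G ((i, j, k) - ?g (l, a)) = (\<Sum>b\<le>degree (coeff f a). coeff (coeff f a) b *s Q (- i - 1 + int l) ((- j - 1 + int a) + (- k - 1 + int b) - int l))"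
      using a by (simp add: G algebra_simps)
    then show "delta_10 (?g (l, a)) *s G ((i, j, k) - ?g (l, a)) = (\<Sum>b\<le>degree (coeff f a).
      coeff (coeff f a) b *s (sbinom (- j - 1 + int a) l *s ((-1) ^ l *s Q (- i - 1 + int l) ((- j - 1 + int a) + (- k - 1 + int b) - int l))))"
      unfolding d by (simp add: scale_sum_right mult_ac)
  qed
  also have "\<dots> = (\<Sum>a\<le>degree f. \<Sum>b\<le>degree (coeff f a). coeff (coeff f a) b *s hat Q (- i - 1) (- j - 1 + int a, - k - 1 + int b))"
  proof (rule sum.cong[OF refl])
    fix a
    have "hat Q (- i - 1) (- j - 1 + int a, - k - 1 + int b) =
        (\<Sum>l<N. sbinom (- j - 1 + int a) l *s ((-1) ^ l *s Q (- i - 1 + int l) ((- j - 1 + int a) + (- k - 1 + int b) - int l)))" for b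
      unfolding hat_def prod.case by (rule binom_sum_eq) (simp add: N)
    then show "(\<Sum>l<N. \<Sum>b\<le>degree (coeff f a). coeff (coeff f a) b *s (sbinom (- j - 1 + int a) l *s ((-1) ^ l *s Q (- i - 1 + int l) ((- j - 1 + int a) + (- k - 1 + int b) - int l)))) =
        (\<Sum>b\<le>degree (coeff f a). coeff (coeff f a) b *s hat Q (- i - 1) (- j - 1 + int a, - k - 1 + int b))"
      by (subst sum.swap) (simp add: scale_sum_right)
  qed
  finally show ?thesis by (simp add: G_def it_def)
qed

text \<open>Reading off the coefficient of x0^(-n-1) x1^(-p-1) x2^(-q-1) turns the left-hand delta
  products into \<open>borch\<close>, the right-hand one into \<open>hat\<close>, and multiplication
  by f into the Laurent action.\<close>

lemma jacobi_iff:
  fixes YV :: "'v::ab_group_add \<Rightarrow> int \<Rightarrow> 'v \<Rightarrow> 'v"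
  assumes U: "is_field (YW u)" and V: "is_field (YW v)" and zero: "\<And>q w. YW 0 q w = 0"
    and trunc: "\<exists>N. \<forall>n\<ge>N. YV u n v = 0"
  shows "jacobi_identity YV (*s) YW f u v w \<longleftrightarrow>
    (\<forall>n. pl f \<star> borch (YW u) (YW v) w n = pl f \<star> hat (\<lambda>n q. YW (YV u n v) q w) n)"
proof -
  define uv where "uv = (\<lambda>(i :: int, j, k). if i = 0 then YW u (- j - 1) (YW v (- k - 1) w) else 0)"
  define vu where "vu = (\<lambda>(i :: int, j, k). if i = 0 then YW v (- k - 1) (YW u (- j - 1) w) else 0)"
  define it where "it = (\<lambda>(i, j :: int, k). if j = 0 then YW (YV u (- i - 1) v) (- k - 1) w else 0)"
  define Q where "Q = (\<lambda>n q. YW (YV u n v) q w)"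
  let ?mult = "series_mult (*s)" and ?F = "poly_series f"
  obtain N0 where N0: "\<forall>n\<ge>N0. YV u n v = 0" using trunc by blast
  have rhs: "?mult delta_10 (?mult ?F it) (i, j, k) = (pl f \<star> hat Q (- i - 1)) (- j - 1, - k - 1)" for i j k
  proof -
    have "it = (\<lambda>(i, j, k). if j = 0 then Q (- i - 1) (- k - 1) else 0)"
      by (auto simp: it_def Q_def fun_eq_iff)
    then show ?thesis
      using mult_delta_10[of "nat (N0 + i + 1)" Q i f j k] N0
      by (simp add: act_pl Q_def zero)
  qed
  define \<Phi> where "\<Phi> = (\<lambda>(p, q). YW u p (YW v q w))"
  define \<Psi> where "\<Psi> = (\<lambda>(p, q). YW v q (YW u p w))"
  have G1: "?mult ?F uv (0, j, k) = (pl f \<star> \<Phi>) (- j - 1, - k - 1)" for j k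
    unfolding mult_poly_series act_pl \<Phi>_def uv_def by (simp add: algebra_simps)
  have G2: "?mult ?F vu (0, j, k) = (pl f \<star> \<Psi>) (- j - 1, - k - 1)" for j k
    unfolding mult_poly_series act_pl \<Psi>_def vu_def by (simp add: algebra_simps)
  have z1: "?mult ?F uv (i, j, k) = 0" "?mult ?F vu (i, j, k) = 0" if "i \<noteq> 0" for i j k
    unfolding mult_poly_series uv_def vu_def using that by simp_all
  have fin1: "fin_seq (\<lambda>l. \<Phi> (e + (n - int l, int l)))" for e n
  proof -
    obtain p q where e: "e = (p, q)" by (cases e)
    show ?thesis using borch_fin[OF U V, of "p + n" q w] by (simp add: e \<Phi>_def add_diff_eq)
  qed
  have fin2: "fin_seq (\<lambda>l. \<Psi> (e + (int l, n - int l)))" for e n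
  proof -
    obtain p q where e: "e = (p, q)" by (cases e)
    show ?thesis using borch_fin[OF V U, of "q + n" p w] by (simp add: e \<Psi>_def add_diff_eq)
  qed
  have lhs: "?mult delta_12 (?mult ?F uv) (i, j, k) - ?mult delta_21 (?mult ?F vu) (i, j, k) =
      (pl f \<star> borch (YW u) (YW v) w (- i - 1)) (- j - 1, - k - 1)" for i j k
  proof -
    define n p q where "n = - i - 1" and "p = - j - 1" and "q = - k - 1"
    have e1: "?mult ?F uv (0, j - n + int l, k - int l) = (pl f \<star> (\<lambda>e. \<Phi> (e + (n - int l, int l)))) (p, q)" for l
      unfolding G1 act_shift by (simp add: p_def q_def algebra_simps)
    have e2: "?mult ?F vu (0, j - int l, k - n + int l) = (pl f \<star> (\<lambda>e. \<Psi> (e + (int l, n - int l)))) (p, q)" for l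
      unfolding G2 act_shift by (simp add: p_def q_def algebra_simps)
    have act_fin: "fin_seq (\<lambda>l. (D \<star> (\<lambda>e. \<phi> e l)) e)" if "\<And>e. fin_seq (\<phi> e)"
      for D :: "int \<times> int \<Rightarrow>\<^sub>0 complex" and \<phi> :: "int \<times> int \<Rightarrow> nat \<Rightarrow> 'w" and e
      unfolding laurent_act_def by (intro fin_seq_sum fin_seq_map[OF that]) simp
    have "?mult delta_12 (?mult ?F uv) (i, j, k) = binom_sum n (\<lambda>l. (pl f \<star> (\<lambda>e. \<Phi> (e + (n - int l, int l)))) (p, q))"
      unfolding e1[symmetric] unfolding n_def
      by (rule mult_delta_12, rule z1(1)) (auto simp: e1[unfolded n_def] intro!: act_fin fin1)
    moreover have "?mult delta_21 (?mult ?F vu) (i, j, k) = (-1) powi n *s binom_sum n (\<lambda>l. (pl f \<star> (\<lambda>e. \<Psi> (e + (int l, n - int l)))) (p, q))"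
      unfolding e2[symmetric] unfolding n_def
      by (rule mult_delta_21, rule z1(2)) (auto simp: e2[unfolded n_def] intro!: act_fin fin2)
    moreover have "borch (YW u) (YW v) w n = (\<lambda>e. binom_sum n (\<lambda>l. \<Phi> (e + (n - int l, int l)))) -
        (\<lambda>e. (-1) powi n *s binom_sum n (\<lambda>l. \<Psi> (e + (int l, n - int l))))"
      by (auto simp: fun_eq_iff borch_def \<Phi>_def \<Psi>_def add_diff_eq)
    ultimately show ?thesis
      unfolding p_def[symmetric] q_def[symmetric] n_def[symmetric]
      by (simp only: act_diff_right act_scale_right minus_apply act_binom_sum[OF fin1] act_binom_sum[OF fin2])
  qed
  have "jacobi_identity YV (*s) YW f u v w \<longleftrightarrow> (\<forall>e. ?mult delta_12 (?mult ?F uv) e - ?mult delta_21 (?mult ?F vu) e = ?mult delta_10 (?mult ?F it) e)"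
    by (simp add: jacobi_identity_def Let_def uv_def vu_def it_def)
  also have "\<dots> \<longleftrightarrow> (\<forall>i j k. (pl f \<star> borch (YW u) (YW v) w (- i - 1)) (- j - 1, - k - 1) = (pl f \<star> hat Q (- i - 1)) (- j - 1, - k - 1))"
    unfolding split_paired_All lhs rhs ..
  also have "\<dots> \<longleftrightarrow> (\<forall>n p q. (pl f \<star> borch (YW u) (YW v) w n) (p, q) = (pl f \<star> hat Q n) (p, q))"
  proof
    assume h: "\<forall>i j k. (pl f \<star> borch (YW u) (YW v) w (- i - 1)) (- j - 1, - k - 1) = (pl f \<star> hat Q (- i - 1)) (- j - 1, - k - 1)"
    show "\<forall>n p q. (pl f \<star> borch (YW u) (YW v) w n) (p, q) = (pl f \<star> hat Q n) (p, q)"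
    proof (intro allI)
      fix n p q
      show "(pl f \<star> borch (YW u) (YW v) w n) (p, q) = (pl f \<star> hat Q n) (p, q)"
        using h[rule_format, of "- n - 1" "- p - 1" "- q - 1"] by simp
    qed
  qed blast
  finally show ?thesis by (simp add: fun_eq_iff Q_def)
qed

text \<open>At \<open>x\<^sub>1 = x\<^sub>2\<close> a nonzero polynomial \<open>f(x\<^sub>1, x\<^sub>2)\<close> has some finite order, whence it can be
  cancelled.\<close>

lemma hat_cancel:
  assumes f: "f \<noteq> 0" and z: "\<And>n. pl f \<star> hat \<Delta> n = 0"
    and N: "\<And>n q. n \<ge> N \<Longrightarrow> \<Delta> n q = 0" and B: "\<And>n. \<exists>B. \<forall>q\<ge>B. \<Delta> n q = 0"
  shows "\<Delta> n q = 0"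
proof -
  let ?x = "mon (1, 0) :: int \<times> int \<Rightarrow>\<^sub>0 complex" and ?y = "mon (0, 1) :: int \<times> int \<Rightarrow>\<^sub>0 complex"
  \<comment> \<open>\<open>a\<close> is the variable x2 as an element of the coefficient ring, so
    the order of f at \<open>a\<close> is its order of vanishing along x1 = x2, and c below is g(x2,
    x2).\<close>
  define a where "a = ([:0, 1:] :: complex poly)"
  obtain g where g: "f = [:- a, 1:] ^ order a f * g" "\<not> [:- a, 1:] dvd g"
    using order_decomp[OF f] by blast
  define c where "c = poly g a"
  have "c \<noteq> 0" using g(2) by (simp add: c_def poly_eq_0_iff_dvd)
  have lin: "pl [:- a, 1:] = ?x - ?y"
  proof -
    have "pl [:- a, 1:] = pev ?y (- a) + ?x * (pev ?y 1 + ?x * pl 0)" by (simp only: bipoly.ev_pCons)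
    also have "pev ?y (- a) = - ?y" by (simp only: const.ev_uminus a_def const.ev_X)
    finally show ?thesis by simp
  qed
  have hat_power: "hat \<Delta> (n + int j) = (?x - ?y) ^ j \<star> hat \<Delta> n" for n j
  proof (induction j)
    case (Suc j)
    have "hat \<Delta> (n + int (Suc j)) = hat \<Delta> ((n + int j) + 1)" by (simp add: algebra_simps)
    then show ?case using Suc hat_Suc[of N \<Delta> "n + int j", OF N] by (simp only: power_Suc act_mult)
  qed simp
  \<comment> \<open>The factors x1 - x2 of f only raise n. As the hypothesis holds for every n, f
    may be replaced by g.\<close>
  have zg: "pl g \<star> hat \<Delta> n = 0" for n
  proof -
    have "pl f = pl g * (?x - ?y) ^ order a f"
      by (subst g(1)) (simp only: bipoly.ev_mult bipoly.ev_power lin mult.commute)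
    then have "pl f \<star> hat \<Delta> (n - int (order a f)) = pl g \<star> hat \<Delta> ((n - int (order a f)) + int (order a f))"
      by (simp only: act_mult hat_power)
    then show ?thesis using z[of "n - int (order a f)"] by simp
  qed
  have "g = [:- a, 1:] * synthetic_div g a + [:c:]"
    using synthetic_div_correct'[of a g] by (simp add: c_def)
  then have plg: "pl g = pl (synthetic_div g a) * (?x - ?y) + pev ?y c"
    using bipoly.ev_add bipoly.ev_mult lin bipoly.ev_const by (metis mult.commute)
  define b0 where "b0 = (LEAST b. coeff c b \<noteq> 0)"
  have "\<exists>b. coeff c b \<noteq> 0" using \<open>c \<noteq> 0\<close> by (meson leading_coeff_0_iff)
  then have b0: "coeff c b0 \<noteq> 0" unfolding b0_def by (rule LeastI_ex)
  have lt: "coeff c b = 0" if "b < b0" for b using not_less_Least that unfolding b0_def by blast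
  \<comment> \<open>If everything above n vanishes, x1 - x2 annihilates
    \<open>hat \<Delta> n\<close> and g acts through c(x2) alone. The lowest term of c is matched
    with the largest mode m at which \<Delta> is nonzero.\<close>
  have main: "\<Delta> n q = 0" if IH: "\<And>n' q. n' > n \<Longrightarrow> \<Delta> n' q = 0" for n q
  proof (rule ccontr)
    assume ne: "\<Delta> n q \<noteq> 0"
    obtain B where B': "\<forall>q\<ge>B. \<Delta> n q = 0" using B by blast
    define S where "S = {q'. q' \<ge> q \<and> \<Delta> n q' \<noteq> 0}"
    have "S \<subseteq> {q..<B}"
    proof
      fix q' assume "q' \<in> S"
      then have "q \<le> q'" "\<not> B \<le> q'" using B' unfolding S_def by blast+
      then show "q' \<in> {q..<B}" by simp
    qed
    then have fS: "finite S" by (rule finite_subset) simp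
    have "q \<in> S" using ne by (simp add: S_def)
    define m where "m = Max S"
    have "m \<in> S" unfolding m_def using fS \<open>q \<in> S\<close> by (intro Max_in) auto
    have gt: "\<Delta> n q' = 0" if "q' > m" for q'
    proof (rule ccontr)
      assume "\<Delta> n q' \<noteq> 0"
      then have "q' \<in> S" using that \<open>m \<in> S\<close> by (auto simp: S_def)
      then have "q' \<le> m" unfolding m_def by (rule Max_ge[OF fS])
      then show False using that by simp
    qed
    have "hat \<Delta> (n + 1) = 0" by (rule hat_zero[of "n + 1"]) (auto intro: IH)
    then have "(?x - ?y) \<star> hat \<Delta> n = 0" using hat_power[of n 1] by simp
    then have "(pev ?y c \<star> hat \<Delta> n) (0, m - int b0) = 0"
      using zg[of n] unfolding plg act_add act_mult by (simp del: act_diff)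
    then have "(\<Sum>b\<le>degree c. coeff c b *s \<Delta> n (m - int b0 + int b)) = 0"
      by (simp add: act_pev hat_0)
    also have "(\<Sum>b\<le>degree c. coeff c b *s \<Delta> n (m - int b0 + int b)) = (\<Sum>b\<in>{b0}. coeff c b *s \<Delta> n (m - int b0 + int b))"
    proof (rule sum.mono_neutral_right)
      show "\<forall>b\<in>{..degree c} - {b0}. coeff c b *s \<Delta> n (m - int b0 + int b) = 0"
      proof
        fix b assume "b \<in> {..degree c} - {b0}"
        then consider "b < b0" | "b > b0" by force
        then show "coeff c b *s \<Delta> n (m - int b0 + int b) = 0"
          by cases (simp_all add: lt gt)
      qed
    qed (use b0 in \<open>auto intro: le_degree\<close>)
    finally have "\<Delta> n m = 0" using b0 by simp
    then show False using \<open>m \<in> S\<close> by (simp add: S_def)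
  qed
  have "\<forall>n q. nat (N - n) \<le> j \<longrightarrow> \<Delta> n q = 0" for j
  proof (induction j)
    case (Suc j)
    show ?case
    proof (intro allI impI)
      fix n q assume n: "nat (N - n) \<le> Suc j"
      show "\<Delta> n q = 0"
      proof (rule main)
        fix n' q' assume "n' > n"
        then have "nat (N - n') \<le> j" using n by linarith
        then show "\<Delta> n' q' = 0" using Suc by blast
      qed
    qed
  qed (use N in simp)
  then show ?thesis by blast
qed

end

section \<open>The quasi module structure\<close>

locale vacuum_setup =
  twisted_module sg bracket form scale T \<sigma> level actW + V: vertex_algebra scaleV Y vac
  for sg :: "complex \<Rightarrow> 'g::ab_group_add \<Rightarrow> 'g" and bracket form
    and scale :: "complex \<Rightarrow> 'w::ab_group_add \<Rightarrow> 'w" (infixr \<open>*s\<close> 75) and T \<sigma> level actW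
    and scaleV :: "complex \<Rightarrow> 'v::ab_group_add \<Rightarrow> 'v" and Y vac +
  fixes actV :: "(int, 'g) affine \<Rightarrow> 'v \<Rightarrow> 'v"
  assumes vacuum_module: "is_affine_vacuum_module sg bracket form level scaleV actV vac"
    and Y_gen: "Y (actV (loop (-1) a) vac) n v = actV (loop n a) v"
begin

sublocale VS: cyclic_space scaleV T
  by unfold_locales (rule T_pos)

section \<open>The vacuum module as a quotient of the free algebra\<close>

definition relations where
  "relations = induced_relations (affine_scale sg) (affine_bracket bracket form of_int)
      {X. \<forall>n\<in>Poly_Mapping.keys (fst X). 0 \<le> n} (\<lambda>X. level * snd X)"

definition proj :: "(((int, 'g) affine free_algebra \<times> complex) \<Rightarrow>\<^sub>0 complex) \<Rightarrow> 'v" where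
  "proj = (SOME \<Phi>. Vector_Spaces.linear fin_scale scaleV \<Phi> \<and> surj \<Phi> \<and>
        {x. \<Phi> x = 0} = module.span fin_scale relations \<and> \<Phi> (pure_tensor 1 1) = vac \<and>
        (\<forall>X u z. \<Phi> (pure_tensor (generator X * u) z) = actV X (\<Phi> (pure_tensor u z))))"

lemma proj: "Vector_Spaces.linear fin_scale scaleV proj" "surj proj"
  "{x. proj x = 0} = module.span fin_scale relations" "proj (pure_tensor 1 1) = vac"
  "proj (pure_tensor (generator X * u) z) = actV X (proj (pure_tensor u z))"
proof -
  have "\<exists>\<Phi>. Vector_Spaces.linear fin_scale scaleV \<Phi> \<and> surj \<Phi> \<and>
        {x. \<Phi> x = 0} = module.span fin_scale relations \<and> \<Phi> (pure_tensor 1 1) = vac \<and>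
        (\<forall>X u z. \<Phi> (pure_tensor (generator X * u) z) = actV X (\<Phi> (pure_tensor u z)))"
    using vacuum_module unfolding is_affine_vacuum_module_def is_induced_module_def relations_def by blast
  from someI_ex[OF this] show "Vector_Spaces.linear fin_scale scaleV proj" "surj proj"
    "{x. proj x = 0} = module.span fin_scale relations" "proj (pure_tensor 1 1) = vac"
    "proj (pure_tensor (generator X * u) z) = actV X (proj (pure_tensor u z))"
    unfolding proj_def by blast+
qed

lemmas proj_linear = linear_additive[OF proj(1)]

lemma proj_relation: "x \<in> relations \<Longrightarrow> proj x = 0"
  using proj(3) FS.span_base[of x relations] by blast

definition pure :: "(int, 'g) affine free_algebra \<Rightarrow> 'v" where
  "pure u = proj (pure_tensor u 1)"

lemma proj_add: "proj (pure_tensor (u + v) z) = proj (pure_tensor u z) + proj (pure_tensor v z)"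
proof -
  have "pure_tensor (u + v) z - pure_tensor u z - pure_tensor v z \<in> relations"
    unfolding relations_def induced_relations_def by blast
  from proj_relation[OF this] show ?thesis by (simp add: proj_linear algebra_simps)
qed

lemma proj_scale: "proj (pure_tensor (fin_scale c u) z) = scaleV c (proj (pure_tensor u z))"
proof -
  have "pure_tensor (fin_scale c u) z - fin_scale c (pure_tensor u z) \<in> relations"
    unfolding relations_def induced_relations_def by blast
  from proj_relation[OF this] show ?thesis by (simp add: proj_linear)
qed

lemma proj_scale_right: "proj (pure_tensor u (c * z)) = scaleV c (proj (pure_tensor u z))"
proof -
  have "pure_tensor u (c * z) - fin_scale c (pure_tensor u z) \<in> relations"
    unfolding relations_def induced_relations_def by blast
  from proj_relation[OF this] show ?thesis by (simp add: proj_linear)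
qed

lemma pure_add: "pure (u + v) = pure u + pure v"
  by (simp add: pure_def proj_add)

lemma pure_scale: "pure (fin_scale c u) = scaleV c (pure u)"
  by (simp add: pure_def proj_scale)

lemma pure_generator: "pure (generator X * u) = actV X (pure u)"
  by (simp add: pure_def proj(5))

lemma pure_one: "pure 1 = vac"
  by (simp add: pure_def proj(4))

lemma pure_diff: "pure (u - v) = pure u - pure v"
  using pure_add[of "u - v" v] by simp

lemma pure_ideal:
  assumes "u \<in> enveloping_ideal (affine_scale sg) (affine_bracket bracket form of_int)"
  shows "pure u = 0"
proof -
  have "pure_tensor u 1 \<in> relations"
    using assms unfolding relations_def induced_relations_def by blast
  then show ?thesis unfolding pure_def by (rule proj_relation)
qed

lemma pure_enveloping:
  assumes "r \<in> enveloping_relations (affine_scale sg) (affine_bracket bracket form of_int)"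
  shows "pure (r * v) = 0"
proof (rule pure_ideal)
  have "1 * r * v \<in> {u * r * v | u r v. r \<in> enveloping_relations (affine_scale sg) (affine_bracket bracket form of_int)}"
    using assms by blast
  then show "r * v \<in> enveloping_ideal (affine_scale sg) (affine_bracket bracket form of_int)"
    unfolding enveloping_ideal_def by (simp add: FS.span_base)
qed

lemma pure_surj: "\<exists>u. v = pure u"
proof -
  obtain x where x: "v = proj x" using proj(2) by (metis surjD)
  have "\<exists>u. proj x = pure u"
  proof (induction x rule: poly_mapping_single_induct)
    case zero
    show ?case by (rule exI[of _ 0]) (use pure_scale[of 0 0] in \<open>simp add: proj_linear\<close>)
  next
    case (single d c)
    obtain u z where d: "d = (u, z)" by (cases d)
    have "Poly_Mapping.single d c = fin_scale c (pure_tensor u z)"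
      by (simp add: d pure_tensor_def fin_scale_single)
    then have "proj (Poly_Mapping.single d c) = scaleV c (proj (pure_tensor u (z * 1)))" by (simp add: proj_linear)
    also have "\<dots> = pure (fin_scale (c * z) u)" unfolding proj_scale_right by (simp add: pure_def proj_scale)
    finally show ?case by blast
  next
    case (add D D')
    then obtain u u' where "proj D = pure u" "proj D' = pure u'" by blast
    then show ?case by (intro exI[of _ "u + u'"]) (simp add: proj_linear pure_add)
  qed
  then show ?thesis using x by simp
qed

lemma actV_add: "actV (X + X') v = actV X v + actV X' v"
proof -
  obtain u where v: "v = pure u" using pure_surj by blast
  have "pure ((generator (X + X') - generator X - generator X') * u) = 0"
    by (rule pure_enveloping) (unfold enveloping_relations_def, blast)
  then have "actV (X + X') v - actV X v - actV X' v = 0"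
    by (simp only: v left_diff_distrib pure_diff pure_generator)
  then show ?thesis by (simp add: algebra_simps)
qed

lemma actV_scale: "actV (affine_scale sg c X) v = scaleV c (actV X v)"
proof -
  obtain u where v: "v = pure u" using pure_surj by blast
  have "pure ((generator (affine_scale sg c X) - fin_scale c (generator X)) * u) = 0"
    by (rule pure_enveloping) (unfold enveloping_relations_def, blast)
  then show ?thesis
    by (simp add: v left_diff_distrib pure_diff pure_generator fin_scale_mult_left[symmetric] pure_scale)
qed

lemma actV_linear: "Vector_Spaces.linear scaleV scaleV (actV X)"
proof (rule linearI)
  fix v v' c
  obtain u u' where v: "v = pure u" "v' = pure u'" using pure_surj by metis
  show "actV X (v + v') = actV X v + actV X v'"
    unfolding v pure_add[symmetric] pure_generator[symmetric] by (simp add: distrib_left)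
  show "actV X (scaleV c v) = scaleV c (actV X v)"
    unfolding v pure_scale[symmetric] pure_generator[symmetric] by (simp add: fin_scale_mult_right)
qed (auto simp: V.vector_space_axioms)

lemma affine_scale_zero: "affine_scale sg 0 X = 0"
  by (auto simp: affine_scale_def zero_prod_def intro!: poly_mapping_eqI simp: Poly_Mapping.map.rep_eq)

lemma actV_zero: "actV 0 v = 0"
  using actV_scale[of 0 0 v] by (simp add: affine_scale_zero)

lemma words_pure_induct:
  assumes "P vac" "\<And>v v'. P v \<Longrightarrow> P v' \<Longrightarrow> P (v + v')" "\<And>c v. P v \<Longrightarrow> P (scaleV c v)"
    and "\<And>X v. P v \<Longrightarrow> P (actV X v)"
  shows "P v"
proof -
  have word: "P (pure (Poly_Mapping.single (NC_Word l) 1))" for l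
  proof (induction l)
    case Nil
    then show ?case using assms(1) by (simp add: zero_nc_word_def[symmetric] pure_one)
  next
    case (Cons X l)
    have "Poly_Mapping.single (NC_Word (X # l)) 1 = generator X * Poly_Mapping.single (NC_Word l) 1"
      by (simp add: generator_def mult_single)
    then show ?case using assms(4)[OF Cons] by (simp add: pure_generator)
  qed
  have "P (pure u)" for u
  proof (induction u rule: poly_mapping_single_induct)
    case zero
    show ?case using assms(3)[OF assms(1), of 0] pure_scale[of 0 0] by simp
  next
    case (single d c)
    obtain l where d: "d = NC_Word l" by (cases d)
    have "Poly_Mapping.single d c = fin_scale c (Poly_Mapping.single (NC_Word l) 1)"
      by (simp add: d fin_scale_single)
    then show ?case using assms(3)[OF word] by (simp add: pure_scale)
  next
    case (add D D')
    then show ?case using assms(2) by (simp add: pure_add)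
  qed
  then show ?thesis using pure_surj[of v] by auto
qed

text \<open>On the vacuum this is the relation u b \<otimes> z = u \<otimes> b z for central b; it
  propagates since b commutes with every generator in the enveloping algebra.\<close>

lemma actV_central: "actV (0, z) v = scaleV (level * z) v"
proof (induction v rule: words_pure_induct)
  case 1
  have "pure_tensor (1 * generator (0, z)) 1 - pure_tensor 1 (level * snd (0 :: int \<Rightarrow>\<^sub>0 'g, z) * 1) \<in> relations"
    unfolding relations_def induced_relations_def
    by (rule UnI2, rule CollectI, rule exI[of _ 1], rule exI[of _ "(0, z)"], rule exI[of _ 1]) simp
  from proj_relation[OF this] have "pure (generator (0, z) * 1) = scaleV (level * z) (pure 1)"
    using proj_scale_right[of 1 "level * z" 1] by (simp add: proj_linear pure_def)
  then show ?case unfolding pure_generator pure_one .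
next
  case (2 v v')
  then show ?case by (simp add: linear_additive[OF actV_linear] V.scale_right_distrib)
next
  case (3 c v)
  then show ?case by (simp add: linear_additive[OF actV_linear] mult.commute)
next
  case (4 X v)
  obtain u where v: "v = pure u" using pure_surj by blast
  have br: "affine_bracket bracket form of_int (0, z) X = 0" by (simp add: affine_bracket_def)
  have "pure ((generator (0, z) * generator X - generator X * generator (0, z) -
      generator (affine_bracket bracket form of_int (0, z) X)) * u) = 0"
    by (rule pure_enveloping) (unfold enveloping_relations_def, blast)
  then have "actV (0, z) (actV X v) = actV X (actV (0, z) v)"
    unfolding br left_diff_distrib pure_diff mult.assoc pure_generator v[symmetric] by (simp add: actV_zero)
  then show ?case using 4 by (simp add: linear_additive[OF actV_linear])
qed

text \<open>An element X is split into its loop components and a central part, which is scalar; the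
  induction step then concerns a single a \<otimes> t^n, that is, one mode of a generator.\<close>

lemma V_induct [case_names vac add scale loop]:
  assumes "P vac" and add: "\<And>v v'. P v \<Longrightarrow> P v' \<Longrightarrow> P (v + v')" and sc: "\<And>c v. P v \<Longrightarrow> P (scaleV c v)"
    and lp: "\<And>a n v. P v \<Longrightarrow> P (actV (loop n a) v)"
  shows "P v"
proof (rule words_pure_induct[of P])
  fix X :: "(int, 'g) affine" and v assume v: "P v"
  have "P (actV (f, 0) v)" for f
  proof (induction f rule: poly_mapping_single_induct)
    case zero
    have "(0 :: int \<Rightarrow>\<^sub>0 'g, 0 :: complex) = 0" by (simp add: zero_prod_def)
    then show ?case using sc[OF v, of 0] by (simp add: actV_zero)
  next
    case (single d c)
    then show ?case using lp[OF v, of d c] by (simp add: loop_def)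
  next
    case (add D D')
    then show ?case using assms(2)[of "actV (D, 0) v" "actV (D', 0) v"] actV_add[of "(D, 0)" "(D', 0)" v] by simp
  qed
  then have "P (actV (fst X, 0) v + actV (0, snd X) v)"
    using sc[OF v] by (intro add) (simp_all add: actV_central)
  then show "P (actV X v)" using actV_add[of "(fst X, 0)" "(0, snd X)" v] by simp
qed (use assms in auto)

definition YW :: "'v \<Rightarrow> int \<Rightarrow> 'w \<Rightarrow> 'w" where
  "YW v = eval_tensor (SOME x. proj x = v)"

text \<open>The choice of a preimage is immaterial: the kernel of \<open>proj\<close> is spanned by
  relations, on which the evaluation vanishes.\<close>

lemma YW_proj: "YW (proj x) = eval_tensor x"
proof -
  define x' where "x' = (SOME x'. proj x' = proj x)"
  have "proj x' = proj x" unfolding x'_def by (rule someI[of _ x]) simp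
  then have "proj (x' - x) = 0" by (simp add: proj_linear)
  then have "x' - x \<in> module.span fin_scale relations" using proj(3) by blast
  then have "eval_tensor (x' - x) = 0" unfolding relations_def by (rule eval_tensor_relations)
  then show ?thesis by (simp add: YW_def x'_def[symmetric] linear_additive[OF eval_tensor_linear])
qed

lemma YW_linear: "Vector_Spaces.linear scaleV fscale YW"
proof (rule linearI)
  fix v v' c
  obtain x x' where v: "v = proj x" "v' = proj x'" using proj(2) by (metis surjD)
  show "YW (v + v') = YW v + YW v'"
    unfolding v proj_linear(1)[symmetric] YW_proj by (rule linear_additive(1)[OF eval_tensor_linear])
  show "YW (scaleV c v) = fscale c (YW v)"
    unfolding v proj_linear(5)[symmetric] YW_proj by (rule linear_additive(5)[OF eval_tensor_linear])
qed (auto simp: V.vector_space_axioms E.vector_space_axioms)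

lemmas YW_simps = linear_additive[OF YW_linear]

lemma good_YW: "good (YW v)"
  using proj(2) YW_proj good_eval_tensor by (metis surjD)

lemma field_YW: "is_field (YW v)"
  by (rule goodD[OF good_YW])

lemma YW_vac: "YW vac = id_field"
  using YW_proj[of "pure_tensor 1 1"] by (simp add: proj(4) eval_pure_tensor eval_one)

lemma YW_act: "YW (actV X v) = aff X (YW v)"
proof -
  obtain u where v: "v = proj (pure_tensor u 1)" using pure_surj by (auto simp: pure_def)
  show ?thesis
    unfolding v proj(5)[symmetric] YW_proj
    by (simp add: eval_pure_tensor eval_mult eval_generator good_id)
qed

lemma YW_loop: "YW (actV (loop n a) v) = nprod (cur a) (YW v) n"
  by (simp add: YW_act aff_loop good_YW)

lemma YW_gen: "YW (actV (loop (-1) a) vac) = cur a"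
  by (simp add: YW_loop YW_vac nprod_id_minus_1[OF field_cur])

text \<open>Fields in the image are quasi-local with the currents; Dong's lemma extends this by
  induction on u to iterated products of currents.\<close>

lemma YW_local: "\<exists>k. quasi_local k (YW u) (YW v)"
proof (induction u rule: V_induct)
  case vac
  show ?case using quasi_local_id_left[OF field_YW] by (auto simp: YW_vac)
next
  case (add u u')
  then obtain k k' where "quasi_local k (YW u) (YW v)" "quasi_local k' (YW u') (YW v)" by blast
  from quasi_local_sym[OF quasi_local_add_right[OF quasi_local_sym[OF this(1)] quasi_local_sym[OF this(2)] field_YW]]
  show ?case unfolding YW_simps by blast
next
  case (scale c u)
  then obtain k where "quasi_local k (YW u) (YW v)" by blast
  from quasi_local_sym[OF quasi_local_scale_right[OF quasi_local_sym[OF this] field_YW, of c]]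
  show ?case by (auto simp: YW_simps fscale_def)
next
  case (loop a n u)
  then obtain k1 where k1: "quasi_local k1 (YW v) (YW u)" using quasi_local_sym by blast
  obtain k2 k3 where k23: "quasi_local k2 (cur a) (YW u)" "quasi_local k3 (cur a) (YW v)"
    using good_local[OF good_YW] by blast
  define K where "K = max k1 (max k2 k3)"
  have "quasi_local (3 * K + nat (- n)) (YW v) (nprod (cur a) (YW u) n)"
    by (rule dong[OF field_YW field_cur field_YW])
      (use quasi_local_mono[OF k1, of K] quasi_local_mono[OF k23(1), of K]
        quasi_local_mono[OF quasi_local_sym[OF k23(2)], of K] in \<open>auto simp: K_def\<close>)
  from quasi_local_sym[OF this] show ?case by (auto simp: YW_loop)
qed

section \<open>Translation operators and compatibility with n-th products\<close>

lemma Y_linear: "Vector_Spaces.linear scaleV scaleV (\<lambda>u. Y u n v)"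
  and Y_field: "VS.is_field (Y u)"
  using V.field_map unfolding field_map_def VS.is_field_def by blast+

lemmas Y_simps = linear_additive[OF Y_linear]

lemma Y_bound: "\<exists>N. \<forall>n\<ge>N. Y u n v = 0"
  using VS.field_bound[OF Y_field] .

lemma borcherds: "VS.borch (Y u) (Y v) w n = VS.hat (\<lambda>n q. Y (Y u n v) q w) n"
  using V.jacobi_identity[of u v w] VS.jacobi_iff[of Y u v Y 1 w, OF Y_field Y_field _ Y_bound]
  by (simp add: Y_simps)

lemma Y_iterate: "Y (Y u n v) q w = VS.borch (Y u) (Y v) w n (0, q)"
  unfolding borcherds VS.hat_0 ..

lemma Y_vac_nonneg: "Y u (int i) vac = 0"
  by (rule V.creation(1)) simp

lemma iterate_vac: "Y (Y u n v) q vac = VS.binom_sum n (\<lambda>i. Y u (n - int i) (Y v (q + int i) vac))"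
  using VS.field_simps_lin(3)[OF Y_field] by (simp add: Y_iterate VS.borch_def Y_vac_nonneg)

lemma sbinom_minus_2: "sbinom (-2) i = of_nat (Suc i)"
proof (induction i)
  case (Suc i)
  then show ?case using sbinom_Suc[of "-2" i] sbinom_minus_1[of "Suc i"] by (simp add: algebra_simps)
qed simp

text \<open>The canonical translation operator of the vertex algebra; \<open>YW\<close> will carry
  it to d/dx.\<close>

definition dV :: "'v \<Rightarrow> 'v" where
  "dV u = Y u (-2) vac"

lemma dV_vac: "Y (dV u) (- 1 - int k) vac = scaleV (of_nat (Suc k)) (Y u (- 2 - int k) vac)"
  unfolding dV_def iterate_vac V.vacuum
  using VS.field_simps_lin(3)[OF Y_field]
  by (subst VS.binom_sum_single[of k]) (auto simp: sbinom_minus_2)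

text \<open>Since u_(-2+i) 1 = 0 for i \<ge> 2, only the terms i = 0 and i = 1 of the iterate
  formula survive.\<close>

lemma dV_Y: "dV (Y a n u) = Y a n (dV u) - scaleV (of_int n) (Y a (n - 1) u)"
proof -
  have z: "Y a (n - int i) (Y u (- 2 + int i) vac) = 0" if "i \<ge> 2" for i
  proof -
    have "Y u (- 2 + int i) vac = 0" using that by (intro V.creation(1)) simp
    then show ?thesis using VS.field_simps_lin(3)[OF Y_field] by simp
  qed
  have s1: "sbinom n (Suc 0) = - of_int n" using sbinom_absorb[of 0 n] by simp
  have "dV (Y a n u) = (\<Sum>i<2. scaleV (sbinom n i) (Y a (n - int i) (Y u (- 2 + int i) vac)))"
    unfolding dV_def iterate_vac by (rule VS.binom_sum_eq) (rule z)
  then show ?thesis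
    by (simp add: dV_def numeral_2_eq_2 s1 V.creation(2))
qed

lemma dfield_add: "dfield (\<alpha> + \<beta>) = dfield \<alpha> + dfield \<beta>"
  and dfield_fscale: "dfield (fscale c \<alpha>) = fscale c (dfield \<alpha>)"
  by (auto simp: dfield_def fscale_def fun_eq_iff scale_right_distrib mult.commute)

text \<open>The rule for d/dx on products with currents has the same form as \<open>dV_Y\<close>, so
  the two derivations match by induction from the vacuum.\<close>

lemma YW_dV: "YW (dV u) = dfield (YW u)"
proof (induction u rule: V_induct)
  case vac
  have "dV vac = 0" by (simp add: dV_def V.vacuum)
  then show ?case by (auto simp: YW_simps YW_vac fun_eq_iff dfield_def id_field_def)
next
  case (add u u')
  then show ?case by (simp only: dV_def Y_simps YW_simps dfield_add)
next
  case (scale c u)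
  then show ?case by (simp only: dV_def Y_simps YW_simps dfield_fscale)
next
  case (loop a n u)
  obtain k where k: "quasi_local k (cur a) (YW u)" using good_local[OF good_YW] by blast
  have "YW (dV (actV (loop n a) u)) = YW (actV (loop n a) (dV u)) - fscale (of_int n) (YW (actV (loop (n - 1) a) u))"
  proof -
    define g where "g = actV (loop (-1) a) vac"
    have g: "actV (loop m a) v = Y g m v" for m v by (simp add: g_def Y_gen)
    show ?thesis unfolding g dV_Y YW_simps ..
  qed
  also have "\<dots> = nprod (cur a) (dfield (YW u)) n - fscale (of_int n) (nprod (cur a) (YW u) (n - 1))"
    by (simp only: YW_loop loop)
  also have "\<dots> = dfield (nprod (cur a) (YW u) n)"
    unfolding nprod_dfield_right[OF field_cur field_YW k] by (simp add: fscale_def fun_eq_iff)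
  finally show ?case by (simp add: YW_loop)
qed

text \<open>Modes below -1 on the vacuum come from translation: (D u)_(-1-k) 1 = (k + 1) u_(-2-k) 1,
  and the fields satisfy the same relation. The step from k to k + 1 applies the hypothesis to D u
  and divides by k + 1.\<close>

lemma YW_vac_product: "YW (Y u n vac) = nprod (YW u) id_field n"
proof (cases "n \<ge> 0")
  case True
  then show ?thesis using V.creation(1)[OF True] by (simp add: YW_simps nprod_id_nonneg[OF field_YW])
next
  case False
  define k where "k = nat (- 1 - n)"
  have "YW (Y u (- 1 - int k) vac) = nprod (YW u) id_field (- 1 - int k)" for u
  proof (induction k arbitrary: u)
    case 0
    then show ?case by (simp add: V.creation(2) nprod_id_minus_1[OF field_YW])
  next
    case (Suc k)
    have "fscale (of_nat (Suc k)) (YW (Y u (- 2 - int k) vac)) = YW (Y (dV u) (- 1 - int k) vac)"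
      by (simp only: dV_vac YW_simps)
    also have "\<dots> = nprod (dfield (YW u)) id_field (- 1 - int k)" unfolding Suc YW_dV ..
    also have "\<dots> = fscale (of_nat (Suc k)) (nprod (YW u) id_field (- 2 - int k))"
    proof -
      have "(- 1 - int k) - 1 = - 2 - int k" "- of_int (- 1 - int k) = (of_nat (Suc k) :: complex)" by simp_all
      then show ?thesis unfolding nprod_id_deriv[OF field_YW] fscale_def by (simp only:)
    qed
    finally have "fscale (1 / of_nat (Suc k)) (fscale (of_nat (Suc k)) (YW (Y u (- 2 - int k) vac))) =
        fscale (1 / of_nat (Suc k)) (fscale (of_nat (Suc k)) (nprod (YW u) id_field (- 2 - int k)))" by (rule arg_cong)
    then have "YW (Y u (- 2 - int k) vac) = nprod (YW u) id_field (- 2 - int k)"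
      by (simp del: of_nat_Suc)
    moreover have "- 1 - int (Suc k) = - 2 - int k" by simp
    ultimately show ?case by (simp only:)
  qed
  from this[of u] show ?thesis using False by (simp add: k_def)
qed

text \<open>Goddard's uniqueness argument: both sides are local with the currents and agree on the
  vacuum.\<close>

lemma YW_product: "YW (Y u n v) = nprod (YW u) (YW v) n"
proof (induction v arbitrary: n rule: V_induct)
  case vac
  show ?case by (simp add: YW_vac YW_vac_product)
next
  case (add v v')
  obtain k k' where k: "quasi_local k (YW u) (YW v)" "quasi_local k' (YW u) (YW v')" using YW_local by blast
  have "Y u n (v + v') = Y u n v + Y u n v'" by (rule VS.field_simps_lin(1)[OF Y_field])
  then show ?case
    using add nprod_add_right[OF field_YW field_YW field_YW k] by (simp only: YW_simps)
next
  case (scale c v)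
  obtain k where k: "quasi_local k (YW u) (YW v)" using YW_local by blast
  have "Y u n (scaleV c v) = scaleV c (Y u n v)" by (rule VS.field_simps_lin(5)[OF Y_field])
  then show ?case
    using scale nprod_scale_right[OF field_YW field_YW k, of c n] by (simp only: YW_simps fscale_def)
next
  case (loop a m0 v)
  define g where "g = actV (loop (-1) a) vac"
  have g: "actV (loop m a) v = Y g m v" for m v by (simp add: g_def Y_gen)
  have YWg: "YW (Y g m v) = nprod (cur a) (YW v) m" for m v unfolding g[symmetric] by (rule YW_loop)
  obtain k1 where k1: "quasi_local k1 (cur a) (YW u)" using good_local[OF good_YW] by blast
  obtain k2 where k2: "quasi_local k2 (cur a) (YW v)" using good_local[OF good_YW] by blast
  obtain k3 where k3: "quasi_local k3 (YW u) (YW v)" using YW_local by blast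
  obtain N where N: "\<forall>j\<ge>N. Y g j u = 0" using Y_bound by blast
  \<comment> \<open>Large enough both for quasi-locality of the current with \<open>YW u\<close> and
    for ordinary locality of g and u in V.\<close>
  define k where "k = max k1 (nat N)"
  have k1': "quasi_local k (cur a) (YW u)" by (rule quasi_local_mono[OF k1]) (simp add: k_def)
  have Vloc: "(VS.laurent_act ((xx - yy) ^ k) (\<lambda>(p, q). Y g p (Y u q v) - Y u q (Y g p v))) = 0"
  proof -
    have "VS.laurent_act ((xx - yy) ^ k) (\<lambda>(p, q). Y g p (Y u q v) - Y u q (Y g p v)) = VS.borch (Y g) (Y u) v (0 + int k)"
      unfolding VS.borch_add_nat[OF Y_field Y_field] VS.borch_0 ..
    also have "\<dots> = 0"
      unfolding borcherds by (rule VS.hat_zero[of "int k"]) (use N in \<open>auto simp: k_def Y_simps\<close>)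
    finally show ?thesis .
  qed
  define \<Theta> where "\<Theta> w = (\<lambda>(m, n, q). YW (Y u n (Y g m v)) q w - nprod (YW u) (YW (Y g m v)) n q w)" for w
  obtain M where M: "\<forall>m\<ge>M. Y g m v = 0" using Y_bound by blast
  have "\<Theta> w = 0" for w
  proof (rule local_zero[where M = M])
    define \<Xi> where "\<Xi> = (\<lambda>(m, n, q). YW (Y g m (Y u n v) - Y u n (Y g m v)) q w)"
    define \<Omega> where "\<Omega> = (\<lambda>(m, n, q). nprod (cur a) (nprod (YW u) (YW v) n) m q w - nprod (YW u) (nprod (cur a) (YW v) m) n q w)"
    \<comment> \<open>By the hypothesis for v the error equals the commutator of products of fields
      minus the image of the commutator in V, and both are local in the shifted variables.\<close>
    have "\<Theta> w = \<Omega> - \<Xi>"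
      by (auto simp: fun_eq_iff \<Theta>_def \<Omega>_def \<Xi>_def YW_simps YWg loop)
    moreover have "((x0 + x2) ^ T - (x1 + x2) ^ T) ^ k \<star> \<Omega> = 0"
      unfolding \<Omega>_def by (rule nprod_commutator_local[OF field_cur field_YW field_YW k3 k2 k1'])
    moreover have "((x0 + x2) ^ T - (x1 + x2) ^ T) ^ k \<star> \<Xi> = 0"
    proof (rule act_dvd_eq_0)
      show "(x0 - x1) ^ k \<star> \<Xi> = 0"
      proof
        fix e :: "int \<times> int \<times> int"
        obtain m n q where e: "e = (m, n, q)" by (cases e)
        have "((x0 - x1) ^ k \<star> \<Xi>) e = YW (VS.laurent_act ((xx - yy) ^ k) (\<lambda>(p, q). Y g p (Y u q v) - Y u q (Y g p v)) (m, n)) q w"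
        proof -
          have lin: "YW (sum f I) q w = (\<Sum>i\<in>I. YW (f i) q w)" for f :: "nat \<Rightarrow> 'v" and I
            by (induction I rule: infinite_finite_induct) (auto simp: YW_simps)
          have sc: "YW (scaleV c x) q w = c *s YW x q w" for c x by (simp add: YW_simps fscale_def)
          show ?thesis
            unfolding act_binomial VS.act_binomial lin sc by (simp add: e \<Xi>_def zero_prod_def)
        qed
        then show "((x0 - x1) ^ k \<star> \<Xi>) e = 0 e" by (simp add: Vloc YW_simps)
      qed
      \<comment> \<open>Locality in V comes with x0 - x1, which is also the difference of x0 + x2
        and x1 + x2 and so divides that of their T-th powers.\<close>
      have "x0 - x1 dvd (x0 + x2) ^ T - (x1 + x2) ^ T"
        using power_diff_dvd[of "x0 + x2" "x1 + x2" T] by simp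
      then show "(x0 - x1) ^ k dvd ((x0 + x2) ^ T - (x1 + x2) ^ T) ^ k" by (rule dvd_power_same)
    qed
    ultimately show "((x0 + x2) ^ T - (x1 + x2) ^ T) ^ k \<star> \<Theta> w = 0" by (simp only: act_diff_right diff_self)
    have "nprod (YW u) 0 n = 0" for n
      using nprod_scale_right[OF field_YW field_id quasi_local_id[OF field_YW], of u 0 n]
      by (simp add: zero_fun_def)
    then show "\<Theta> w (m, n, q) = 0" if "m \<ge> M" for m n q
      using M that VS.field_simps_lin(3)[OF Y_field] by (simp add: \<Theta>_def YW_simps)
    show "\<exists>N. \<forall>n\<ge>N. \<forall>q. \<Theta> w (m, n, q) = 0" for m
    proof -
      obtain N1 where "\<forall>n\<ge>N1. Y u n (Y g m v) = 0" using Y_bound by blast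
      moreover obtain N2 where "quasi_local N2 (YW u) (YW (Y g m v))" using YW_local by blast
      ultimately show ?thesis
        by (intro exI[of _ "max N1 (int N2)"]) (auto simp: \<Theta>_def YW_simps nprod_large[OF field_YW field_YW])
    qed
  qed
  then have "\<Theta> w (m0, n, q) = 0" for w q by simp
  then show ?case by (auto simp: \<Theta>_def g fun_eq_iff)
qed

section \<open>The quasi module axioms and uniqueness\<close>

definition cyc :: "complex poly poly" where
  "cyc = monom 1 T - [:monom 1 T:]"

lemma cyc_nonzero: "cyc \<noteq> 0"
proof -
  have "coeff cyc T = 1" using T_pos by (auto simp: cyc_def coeff_pCons split: nat.split)
  then show ?thesis by auto
qed

lemma pl_cyc: "pl (cyc ^ k) = (xx ^ T - yy ^ T) ^ k"
  by (simp add: cyc_def bipoly.ev_power bipoly.ev_diff bipoly.ev_monom_1 bipoly.ev_const const.ev_monom_1)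

lemma YW_jacobi:
  assumes "quasi_local k (YW u) (YW v)"
  shows "jacobi_identity Y (*s) YW (cyc ^ k) u v w"
  using quasi_jacobi[OF field_YW field_YW assms]
    jacobi_iff[where YW = YW and YV = Y and u = u and v = v and f = "cyc ^ k" and w = w]
  by (simp add: field_YW Y_bound YW_simps pl_cyc YW_product)

lemma YW_quasi_module: "quasi_module scaleV Y vac (*s) YW"
  unfolding quasi_module_def
proof (intro conjI allI)
  show "vector_space (*s)" by (rule vector_space_axioms)
  show "field_map scaleV (*s) YW"
    unfolding field_map_def
  proof (intro conjI allI)
    show "Vector_Spaces.linear scaleV (*s) (\<lambda>u. YW u n w)" for n w
      by (rule linearI) (auto simp: V.vector_space_axioms vector_space_axioms YW_simps fscale_def)
    show "lin (YW u n)" for u n by (rule field_lin[OF field_YW])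
    show "\<exists>N. \<forall>n\<ge>N. YW u n w = 0" for u w by (rule field_bound[OF field_YW])
  qed
  show "YW vac n w = (if n = -1 then w else 0)" for n w by (simp add: YW_vac id_field_def)
  fix u v
  obtain k where "quasi_local k (YW u) (YW v)" using YW_local by blast
  then show "\<exists>f. f \<noteq> 0 \<and> (\<forall>w. jacobi_identity Y (*s) YW f u v w)"
    using cyc_nonzero YW_jacobi by (intro exI[of _ "cyc ^ k"]) auto
qed

text \<open>Both structures agree on g and, by induction, on v, so the left-hand sides of their
  Jacobi identities coincide. Multiplication by f cyc^k serves both identities; it annihilates the
  difference of the iterates, and \<open>hat_cancel\<close> applies.\<close>

lemma YW_unique:
  assumes qm: "quasi_module scaleV Y vac (*s) YW'"
    and gen: "\<And>a n w. YW' (actV (loop (-1) a) vac) n w = cur a n w"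
  shows "YW' = YW"
proof
  fix v
  have fm: "field_map scaleV (*s) YW'" using qm by (simp add: quasi_module_def)
  have f': "is_field (YW' u)" for u using fm unfolding field_map_def is_field_def by blast
  have lin': "Vector_Spaces.linear scaleV (*s) (\<lambda>u. YW' u n w)" for n w using fm unfolding field_map_def by blast
  note s' = linear_additive[OF lin']
  show "YW' v = YW v"
  proof (induction v rule: V_induct)
    case vac
    show ?case using qm by (auto simp: quasi_module_def YW_vac fun_eq_iff id_field_def)
  next
    case (add v v')
    then show ?case by (auto simp: fun_eq_iff s' YW_simps)
  next
    case (scale c v)
    then show ?case by (auto simp: fun_eq_iff s' YW_simps fscale_def)
  next
    case (loop a n v)
    define g where "g = actV (loop (-1) a) vac"
    have YWg: "YW' g = YW g" by (auto simp: fun_eq_iff g_def gen YW_gen)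
    obtain k where k: "quasi_local k (YW g) (YW v)" using YW_local by blast
    obtain f where f: "f \<noteq> 0" "\<And>w. jacobi_identity Y (*s) YW' f g v w"
      using qm unfolding quasi_module_def by blast
    obtain N where N: "\<forall>n\<ge>N. Y g n v = 0" using Y_bound by blast
    have "YW' (Y g n v) q w - YW (Y g n v) q w = 0" for q w
    proof (rule hat_cancel[where f = "f * cyc ^ k" and \<Delta> = "\<lambda>n q. YW' (Y g n v) q w - YW (Y g n v) q w" and N = N])
      show "f * cyc ^ k \<noteq> 0" using f(1) cyc_nonzero by simp
      fix n
      have fin: "fin_seq (\<lambda>j. (-1) ^ j *s YW' (Y g (n + int j) v) (q - int j) w)"
        "fin_seq (\<lambda>j. (-1) ^ j *s YW (Y g (n + int j) v) (q - int j) w)" for q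
        using N by (auto intro!: fin_seqI[of "nat (N - n)"] simp: s' YW_simps)
      have hat: "hat (\<lambda>n q. YW' (Y g n v) q w - YW (Y g n v) q w) n =
          hat (\<lambda>n q. YW' (Y g n v) q w) n - hat (\<lambda>n q. YW (Y g n v) q w) n"
        using fin by (auto simp: fun_eq_iff hat_def scale_right_diff_distrib binom_sum_diff)
      have 1: "pl f \<star> borch (YW g) (YW v) w n = pl f \<star> hat (\<lambda>n q. YW' (Y g n v) q w) n"
        using f(2)[of w] jacobi_iff[where YW = YW' and YV = Y and u = g and v = v and f = f and w = w]
        by (simp add: f' field_YW Y_bound s' YWg loop)
      have 2: "pl (cyc ^ k) \<star> borch (YW g) (YW v) w n = pl (cyc ^ k) \<star> hat (\<lambda>n q. YW (Y g n v) q w) n"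
        using YW_jacobi[OF k, of w] jacobi_iff[where YW = YW and YV = Y and u = g and v = v and f = "cyc ^ k" and w = w]
        by (simp add: field_YW Y_bound YW_simps)
      have "pl (f * cyc ^ k) \<star> hat (\<lambda>n q. YW' (Y g n v) q w) n = pl (f * cyc ^ k) \<star> borch (YW g) (YW v) w n"
        by (simp only: bipoly.ev_mult mult.commute[of "pl f"] act_mult 1)
      also have "\<dots> = pl (f * cyc ^ k) \<star> hat (\<lambda>n q. YW (Y g n v) q w) n"
        by (simp only: bipoly.ev_mult act_mult 2)
      finally show "pl (f * cyc ^ k) \<star> hat (\<lambda>n q. YW' (Y g n v) q w - YW (Y g n v) q w) n = 0"
        unfolding hat act_diff_right by simp
      obtain B1 B2 where "\<forall>q\<ge>B1. YW' (Y g n v) q w = 0" "\<forall>q\<ge>B2. YW (Y g n v) q w = 0"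
        using field_bound[OF f'] field_bound[OF field_YW] by blast
      then show "\<exists>B. \<forall>q\<ge>B. YW' (Y g n v) q w - YW (Y g n v) q w = 0"
        by (intro exI[of _ "max B1 B2"]) auto
    qed (use N in \<open>auto simp: s' YW_simps\<close>)
    then show ?case by (auto simp: fun_eq_iff g_def Y_gen)
  qed
qed

end

section \<open>The minimal polynomial\<close>

context cyclic_space
begin

lemma mult_ratio_series:
  "series_mult (*s) (ratio_series P) (\<lambda>(j, k). C (- j - 1, - k - 1)) (j, k) = (pev rr P \<star> C) (- j - 1, - k - 1)"
proof -
  have zero: "ratio_series P d = 0" if d: "d \<notin> (\<lambda>a. (int a, - int a)) ` {..degree P}" for d
  proof (rule ccontr)
    assume nz: "ratio_series P d \<noteq> 0"
    obtain x y where xy: "d = (x, y)" by (cases d)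
    have h: "x \<ge> 0" "y = - x" "coeff P (nat x) \<noteq> 0" using nz by (auto simp: ratio_series_def xy split: if_splits)
    then have "d \<in> (\<lambda>a. (int a, - int a)) ` {..degree P}"
      by (intro image_eqI[of _ _ "nat x"]) (auto simp: xy intro: le_degree)
    then show False using d by blast
  qed
  have "series_mult (*s) (ratio_series P) (\<lambda>(j, k). C (- j - 1, - k - 1)) (j, k) =
      (\<Sum>a\<le>degree P. ratio_series P (int a, - int a) *s (\<lambda>(j, k). C (- j - 1, - k - 1)) ((j, k) - (int a, - int a)))"
    unfolding series_mult_def by (rule Sum_any_image) (use zero in \<open>auto simp: inj_on_def\<close>)
  then show ?thesis by (simp add: act_pev ratio_series_def algebra_simps)
qed

lemma kills_commutators_iff:
  "kills_commutators (*s) YW P \<longleftrightarrow> P \<noteq> 0 \<and>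
    (\<forall>u v. \<exists>r. \<forall>w. pev rr (P ^ r) \<star> (\<lambda>(p, q). YW u p (YW v q w) - YW v q (YW u p w)) = 0)"
proof -
  have "(\<forall>e. series_mult (*s) (ratio_series Q)
      (\<lambda>(j, k). YW u (- j - 1) (YW v (- k - 1) w) - YW v (- k - 1) (YW u (- j - 1) w)) e = 0) \<longleftrightarrow>
    pev rr Q \<star> (\<lambda>(p, q). YW u p (YW v q w) - YW v q (YW u p w)) = 0" (is "?L \<longleftrightarrow> ?R") for Q u v w
  proof -
    let ?C = "\<lambda>(p, q). YW u p (YW v q w) - YW v q (YW u p w)"
    have eq: "series_mult (*s) (ratio_series Q)
      (\<lambda>(j, k). YW u (- j - 1) (YW v (- k - 1) w) - YW v (- k - 1) (YW u (- j - 1) w)) (j, k) =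
      (pev rr Q \<star> ?C) (- j - 1, - k - 1)" for j k
      using mult_ratio_series[of Q ?C j k] by simp
    have "?L \<longleftrightarrow> (\<forall>j k. (pev rr Q \<star> ?C) (- j - 1, - k - 1) = 0)"
      unfolding split_paired_All eq ..
    also have "\<dots> \<longleftrightarrow> ?R"
    proof
      assume h: "\<forall>j k. (pev rr Q \<star> ?C) (- j - 1, - k - 1) = 0"
      show ?R
      proof
        fix e :: "int \<times> int"
        obtain p q where "e = (p, q)" by (cases e)
        then show "(pev rr Q \<star> ?C) e = 0 e" using h[rule_format, of "- p - 1" "- q - 1"] by simp
      qed
    qed simp
    finally show ?thesis .
  qed
  then show ?thesis unfolding kills_commutators_def by simp
qed

lemma kills_cyclotomic:
  assumes "\<And>u v. \<exists>k. quasi_local k (YW u) (YW v)"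
  shows "kills_commutators (*s) YW (monom 1 T - 1)"
  unfolding kills_commutators_iff
proof (intro conjI allI)
  have "coeff (monom 1 T - 1 :: complex poly) T = 1" using T_pos by (simp add: coeff_1)
  then show "monom 1 T - 1 \<noteq> (0 :: complex poly)" by (metis coeff_0 zero_neq_one)
  fix u v
  obtain k where k: "quasi_local k (YW u) (YW v)" using assms by blast
  have y: "mon (0, -1) * yy = 1" by (simp add: mult_single zero_prod_def[symmetric])
  then have yT: "mon (0, -1) ^ T * yy ^ T = 1" by (simp only: power_mult_distrib[symmetric] power_one)
  have "rr ^ T = mon (0, -1) ^ T * xx ^ T" by (simp only: power_mult_distrib[symmetric]) (simp add: mult_single)
  then have "pev rr (monom 1 T - 1) = mon (0, -1) ^ T * (xx ^ T - yy ^ T)"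
    by (simp only: const.ev_diff const.ev_monom_1 const.ev_1 right_diff_distrib yT)
  then have "pev rr ((monom 1 T - 1) ^ k) = (mon (0, -1) ^ T) ^ k * (xx ^ T - yy ^ T) ^ k"
    by (simp only: const.ev_power power_mult_distrib)
  then show "\<exists>r. \<forall>w. pev rr ((monom 1 T - 1) ^ r) \<star> (\<lambda>(p, q). YW u p (YW v q w) - YW v q (YW u p w)) = 0"
    using k unfolding quasi_local_act by (intro exI[of _ k]) (simp only: act_mult act_zero_right simp_thms)
qed

lemma delta_term_ratio_kill:
  assumes "\<zeta> \<noteq> 0"
  shows "pev rr ([:- \<zeta>, 1:] ^ 2) \<star> (\<lambda>(p, q). delta_term \<zeta> c C p q w) = 0"
proof -
  have z: "\<zeta> powi (n + 1) = \<zeta> * \<zeta> powi n" for n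
    using assms by (simp add: power_int_add mult.commute)
  have lin: "pev rr [:- \<zeta>, 1:] = rr - const \<zeta>"
    by (simp add: const.ev_pCons single_uminus)
  have "(rr - const \<zeta>) \<star> (\<lambda>(p, q). delta_term \<zeta> c C p q w) =
      (\<lambda>(p, q). \<zeta> powi (p + 1) *s (if p + q = 0 then c *s w else 0))" (is "_ = ?\<psi>")
    unfolding act_diff
    by (auto simp: fun_eq_iff delta_term_def z scale_right_distrib scale_left_distrib algebra_simps)
  moreover have "(rr - const \<zeta>) \<star> ?\<psi> = 0"
    unfolding act_diff by (auto simp: fun_eq_iff z algebra_simps)
  moreover have "pev rr ([:- \<zeta>, 1:] ^ 2) = (rr - const \<zeta>) * (rr - const \<zeta>)"
    unfolding const.ev_power lin by (rule power2_eq_square)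
  ultimately show ?thesis by (simp only: act_mult)
qed

end

context vacuum_setup
begin

lemma om_inj: "inj_on (\<lambda>i. om powi (- int i)) {..<T}"
proof (rule inj_onI)
  fix i j assume ij: "i \<in> {..<T}" "j \<in> {..<T}" "om powi (- int i) = om powi (- int j)"
  have "om powi (int j - int i) = om powi (int j) * om powi (- int i)" by (simp only: om_add[symmetric]) simp
  also have "\<dots> = om powi (int j) * om powi (- int j)" by (simp only: ij(3))
  also have "\<dots> = 1" by (simp only: om_add[symmetric]) simp
  finally have d: "int T dvd int j - int i" using root_unity_powi_eq_1_iff[OF T_pos] by simp
  then have "int T dvd int i - int j" by (simp add: dvd_diff_commute)
  with d show "i = j" using ij zdvd_imp_le[of "int T" "int j - int i"] zdvd_imp_le[of "int T" "int i - int j"]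
    by (cases i j rule: linorder_cases) auto
qed

text \<open>R contains the squares that kill every component but the j-th, and P = Q^r R is nonzero
  at the j-th root. So the j-th component is killed by P and by the square of x - z_j, which are
  coprime.\<close>

lemma cterm_zero:
  assumes q: "\<And>a b. \<exists>r. \<forall>w. pev rr (Q ^ r) \<star> (\<lambda>(p, q). cur a p (cur b q w) - cur b q (cur a p w)) = 0"
    and j: "j < T" "poly Q (om powi (- int j)) \<noteq> 0"
  shows "cterm a b j p q w = 0"
proof -
  define z where "z i = om powi (- int i)" for i :: nat
  have z0: "z i \<noteq> 0" for i by (simp add: z_def root_unity_nonzero power_int_eq_0_iff)
  obtain r where r: "pev rr (Q ^ r) \<star> (\<lambda>(p, q). cur a p (cur b q w) - cur b q (cur a p w)) = 0" using q by blast
  define R where "R = (\<Prod>i\<in>{..<T} - {j}. [:- z i, 1:] ^ 2)"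
  define P where "P = Q ^ r * R"
  have inj: "z i \<noteq> z j" if "i < T" "i \<noteq> j" for i
    using inj_onD[OF om_inj, of i j] that j(1) by (auto simp: z_def)
  have "poly Q (z j) \<noteq> 0" using j(2) by (simp add: z_def)
  moreover have "poly R (z j) \<noteq> 0" unfolding R_def poly_prod by (subst prod_zero_iff) (use inj inj[symmetric] in auto)
  ultimately have "poly P (z j) \<noteq> 0"
    by (simp add: P_def)
  then have "poly (1 - smult (1 / poly P (z j)) P) (z j) = 0" by simp
  then have "[:- z j, 1:] dvd 1 - smult (1 / poly P (z j)) P" by (simp only: poly_eq_0_iff_dvd)
  then obtain S where S: "1 - smult (1 / poly P (z j)) P = [:- z j, 1:] * S" by (rule dvdE)
  have ct: "cterm a b i = delta_term (z i) (level * form ((\<sigma> ^^ i) a) b) (cur (bracket ((\<sigma> ^^ i) a) b))" for i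
    by (simp add: cterm_def z_def)
  let ?t = "\<lambda>i. (\<lambda>(p, q). cterm a b i p q w)"
  have kill: "pev rr ([:- z i, 1:] ^ 2) \<star> ?t i = 0" for i
    unfolding ct by (rule delta_term_ratio_kill[OF z0])
  have "pev rr P \<star> (\<lambda>e. \<Sum>i<T. ?t i e) = 0"
  proof -
    have "(\<lambda>(p, q). cur a p (cur b q w) - cur b q (cur a p w)) = (\<lambda>e. \<Sum>i<T. ?t i e)"
      by (auto simp: fun_eq_iff cur_commutator)
    then show ?thesis using r by (simp only: P_def mult.commute[of "Q ^ r"] const.ev_mult act_mult act_zero_right)
  qed
  moreover have "pev rr P \<star> ?t i = 0" if i: "i < T" "i \<noteq> j" for i
  proof (rule act_dvd_eq_0[OF kill])
    have "[:- z i, 1:] ^ 2 dvd R" unfolding R_def by (rule dvd_prodI) (use i in auto)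
    then show "pev rr ([:- z i, 1:] ^ 2) dvd pev rr P" unfolding P_def by (intro const.ev_dvd dvd_mult)
  qed
  ultimately have "pev rr P \<star> ?t j = 0"
  proof -
    assume s: "pev rr P \<star> (\<lambda>e. \<Sum>i<T. ?t i e) = 0"
      and o: "\<And>i. i < T \<Longrightarrow> i \<noteq> j \<Longrightarrow> pev rr P \<star> ?t i = 0"
    show ?thesis
    proof
      fix e
      have "(\<Sum>i<T. (pev rr P \<star> ?t i) e) = 0" using fun_cong[OF s, of e] by (simp only: act_sum_right zero_fun_apply)
      moreover have "(\<Sum>i<T. (pev rr P \<star> ?t i) e) = (\<Sum>i\<in>{j}. (pev rr P \<star> ?t i) e)"
        by (rule sum.mono_neutral_right) (use j(1) o in auto)
      ultimately show "(pev rr P \<star> ?t j) e = 0 e" by simp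
    qed
  qed
  \<comment> \<open>B is 1 at z_j, so x - z_j divides 1 - B, and B (2 - B) + (1 - B)^2 = 1 is the
    required Bezout relation.\<close>
  moreover define B where "B = smult (1 / poly P (z j)) P"
  have "P * (smult (1 / poly P (z j)) (2 - B)) = B * (2 - B)" by (simp add: B_def)
  moreover have "[:- z j, 1:] ^ 2 * S\<^sup>2 = (1 - B)\<^sup>2" by (simp only: B_def S power_mult_distrib)
  moreover have "B * (2 - B) + (1 - B)\<^sup>2 = 1" by (simp add: power2_eq_square algebra_simps)
  ultimately have P: "pev rr P \<star> ?t j = 0"
    and bez: "P * (smult (1 / poly P (z j)) (2 - B)) + [:- z j, 1:] ^ 2 * S\<^sup>2 = 1" by simp_all
  have "pev rr (P * (smult (1 / poly P (z j)) (2 - B))) \<star> ?t j = 0"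
    by (rule act_dvd_eq_0[OF P]) (intro const.ev_dvd dvd_triv_left)
  moreover have "pev rr ([:- z j, 1:] ^ 2 * S\<^sup>2) \<star> ?t j = 0"
    by (rule act_dvd_eq_0[OF kill]) (intro const.ev_dvd dvd_triv_left)
  moreover have "?t j = (pev rr (P * (smult (1 / poly P (z j)) (2 - B))) + pev rr ([:- z j, 1:] ^ 2 * S\<^sup>2)) \<star> ?t j"
    by (simp only: const.ev_add[symmetric] bez const.ev_1 act_one)
  ultimately have "?t j = 0" by (simp only: act_add add_0)
  then have "?t j (p, q) = 0" by simp
  then show ?thesis by simp
qed

text \<open>Replacing a by \<sigma>^l a with j + l congruent to i modulo T puts the content of the
  i-th component into position j. Its vanishing does not depend on the root of unity, since the
  prefactor is a power of a nonzero number.\<close>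

lemma commuting:
  assumes "\<And>a b. \<exists>r. \<forall>w. pev rr (Q ^ r) \<star> (\<lambda>(p, q). cur a p (cur b q w) - cur b q (cur a p w)) = 0"
    and j: "j < T" "poly Q (om powi (- int j)) \<noteq> 0"
  shows "cur a m (cur b n w) = cur b n (cur a m w)"
proof -
  have "cterm a b i m n w = 0" if "i < T" for i
  proof -
    \<comment> \<open>T is added to keep the difference i - j a natural number.\<close>
    define l where "l = i + T - j"
    have l: "(\<sigma> ^^ j) ((\<sigma> ^^ l) a) = (\<sigma> ^^ i) a"
    proof -
      have "(\<sigma> ^^ j) ((\<sigma> ^^ l) a) = (\<sigma> ^^ (j + l)) a" by (simp add: funpow_add)
      also have "j + l = i + T" using j(1) by (simp add: l_def)
      finally show ?thesis by (simp only: \<sigma>_pow_T)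
    qed
    have nz: "(om powi (- int k)) powi p \<noteq> 0" for k p
      by (simp add: root_unity_nonzero power_int_eq_0_iff)
    have c: "cterm ((\<sigma> ^^ l) a) b j p q w = 0" for p q w by (rule cterm_zero[OF assms])
    have main: "cur (bracket ((\<sigma> ^^ i) a) b) (p + q) w + (if p + q = 0 then (of_int p * (level * form ((\<sigma> ^^ i) a) b)) *s w else 0) = 0" for p q w
      using c[of p q w] nz[of j p] unfolding cterm_def delta_term_def l scale_eq_0_iff by blast
    have "cur (bracket ((\<sigma> ^^ i) a) b) (m + n) w + (if m + n = 0 then (of_int m * (level * form ((\<sigma> ^^ i) a) b)) *s w else 0) = 0"
      by (rule main)
    then show ?thesis unfolding cterm_def delta_term_def by simp
  qed
  then show ?thesis using cur_commutator[of a m b n w] by simp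
qed

lemma tproj_fixed: "x \<in> eig n \<Longrightarrow> tproj x n = sg (of_nat T) x"
proof -
  assume x: "x \<in> eig n"
  have "(\<sigma> ^^ i) x = sg (om powi (int i * n)) x" for i
  proof (induction i)
    case (Suc i)
    have "\<sigma> x = sg (om powi n) x" using x by (simp add: eigenspace_def)
    then show ?case
      using Suc by (simp add: linear_additive[OF \<sigma>_linear] om_add[symmetric] algebra_simps)
  qed simp
  then have "tproj x n = (\<Sum>i<T. x)" by (simp add: tproj_def om_add[symmetric])
  also have "\<dots> = (\<Sum>i<T. sg 1 x)" by simp
  also have "\<dots> = sg (\<Sum>i<T. 1) x" by (simp only: g.scale_sum_left)
  finally show ?thesis by simp
qed

text \<open>On eigenvectors of index n the map \<open>tproj\<close> is multiplication by T, so each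
  loop element is 1 / T of a current mode: the currents determine the action of the whole
  algebra.\<close>

lemma actW_decomp:
  assumes "X \<in> FA"
  shows "actW X w = (\<Sum>n\<in>Poly_Mapping.keys (fst X). (1 / of_nat T) *s cur (Poly_Mapping.lookup (fst X) n) n w) +
    (snd X * level / of_nat T) *s w"
proof -
  let ?x = "Poly_Mapping.lookup (fst X)"
  have e: "?x n \<in> eig n" for n using assms by (simp add: fixed_affine_def)
  have "(\<Sum>n\<in>S. loop n (?x n)) \<in> FA \<and> actW (\<Sum>n\<in>S. loop n (?x n)) w = (\<Sum>n\<in>S. actW (loop n (?x n)) w)"
    if "finite S" for S
    using that
  proof (induction S rule: finite_induct)
    case empty
    then show ?case using central_FA[of 0] actW_central[of 0 w] by (simp add: zero_prod_def)
  next
    case (insert n S)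
    then show ?case using loop_FA[OF e, of n] by (simp add: FA_add actW_add)
  qed
  then have s: "(\<Sum>n\<in>Poly_Mapping.keys (fst X). loop n (?x n)) \<in> FA"
    "actW (\<Sum>n\<in>Poly_Mapping.keys (fst X). loop n (?x n)) w = (\<Sum>n\<in>Poly_Mapping.keys (fst X). actW (loop n (?x n)) w)"
    by auto
  have "fst (\<Sum>n\<in>S. loop n (?x n)) = (\<Sum>n\<in>S. Poly_Mapping.single n (?x n)) \<and> snd (\<Sum>n\<in>S. loop n (?x n)) = 0" for S
    by (induction S rule: infinite_finite_induct) (auto simp: loop_def)
  moreover have "(\<Sum>n\<in>Poly_Mapping.keys (fst X). Poly_Mapping.single n (?x n)) = fst X"
    by (rule poly_mapping_eqI) (simp add: lookup_sum lookup_single when_def in_keys_iff)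
  ultimately have X: "X = (\<Sum>n\<in>Poly_Mapping.keys (fst X). loop n (?x n)) + (0, snd X)"
    by (auto intro: prod_eqI)
  have l: "actW (loop n (?x n)) w = (1 / of_nat T) *s cur (?x n) n w" for n
    using T_pos by (simp add: cur_eq tproj_fixed[OF e] actW_loop_scale[OF e])
  show ?thesis
    by (subst X) (simp only: actW_add[OF s(1) central_FA] s(2) actW_central l)
qed

lemma actW_commute:
  assumes c: "\<And>a b m n w. cur a m (cur b n w) = cur b n (cur a m w)" and X: "X \<in> FA" and Z: "Z \<in> FA"
  shows "actW X (actW Z w) = actW Z (actW X w)"
proof -
  have "cur b n (actW X w) = actW X (cur b n w)" for b n w
    unfolding actW_decomp[OF X] by (simp add: field_simps_lin[OF field_cur] c[of b])
  then show ?thesis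
    unfolding actW_decomp[OF Z] by (simp add: linear_additive[OF actW_linear[OF X]])
qed

text \<open>If a competitor Q missed one of the T roots of unity, all currents and hence the whole
  algebra would commute on W, against the hypothesis. A monic polynomial of degree at most T with
  these T roots is x^T - 1.\<close>

lemma minimal:
  assumes nc: "\<exists>X\<in>FA. \<exists>Z\<in>FA. \<exists>w. actW X (actW Z w) \<noteq> actW Z (actW X w)"
  shows "is_minimal_polynomial (*s) YW (monom 1 T - 1)"
  unfolding is_minimal_polynomial_def
proof (intro conjI allI impI)
  let ?p = "monom 1 T - 1 :: complex poly"
  show "kills_commutators (*s) YW ?p" by (rule kills_cyclotomic[OF YW_local])
  have coeffT: "coeff ?p T = 1" using T_pos by (simp add: coeff_1)
  have deg: "degree ?p = T"
  proof (rule antisym)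
    show "degree ?p \<le> T" by (rule degree_diff_le[OF degree_monom_le]) simp
    show "T \<le> degree ?p" by (rule le_degree) (simp only: coeffT one_neq_zero not_False_eq_True)
  qed
  then show "lead_coeff ?p = 1" using coeffT by simp
  fix Q
  assume Q: "kills_commutators (*s) YW Q \<and> lead_coeff Q = 1 \<and> Q \<noteq> ?p"
  define Z where "Z = (\<lambda>j. om powi (- int j)) ` {..<T}"
  have rootQ: "poly Q z = 0" if z: "z \<in> Z" for z
  proof (rule ccontr)
    assume nz: "poly Q z \<noteq> 0"
    obtain j where j: "j < T" "z = om powi (- int j)" using z unfolding Z_def by blast
    have "\<exists>r. \<forall>w. pev rr (Q ^ r) \<star> (\<lambda>(p, q). cur a p (cur b q w) - cur b q (cur a p w)) = 0" for a b
      using Q unfolding kills_commutators_iff YW_gen[symmetric] by blast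
    then have "cur a m (cur b n w) = cur b n (cur a m w)" for a b m n w
      using commuting[of Q j] nz j by blast
    then have "actW X (actW Z w) = actW Z (actW X w)" if "X \<in> FA" "Z \<in> FA" for X Z w
      using actW_commute that by blast
    then show False using nc by blast
  qed
  have rootp: "poly ?p z = 0" if "z \<in> Z" for z
    using that om_root by (auto simp: Z_def poly_monom)
  have few: "P = 0" if "\<And>z. z \<in> Z \<Longrightarrow> poly P z = 0" "degree P < T" for P
  proof (rule ccontr)
    assume "P \<noteq> 0"
    then have "card Z \<le> card {x. poly P x = 0}"
      using that(1) by (intro card_mono poly_roots_finite) auto
    also have "\<dots> \<le> degree P" using \<open>P \<noteq> 0\<close> by (rule card_poly_roots_bound)
    finally show False using that(2) by (simp add: Z_def card_image[OF om_inj])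
  qed
  show "degree ?p < degree Q"
  proof (rule ccontr)
    assume "\<not> degree ?p < degree Q"
    then consider "degree Q < T" | "degree Q = T" unfolding deg by linarith
    then show False
    proof cases
      case 1
      then have "Q = 0" using few rootQ by blast
      then show False using Q by simp
    next
      case 2
      have "degree (Q - ?p) \<le> T" by (rule degree_diff_le) (use 2 deg in simp_all)
      moreover have "coeff (Q - ?p) T = 0" using 2 Q coeffT by simp
      ultimately have "degree (Q - ?p) < T \<or> Q - ?p = 0"
        by (metis leading_coeff_0_iff le_neq_implies_less)
      then have "Q - ?p = 0" using few[of "Q - ?p"] rootQ rootp by auto
      then show False using Q by simp
    qed
  qed
qed

end

section \<open>Fractional exponents\<close>

definition frac_exp :: "nat \<Rightarrow> int \<Rightarrow> rat" where
  "frac_exp T n = of_int n / of_nat T"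

lemma to_twisted_eq:
  "to_twisted T X = (\<Sum>n\<in>Poly_Mapping.keys (fst X). Poly_Mapping.single (frac_exp T n) (Poly_Mapping.lookup (fst X) n), snd X / of_nat T)"
  by (simp add: to_twisted_def frac_exp_def)

context
  fixes T :: nat
  assumes T_pos: "T > 0"
begin

lemma frac_exp_inj: "frac_exp T m = frac_exp T n \<longleftrightarrow> m = n"
  using T_pos by (simp add: frac_exp_def)

lemma lookup_to_twisted: "Poly_Mapping.lookup (fst (to_twisted T X)) (frac_exp T n) = Poly_Mapping.lookup (fst X) n"
proof -
  have "Poly_Mapping.lookup (fst (to_twisted T X)) (frac_exp T n) =
      (\<Sum>m\<in>Poly_Mapping.keys (fst X). if m = n then Poly_Mapping.lookup (fst X) m else 0)"
    by (simp add: to_twisted_eq lookup_sum lookup_single frac_exp_inj when_def)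
  then show ?thesis by (simp add: in_keys_iff)
qed

lemma lookup_to_twisted_out:
  assumes "q \<notin> range (frac_exp T)"
  shows "Poly_Mapping.lookup (fst (to_twisted T X)) q = 0"
proof -
  have "frac_exp T m \<noteq> q" for m using assms by blast
  then show ?thesis by (simp add: to_twisted_eq lookup_sum lookup_single)
qed

lemma to_twisted_eqI:
  assumes "\<And>n. Poly_Mapping.lookup (fst Y) (frac_exp T n) = Poly_Mapping.lookup (fst X) n"
    and "\<And>q. q \<notin> range (frac_exp T) \<Longrightarrow> Poly_Mapping.lookup (fst Y) q = 0" "snd X / of_nat T = snd Y"
  shows "to_twisted T X = Y"
proof (rule prod_eqI)
  show "fst (to_twisted T X) = fst Y"
  proof (rule poly_mapping_eqI)
    fix q
    show "Poly_Mapping.lookup (fst (to_twisted T X)) q = Poly_Mapping.lookup (fst Y) q"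
    proof (cases "q \<in> range (frac_exp T)")
      case True
      then obtain n where "q = frac_exp T n" by blast
      then show ?thesis by (simp add: assms(1) lookup_to_twisted)
    next
      case False
      show ?thesis unfolding assms(2)[OF False] by (rule lookup_to_twisted_out[OF False])
    qed
  qed
qed (simp add: to_twisted_eq assms(3))

lemma keys_to_twisted: "Poly_Mapping.keys (fst (to_twisted T X)) = frac_exp T ` Poly_Mapping.keys (fst X)"
proof (intro set_eqI iffI)
  fix q assume q: "q \<in> Poly_Mapping.keys (fst (to_twisted T X))"
  then have "q \<in> range (frac_exp T)" using lookup_to_twisted_out[of q X] unfolding in_keys_iff by blast
  then obtain n where "q = frac_exp T n" by blast
  then show "q \<in> frac_exp T ` Poly_Mapping.keys (fst X)" using q by (simp add: in_keys_iff lookup_to_twisted)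
qed (auto simp: in_keys_iff lookup_to_twisted)

lemma snd_to_twisted: "snd (to_twisted T X) = snd X / of_nat T"
  by (simp add: to_twisted_eq)

lemma to_twisted_add: "to_twisted T (X + Y) = to_twisted T X + to_twisted T Y"
  by (rule to_twisted_eqI)
    (simp_all only: fst_add snd_add lookup_add lookup_to_twisted lookup_to_twisted_out snd_to_twisted add_divide_distrib add_0 not_False_eq_True)

lemma to_twisted_zero: "to_twisted T 0 = 0"
  by (simp add: to_twisted_def zero_prod_def)

lemma to_twisted_sum: "to_twisted T (sum f A) = (\<Sum>a\<in>A. to_twisted T (f a))"
  by (induction A rule: infinite_finite_induct) (auto simp: to_twisted_zero to_twisted_add)

lemma to_twisted_single: "to_twisted T (Poly_Mapping.single n x, z) = (Poly_Mapping.single (frac_exp T n) x, z / of_nat T)"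
  by (cases "x = 0") (auto simp: to_twisted_eq)

lemma to_twisted_loop: "to_twisted T (loop n x) = loop (frac_exp T n) x"
  by (simp add: loop_def to_twisted_single)

lemma to_twisted_scale:
  assumes "\<And>c. sc c 0 = 0"
  shows "to_twisted T (affine_scale sc c X) = affine_scale sc c (to_twisted T X)"
  by (rule to_twisted_eqI)
    (simp_all add: lookup_to_twisted lookup_to_twisted_out snd_to_twisted affine_scale_def Poly_Mapping.map.rep_eq when_def assms)

lemma to_twisted_mem:
  assumes "X \<in> fixed_affine sc \<sigma> T"
  shows "to_twisted T X \<in> twisted_affine sc \<sigma> T"
  unfolding twisted_affine_def mem_Collect_eq keys_to_twisted frac_exp_def[symmetric]
proof
  fix q assume "q \<in> frac_exp T ` Poly_Mapping.keys (fst X)"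
  then obtain n where "q = frac_exp T n" by blast
  then show "\<exists>n. q = frac_exp T n \<and> Poly_Mapping.lookup (fst (to_twisted T X)) q \<in> eigenspace sc \<sigma> T n"
    using assms by (intro exI[of _ n]) (simp add: lookup_to_twisted fixed_affine_def)
qed

text \<open>The cocycle is linear in the exponent, which is divided by T exactly as the central
  coordinate is.\<close>

lemma to_twisted_bracket:
  "to_twisted T (affine_bracket br fm of_int X Y) = affine_bracket br fm of_rat (to_twisted T X) (to_twisted T Y)"
proof -
  have inj: "inj_on (frac_exp T) S" for S by (rule inj_onI) (simp add: frac_exp_inj)
  have add: "frac_exp T m + frac_exp T n = frac_exp T (m + n)" for m n by (simp add: frac_exp_def add_divide_distrib)
  have zero: "frac_exp T m = 0 \<longleftrightarrow> m = 0" for m using T_pos by (simp add: frac_exp_def)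
  have rat: "of_rat (frac_exp T m) = (of_int m / of_nat T :: complex)" for m by (simp add: frac_exp_def of_rat_divide)
  show ?thesis
    unfolding affine_bracket_def keys_to_twisted sum.reindex[OF inj] o_def lookup_to_twisted Let_def
      to_twisted_sum to_twisted_single add zero rat
    by simp
qed

lemma restricted_to_twisted:
  assumes mod: "restricted_module_on sc br fm of_rat (twisted_affine sc \<sigma> T) level scaleW \<rho>" and sc: "\<And>c. sc c 0 = 0"
  shows "restricted_module_on sc br fm of_int (fixed_affine sc \<sigma> T) (level / of_nat T) scaleW (\<lambda>X. \<rho> (to_twisted T X))"
proof -
  let ?S = "twisted_affine sc \<sigma> T"
  have lm: "lie_module_on (affine_scale sc) (affine_bracket br fm of_rat) ?S scaleW \<rho>"
    and cen: "\<And>w. \<rho> central w = scaleW level w"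
    and res: "\<And>w a. \<exists>N. \<forall>n\<ge>N. loop n a \<in> ?S \<longrightarrow> \<rho> (loop n a) w = 0"
    using mod unfolding restricted_module_on_def by blast+
  interpret W: vector_space scaleW using lm by (simp add: lie_module_on_def)
  have "to_twisted T (central :: (int, 'a) affine) = affine_scale sc (1 / of_nat T) central"
    by (auto simp: to_twisted_eq central_def affine_scale_def intro!: poly_mapping_eqI simp: Poly_Mapping.map.rep_eq)
  moreover have "central \<in> ?S" by (simp add: twisted_affine_def central_def)
  then have "\<rho> (affine_scale sc (1 / of_nat T) central) w = scaleW (1 / of_nat T) (\<rho> central w)" for w
    using lm unfolding lie_module_on_def by blast
  ultimately have "\<rho> (to_twisted T central) w = scaleW (level / of_nat T) w" for w by (simp add: cen)
  moreover have "\<exists>N. \<forall>n\<ge>N. loop n a \<in> fixed_affine sc \<sigma> T \<longrightarrow> \<rho> (to_twisted T (loop n a)) w = 0" for w a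
  proof -
    obtain N where N: "\<forall>n\<ge>N. loop n a \<in> ?S \<longrightarrow> \<rho> (loop n a) w = 0" using res by blast
    \<comment> \<open>A bound N for the fractional exponents n / T becomes the bound N T for
      n.\<close>
    have "\<rho> (to_twisted T (loop n a)) w = 0" if n: "n \<ge> \<lceil>N * of_nat T\<rceil>" and S: "loop n a \<in> fixed_affine sc \<sigma> T" for n
    proof -
      have "N * of_nat T \<le> of_int n" using n by (simp add: ceiling_le_iff)
      then have "N \<le> frac_exp T n" using T_pos by (simp add: frac_exp_def pos_le_divide_eq)
      then show ?thesis using N to_twisted_mem[OF S] unfolding to_twisted_loop by blast
    qed
    then show ?thesis by blast
  qed
  moreover have "lie_module_on (affine_scale sc) (affine_bracket br fm of_int) (fixed_affine sc \<sigma> T) scaleW (\<lambda>X. \<rho> (to_twisted T X))"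
    using lm to_twisted_mem unfolding lie_module_on_def to_twisted_add to_twisted_scale[of sc, OF sc] to_twisted_bracket
    by blast
  ultimately show ?thesis unfolding restricted_module_on_def by blast
qed

end

text \<open>Minimality is asserted for modules on which some two elements of the algebra fail to
  commute: on W = 0, for instance, the constant polynomial 1 already kills all commutators. That x^T
  - 1 kills the commutators is asserted for every W.\<close>

theorem proposition7p4:
  fixes scale :: "complex \<Rightarrow> 'g::ab_group_add \<Rightarrow> 'g"
    and bracket :: "'g \<Rightarrow> 'g \<Rightarrow> 'g"
    and form :: "'g \<Rightarrow> 'g \<Rightarrow> complex"
    and \<sigma> :: "'g \<Rightarrow> 'g"
    and T :: nat
    and level :: complex
    and scaleV :: "complex \<Rightarrow> 'v::ab_group_add \<Rightarrow> 'v"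
    and actV :: "(int, 'g) affine \<Rightarrow> 'v \<Rightarrow> 'v"
    and vac :: 'v
    and Y :: "'v \<Rightarrow> int \<Rightarrow> 'v \<Rightarrow> 'v"
    and scaleW :: "complex \<Rightarrow> 'w::ab_group_add \<Rightarrow> 'w"
    and actW :: "(int, 'g) affine \<Rightarrow> 'w \<Rightarrow> 'w"
  assumes "quadratic_lie_algebra scale bracket form"
    and "lie_automorphism scale bracket \<sigma>"
    and "\<And>a b. form (\<sigma> a) (\<sigma> b) = form a b"
    and "has_finite_order \<sigma> T"
    and "is_affine_vacuum_module scale bracket form level scaleV actV vac"
    and "vertex_algebra scaleV Y vac"
    and "\<And>a n v. Y (actV (loop (-1) a) vac) n v = actV (loop n a) v"
    and "(\<exists>\<rho>. restricted_module_on scale bracket form of_rat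
                (twisted_affine scale \<sigma> T) level scaleW \<rho> \<and>
              actW = (\<lambda>X. \<rho> (to_twisted T X))) \<or>
         restricted_module_on scale bracket form of_int
           (fixed_affine scale \<sigma> T) (level / of_nat T) scaleW actW"
  shows "\<exists>YW. quasi_module scaleV Y vac scaleW YW \<and>
           (\<forall>a n w. YW (actV (loop (-1) a) vac) n w = actW (twisted_current scale \<sigma> T a n) w) \<and>
           (\<forall>YW'. quasi_module scaleV Y vac scaleW YW' \<and>
              (\<forall>a n w. YW' (actV (loop (-1) a) vac) n w = actW (twisted_current scale \<sigma> T a n) w)
              \<longrightarrow> YW' = YW) \<and>
           kills_commutators scaleW YW (monom 1 T - 1) \<and>
           ((\<exists>X \<in> fixed_affine scale \<sigma> T. \<exists>Z \<in> fixed_affine scale \<sigma> T. \<exists>w.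
               actW X (actW Z w) \<noteq> actW Z (actW X w))
            \<longrightarrow> is_minimal_polynomial scaleW YW (monom 1 T - 1))"
proof -
  interpret g: quadratic_lie_algebra scale bracket form by fact
  have T: "T > 0" using assms(4) by (simp add: has_finite_order_def)
  have restr: "restricted_module_on scale bracket form of_int (fixed_affine scale \<sigma> T) (level / of_nat T) scaleW actW"
    using assms(8) restricted_to_twisted[OF T, of scale bracket form \<sigma> level scaleW] by auto
  then have vs: "vector_space scaleW" by (simp add: restricted_module_on_def lie_module_on_def)
  interpret vacuum_setup scale bracket form scaleW T \<sigma> level actW scaleV Y vac actV
    by (intro vacuum_setup.intro twisted_module.intro cyclic_space.intro complex_space.intro
        cyclic_space_axioms.intro twisted_module_axioms.intro vacuum_setup_axioms.intro)
      (fact assms T restr vs)+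
  show ?thesis
  proof (intro exI[of _ YW] conjI allI impI)
    show "quasi_module scaleV Y vac scaleW YW" by (rule YW_quasi_module)
    show "YW (actV (loop (-1) a) vac) n w = actW (twisted_current scale \<sigma> T a n) w" for a n w
      by (simp only: YW_gen cur_def)
    show "YW' = YW" if "quasi_module scaleV Y vac scaleW YW' \<and>
        (\<forall>a n w. YW' (actV (loop (-1) a) vac) n w = actW (twisted_current scale \<sigma> T a n) w)" for YW'
      by (rule YW_unique) (use that in \<open>simp_all only: cur_def\<close>)
    show "kills_commutators scaleW YW (monom 1 T - 1)" by (rule kills_cyclotomic[OF YW_local])
    show "is_minimal_polynomial scaleW YW (monom 1 T - 1)"
      if "\<exists>X \<in> fixed_affine scale \<sigma> T. \<exists>Z \<in> fixed_affine scale \<sigma> T. \<exists>w. actW X (actW Z w) \<noteq> actW Z (actW X w)"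
      by (rule minimal) (rule that)
  qed
qed

end
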